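(* Let $G$ be a second countable, locally compact group and let $d$ be a proper, left invariant metric on $G$ which has at most exponential growth, i.e., there are constants $a,b>0$ such that $$\mu(B_n(e))\leq a\cdot e^{bn}\qquad(n\in\mathbb N),$$ where $\mu$ is a left invariant Haar measure on $G$ and $B_n(e)=\{g\in G : d(g,e)<n\}$ is the open ball of radius $n$ centered at the identity element $e\in G$. Then for any continuous Herz--Schur multiplier $\varphi$ on $G$ there exist a strongly continuous representation $(\pi,\mathscr H)$ of $G$ on a Hilbert space $\mathscr H$ and vectors $\xi,\eta\in\mathscr H$ such that $$\varphi(y^{-1}x)=\langle \pi(x)\xi,\pi(y^{-1})^*\eta\rangle\qquad(x,y\in G),$$ with $$\sup_{x\in G}\|\pi(x)\xi\|=\|\varphi\|_{M_0A(G)}^{1/2}\quad\text{and}\quad \sup_{y\in G}\|\pi(y^{-1})^*\eta\|=\|\varphi\|_{M_0A(G)}^{1/2}.$$ Moreover, for every fixed $c>b$, $(\pi,\mathscr H)$ (together with such $\xi,\eta$) can be chosen such that $$\|\pi(g)\|\leq e^{\frac{c}{2}d(g,e)}\qquad(g\in G).$$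
   Context: Schur multipliers: for a non-empty set $Y$, a function $\psi:Y\times Y\to\mathbb C$ is a Schur multiplier if for every operator $A=(a_{x,y})_{x,y\in Y}\in B(\ell^2(Y))$ the matrix $(\psi(x,y)a_{x,y})_{x,y\in Y}$ represents an operator $M_\psi A\in B(\ell^2(Y))$; then $M_\psi$ is a bounded operator on $B(\ell^2(Y))$ and $\|\psi\|_S=\|M_\psi\|$. Herz--Schur multipliers: a continuous function $\varphi:G\to\mathbb C$ on a locally compact group $G$ is a (continuous) Herz--Schur multiplier if $\hat\varphi(x,y)=\varphi(y^{-1}x)$ $(x,y\in G)$ is a Schur multiplier on $G\times G$ ($G$ viewed as a set), and its Herz--Schur norm is $\|\varphi\|_{HS}=\|\hat\varphi\|_S$. The norm $\|\cdot\|_{M_0A(G)}$: $M_0A(G)$ is the algebra of completely bounded Fourier multipliers, i.e. continuous $\varphi:G\to\mathbb C$ such that $\lambda(g)\mapsto\varphi(g)\lambda(g)$ ($\lambda$ the left regular representation) extends to a $\sigma$-weakly continuous, completely bounded operator $M_\varphi$ on the group von Neumann algebra of $G$, with $\|\varphi\|_{M_0A(G)}=\|M_\varphi\|_{\mathrm{cb}}$. By a known theorem of Bożejko and Fendler, $M_0A(G)$ coincides isometrically with the continuous Herz--Schur multipliers, so $\|\varphi\|_{M_0A(G)}=\|\varphi\|_{HS}$. Representations: a representation $(\pi,\mathscr H)$ of $G$ on a (complex) Hilbert space $\mathscr H$ is a homomorphism of $G$ into the group of invertible elements of $B(\mathscr H)$ (not assumed unitary or uniformly bounded). It is strongly continuous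 if $g\mapsto\pi(g)$ is continuous for the strong operator topology on $B(\mathscr H)$. Inner products are linear in the first variable. A metric $d$ on $G$ is understood to induce the topology of $G$; it is left invariant if $d(gx,gy)=d(x,y)$ for all $g,x,y\in G$, and proper if closed balls are compact. *)

theory Defs
  imports "HOL-Analysis.Analysis"
begin

section \<open>Complex Hilbert spaces with explicit carriers\<close>

text \<open>
  The carrier is explicit because the Hilbert space in the theorem is existentially quantified,
  and because the space \<open>L2 \<mu>\<close> below depends on a measure.
  Inner products are linear in the first variable.
\<close>

record 'v hspace =
  vecs :: "'v set"
  vadd :: "'v \<Rightarrow> 'v \<Rightarrow> 'v"
  vzero :: "'v"
  vscale :: "complex \<Rightarrow> 'v \<Rightarrow> 'v"
  ip :: "'v \<Rightarrow> 'v \<Rightarrow> complex"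

definition vnorm :: "'v hspace \<Rightarrow> 'v \<Rightarrow> real" where
  "vnorm H v = sqrt (Re (ip H v v))"

text \<open>Off the carrier the distance is \<open>0\<close>, since the locale \<open>Metric_space\<close> requires a distance to
  be symmetric and nonnegative on the whole type.\<close>

definition vdist :: "'v hspace \<Rightarrow> 'v \<Rightarrow> 'v \<Rightarrow> real" where
  "vdist H v w =
     (if v \<in> vecs H \<and> w \<in> vecs H then vnorm H (vadd H v (vscale H (-1) w)) else 0)"

locale hilbert_space =
  fixes H :: "'v hspace"
  assumes zero_closed: "vzero H \<in> vecs H"
    and add_closed: "\<lbrakk>u \<in> vecs H; v \<in> vecs H\<rbrakk> \<Longrightarrow> vadd H u v \<in> vecs H"
    and scale_closed: "v \<in> vecs H \<Longrightarrow> vscale H \<alpha> v \<in> vecs H"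
    and add_assoc: "\<lbrakk>u \<in> vecs H; v \<in> vecs H; w \<in> vecs H\<rbrakk>
      \<Longrightarrow> vadd H (vadd H u v) w = vadd H u (vadd H v w)"
    and add_commute: "\<lbrakk>u \<in> vecs H; v \<in> vecs H\<rbrakk> \<Longrightarrow> vadd H u v = vadd H v u"
    and add_zero: "v \<in> vecs H \<Longrightarrow> vadd H v (vzero H) = v"
    and add_inverse: "v \<in> vecs H \<Longrightarrow> \<exists>w\<in>vecs H. vadd H v w = vzero H"
    and scale_add_right: "\<lbrakk>u \<in> vecs H; v \<in> vecs H\<rbrakk>
      \<Longrightarrow> vscale H \<alpha> (vadd H u v) = vadd H (vscale H \<alpha> u) (vscale H \<alpha> v)"
    and scale_add_left: "v \<in> vecs H
      \<Longrightarrow> vscale H (\<alpha> + \<beta>) v = vadd H (vscale H \<alpha> v) (vscale H \<beta> v)"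
    and scale_scale: "v \<in> vecs H \<Longrightarrow> vscale H \<alpha> (vscale H \<beta> v) = vscale H (\<alpha> * \<beta>) v"
    and scale_one: "v \<in> vecs H \<Longrightarrow> vscale H 1 v = v"
    and ip_add_left: "\<lbrakk>u \<in> vecs H; v \<in> vecs H; w \<in> vecs H\<rbrakk>
      \<Longrightarrow> ip H (vadd H u v) w = ip H u w + ip H v w"
    and ip_scale_left: "\<lbrakk>u \<in> vecs H; v \<in> vecs H\<rbrakk> \<Longrightarrow> ip H (vscale H \<alpha> u) v = \<alpha> * ip H u v"
    and ip_commute: "\<lbrakk>u \<in> vecs H; v \<in> vecs H\<rbrakk> \<Longrightarrow> ip H v u = cnj (ip H u v)"
    and ip_nonneg: "v \<in> vecs H \<Longrightarrow> 0 \<le> Re (ip H v v)"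
    and ip_eq_zero: "\<lbrakk>v \<in> vecs H; ip H v v = 0\<rbrakk> \<Longrightarrow> v = vzero H"
    and complete: "Metric_space.mcomplete (vecs H) (vdist H)"

text \<open>
  Operators are taken to be extensional (equal to \<open>undefined\<close> off the carrier), so that equality
  of operators is equality of functions.
\<close>

definition bounded_ops :: "'v hspace \<Rightarrow> ('v \<Rightarrow> 'v) set" where
  "bounded_ops H = {T \<in> vecs H \<rightarrow>\<^sub>E vecs H.
     (\<forall>u\<in>vecs H. \<forall>v\<in>vecs H. T (vadd H u v) = vadd H (T u) (T v)) \<and>
     (\<forall>\<alpha>. \<forall>v\<in>vecs H. T (vscale H \<alpha> v) = vscale H \<alpha> (T v)) \<and>
     (\<exists>C. \<forall>v\<in>vecs H. vnorm H (T v) \<le> C * vnorm H v)}"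

definition op_norm :: "'v hspace \<Rightarrow> ('v \<Rightarrow> 'v) \<Rightarrow> real" where
  "op_norm H T = Sup {vnorm H (T v) | v. v \<in> vecs H \<and> vnorm H v \<le> 1}"

definition id_op :: "'v hspace \<Rightarrow> 'v \<Rightarrow> 'v" where
  "id_op H = (\<lambda>v\<in>vecs H. v)"

definition op_add :: "'v hspace \<Rightarrow> ('v \<Rightarrow> 'v) \<Rightarrow> ('v \<Rightarrow> 'v) \<Rightarrow> 'v \<Rightarrow> 'v" where
  "op_add H S T = (\<lambda>v\<in>vecs H. vadd H (S v) (T v))"

definition op_scale :: "'v hspace \<Rightarrow> complex \<Rightarrow> ('v \<Rightarrow> 'v) \<Rightarrow> 'v \<Rightarrow> 'v" where
  "op_scale H \<alpha> T = (\<lambda>v\<in>vecs H. vscale H \<alpha> (T v))"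

definition adjoint_op :: "'v hspace \<Rightarrow> ('v \<Rightarrow> 'v) \<Rightarrow> 'v \<Rightarrow> 'v" where
  "adjoint_op H T = (THE S. S \<in> bounded_ops H \<and>
     (\<forall>v\<in>vecs H. \<forall>w\<in>vecs H. ip H (T v) w = ip H v (S w)))"

definition invertible_ops :: "'v hspace \<Rightarrow> ('v \<Rightarrow> 'v) set" where
  "invertible_ops H = {T \<in> bounded_ops H. \<exists>S\<in>bounded_ops H.
     compose (vecs H) S T = id_op H \<and> compose (vecs H) T S = id_op H}"

definition strong_topology :: "'v hspace \<Rightarrow> ('v \<Rightarrow> 'v) topology" where
  "strong_topology H = topology_generated_by
     {{T \<in> bounded_ops H. T v \<in> U} | v U.
        v \<in> vecs H \<and> openin (Metric_space.mtopology (vecs H) (vdist H)) U}"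

definition square_summable :: "'v hspace \<Rightarrow> (nat \<Rightarrow> 'v) \<Rightarrow> bool" where
  "square_summable H \<xi> \<longleftrightarrow> range \<xi> \<subseteq> vecs H \<and> summable (\<lambda>i. (vnorm H (\<xi> i))\<^sup>2)"

definition sigma_weak_topology :: "'v hspace \<Rightarrow> ('v \<Rightarrow> 'v) topology" where
  "sigma_weak_topology H = topology_generated_by
     {{T \<in> bounded_ops H. (\<Sum>i. ip H (T (\<xi> i)) (\<eta> i)) \<in> U} | \<xi> \<eta> U.
        square_summable H \<xi> \<and> square_summable H \<eta> \<and> open U}"

section \<open>Schur multipliers and Herz--Schur multipliers\<close>

definition ell2 :: "('y \<Rightarrow> complex) hspace" where
  "ell2 = \<lparr>vecs = {f. (\<lambda>y. (cmod (f y))\<^sup>2) summable_on UNIV},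
           vadd = (\<lambda>f g y. f y + g y),
           vzero = (\<lambda>y. 0),
           vscale = (\<lambda>\<alpha> f y. \<alpha> * f y),
           ip = (\<lambda>f g. \<Sum>\<^sub>\<infinity>y. f y * cnj (g y))\<rparr>"

definition mat_entry :: "(('y \<Rightarrow> complex) \<Rightarrow> ('y \<Rightarrow> complex)) \<Rightarrow> 'y \<Rightarrow> 'y \<Rightarrow> complex" where
  "mat_entry A x y = A (\<lambda>z. if z = y then 1 else 0) x"

definition schur_multiplier :: "('y \<Rightarrow> 'y \<Rightarrow> complex) \<Rightarrow> bool" where
  "schur_multiplier \<psi> \<longleftrightarrow> (\<forall>A\<in>bounded_ops ell2. \<exists>B\<in>bounded_ops ell2.
     \<forall>x y. mat_entry B x y = \<psi> x y * mat_entry A x y)"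

text \<open>
  Topological groups are those of the class \<open>topological_group_add\<close>. Its sum is not assumed to be
  commutative, so this is an arbitrary topological group written additively: \<open>- y + x\<close> is
  $y^{-1}x$ and \<open>0\<close> is the identity element.
\<close>

definition herz_schur_multiplier :: "('g::topological_group_add \<Rightarrow> complex) \<Rightarrow> bool" where
  "herz_schur_multiplier \<phi> \<longleftrightarrow>
     continuous_on UNIV \<phi> \<and> schur_multiplier (\<lambda>x y. \<phi> (- y + x))"

section \<open>Haar measure, the regular representation and the group von Neumann algebra\<close>

text \<open>
  No regularity is demanded: on a second countable locally compact Hausdorff space every Borel
  measure that is finite on compact sets is regular.
\<close>

definition left_haar_measure :: "'g::topological_group_add measure \<Rightarrow> bool" where
  "left_haar_measure \<mu> \<longleftrightarrow> sets \<mu> = sets borel \<and>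
     (\<forall>g. \<forall>A\<in>sets borel. emeasure \<mu> ((\<lambda>x. g + x) ` A) = emeasure \<mu> A) \<and>
     (\<forall>K. compact K \<longrightarrow> emeasure \<mu> K < \<infinity>) \<and>
     emeasure \<mu> UNIV \<noteq> 0"

text \<open>The vectors of \<open>L2 \<mu>\<close> are classes of square integrable functions modulo null sets.\<close>

definition l2_fun :: "'g measure \<Rightarrow> ('g \<Rightarrow> complex) set" where
  "l2_fun \<mu> = {f \<in> borel_measurable \<mu>. integrable \<mu> (\<lambda>x. (cmod (f x))\<^sup>2)}"

definition l2_class :: "'g measure \<Rightarrow> ('g \<Rightarrow> complex) \<Rightarrow> ('g \<Rightarrow> complex) set" where
  "l2_class \<mu> f = {g \<in> l2_fun \<mu>. AE x in \<mu>. g x = f x}"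

definition l2_rep :: "('g \<Rightarrow> complex) set \<Rightarrow> 'g \<Rightarrow> complex" where
  "l2_rep F = (SOME f. f \<in> F)"

definition L2 :: "'g measure \<Rightarrow> ('g \<Rightarrow> complex) set hspace" where
  "L2 \<mu> = \<lparr>vecs = l2_class \<mu> ` l2_fun \<mu>,
          vadd = (\<lambda>E F. l2_class \<mu> (\<lambda>x. l2_rep E x + l2_rep F x)),
          vzero = l2_class \<mu> (\<lambda>x. 0),
          vscale = (\<lambda>\<alpha> F. l2_class \<mu> (\<lambda>x. \<alpha> * l2_rep F x)),
          ip = (\<lambda>E F. \<integral>x. l2_rep E x * cnj (l2_rep F x) \<partial>\<mu>)\<rparr>"

definition left_regular ::
    "'g::topological_group_add measure \<Rightarrow> 'g \<Rightarrow> ('g \<Rightarrow> complex) set \<Rightarrow> ('g \<Rightarrow> complex) set" where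
  "left_regular \<mu> g = (\<lambda>F\<in>vecs (L2 \<mu>). l2_class \<mu> (\<lambda>x. l2_rep F (- g + x)))"

inductive_set op_span :: "'v hspace \<Rightarrow> ('v \<Rightarrow> 'v) set \<Rightarrow> ('v \<Rightarrow> 'v) set"
  for H :: "'v hspace" and \<S> :: "('v \<Rightarrow> 'v) set" where
  base: "T \<in> \<S> \<Longrightarrow> T \<in> op_span H \<S>"
| add: "\<lbrakk>S \<in> op_span H \<S>; T \<in> op_span H \<S>\<rbrakk> \<Longrightarrow> op_add H S T \<in> op_span H \<S>"
| scale: "T \<in> op_span H \<S> \<Longrightarrow> op_scale H \<alpha> T \<in> op_span H \<S>"

text \<open>
  The linear span of the left regular representation is a unital *-algebra; its closure in the
  \<open>\<sigma>\<close>-weak topology is the von Neumann algebra it generates.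
\<close>

definition group_vn :: "'g::topological_group_add measure
    \<Rightarrow> (('g \<Rightarrow> complex) set \<Rightarrow> ('g \<Rightarrow> complex) set) set" where
  "group_vn \<mu> = (sigma_weak_topology (L2 \<mu>)) closure_of (op_span (L2 \<mu>) (range (left_regular \<mu>)))"

section \<open>Completely bounded maps and the completely bounded Fourier multipliers\<close>

text \<open>
  The space \<open>power_space n H\<close> is the Hilbert space direct sum of \<open>n\<close> copies of \<open>H\<close>, on which
  \<open>n \<times> n\<close> matrices of operators act; this gives the norm of a matrix over a space of operators.
\<close>

definition power_space :: "nat \<Rightarrow> 'v hspace \<Rightarrow> (nat \<Rightarrow> 'v) hspace" where
  "power_space n H = \<lparr>vecs = {..<n} \<rightarrow>\<^sub>E vecs H,
     vadd = (\<lambda>v w. \<lambda>i\<in>{..<n}. vadd H (v i) (w i)),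
     vzero = (\<lambda>i\<in>{..<n}. vzero H),
     vscale = (\<lambda>\<alpha> v. \<lambda>i\<in>{..<n}. vscale H \<alpha> (v i)),
     ip = (\<lambda>v w. \<Sum>i<n. ip H (v i) (w i))\<rparr>"

primrec vsum :: "'v hspace \<Rightarrow> (nat \<Rightarrow> 'v) \<Rightarrow> nat \<Rightarrow> 'v" where
  "vsum H v 0 = vzero H"
| "vsum H v (Suc n) = vadd H (vsum H v n) (v n)"

definition matrix_op ::
    "'v hspace \<Rightarrow> nat \<Rightarrow> (nat \<Rightarrow> nat \<Rightarrow> 'v \<Rightarrow> 'v) \<Rightarrow> (nat \<Rightarrow> 'v) \<Rightarrow> nat \<Rightarrow> 'v" where
  "matrix_op H n T =
     (\<lambda>v\<in>vecs (power_space n H). \<lambda>i\<in>{..<n}. vsum H (\<lambda>j. T i j (v j)) n)"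

definition matrix_norm :: "'v hspace \<Rightarrow> nat \<Rightarrow> (nat \<Rightarrow> nat \<Rightarrow> 'v \<Rightarrow> 'v) \<Rightarrow> real" where
  "matrix_norm H n T = op_norm (power_space n H) (matrix_op H n T)"

definition cb_values ::
    "'v hspace \<Rightarrow> ('v \<Rightarrow> 'v) set \<Rightarrow> (('v \<Rightarrow> 'v) \<Rightarrow> 'v \<Rightarrow> 'v) \<Rightarrow> real set" where
  "cb_values H \<V> M = {matrix_norm H n (\<lambda>i j. M (T i j)) | n T.
     (\<forall>i<n. \<forall>j<n. T i j \<in> \<V>) \<and> matrix_norm H n T \<le> 1}"

definition completely_bounded ::
    "'v hspace \<Rightarrow> ('v \<Rightarrow> 'v) set \<Rightarrow> (('v \<Rightarrow> 'v) \<Rightarrow> 'v \<Rightarrow> 'v) \<Rightarrow> bool" where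
  "completely_bounded H \<V> M \<longleftrightarrow> bdd_above (cb_values H \<V> M)"

definition cb_norm ::
    "'v hspace \<Rightarrow> ('v \<Rightarrow> 'v) set \<Rightarrow> (('v \<Rightarrow> 'v) \<Rightarrow> 'v \<Rightarrow> 'v) \<Rightarrow> real" where
  "cb_norm H \<V> M = Sup (cb_values H \<V> M)"

definition fourier_multiplier_map ::
    "'g::topological_group_add measure \<Rightarrow> ('g \<Rightarrow> complex)
     \<Rightarrow> ((('g \<Rightarrow> complex) set \<Rightarrow> ('g \<Rightarrow> complex) set) \<Rightarrow> ('g \<Rightarrow> complex) set \<Rightarrow> ('g \<Rightarrow> complex) set)
     \<Rightarrow> bool" where
  "fourier_multiplier_map \<mu> \<phi> M \<longleftrightarrow>
     M \<in> group_vn \<mu> \<rightarrow>\<^sub>E group_vn \<mu> \<and>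
     (\<forall>S\<in>group_vn \<mu>. \<forall>T\<in>group_vn \<mu>. M (op_add (L2 \<mu>) S T) = op_add (L2 \<mu>) (M S) (M T)) \<and>
     (\<forall>\<alpha>. \<forall>T\<in>group_vn \<mu>. M (op_scale (L2 \<mu>) \<alpha> T) = op_scale (L2 \<mu>) \<alpha> (M T)) \<and>
     continuous_map (subtopology (sigma_weak_topology (L2 \<mu>)) (group_vn \<mu>))
       (subtopology (sigma_weak_topology (L2 \<mu>)) (group_vn \<mu>)) M \<and>
     completely_bounded (L2 \<mu>) (group_vn \<mu>) M \<and>
     (\<forall>g. M (left_regular \<mu> g) = op_scale (L2 \<mu>) (\<phi> g) (left_regular \<mu> g))"

text \<open>
  The map $M_\varphi$ is unique when it exists, by \<open>\<sigma>\<close>-weak continuity. It exists for every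
  continuous Herz--Schur multiplier, by a theorem of Bozejko and Fendler.
\<close>

definition m0a_norm :: "'g::topological_group_add measure \<Rightarrow> ('g \<Rightarrow> complex) \<Rightarrow> real" where
  "m0a_norm \<mu> \<phi> = cb_norm (L2 \<mu>) (group_vn \<mu>) (THE M. fourier_multiplier_map \<mu> \<phi> M)"

section \<open>Representations\<close>

definition group_rep ::
    "'v hspace \<Rightarrow> ('g::topological_group_add \<Rightarrow> 'v \<Rightarrow> 'v) \<Rightarrow> bool" where
  "group_rep H \<pi> \<longleftrightarrow> hilbert_space H \<and> range \<pi> \<subseteq> invertible_ops H \<and>
     (\<forall>g h. \<pi> (g + h) = compose (vecs H) (\<pi> g) (\<pi> h))"

definition strongly_continuous_rep ::
    "'v hspace \<Rightarrow> ('g::topological_group_add \<Rightarrow> 'v \<Rightarrow> 'v) \<Rightarrow> bool" where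
  "strongly_continuous_rep H \<pi> \<longleftrightarrow>
     group_rep H \<pi> \<and> continuous_map euclidean (strong_topology H) \<pi>"

text \<open>
  The suprema are taken in the extended reals, so that the equations include their finiteness.
\<close>

definition represents ::
    "'g::topological_group_add measure \<Rightarrow> ('g \<Rightarrow> complex)
     \<Rightarrow> 'v hspace \<Rightarrow> ('g \<Rightarrow> 'v \<Rightarrow> 'v) \<Rightarrow> 'v \<Rightarrow> 'v \<Rightarrow> bool" where
  "represents \<mu> \<phi> H \<pi> \<xi> \<eta> \<longleftrightarrow>
     strongly_continuous_rep H \<pi> \<and> \<xi> \<in> vecs H \<and> \<eta> \<in> vecs H \<and>
     (\<forall>x y. \<phi> (- y + x) = ip H (\<pi> x \<xi>) (adjoint_op H (\<pi> (- y)) \<eta>)) \<and>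
     (SUP x. ereal (vnorm H (\<pi> x \<xi>))) = ereal (sqrt (m0a_norm \<mu> \<phi>)) \<and>
     (SUP y. ereal (vnorm H (adjoint_op H (\<pi> (- y)) \<eta>))) = ereal (sqrt (m0a_norm \<mu> \<phi>))"

text \<open>
  An existentially quantified Hilbert space has to live in some type of vectors. The theorem uses
  \<open>nat \<Rightarrow> complex\<close>, which contains a copy (inside \<open>ell2\<close>) of every separable Hilbert space, and hence,
  the group being separable, of the closed linear span of any orbit of a strongly continuous
  representation.
\<close>

type_synonym separable_hspace = "(nat \<Rightarrow> complex) hspace"

end

theory Submission
  imports Defs
begin

text \<open>  Write the group additively and let \<open>k\<close> be the norm of \<open>\<phi>\<close>. By Grothendieck's theorem on Schur
  multipliers (\<open>psd_completion\<close>), the kernel \<open>\<phi> (- y + x)\<close> is the off-diagonal corner of a positive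
  semidefinite kernel on two copies of the group whose diagonal is at most \<open>k\<close>. It is therefore an inner
  product of vectors \<open>f x\<close> and \<open>h y\<close> of square norm at most \<open>k\<close>. Nothing relates \<open>f\<close> to the group
  structure, so left translation need not act boundedly on the vectors \<open>f x\<close>.

  The growth condition repairs this. For \<open>c > b\<close> the weight \<open>exp (- c * d u 0)\<close> has a finite integral, and
  the kernel \<open>cip (f x) (f y)\<close> is replaced by the weighted mean over \<open>u\<close> of the kernels
  \<open>cip (f (- u + x)) (f (- u + y))\<close>. Translating the mean by \<open>g\<close> changes only the weight, by the triangle
  inequality at most by the factor \<open>exp (c * d g 0)\<close>. So if the averaged kernel is the Gram kernel of vectors
  \<open>P x\<close>, then \<open>P x \<mapsto> P (g + x)\<close> extends to an operator of norm at most \<open>exp (c / 2 * d g 0)\<close>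
  on the closed span of the vectors \<open>P x\<close>; this is the representation. Since \<open>\<phi> (- y + x)\<close> does not change
  when \<open>x\<close> and \<open>y\<close> are both translated, averaging keeps the bound that says that
  \<open>P x \<mapsto> \<phi> (- y + x)\<close> is a functional of norm at most \<open>sqrt k\<close>; the Riesz theorem represents it by a
  vector \<open>Q y\<close>. Then \<open>\<xi> = P 0\<close>, \<open>\<eta> = Q 0\<close>, and all vectors \<open>P x\<close> and \<open>Q y\<close> have norm at
  most \<open>sqrt k\<close>. Averaging also makes the kernel continuous on the diagonal, whence the strong continuity
  (\<open>avg_translate\<close>, \<open>avg_dominates\<close>, \<open>avg_diagonal_continuous\<close>, \<open>kernel_representation\<close>).

  The suprema equal \<open>sqrt k\<close> because of the identification of \<open>k\<close> with the completely bounded norm of the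
  Fourier multiplier (Bozejko and Fendler), of which both halves are proved below. A factorization
  \<open>cip (P x) (Q y) = \<phi> (- y + x)\<close> with weakly continuous factors bounded by \<open>A\<close> and \<open>B\<close> yields a Fourier
  multiplier of completely bounded norm at most \<open>A * B\<close> (\<open>fourier_multiplier_map_exists\<close>,
  \<open>m0a_norm_le\<close>). Conversely that norm is a bound for the Schur multiplier
  (\<open>fourier_multiplier_schur_bounded\<close>), so the construction can be carried out with \<open>k\<close> equal to it,
  and smaller suprema would contradict the first half. That a translation invariant Schur multiplier
  has a bound to start from at all follows by a gliding hump argument (\<open>schur_multiplier_schur_bounded\<close>).\<close>

section \<open>The Hilbert space of square summable families\<close>

lemma summable_on_mult_of_square_summable:
  fixes f g :: "'i \<Rightarrow> complex"
  assumes "(\<lambda>i. (cmod (f i))\<^sup>2) summable_on A" "(\<lambda>i. (cmod (g i))\<^sup>2) summable_on A"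
  shows "(\<lambda>i. f i * cnj (g i)) summable_on A"
    and "(\<lambda>i. cmod (f i) * cmod (g i)) summable_on A"
proof -
  have "(\<lambda>i. (cmod (f i))\<^sup>2 + (cmod (g i))\<^sup>2) summable_on A"
    by (intro summable_on_add assms)
  then show *: "(\<lambda>i. cmod (f i) * cmod (g i)) summable_on A"
  proof (rule summable_on_comparison_test)
    fix i
    show "cmod (f i) * cmod (g i) \<le> (cmod (f i))\<^sup>2 + (cmod (g i))\<^sup>2"
      using sum_squares_bound[of "cmod (f i)" "cmod (g i)"] mult_nonneg_nonneg[of "cmod (f i)" "cmod (g i)"]
      by (simp only: norm_ge_zero mult.assoc simp_thms True_implies_equals)
  qed simp
  have "(\<lambda>i. norm (f i * cnj (g i))) summable_on A"
    using * by (simp add: norm_mult)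
  then show "(\<lambda>i. f i * cnj (g i)) summable_on A"
    by (rule abs_summable_summable)
qed

lemma square_summable_add:
  fixes f g :: "'i \<Rightarrow> complex"
  assumes "(\<lambda>i. (cmod (f i))\<^sup>2) summable_on A" "(\<lambda>i. (cmod (g i))\<^sup>2) summable_on A"
  shows "(\<lambda>i. (cmod (f i + g i))\<^sup>2) summable_on A"
proof -
  have "(\<lambda>i. 2 * ((cmod (f i))\<^sup>2 + (cmod (g i))\<^sup>2)) summable_on A"
    by (intro summable_on_cmult_right summable_on_add assms)
  then show ?thesis
  proof (rule summable_on_comparison_test)
    fix i
    have "(cmod (f i + g i))\<^sup>2 \<le> (cmod (f i) + cmod (g i))\<^sup>2"
      by (intro power_mono norm_triangle_ineq norm_ge_zero)
    also have "\<dots> \<le> 2 * ((cmod (f i))\<^sup>2 + (cmod (g i))\<^sup>2)"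
      using sum_squares_bound[of "cmod (f i)" "cmod (g i)"] by (simp add: power2_sum)
    finally show "(cmod (f i + g i))\<^sup>2 \<le> 2 * ((cmod (f i))\<^sup>2 + (cmod (g i))\<^sup>2)" .
  qed auto
qed

text \<open>A type, unlike the carrier \<open>ell2\<close>, so that it can be a complete real inner product space
  in the sense of the type classes. The complex structure is carried by \<open>scaleC\<close> and \<open>cip\<close>.\<close>

typedef 'i l2 = "{f :: 'i \<Rightarrow> complex. (\<lambda>i. (cmod (f i))\<^sup>2) summable_on UNIV}"
  morphisms coord Abs_l2
  by (rule exI[of _ "\<lambda>_. 0"]) simp

setup_lifting type_definition_l2

lemma coord_square_summable: "(\<lambda>i. (cmod (coord f i))\<^sup>2) summable_on UNIV"
  using coord[of f] by simp

lemma l2_eqI: "(\<And>i. coord f i = coord g i) \<Longrightarrow> f = g"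
  by (metis coord_inject ext)

lift_definition scaleC :: "complex \<Rightarrow> 'i l2 \<Rightarrow> 'i l2" is "\<lambda>c f i. c * f i"
  by (auto simp: norm_mult power_mult_distrib intro!: summable_on_cmult_right)

definition cip :: "'i l2 \<Rightarrow> 'i l2 \<Rightarrow> complex" where
  "cip f g = (\<Sum>\<^sub>\<infinity>i. coord f i * cnj (coord g i))"

instantiation l2 :: (type) real_vector
begin
lift_definition zero_l2 :: "'a l2" is "\<lambda>_. 0" by simp
lift_definition plus_l2 :: "'a l2 \<Rightarrow> 'a l2 \<Rightarrow> 'a l2" is "\<lambda>f g i. f i + g i"
  by (auto intro: square_summable_add)
lift_definition uminus_l2 :: "'a l2 \<Rightarrow> 'a l2" is "\<lambda>f i. - f i" by simp
lift_definition minus_l2 :: "'a l2 \<Rightarrow> 'a l2 \<Rightarrow> 'a l2" is "\<lambda>f g i. f i - g i"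
  subgoal for f g
    using square_summable_add[of f UNIV "\<lambda>i. - g i"] by simp
  done
lift_definition scaleR_l2 :: "real \<Rightarrow> 'a l2 \<Rightarrow> 'a l2" is "\<lambda>c f i. complex_of_real c * f i"
  by (auto simp: norm_mult power_mult_distrib intro!: summable_on_cmult_right)
instance
  by standard (transfer; auto simp: algebra_simps)+
end

lemma coord_simps [simp]:
  "coord 0 i = 0" "coord (f + g) i = coord f i + coord g i"
  "coord (f - g) i = coord f i - coord g i" "coord (- f) i = - coord f i"
  "coord (scaleC c f) i = c * coord f i" "coord (r *\<^sub>R f) i = of_real r * coord f i"
  by (transfer; simp)+

lemma coord_sum: "coord (sum f A) i = (\<Sum>a\<in>A. coord (f a) i)"
  by (induction A rule: infinite_finite_induct) auto

lemma cip_summable: "(\<lambda>i. coord f i * cnj (coord g i)) summable_on UNIV"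
  by (rule summable_on_mult_of_square_summable) (rule coord_square_summable)+

lemma cip_add_left: "cip (f + g) h = cip f h + cip g h"
  unfolding cip_def by (simp add: distrib_right infsum_add cip_summable)

lemma cip_scaleC_left: "cip (scaleC c f) h = c * cip f h"
  unfolding cip_def by (simp add: mult.assoc infsum_cmult_right cip_summable)

lemma cip_commute: "cip g f = cnj (cip f g)"
  unfolding cip_def infsum_cnj[symmetric] by (simp add: mult.commute)

lemma cip_self: "cip f f = of_real (\<Sum>\<^sub>\<infinity>i. (cmod (coord f i))\<^sup>2)"
proof -
  have "((\<lambda>i. (cmod (coord f i))\<^sup>2) has_sum (\<Sum>\<^sub>\<infinity>i. (cmod (coord f i))\<^sup>2)) UNIV"
    using coord_square_summable by (rule has_sum_infsum)
  then have "((\<lambda>i. complex_of_real ((cmod (coord f i))\<^sup>2)) has_sum of_real (\<Sum>\<^sub>\<infinity>i. (cmod (coord f i))\<^sup>2)) UNIV"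
    by (simp only: has_sum_of_real_iff)
  then show ?thesis
    unfolding cip_def complex_norm_square[symmetric] by (rule infsumI)
qed

lemma scaleR_scaleC: "r *\<^sub>R f = scaleC (of_real r) f"
  by (rule l2_eqI) simp

instantiation l2 :: (type) real_inner
begin
definition inner_l2 :: "'a l2 \<Rightarrow> 'a l2 \<Rightarrow> real" where "inner_l2 f g = Re (cip f g)"
definition norm_l2 :: "'a l2 \<Rightarrow> real" where "norm_l2 f = sqrt (inner f f)"
definition dist_l2 :: "'a l2 \<Rightarrow> 'a l2 \<Rightarrow> real" where "dist_l2 f g = norm (f - g)"
definition sgn_l2 :: "'a l2 \<Rightarrow> 'a l2" where "sgn_l2 f = f /\<^sub>R norm f"
definition uniformity_l2 :: "('a l2 \<times> 'a l2) filter" where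
  "uniformity_l2 = (INF e\<in>{0 <..}. principal {(x, y). dist x y < e})"
definition open_l2 :: "'a l2 set \<Rightarrow> bool" where
  "open_l2 U = (\<forall>x\<in>U. eventually (\<lambda>(x', y). x' = x \<longrightarrow> y \<in> U) uniformity)"
instance
proof
  fix f g h :: "'a l2" and r :: real
  show "inner f g = inner g f"
    unfolding inner_l2_def using cip_commute[of g f] by simp
  show "inner (f + g) h = inner f h + inner g h"
    unfolding inner_l2_def by (simp add: cip_add_left)
  show "inner (r *\<^sub>R f) g = r * inner f g"
    unfolding inner_l2_def by (simp add: scaleR_scaleC cip_scaleC_left)
  show "0 \<le> inner f f"
    unfolding inner_l2_def cip_self by (simp add: infsum_nonneg)
  show "inner f f = 0 \<longleftrightarrow> f = 0"
  proof
    assume *: "inner f f = 0"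
    have "(cmod (coord f i))\<^sup>2 = 0" for i
    proof (rule nonneg_infsum_le_0D[where f = "\<lambda>i. (cmod (coord f i))\<^sup>2" and A = UNIV])
      show "(\<Sum>\<^sub>\<infinity>i. (cmod (coord f i))\<^sup>2) \<le> 0"
        using * unfolding inner_l2_def cip_self by simp
    qed (auto simp: coord_square_summable)
    then show "f = 0" by (intro l2_eqI) simp
  qed (simp add: inner_l2_def cip_def)
  show "norm f = sqrt (inner f f)" by (rule norm_l2_def)
  show "dist f g = norm (f - g)" by (rule dist_l2_def)
  show "sgn f = f /\<^sub>R norm f" by (rule sgn_l2_def)
  show "(uniformity :: ('a l2 \<times> 'a l2) filter) = (INF e\<in>{0 <..}. principal {(x, y). dist x y < e})"
    by (rule uniformity_l2_def)
  show "open U = (\<forall>x\<in>U. eventually (\<lambda>(x', y). x' = x \<longrightarrow> y \<in> U) uniformity)" for U :: "'a l2 set"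
    by (rule open_l2_def)
qed
end

lemma norm_l2_power2: "(norm f)\<^sup>2 = (\<Sum>\<^sub>\<infinity>i. (cmod (coord f i))\<^sup>2)"
  unfolding power2_norm_eq_inner[of f] inner_l2_def cip_self by simp

lemma cip_self_norm: "cip f f = of_real ((norm f)\<^sup>2)"
  unfolding norm_l2_power2 cip_self ..

lemma sum_coord_le_norm: "finite F \<Longrightarrow> (\<Sum>i\<in>F. (cmod (coord f i))\<^sup>2) \<le> (norm f)\<^sup>2"
  unfolding norm_l2_power2 by (rule finite_sum_le_infsum) (auto simp: coord_square_summable)

lemma coord_le_norm: "cmod (coord f i) \<le> norm f"
  by (rule power2_le_imp_le) (use sum_coord_le_norm[of "{i}" f] in auto)

lemma norm_l2_le:
  assumes "\<And>F. finite F \<Longrightarrow> (\<Sum>i\<in>F. (cmod (coord f i))\<^sup>2) \<le> C\<^sup>2" "0 \<le> C"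
  shows "norm f \<le> C"
proof -
  have "(norm f)\<^sup>2 \<le> C\<^sup>2"
    unfolding norm_l2_power2 by (rule infsum_le_finite_sums) (auto simp: coord_square_summable assms)
  then show ?thesis using assms(2) by (rule power2_le_imp_le)
qed

instance l2 :: (type) complete_space
proof
  fix X :: "nat \<Rightarrow> 'a l2"
  assume C: "Cauchy X"
  have "Cauchy (\<lambda>n. coord (X n) i)" for i
  proof (rule metric_CauchyI)
    fix e :: real assume "e > 0"
    then obtain N where N: "\<forall>m\<ge>N. \<forall>n\<ge>N. dist (X m) (X n) < e"
      using metric_CauchyD[OF C] by blast
    have "dist (coord (X m) i) (coord (X n) i) < e" if "m \<ge> N" "n \<ge> N" for m n
      using N that coord_le_norm[of "X m - X n" i] unfolding dist_norm coord_simps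
      by (meson order_le_less_trans)
    then show "\<exists>M. \<forall>m\<ge>M. \<forall>n\<ge>M. dist (coord (X m) i) (coord (X n) i) < e"
      by blast
  qed
  then have "\<forall>i. \<exists>l. (\<lambda>n. coord (X n) i) \<longlonglongrightarrow> l"
    using Cauchy_convergent convergent_def by blast
  then obtain g where g: "\<And>i. (\<lambda>n. coord (X n) i) \<longlonglongrightarrow> g i"
    by metis
  have bound: "(\<Sum>i\<in>F. (cmod (coord (X m) i - g i))\<^sup>2) \<le> e\<^sup>2"
    if F: "finite F" and e: "\<And>n. n \<ge> N \<Longrightarrow> dist (X m) (X n) \<le> e" for F m N e
  proof (rule tendsto_upperbound)
    show "(\<lambda>n. \<Sum>i\<in>F. (cmod (coord (X m) i - coord (X n) i))\<^sup>2)
        \<longlonglongrightarrow> (\<Sum>i\<in>F. (cmod (coord (X m) i - g i))\<^sup>2)"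
      by (intro tendsto_intros g)
    show "\<forall>\<^sub>F n in sequentially. (\<Sum>i\<in>F. (cmod (coord (X m) i - coord (X n) i))\<^sup>2) \<le> e\<^sup>2"
    proof (rule eventually_sequentiallyI)
      fix n assume "n \<ge> N"
      then have "(norm (X m - X n))\<^sup>2 \<le> e\<^sup>2"
        using e[of n] by (intro power_mono) (auto simp: dist_norm)
      then show "(\<Sum>i\<in>F. (cmod (coord (X m) i - coord (X n) i))\<^sup>2) \<le> e\<^sup>2"
        using sum_coord_le_norm[OF F, of "X m - X n"] by simp
    qed
  qed simp
  have "\<exists>N. \<forall>m\<ge>N. \<forall>n\<ge>N. dist (X m) (X n) < 1"
    using metric_CauchyD[OF C, of 1] by auto
  then obtain N1 where N1: "\<And>m n. m \<ge> N1 \<Longrightarrow> n \<ge> N1 \<Longrightarrow> dist (X m) (X n) < 1"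
    by blast
  have "(\<lambda>i. (cmod (coord (X N1) i - g i))\<^sup>2) summable_on UNIV"
  proof (rule nonneg_bdd_above_summable_on)
    show "bdd_above (sum (\<lambda>i. (cmod (coord (X N1) i - g i))\<^sup>2) ` {F. F \<subseteq> UNIV \<and> finite F})"
      using bound[of _ N1 N1 1] N1 by (intro bdd_aboveI2[of _ _ "1\<^sup>2"]) (auto intro: less_imp_le)
  qed simp
  then have "(\<lambda>i. (cmod ((g i - coord (X N1) i) + coord (X N1) i))\<^sup>2) summable_on UNIV"
    by (intro square_summable_add coord_square_summable) (simp add: norm_minus_commute)
  then have g': "coord (Abs_l2 g) = g"
    by (intro Abs_l2_inverse) simp
  have "X \<longlonglongrightarrow> Abs_l2 g"
  proof (rule metric_LIMSEQ_I)
    fix r :: real assume "r > 0"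
    then obtain N where N: "\<And>m n. m \<ge> N \<Longrightarrow> n \<ge> N \<Longrightarrow> dist (X m) (X n) < r / 2"
      using metric_CauchyD[OF C, of "r/2"] half_gt_zero by blast
    have "norm (X m - Abs_l2 g) \<le> r / 2" if "m \<ge> N" for m
    proof (rule norm_l2_le)
      fix F :: "'a set" assume "finite F"
      then show "(\<Sum>i\<in>F. (cmod (coord (X m - Abs_l2 g) i))\<^sup>2) \<le> (r / 2)\<^sup>2"
        using bound[of F N m "r/2"] N[OF that] by (auto simp: g' intro: less_imp_le)
    qed (use \<open>r > 0\<close> in auto)
    then show "\<exists>no. \<forall>n\<ge>no. dist (X n) (Abs_l2 g) < r"
      using \<open>r > 0\<close> by (intro exI[of _ N]) (force simp: dist_norm)
  qed
  then show "convergent X" by (rule convergentI)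
qed

lemma cip_add_right: "cip h (f + g) = cip h f + cip h g"
  using cip_add_left[of f g h] by (metis cip_commute complex_cnj_add)

lemma cip_scaleC_right: "cip h (scaleC c f) = cnj c * cip h f"
  using cip_scaleC_left[of c f h] by (metis cip_commute complex_cnj_mult)

lemma norm_scaleC: "norm (scaleC c f) = cmod c * norm f"
proof -
  have "cip (scaleC c f) (scaleC c f) = (c * cnj c) * cip f f"
    by (simp add: cip_scaleC_left cip_scaleC_right)
  then have "complex_of_real ((norm (scaleC c f))\<^sup>2) = of_real ((cmod c * norm f)\<^sup>2)"
    unfolding cip_self_norm complex_norm_square[symmetric] by (simp add: power_mult_distrib)
  then show ?thesis
    by (simp only: of_real_eq_iff) (simp add: power2_eq_iff_nonneg)
qed

lemma cmod_cip_le: "cmod (cip f g) \<le> norm f * norm g"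
proof (cases "cip f g = 0")
  case False
  define c where "c = cnj (sgn (cip f g))"
  have c: "cmod c = 1"
    using False by (simp add: c_def norm_sgn)
  have "cmod (cip f g) = inner (scaleC c f) g"
    unfolding inner_l2_def cip_scaleC_left c_def
    by (simp add: sgn_eq complex_norm_square[symmetric] power2_eq_square mult.commute[of "cnj _"])
  also have "\<dots> \<le> norm f * norm g"
    using norm_cauchy_schwarz[of "scaleC c f" g] by (simp add: norm_scaleC c)
  finally show ?thesis .
qed simp

interpretation cip: bounded_bilinear cip
proof
  show "\<exists>K. \<forall>a b. norm (cip a b) \<le> norm a * norm b * K"
    by (rule exI[of _ 1]) (simp add: cmod_cip_le)
qed (simp_all add: cip_add_left cip_add_right scaleR_scaleC cip_scaleC_left cip_scaleC_right scaleR_conv_of_real)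

interpretation scaleC: bounded_bilinear scaleC
proof
  show "\<exists>K. \<forall>a b. norm (scaleC a b) \<le> norm a * norm b * K"
    by (rule exI[of _ 1]) (simp add: norm_scaleC)
qed (auto intro!: l2_eqI simp: algebra_simps scaleR_conv_of_real)

lemma scaleC_scaleC [simp]: "scaleC a (scaleC b f) = scaleC (a * b) f"
  by (rule l2_eqI) simp

lemma scaleC_one [simp]: "scaleC 1 f = f"
  by (rule l2_eqI) simp

lemma norm_diff_l2: "(norm (f - g))\<^sup>2 = (norm f)\<^sup>2 - 2 * Re (cip f g) + (norm g)\<^sup>2"
  by (simp add: power2_norm_eq_inner inner_diff_left inner_diff_right inner_commute[of g f])
    (simp add: inner_l2_def)

section \<open>Closed subspaces and the Riesz representation theorem\<close>

definition lincomb :: "('j \<Rightarrow> 'i l2) \<Rightarrow> 'j set \<Rightarrow> ('j \<Rightarrow> complex) \<Rightarrow> 'i l2" where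
  "lincomb w F c = (\<Sum>i\<in>F. scaleC (c i) (w i))"

definition closed_cspan :: "('j \<Rightarrow> 'i l2) \<Rightarrow> 'i l2 set" where
  "closed_cspan w = closure {lincomb w F c | F c. finite F}"

definition closed_csubspace :: "'i l2 set \<Rightarrow> bool" where
  "closed_csubspace M \<longleftrightarrow> closed M \<and> 0 \<in> M \<and> (\<forall>x\<in>M. \<forall>y\<in>M. x + y \<in> M) \<and>
     (\<forall>c. \<forall>x\<in>M. scaleC c x \<in> M)"

lemma closed_csubspaceD:
  assumes "closed_csubspace M"
  shows "closed M" "0 \<in> M" "x \<in> M \<Longrightarrow> y \<in> M \<Longrightarrow> x + y \<in> M" "x \<in> M \<Longrightarrow> scaleC c x \<in> M"
  using assms by (auto simp: closed_csubspace_def)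

lemma closed_csubspace_diff: "closed_csubspace M \<Longrightarrow> x \<in> M \<Longrightarrow> y \<in> M \<Longrightarrow> x - y \<in> M"
  using closed_csubspaceD(3)[of M x "scaleC (-1) y"] closed_csubspaceD(4)[of M y "-1"]
  by (simp add: scaleC.minus_left)

lemma lincomb_add: 
  assumes "finite F" "finite F'"
  shows "lincomb w F c + lincomb w F' c' =
    lincomb w (F \<union> F') (\<lambda>i. (if i \<in> F then c i else 0) + (if i \<in> F' then c' i else 0))"
proof -
  have "lincomb w F c = lincomb w (F \<union> F') (\<lambda>i. if i \<in> F then c i else 0)"
       "lincomb w F' c' = lincomb w (F \<union> F') (\<lambda>i. if i \<in> F' then c' i else 0)"
    unfolding lincomb_def using assms by (auto intro!: sum.mono_neutral_cong_left simp: scaleC.zero_left)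
  then show ?thesis
    unfolding lincomb_def by (simp add: scaleC.add_left sum.distrib)
qed

lemma lincomb_scaleC: "scaleC a (lincomb w F c) = lincomb w F (\<lambda>i. a * c i)"
  unfolding lincomb_def by (simp add: scaleC.sum_right)

lemma lincomb_in_closed_cspan: "finite F \<Longrightarrow> lincomb w F c \<in> closed_cspan w"
  unfolding closed_cspan_def by (rule subsetD[OF closure_subset]) blast

lemma base_in_closed_cspan: "w i \<in> closed_cspan w"
  using lincomb_in_closed_cspan[of "{i}" w "\<lambda>_. 1"] by (simp add: lincomb_def)

lemma closed_cspan_sequence:
  assumes "v \<in> closed_cspan w"
  obtains F c where "\<And>n. finite (F n)" "(\<lambda>n. lincomb w (F n) (c n)) \<longlonglongrightarrow> v"
proof -
  obtain u where u: "\<And>n::nat. u n \<in> {lincomb w F c | F c. finite F}" "u \<longlonglongrightarrow> v"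
    using assms unfolding closed_cspan_def closure_sequential by blast
  then have "\<forall>n. \<exists>F c. u n = lincomb w F c \<and> finite F" by blast
  then obtain F c where "\<And>n. u n = lincomb w (F n) (c n)" "\<And>n. finite (F n)" by metis
  then show ?thesis using u(2) by (intro that[of F c]) (simp_all flip: \<open>\<And>n. u n = lincomb w (F n) (c n)\<close>)
qed

lemma closed_csubspace_closed_cspan: "closed_csubspace (closed_cspan w)"
  unfolding closed_csubspace_def
proof (intro conjI ballI allI)
  show "closed (closed_cspan w)" by (simp add: closed_cspan_def)
  show "0 \<in> closed_cspan w"
    using lincomb_in_closed_cspan[of "{}" w] by (simp add: lincomb_def)
  fix x y c assume x: "x \<in> closed_cspan w" and y: "y \<in> closed_cspan w"
  obtain F c' where F: "\<And>n. finite (F n)" "(\<lambda>n. lincomb w (F n) (c' n)) \<longlonglongrightarrow> x"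
    using closed_cspan_sequence[OF x] by blast
  obtain F' c'' where F': "\<And>n. finite (F' n)" "(\<lambda>n. lincomb w (F' n) (c'' n)) \<longlonglongrightarrow> y"
    using closed_cspan_sequence[OF y] by blast
  show "x + y \<in> closed_cspan w"
    using tendsto_add[OF F(2) F'(2)] unfolding lincomb_add[OF F(1) F'(1)]
    by (rule closed_sequentially[rotated 2]) (auto simp: F F' lincomb_in_closed_cspan, simp add: closed_cspan_def)
next
  fix x c assume x: "x \<in> closed_cspan w"
  obtain F c' where F: "\<And>n. finite (F n)" "(\<lambda>n. lincomb w (F n) (c' n)) \<longlonglongrightarrow> x"
    using closed_cspan_sequence[OF x] by blast
  show "scaleC c x \<in> closed_cspan w"
    using scaleC.tendsto[OF tendsto_const F(2), of c] unfolding lincomb_scaleC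
    by (rule closed_sequentially[rotated 2]) (auto simp: F lincomb_in_closed_cspan, simp add: closed_cspan_def)
qed

lemma lincomb_in_csubspace:
  assumes "closed_csubspace M" "\<And>i. i \<in> F \<Longrightarrow> w i \<in> M"
  shows "lincomb w F c \<in> M"
  using assms(2) unfolding lincomb_def
  by (induction F rule: infinite_finite_induct) (auto simp: closed_csubspaceD[OF assms(1)])

lemma closed_cspan_least:
  assumes "closed_csubspace M" "\<And>i. w i \<in> M"
  shows "closed_cspan w \<subseteq> M"
  unfolding closed_cspan_def
  by (rule closure_minimal) (auto simp: lincomb_in_csubspace assms closed_csubspaceD)

lemma cip_lincomb_left: "cip (lincomb w F c) v = (\<Sum>i\<in>F. c i * cip (w i) v)"
  unfolding lincomb_def by (simp add: cip.sum_left cip_scaleC_left)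

lemma cip_lincomb_right: "cip v (lincomb w F c) = (\<Sum>i\<in>F. cnj (c i) * cip v (w i))"
  unfolding lincomb_def by (simp add: cip.sum_right cip_scaleC_right)

lemma closed_csubspace_orthogonal: "closed_csubspace {v. \<forall>i\<in>I. cip (w i) v = 0}"
proof -
  have "{v. \<forall>i\<in>I. cip (w i) v = 0} = (\<Inter>i\<in>I. (\<lambda>v. cip (w i) v) -` {0})" by auto
  moreover have "closed \<dots>"
    by (intro closed_INT ballI closed_vimage) (auto intro!: cip.continuous_on continuous_intros)
  ultimately show ?thesis
    unfolding closed_csubspace_def by (auto simp: cip_add_right cip_scaleC_right cip.zero_right)
qed

lemma cip_eq_on_closed_cspan:
  assumes "\<And>i. cip (w i) x = cip (w i) y" "v \<in> closed_cspan w"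
  shows "cip v x = cip v y"
proof -
  have "closed_cspan w \<subseteq> {v. \<forall>i\<in>{()}. cip ((\<lambda>_. x - y) i) v = 0}"
  proof (rule closed_cspan_least[OF closed_csubspace_orthogonal])
    fix i
    have "cip (w i) (x - y) = 0" by (simp add: cip.diff_right assms)
    then show "w i \<in> {v. \<forall>i\<in>{()}. cip (x - y) v = 0}"
      using cip_commute[of "x - y" "w i"] by simp
  qed
  with assms(2) have "cip (x - y) v = 0" by auto
  then have "cip v (x - y) = 0" using cip_commute[of v "x - y"] by simp
  then show ?thesis by (simp add: cip.diff_right)
qed

lemma eq_in_closed_cspan:
  assumes "\<And>i. cip (w i) x = cip (w i) y" "x \<in> closed_cspan w" "y \<in> closed_cspan w"
  shows "x = y"
proof -
  have "x - y \<in> closed_cspan w"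
    using assms closed_csubspace_diff closed_csubspace_closed_cspan by blast
  then have "cip (x - y) (x - y) = 0"
    using cip_eq_on_closed_cspan[of w x y] assms(1) by (simp add: cip.diff_right)
  then show ?thesis by (simp add: cip_self_norm)
qed

text \<open>The nearest point exists because a minimizing sequence is Cauchy by the parallelogram law;
  the inequality says that moving towards \<open>s\<close> does not bring one closer to \<open>t\<close>.\<close>

lemma projection_on_closed_convex:
  fixes C :: "'a :: {real_inner, complete_space} set"
  assumes "closed C" "convex C" "C \<noteq> {}"
  obtains v where "v \<in> C" "\<And>s. s \<in> C \<Longrightarrow> inner (t - v) (s - v) \<le> 0"
proof -
  define m where "m = (INF s\<in>C. (norm (t - s))\<^sup>2)"
  have bdd: "bdd_below ((\<lambda>s. (norm (t - s))\<^sup>2) ` C)"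
    by (rule bdd_belowI2[of _ 0]) simp
  have m_le: "m \<le> (norm (t - s))\<^sup>2" if "s \<in> C" for s
    unfolding m_def by (rule cINF_lower[OF bdd that])
  have "\<exists>s\<in>C. (norm (t - s))\<^sup>2 < m + 1 / real (Suc n)" for n
    using cINF_less_iff[OF assms(3) bdd, of "m + 1 / real (Suc n)"] unfolding m_def by auto
  then obtain u where u: "\<And>n. u n \<in> C" "\<And>n. (norm (t - u n))\<^sup>2 < m + 1 / real (Suc n)"
    by metis
  have close: "(norm (u i - u j))\<^sup>2 \<le> 2 / real (Suc i) + 2 / real (Suc j)" for i j
  proof -
    have "(1/2) *\<^sub>R u i + (1/2) *\<^sub>R u j \<in> C"
      by (rule convexD[OF assms(2)]) (auto simp: u)
    then have "m \<le> (norm (t - ((1/2) *\<^sub>R u i + (1/2) *\<^sub>R u j)))\<^sup>2" by (rule m_le)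
    moreover have "(norm (u i - u j))\<^sup>2 + 4 * (norm (t - ((1/2) *\<^sub>R u i + (1/2) *\<^sub>R u j)))\<^sup>2
        = 2 * (norm (t - u i))\<^sup>2 + 2 * (norm (t - u j))\<^sup>2"
      unfolding power2_norm_eq_inner
      by (simp add: inner_diff_left inner_diff_right inner_add_left inner_add_right
          inner_commute[of "u i" t] inner_commute[of "u j" t] inner_commute[of "u j" "u i"] field_simps)
    moreover have "2 * (1 / real (Suc k)) = 2 / real (Suc k)" for k by simp
    ultimately show ?thesis using u(2)[of i] u(2)[of j] by (smt (verit))
  qed
  have "Cauchy u"
  proof (rule metric_CauchyI)
    fix e :: real assume e: "e > 0"
    obtain N :: nat where N: "4 / e\<^sup>2 < real N" using reals_Archimedean2 by blast
    have "norm (u i - u j) < e" if "i \<ge> N" "j \<ge> N" for i j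
    proof -
      have *: "2 / real (Suc k) < e\<^sup>2 / 2" if "k \<ge> N" for k
      proof -
        have "4 / e\<^sup>2 < real (Suc k)" using N that by linarith
        then show ?thesis using e by (simp add: field_simps)
      qed
      have "(norm (u i - u j))\<^sup>2 < e\<^sup>2" using close[of i j] *[OF that(1)] *[OF that(2)] by linarith
      then show ?thesis by (rule power2_less_imp_less) (use e in simp)
    qed
    then show "\<exists>M. \<forall>m\<ge>M. \<forall>n\<ge>M. dist (u m) (u n) < e" unfolding dist_norm by blast
  qed
  then obtain v where v: "u \<longlonglongrightarrow> v" using Cauchy_convergent convergent_def by blast
  have vC: "v \<in> C" by (rule closed_sequentially[OF assms(1) u(1) v])
  have vm: "(norm (t - v))\<^sup>2 \<le> m"
  proof (rule LIMSEQ_le)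
    show "(\<lambda>n. (norm (t - u n))\<^sup>2) \<longlonglongrightarrow> (norm (t - v))\<^sup>2" by (intro tendsto_intros v)
    have "(\<lambda>n. m + 1 / real (Suc n)) \<longlonglongrightarrow> m + 0"
      by (intro tendsto_intros) (use LIMSEQ_inverse_real_of_nat in \<open>simp add: inverse_eq_divide\<close>)
    then show "(\<lambda>n. m + 1 / real (Suc n)) \<longlonglongrightarrow> m" by simp
    show "\<exists>N. \<forall>n\<ge>N. (norm (t - u n))\<^sup>2 \<le> m + 1 / real (Suc n)" using u(2) less_imp_le by blast
  qed
  have "dist t v \<le> dist t z" if "z \<in> C" for z
    unfolding dist_norm by (rule power2_le_imp_le) (use order_trans[OF vm m_le[OF that]] in auto)
  then have "inner (t - v) (s - v) \<le> 0" if "s \<in> C" for s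
    using any_closest_point_dot[OF assms(2,1) vC that] by blast
  then show thesis using that vC by blast
qed

lemma sum_mult_add:
  fixes c c' h :: "'j \<Rightarrow> complex"
  assumes "finite F" "finite F'"
  shows "(\<Sum>i\<in>F. c i * h i) + (\<Sum>i\<in>F'. c' i * h i) =
    (\<Sum>i\<in>F \<union> F'. ((if i \<in> F then c i else 0) + (if i \<in> F' then c' i else 0)) * h i)"
proof -
  have "(\<Sum>i\<in>F. c i * h i) = (\<Sum>i\<in>F \<union> F'. (if i \<in> F then c i else 0) * h i)"
       "(\<Sum>i\<in>F'. c' i * h i) = (\<Sum>i\<in>F \<union> F'. (if i \<in> F' then c' i else 0) * h i)"
    using assms by (auto intro!: sum.mono_neutral_cong_left)
  then show ?thesis by (simp add: distrib_right sum.distrib)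
qed

text \<open>
  The functional that sends \<open>w i\<close> to \<open>h i\<close> is bounded, so the closure of its graph contains no
  vertical vector. Projecting \<open>(0, 1)\<close> onto this closed subspace leaves a normal vector whose second
  component is nonzero, and the first component represents the functional.
\<close>

theorem riesz:
  fixes w :: "'j \<Rightarrow> 'i l2" and h :: "'j \<Rightarrow> complex"
  assumes bound: "\<And>F c. finite F \<Longrightarrow> cmod (\<Sum>i\<in>F. c i * h i) \<le> a * norm (lincomb w F c)"
    and a: "a \<ge> 0"
  obtains v where "v \<in> closed_cspan w" "norm v \<le> a" "\<And>i. cip (w i) v = h i"
proof -
  define G where "G = {(lincomb w F c, \<Sum>i\<in>F. c i * h i) | F c. finite F}"
  have G_add: "x + y \<in> G" if xy: "x \<in> G" "y \<in> G" for x y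
  proof -
    obtain F c F' c' where x: "x = (lincomb w F c, \<Sum>i\<in>F. c i * h i)" "finite F"
      and y: "y = (lincomb w F' c', \<Sum>i\<in>F'. c' i * h i)" "finite F'"
      using xy unfolding G_def by blast
    show ?thesis
      unfolding x(1) y(1) add_Pair lincomb_add[OF x(2) y(2)] sum_mult_add[OF x(2) y(2)] G_def
      using x(2) y(2) by blast
  qed
  have G_scaleC: "(scaleC b x, b * y) \<in> G" if "(x, y) \<in> G" for b x y
    using that unfolding G_def
    by (clarsimp simp: lincomb_scaleC sum_distrib_left mult.assoc[symmetric]) blast
  have G_scaleR: "r *\<^sub>R x \<in> G" if "x \<in> G" for r x
    using G_scaleC[of "fst x" "snd x" "of_real r"] that
    by (simp add: scaleR_prod_def scaleR_scaleC scaleR_conv_of_real)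
  have "convex G" by (auto intro!: convexI G_add G_scaleR)
  moreover have "G \<noteq> {}" unfolding G_def by blast
  ultimately have "convex (closure G)" "closure G \<noteq> {}" by (simp_all add: convex_closure)
  then obtain p where p: "p \<in> closure G"
      "\<And>s. s \<in> closure G \<Longrightarrow> inner ((0, 1) - p) (s - p) \<le> 0"
    using projection_on_closed_convex[OF closed_closure, of G "(0, 1)"] by blast
  obtain u z where uz: "p = (u, z)" by (cases p)
  obtain q where q: "\<And>n::nat. q n \<in> G" "q \<longlonglongrightarrow> p"
    using p(1) unfolding closure_sequential by blast
  have add_p: "p + s \<in> closure G" if "s \<in> G" for s
  proof -
    have "(\<lambda>n. q n + s) \<longlonglongrightarrow> p + s" by (intro tendsto_intros q)
    moreover have "q n + s \<in> G" for n using G_add q(1) that by blast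
    ultimately show ?thesis
      unfolding closure_sequential by (intro exI[of _ "\<lambda>n. q n + s"]) blast
  qed
  have nonpos: "inner ((0, 1) - p) s \<le> 0" if "s \<in> G" for s
    using p(2)[OF add_p[OF that]] by simp
  have "inner ((0, 1) - p) s = 0" if "s \<in> G" for s
    using nonpos[OF that] nonpos[OF G_scaleR[OF that, of "-1"]] by simp
  then have Re0: "Re (cip (- u) x + (1 - z) * cnj y) = 0" if "(x, y) \<in> G" for x y
  proof -
    have "inner ((0, 1) - p) (x, y) = 0" using that by fact
    then show ?thesis by (simp add: uz inner_l2_def inner_complex_def inner_prod_def)
  qed
  have normal: "cip x u = cnj (1 - z) * y" if "(x, y) \<in> G" for x y
  proof -
    have "Re (cip (- u) x + (1 - z) * cnj y) = 0" using that by (rule Re0)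
    moreover have "Im (cip (- u) x + (1 - z) * cnj y) = 0"
      using Re0[OF G_scaleC[OF that, of \<i>]] by (simp add: cip_scaleC_right algebra_simps)
    ultimately have "cip u x = (1 - z) * cnj y"
      by (simp add: complex_eq_iff cip.minus_left)
    then have "cnj (cip u x) = cnj ((1 - z) * cnj y)" by simp
    then show ?thesis by (simp add: cip_commute[of x u])
  qed
  have base: "(w i, h i) \<in> G" for i
    unfolding G_def by (auto intro!: exI[of _ "{i}"] exI[of _ "\<lambda>_. 1"] simp: lincomb_def)
  have "(\<lambda>n. fst (q n)) \<longlonglongrightarrow> u" "(\<lambda>n. snd (q n)) \<longlonglongrightarrow> z"
    using tendsto_fst[OF q(2)] tendsto_snd[OF q(2)] by (auto simp: uz)
  moreover have "\<exists>F c. finite F \<and> q n = (lincomb w F c, \<Sum>i\<in>F. c i * h i)" for n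
    using q(1)[of n] unfolding G_def by blast
  then have "fst (q n) \<in> closed_cspan w" "cmod (snd (q n)) \<le> a * norm (fst (q n))" for n
    using bound lincomb_in_closed_cspan by (metis fst_conv, metis fst_conv snd_conv)
  ultimately have q': "(\<lambda>n. fst (q n)) \<longlonglongrightarrow> u" "(\<lambda>n. snd (q n)) \<longlonglongrightarrow> z"
    "\<And>n. fst (q n) \<in> closed_cspan w" "\<And>n. cmod (snd (q n)) \<le> a * norm (fst (q n))"
    by blast+
  have u: "u \<in> closed_cspan w"
    by (rule closed_sequentially[OF closed_csubspaceD(1)[OF closed_csubspace_closed_cspan] q'(3,1)])
  have z: "cmod z \<le> a * norm u"
    using q'(4) by (intro LIMSEQ_le[OF tendsto_norm[OF q'(2)] tendsto_mult[OF tendsto_const tendsto_norm[OF q'(1)]]]) blast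
  have "z \<noteq> 1"
  proof
    assume "z = 1"
    then have "cip (w i) u = cip (w i) 0" for i using normal[OF base] by (simp add: cip.zero_right)
    then have "u = 0" using u eq_in_closed_cspan closed_csubspaceD(2)[OF closed_csubspace_closed_cspan] by blast
    then show False using z \<open>z = 1\<close> by simp
  qed
  define v where "v = scaleC (1 / (1 - z)) u"
  have v: "v \<in> closed_cspan w"
    unfolding v_def using u by (rule closed_csubspaceD(4)[OF closed_csubspace_closed_cspan])
  have wv: "cip (w i) v = h i" for i
  proof -
    have "1 - z \<noteq> 0" using \<open>z \<noteq> 1\<close> by simp
    then have "cnj (1 / (1 - z)) * cnj (1 - z) = 1"
      unfolding complex_cnj_mult[symmetric] by simp
    then show ?thesis unfolding v_def cip_scaleC_right normal[OF base] by (simp add: mult.assoc[symmetric])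
  qed
  obtain F c where Fc: "\<And>n. finite (F n)" "(\<lambda>n. lincomb w (F n) (c n)) \<longlonglongrightarrow> v"
    using closed_cspan_sequence[OF v] by blast
  have "cmod (cip v v) \<le> a * norm v"
  proof (rule LIMSEQ_le)
    show "(\<lambda>n. cmod (cip (lincomb w (F n) (c n)) v)) \<longlonglongrightarrow> cmod (cip v v)"
      by (intro tendsto_norm cip.tendsto Fc tendsto_const)
    show "(\<lambda>n. a * norm (lincomb w (F n) (c n))) \<longlonglongrightarrow> a * norm v"
      by (intro tendsto_intros Fc)
    show "\<exists>N. \<forall>n\<ge>N. cmod (cip (lincomb w (F n) (c n)) v) \<le> a * norm (lincomb w (F n) (c n))"
      unfolding cip_lincomb_left wv using bound Fc(1) by blast
  qed
  then have "norm v * norm v \<le> a * norm v"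
    unfolding cip_self_norm norm_of_real by (simp add: power2_eq_square)
  then have "norm v \<le> a" using a by (cases "v = 0") auto
  show thesis by (rule that) fact+
qed

lemma eq_in_closed_csubspace:
  assumes "closed_csubspace M" "x \<in> M" "y \<in> M" "\<And>z. z \<in> M \<Longrightarrow> cip z x = cip z y"
  shows "x = y"
proof -
  have "cip (x - y) (x - y) = 0"
    using assms(4)[OF closed_csubspace_diff[OF assms(1-3)]] by (simp add: cip.diff_right)
  then show ?thesis by (simp add: cip_self_norm)
qed

text \<open>For fixed \<open>v\<close> the vector \<open>T v\<close> represents the functional that sends \<open>z\<close> to \<open>cip (S z) v\<close>.
  The Riesz theorem is applied to the family of all elements of \<open>M\<close>, with \<open>0\<close> in place of the others.\<close>

lemma adjoint_on_closed_csubspace: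
  assumes M: "closed_csubspace M"
    and add: "\<And>x y. x \<in> M \<Longrightarrow> y \<in> M \<Longrightarrow> S (x + y) = S x + S y"
    and scale: "\<And>c x. x \<in> M \<Longrightarrow> S (scaleC c x) = scaleC c (S x)"
    and bound: "\<And>x. x \<in> M \<Longrightarrow> norm (S x) \<le> C * norm x" and C: "C \<ge> 0"
  obtains T where "\<And>v. T v \<in> M" "\<And>v. norm (T v) \<le> C * norm v"
    "\<And>z v. z \<in> M \<Longrightarrow> cip z (T v) = cip (S z) v"
proof -
  define w where "w = (\<lambda>z. if z \<in> M then z else 0)"
  have wM: "w z \<in> M" for z using closed_csubspaceD(2)[OF M] by (simp add: w_def)
  have "S 0 = 0" using add[of 0 0] closed_csubspaceD(2)[OF M] by simp
  have S_lincomb: "cip (S (lincomb w F c)) v = (\<Sum>z\<in>F. c z * cip (S (w z)) v)" if "finite F" for F c v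
    using that
  proof (induction F)
    case empty
    then show ?case by (simp add: lincomb_def \<open>S 0 = 0\<close> cip.zero_left)
  next
    case (insert z F)
    have "lincomb w (insert z F) c = scaleC (c z) (w z) + lincomb w F c"
      using insert by (simp add: lincomb_def)
    moreover have "scaleC (c z) (w z) \<in> M" "lincomb w F c \<in> M"
      using wM M by (auto intro: closed_csubspaceD lincomb_in_csubspace)
    ultimately show ?case
      using insert by (simp add: add scale wM cip_add_left cip_scaleC_left)
  qed
  have "\<exists>t. t \<in> M \<and> norm t \<le> C * norm v \<and> (\<forall>z\<in>M. cip z t = cip (S z) v)" for v
  proof -
    have "cmod (\<Sum>z\<in>F. c z * cip (S (w z)) v) \<le> C * norm v * norm (lincomb w F c)" if "finite F" for F c
    proof -
      have "lincomb w F c \<in> M" using wM M by (auto intro: lincomb_in_csubspace)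
      then have "norm (S (lincomb w F c)) * norm v \<le> C * norm (lincomb w F c) * norm v"
        by (intro mult_right_mono bound) auto
      then show ?thesis
        using cmod_cip_le[of "S (lincomb w F c)" v] S_lincomb[OF that, of c v] by (simp add: mult_ac)
    qed
    then obtain t where t: "t \<in> closed_cspan w" "norm t \<le> C * norm v" "\<And>z. cip (w z) t = cip (S (w z)) v"
      using riesz[of "\<lambda>z. cip (S (w z)) v" "C * norm v" w, OF _ mult_nonneg_nonneg[OF C norm_ge_zero]] by blast
    moreover have "t \<in> M" using t(1) closed_cspan_least[of M w, OF M wM] by blast
    moreover have "cip z t = cip (S z) v" if "z \<in> M" for z
      using t(3)[of z] that by (simp add: w_def)
    ultimately show ?thesis by blast
  qed
  then show thesis using that by metis
qed

text \<open>Only the component of \<open>v\<close> in the span matters. It is a limit of finite combinations of the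
  vectors \<open>w i\<close>, and since \<open>f\<close> is bounded the inner products converge uniformly.\<close>

lemma weakly_continuous_in_closed_cspan:
  fixes f :: "'t :: topological_space \<Rightarrow> 'i l2"
  assumes span: "\<And>x. f x \<in> closed_cspan w" and bound: "\<And>x. norm (f x) \<le> C"
    and cont: "\<And>i. continuous_on UNIV (\<lambda>x. cip (f x) (w i))"
  shows "continuous_on UNIV (\<lambda>x. cip (f x) v)"
proof -
  have "cmod (\<Sum>i\<in>F. c i * cip (w i) v) \<le> norm v * norm (lincomb w F c)" for F c
    using cmod_cip_le[of "lincomb w F c" v] by (simp add: cip_lincomb_left mult.commute)
  then obtain v' where v': "v' \<in> closed_cspan w" "\<And>i. cip (w i) v' = cip (w i) v"
    using riesz[of "\<lambda>i. cip (w i) v" "norm v" w, OF _ norm_ge_zero] by blast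
  obtain F c where Fc: "\<And>n. finite (F n)" "(\<lambda>n. lincomb w (F n) (c n)) \<longlonglongrightarrow> v'"
    using closed_cspan_sequence[OF v'(1)] by blast
  have "continuous_on UNIV (\<lambda>x. cip (f x) v')"
  proof (rule uniform_limit_theorem[where F = sequentially])
    show "\<forall>\<^sub>F n in sequentially. continuous_on UNIV (\<lambda>x. cip (f x) (lincomb w (F n) (c n)))"
      unfolding cip_lincomb_right by (intro always_eventually allI continuous_intros cont)
    show "uniform_limit UNIV (\<lambda>n x. cip (f x) (lincomb w (F n) (c n))) (\<lambda>x. cip (f x) v') sequentially"
    proof (rule uniform_limitI)
      fix e :: real assume e: "e > 0"
      have "C \<ge> 0" using bound norm_ge_zero order_trans by blast
      then have "e / (C + 1) > 0" using e by simp
      then have "\<forall>\<^sub>F n in sequentially. dist (lincomb w (F n) (c n)) v' < e / (C + 1)"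
        using tendstoD[OF Fc(2)] by blast
      then show "\<forall>\<^sub>F n in sequentially. \<forall>x\<in>UNIV. dist (cip (f x) (lincomb w (F n) (c n))) (cip (f x) v') < e"
      proof eventually_elim
        case (elim n)
        show ?case
        proof
          fix x
          have "dist (cip (f x) (lincomb w (F n) (c n))) (cip (f x) v') = cmod (cip (f x) (lincomb w (F n) (c n) - v'))"
            by (simp add: dist_norm cip.diff_right)
          also have "\<dots> \<le> norm (f x) * norm (lincomb w (F n) (c n) - v')" by (rule cmod_cip_le)
          also have "\<dots> \<le> C * (e / (C + 1))"
            using elim \<open>C \<ge> 0\<close> by (intro mult_mono bound) (auto simp: dist_norm)
          also have "\<dots> < e" using e \<open>C \<ge> 0\<close> by (simp add: field_simps)
          finally show "dist (cip (f x) (lincomb w (F n) (c n))) (cip (f x) v') < e" .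
        qed
      qed
    qed
  qed simp
  moreover have "cip (f x) v = cip (f x) v'" for x
    using cip_eq_on_closed_cspan[of w v v' "f x"] v'(2) span by simp
  ultimately show ?thesis by simp
qed

section \<open>Schur multipliers and positive semidefinite kernels\<close>

definition psd :: "('j \<Rightarrow> 'j \<Rightarrow> complex) \<Rightarrow> bool" where
  "psd Z \<longleftrightarrow> (\<forall>i j. Z j i = cnj (Z i j)) \<and>
     (\<forall>F c. finite F \<longrightarrow> 0 \<le> Re (\<Sum>i\<in>F. \<Sum>j\<in>F. c i * cnj (c j) * Z i j))"

text \<open>This is the boundedness of Schur multiplication on finite matrices: the premise says that \<open>a\<close>
  is a contraction, the conclusion that its Schur product with \<open>\<psi>\<close> has norm at most \<open>k\<close>.\<close>

definition schur_bounded :: "('y \<Rightarrow> 'y \<Rightarrow> complex) \<Rightarrow> real \<Rightarrow> bool" where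
  "schur_bounded \<psi> k \<longleftrightarrow> (\<forall>F a. finite F \<longrightarrow>
     (\<forall>s t. cmod (\<Sum>x\<in>F. \<Sum>y\<in>F. a x y * s x * cnj (t y))
        \<le> L2_set (\<lambda>x. cmod (s x)) F * L2_set (\<lambda>y. cmod (t y)) F) \<longrightarrow>
     (\<forall>s t. cmod (\<Sum>x\<in>F. \<Sum>y\<in>F. \<psi> x y * a x y * s x * cnj (t y))
        \<le> k * L2_set (\<lambda>x. cmod (s x)) F * L2_set (\<lambda>y. cmod (t y)) F))"

lemma schur_bounded_nonneg:
  assumes "schur_bounded \<psi> k"
  shows "k \<ge> 0"
proof -
  have *: "(\<forall>s t. cmod (\<Sum>x\<in>F. \<Sum>y\<in>F. a x y * s x * cnj (t y))
        \<le> L2_set (\<lambda>x. cmod (s x)) F * L2_set (\<lambda>y. cmod (t y)) F) \<Longrightarrow>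
     cmod (\<Sum>x\<in>F. \<Sum>y\<in>F. \<psi> x y * a x y * s x * cnj (t y))
        \<le> k * L2_set (\<lambda>x. cmod (s x)) F * L2_set (\<lambda>y. cmod (t y)) F" if "finite F" for F a s t
    using assms that unfolding schur_bounded_def by blast
  have "cmod (\<psi> undefined undefined) \<le> k"
    using *[of "{undefined}" "\<lambda>_ _. 1" "\<lambda>_. 1" "\<lambda>_. 1"] by (simp add: norm_mult)
  then show ?thesis using norm_ge_zero order_trans by blast
qed

lemma psdI:
  assumes "\<And>i j. Z j i = cnj (Z i j)"
    "\<And>F c. finite F \<Longrightarrow> 0 \<le> Re (\<Sum>i\<in>F. \<Sum>j\<in>F. c i * cnj (c j) * Z i j)"
  shows "psd Z"
  using assms unfolding psd_def by blast

lemma psd_hermitian: "psd Z \<Longrightarrow> Z j i = cnj (Z i j)"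
  unfolding psd_def by blast

lemma psd_nonneg: "psd Z \<Longrightarrow> finite F \<Longrightarrow> 0 \<le> Re (\<Sum>i\<in>F. \<Sum>j\<in>F. c i * cnj (c j) * Z i j)"
  unfolding psd_def by blast

lemma psd_add: 
  assumes "psd Z" "psd Z'"
  shows "psd (\<lambda>i j. Z i j + Z' i j)"
proof (rule psdI)
  show "Z j i + Z' j i = cnj (Z i j + Z' i j)" for i j
    unfolding psd_hermitian[OF assms(1), of j i] psd_hermitian[OF assms(2), of j i] by (rule complex_cnj_add[symmetric])
  show "0 \<le> Re (\<Sum>i\<in>F. \<Sum>j\<in>F. c i * cnj (c j) * (Z i j + Z' i j))" if "finite F" for F c
    using psd_nonneg[OF assms(1) that, of c] psd_nonneg[OF assms(2) that, of c]
    by (simp add: distrib_left sum.distrib)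
qed

lemma psd_scale: 
  assumes "psd Z" "r \<ge> 0" 
  shows "psd (\<lambda>i j. of_real r * Z i j)"
proof (rule psdI)
  show "of_real r * Z j i = cnj (of_real r * Z i j)" for i j
    unfolding psd_hermitian[OF assms(1), of j i] by simp
  fix F c assume F: "finite (F :: 'a set)"
  have "(\<Sum>i\<in>F. \<Sum>j\<in>F. c i * cnj (c j) * (of_real r * Z i j)) = of_real r * (\<Sum>i\<in>F. \<Sum>j\<in>F. c i * cnj (c j) * Z i j)"
    by (simp add: sum_distrib_left mult_ac)
  then show "0 \<le> Re (\<Sum>i\<in>F. \<Sum>j\<in>F. c i * cnj (c j) * (of_real r * Z i j))"
    using mult_nonneg_nonneg[OF assms(2) psd_nonneg[OF assms(1) F, of c]] by simp
qed

lemma psd_rank_one: "psd (\<lambda>i j. u i * cnj (u j))"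
proof (rule psdI)
  fix F c assume "finite (F :: 'a set)"
  have "(\<Sum>i\<in>F. \<Sum>j\<in>F. c i * cnj (c j) * (u i * cnj (u j))) = (\<Sum>i\<in>F. c i * u i) * cnj (\<Sum>i\<in>F. c i * u i)"
    by (simp add: sum_product mult_ac)
  then show "0 \<le> Re (\<Sum>i\<in>F. \<Sum>j\<in>F. c i * cnj (c j) * (u i * cnj (u j)))"
    unfolding complex_norm_square[symmetric] by simp
qed simp

lemma psd_restrict:
  assumes "psd Z" "finite S"
  shows "psd (\<lambda>i j. if i \<in> S \<and> j \<in> S then Z i j else 0)"
proof (rule psdI)
  show "(if j \<in> S \<and> i \<in> S then Z j i else 0) = cnj (if i \<in> S \<and> j \<in> S then Z i j else 0)" for i j
    using psd_hermitian[OF assms(1), of j i] by (cases "i \<in> S"; cases "j \<in> S") simp_all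
  fix F c assume F: "finite (F :: 'a set)"
  have "(\<Sum>j\<in>F. c i * cnj (c j) * (if i \<in> S \<and> j \<in> S then Z i j else 0))
      = (if i \<in> S then \<Sum>j\<in>F \<inter> S. c i * cnj (c j) * Z i j else 0)" for i
    using F by (cases "i \<in> S") (simp_all add: sum.inter_restrict if_distrib[of "\<lambda>x. _ * x"] cong: if_cong)
  then have "(\<Sum>i\<in>F. \<Sum>j\<in>F. c i * cnj (c j) * (if i \<in> S \<and> j \<in> S then Z i j else 0))
      = (\<Sum>i\<in>F \<inter> S. \<Sum>j\<in>F \<inter> S. c i * cnj (c j) * Z i j)"
    by (simp only: sum.inter_restrict[OF F, of _ S])
  then show "0 \<le> Re (\<Sum>i\<in>F. \<Sum>j\<in>F. c i * cnj (c j) * (if i \<in> S \<and> j \<in> S then Z i j else 0))"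
    using psd_nonneg[OF assms(1), of "F \<inter> S" c] F by simp
qed

lemma psd_diagonal:
  assumes "psd Z"
  shows "Z i i = of_real (Re (Z i i))" "0 \<le> Re (Z i i)"
proof -
  have "Im (Z i i) = Im (cnj (Z i i))" using arg_cong[OF psd_hermitian[OF assms, of i i], of Im] .
  then show "Z i i = of_real (Re (Z i i))" by (simp add: complex_eq_iff)
  show "0 \<le> Re (Z i i)"
    using psd_nonneg[OF assms, of "{i}" "\<lambda>_. 1"] by simp
qed

text \<open>The values of the form at \<open>c\<close> plus multiples of the point \<open>p\<close> are a nonnegative quadratic
  polynomial, whose discriminant is the inequality.\<close>

lemma psd_cauchy_schwarz:
  assumes Z: "psd Z" and F: "finite F"
  shows "(cmod (\<Sum>i\<in>F. c i * Z i p))\<^sup>2 \<le> Re (Z p p) * Re (\<Sum>i\<in>F. \<Sum>j\<in>F. c i * cnj (c j) * Z i j)"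
proof -
  define h where "h = (\<Sum>i\<in>F. c i * Z i p)"
  define N where "N = Re (\<Sum>i\<in>F. \<Sum>j\<in>F. c i * cnj (c j) * Z i j)"
  have key: "0 \<le> N + 2 * Re (cnj b * h) + (cmod b)\<^sup>2 * Re (Z p p)" for b
  proof -
    define c' where "c' = (\<lambda>i. (if i \<in> F then c i else 0) + (if i = p then b else 0))"
    have ext: "(\<Sum>i\<in>insert p F. (if i \<in> F then c i else 0) * g i) = (\<Sum>i\<in>F. c i * g i)" for g :: "_ \<Rightarrow> complex"
      using F by (intro sum.mono_neutral_cong_right) auto
    have ext': "(\<Sum>i\<in>insert p F. cnj (if i \<in> F then c i else 0) * g i) = (\<Sum>i\<in>F. cnj (c i) * g i)" for g :: "_ \<Rightarrow> complex"
      using F by (intro sum.mono_neutral_cong_right) auto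
    have pt: "(\<Sum>i\<in>insert p F. (if i = p then b else 0) * g i) = b * g p" for g :: "_ \<Rightarrow> complex"
      using F by (simp add: if_distrib[of "\<lambda>x. x * _"] cong: if_cong)
    have pt': "(\<Sum>i\<in>insert p F. cnj (if i = p then b else 0) * g i) = cnj b * g p" for g :: "_ \<Rightarrow> complex"
      using F by (simp add: if_distrib[of "\<lambda>x. x * _"] if_distrib[of cnj] cong: if_cong)
    have "(\<Sum>i\<in>insert p F. \<Sum>j\<in>insert p F. c' i * cnj (c' j) * Z i j)
        = (\<Sum>i\<in>insert p F. c' i * (\<Sum>j\<in>insert p F. cnj (c' j) * Z i j))"
      by (simp add: sum_distrib_left mult.assoc)
    also have "\<dots> = (\<Sum>i\<in>F. c i * ((\<Sum>j\<in>F. cnj (c j) * Z i j) + cnj b * Z i p))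
        + b * ((\<Sum>j\<in>F. cnj (c j) * Z p j) + cnj b * Z p p)"
      unfolding c'_def by (simp only: complex_cnj_add distrib_right sum.distrib ext ext' pt pt')
    also have "\<dots> = (\<Sum>i\<in>F. \<Sum>j\<in>F. c i * cnj (c j) * Z i j) + cnj b * h + b * (\<Sum>j\<in>F. cnj (c j) * Z p j) + b * cnj b * Z p p"
      by (simp add: h_def distrib_left sum.distrib sum_distrib_left mult_ac)
    also have "(\<Sum>j\<in>F. cnj (c j) * Z p j) = cnj h"
      unfolding h_def cnj_sum by (intro sum.cong refl) (subst psd_hermitian[OF Z, of p], simp)
    also have "b * cnj b = of_real ((cmod b)\<^sup>2)" by (simp only: complex_norm_square)
    finally have "Re (\<Sum>i\<in>insert p F. \<Sum>j\<in>insert p F. c' i * cnj (c' j) * Z i j)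
        = N + 2 * Re (cnj b * h) + (cmod b)\<^sup>2 * Re (Z p p)"
      by (simp add: N_def)
    moreover have "0 \<le> Re (\<Sum>i\<in>insert p F. \<Sum>j\<in>insert p F. c' i * cnj (c' j) * Z i j)"
      using F by (intro psd_nonneg[OF Z]) simp
    ultimately show ?thesis by simp
  qed
  define q where "q = Re (Z p p)"
  have q: "q \<ge> 0" using psd_diagonal[OF Z] by (simp add: q_def)
  have key': "0 \<le> N - 2 * r * (cmod h)\<^sup>2 + r\<^sup>2 * (cmod h)\<^sup>2 * q" for r :: real
  proof -
    have "cnj (- of_real r * h) * h = of_real (- r * (cmod h)\<^sup>2)"
      by (simp add: complex_norm_square mult_ac del: of_real_power)
    then have "Re (cnj (- of_real r * h) * h) = - r * (cmod h)\<^sup>2" by (metis Re_complex_of_real)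
    then show ?thesis using key[of "- of_real r * h"]
      by (simp add: norm_mult power_mult_distrib q_def)
  qed
  have "(cmod h)\<^sup>2 \<le> q * N"
  proof (cases "q = 0")
    case True
    then have 1: "2 * r * (cmod h)\<^sup>2 \<le> N" for r using key'[of r] by simp
    have "(cmod h)\<^sup>2 = 0"
    proof (rule ccontr)
      assume "(cmod h)\<^sup>2 \<noteq> 0"
      then have "2 * ((N + 1) / (2 * (cmod h)\<^sup>2)) * (cmod h)\<^sup>2 = N + 1" by (simp add: field_simps)
      then show False using 1[of "(N + 1) / (2 * (cmod h)\<^sup>2)"] by linarith
    qed
    then show ?thesis using True by simp
  next
    case False
    then have "q > 0" using q by simp
    then show ?thesis using key'[of "1/q"] by (simp add: field_simps power2_eq_square)
  qed
  then show ?thesis by (simp add: h_def N_def q_def)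
qed

lemma psd_entry_le:
  assumes "psd Z" "Re (Z i i) \<le> r" "Re (Z j j) \<le> r"
  shows "cmod (Z i j) \<le> r"
proof -
  have r: "r \<ge> 0" using psd_diagonal(2)[OF assms(1), of i] assms(2) by linarith
  have "(cmod (Z i j))\<^sup>2 \<le> Re (Z j j) * Re (Z i i)"
    using psd_cauchy_schwarz[OF assms(1), of "{i}" "\<lambda>_. 1" j] by simp
  also have "\<dots> \<le> r * r"
    using assms psd_diagonal(2)[OF assms(1)] r by (intro mult_mono) auto
  finally show ?thesis by (rule power2_le_imp_le[OF _ r, unfolded power2_eq_square[of r]])
qed

lemma cip_finite_support:
  assumes "finite S" "\<And>j. j \<notin> S \<Longrightarrow> coord g j = 0"
  shows "cip f g = (\<Sum>j\<in>S. coord f j * cnj (coord g j))"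
proof -
  have "cip f g = (\<Sum>\<^sub>\<infinity>j\<in>S. coord f j * cnj (coord g j))"
    unfolding cip_def using assms(2) by (intro infsum_cong_neutral) auto
  then show ?thesis using assms(1) by simp
qed

lemma coord_Abs_finite_support:
  assumes "finite S" "\<And>j. j \<notin> S \<Longrightarrow> f j = 0"
  shows "coord (Abs_l2 f) = f"
proof (rule Abs_l2_inverse)
  have "(\<lambda>i. (cmod (f i))\<^sup>2) summable_on S \<longleftrightarrow> (\<lambda>i. (cmod (f i))\<^sup>2) summable_on UNIV"
    by (rule summable_on_cong_neutral) (simp_all add: assms(2))
  then show "f \<in> {f. (\<lambda>i. (cmod (f i))\<^sup>2) summable_on UNIV}"
    using assms(1) by simp
qed

lemma cnj_sgn_mult: "cnj (sgn b) * b = of_real (cmod b)"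
proof (cases "b = 0")
  case False
  have "cnj (sgn b) * b = (b * cnj b) / of_real (cmod b)" unfolding sgn_eq by simp
  also have "\<dots> = of_real (cmod b)"
    unfolding complex_norm_square[symmetric] using False by (simp add: power2_eq_square)
  finally show ?thesis .
qed simp

text \<open>Rotating \<open>s\<close> by a phase turns the lower bound for the real part into a bound for the absolute
  value, and scaling \<open>s\<close> and \<open>t\<close> to norm one turns the mean of squares into a product.\<close>

lemma sesquilinear_bound:
  assumes F: "finite F" and
    lower: "\<And>s t. Re (\<Sum>x\<in>F. \<Sum>y\<in>F. a x y * s x * cnj (t y))
      \<ge> - ((L2_set (\<lambda>x. cmod (s x)) F)\<^sup>2 + (L2_set (\<lambda>y. cmod (t y)) F)\<^sup>2) / 2"
  shows "cmod (\<Sum>x\<in>F. \<Sum>y\<in>F. a x y * s x * cnj (t y))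
    \<le> L2_set (\<lambda>x. cmod (s x)) F * L2_set (\<lambda>y. cmod (t y)) F"
proof -
  define S where "S = L2_set (\<lambda>x. cmod (s x)) F"
  define T where "T = L2_set (\<lambda>y. cmod (t y)) F"
  define B where "B = (\<Sum>x\<in>F. \<Sum>y\<in>F. a x y * s x * cnj (t y))"
  show ?thesis
  proof (cases "S = 0 \<or> T = 0 \<or> B = 0")
    case True
    then have "(\<forall>x\<in>F. s x = 0) \<or> (\<forall>y\<in>F. t y = 0) \<or> B = 0"
      unfolding S_def T_def L2_set_eq_0_iff[OF F] by simp
    then have "B = 0" unfolding B_def by (elim disjE) (simp_all cong: sum.cong)
    then show ?thesis unfolding B_def[symmetric] by (simp add: L2_set_nonneg)
  next
    case False
    then have pos: "S > 0" "T > 0" by (auto simp: S_def T_def less_le L2_set_nonneg)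
    define c where "c = - cnj (sgn B) / S"
    have c: "cmod c = 1 / S" using False pos by (simp add: c_def norm_divide norm_sgn)
    have scale: "L2_set (\<lambda>x. cmod (z * f x)) F = cmod z * L2_set (\<lambda>x. cmod (f x)) F" for z f
      by (simp add: norm_mult L2_set_right_distrib)
    have S': "L2_set (\<lambda>x. cmod (c * s x)) F = 1"
      unfolding scale c S_def[symmetric] using pos by simp
    have T': "L2_set (\<lambda>y. cmod (of_real (1/T) * t y)) F = 1"
      unfolding scale T_def[symmetric] using pos by (simp add: norm_divide)
    have "- 1 \<le> Re (\<Sum>x\<in>F. \<Sum>y\<in>F. a x y * (c * s x) * cnj (of_real (1/T) * t y))"
      using lower[of "\<lambda>x. c * s x" "\<lambda>y. of_real (1/T) * t y"] unfolding S' T' by simp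
    also have "(\<Sum>x\<in>F. \<Sum>y\<in>F. a x y * (c * s x) * cnj (of_real (1/T) * t y)) = c * of_real (1/T) * B"
      unfolding B_def by (simp add: sum_distrib_left mult_ac)
    also have "c * of_real (1/T) * B = - (cnj (sgn B) * B) / (of_real S * of_real T)"
      by (simp add: c_def)
    also have "\<dots> = of_real (- (cmod B / (S * T)))"
      unfolding cnj_sgn_mult by simp
    also have "Re \<dots> = - (cmod B / (S * T))" by (rule Re_complex_of_real)
    finally have "cmod B / (S * T) \<le> 1" using pos by simp
    then show ?thesis unfolding B_def[symmetric] S_def[symmetric] T_def[symmetric] using pos by simp
  qed
qed

text \<open>A matrix on \<open>F\<close> together with diagonal weights on two copies of \<open>F\<close>, as one vector of a real
  inner product space in which convex sets can be separated.\<close>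

definition pair_vec :: "'y set \<Rightarrow> ('y \<Rightarrow> 'y \<Rightarrow> complex) \<Rightarrow> ('y + 'y \<Rightarrow> real) \<Rightarrow> ('y \<times> 'y + ('y + 'y)) l2" where
  "pair_vec F f d = Abs_l2 (\<lambda>j. case j of
      Inl (x, y) \<Rightarrow> if x \<in> F \<and> y \<in> F then f x y else 0
    | Inr i \<Rightarrow> if i \<in> F <+> F then of_real (d i) else 0)"

lemma coord_pair_vec:
  assumes "finite F"
  shows "coord (pair_vec F f d) = (\<lambda>j. case j of
      Inl (x, y) \<Rightarrow> if x \<in> F \<and> y \<in> F then f x y else 0
    | Inr i \<Rightarrow> if i \<in> F <+> F then of_real (d i) else 0)"
  unfolding pair_vec_def
  by (rule coord_Abs_finite_support[of "(F \<times> F) <+> (F <+> F)"])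
     (use assms in \<open>auto split: sum.split\<close>)

lemma pair_vec_add:
  assumes "finite F"
  shows "pair_vec F f d + pair_vec F f' d' = pair_vec F (\<lambda>x y. f x y + f' x y) (\<lambda>i. d i + d' i)"
  by (rule l2_eqI) (auto simp: coord_pair_vec[OF assms] split: sum.split)

lemma pair_vec_scaleR:
  assumes "finite F"
  shows "r *\<^sub>R pair_vec F f d = pair_vec F (\<lambda>x y. of_real r * f x y) (\<lambda>i. r * d i)"
  by (rule l2_eqI) (auto simp: coord_pair_vec[OF assms] split: sum.split)

lemma inner_pair_vec:
  assumes F: "finite F"
  shows "inner n (pair_vec F f d) =
    Re (\<Sum>x\<in>F. \<Sum>y\<in>F. coord n (Inl (x, y)) * cnj (f x y)) + (\<Sum>i\<in>F <+> F. Re (coord n (Inr i)) * d i)"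
proof -
  have fin: "finite (F \<times> F)" "finite (F <+> F)" using F by auto
  have "cip n (pair_vec F f d) = (\<Sum>j\<in>(F \<times> F) <+> (F <+> F). coord n j * cnj (coord (pair_vec F f d) j))"
    by (rule cip_finite_support) (use F in \<open>auto simp: coord_pair_vec split: sum.split\<close>)
  also have "\<dots> = (\<Sum>p\<in>F \<times> F. coord n (Inl p) * cnj (coord (pair_vec F f d) (Inl p)))
      + (\<Sum>i\<in>F <+> F. coord n (Inr i) * cnj (coord (pair_vec F f d) (Inr i)))"
    unfolding sum.Plus[OF fin] by simp
  also have "(\<Sum>p\<in>F \<times> F. coord n (Inl p) * cnj (coord (pair_vec F f d) (Inl p)))
      = (\<Sum>x\<in>F. \<Sum>y\<in>F. coord n (Inl (x, y)) * cnj (f x y))"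
    unfolding sum.cartesian_product by (rule sum.cong) (auto simp: coord_pair_vec[OF F])
  also have "(\<Sum>i\<in>F <+> F. coord n (Inr i) * cnj (coord (pair_vec F f d) (Inr i)))
      = (\<Sum>i\<in>F <+> F. coord n (Inr i) * of_real (d i))"
    by (rule sum.cong) (simp_all add: coord_pair_vec[OF F])
  finally show ?thesis unfolding inner_l2_def by simp
qed

text \<open>
  The data \<open>(Z (Inl x) (Inr y), Z i i + slack)\<close> of positive semidefinite kernels \<open>Z\<close> form a convex
  cone. Were \<open>(\<psi>, k)\<close> outside its closure, a normal vector at the nearest point would consist of a
  matrix \<open>B\<close> and weights \<open>p\<close>. Testing it on kernels of rank one shows that \<open>B\<close> divided by the
  square roots of the weights is a contraction, and then the Schur bound for \<open>\<psi>\<close> contradicts the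
  strict separation.
\<close>

lemma psd_completion_approximate:
  fixes \<psi> :: "'y \<Rightarrow> 'y \<Rightarrow> complex"
  assumes \<psi>: "schur_bounded \<psi> k" and F: "finite F" and e: "e > 0"
  shows "\<exists>Z. psd Z \<and> (\<forall>i\<in>F <+> F. Re (Z i i) \<le> k + e) \<and>
    (\<forall>x\<in>F. \<forall>y\<in>F. cmod (Z (Inl x) (Inr y) - \<psi> x y) \<le> e)"
proof -
  define elt where "elt = (\<lambda>Z \<rho>. pair_vec F (\<lambda>x y. Z (Inl x) (Inr y)) (\<lambda>i. Re (Z i i) + \<rho> i))"
  define C where "C = {elt Z \<rho> | Z \<rho>. psd Z \<and> (\<forall>i. 0 \<le> \<rho> i)}"
  define t where "t = pair_vec F \<psi> (\<lambda>_. k)"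
  have C_I: "elt Z \<rho> \<in> C" if "psd Z" "\<And>i. 0 \<le> \<rho> i" for Z \<rho>
    using that unfolding C_def by blast
  have C_add: "a + b \<in> C" if ab: "a \<in> C" "b \<in> C" for a b
  proof -
    obtain Z \<rho> where a: "a = elt Z \<rho>" "psd Z" "\<And>i. 0 \<le> \<rho> i" using ab(1) unfolding C_def by blast
    obtain Z' \<rho>' where b: "b = elt Z' \<rho>'" "psd Z'" "\<And>i. 0 \<le> \<rho>' i" using ab(2) unfolding C_def by blast
    have "a + b = elt (\<lambda>i j. Z i j + Z' i j) (\<lambda>i. \<rho> i + \<rho>' i)"
      unfolding a(1) b(1) elt_def pair_vec_add[OF F] by (simp add: add_ac)
    also have "\<dots> \<in> C" by (rule C_I[OF psd_add[OF a(2) b(2)] add_nonneg_nonneg[OF a(3) b(3)]])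
    finally show ?thesis .
  qed
  have C_scale: "r *\<^sub>R a \<in> C" if ra: "a \<in> C" "r \<ge> 0" for r a
  proof -
    obtain Z \<rho> where a: "a = elt Z \<rho>" "psd Z" "\<And>i. 0 \<le> \<rho> i" using ra(1) unfolding C_def by blast
    have "r *\<^sub>R a = elt (\<lambda>i j. of_real r * Z i j) (\<lambda>i. r * \<rho> i)"
      unfolding a(1) elt_def pair_vec_scaleR[OF F] by (simp add: distrib_left)
    also have "\<dots> \<in> C" by (rule C_I[OF psd_scale[OF a(2) ra(2)] mult_nonneg_nonneg[OF ra(2) a(3)]])
    finally show ?thesis .
  qed
  have zero: "psd (\<lambda>_ _ :: 'y + 'y. 0)" by (rule psdI) simp_all
  have "0 \<in> C"
    using C_scale[OF C_I[OF zero, of "\<lambda>_. 0"], of 0] by simp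
  have "convex C" by (rule convexI) (blast intro: C_add C_scale)
  then have "convex (closure C)" by (rule convex_closure)
  moreover have "closure C \<noteq> {}" using \<open>0 \<in> C\<close> closure_subset by blast
  ultimately obtain v where v: "v \<in> closure C" "\<And>s. s \<in> closure C \<Longrightarrow> inner (t - v) (s - v) \<le> 0"
    using projection_on_closed_convex[OF closed_closure, of C t] by blast
  have "v = t"
  proof (rule ccontr)
    assume "v \<noteq> t"
    define n where "n = v - t"
    obtain q where q: "\<And>m::nat. q m \<in> C" "q \<longlonglongrightarrow> v" using v(1) unfolding closure_sequential by blast
    have n_nonneg: "0 \<le> inner n s" if s: "s \<in> C" for s
    proof -
      have "(\<lambda>m. q m + s) \<longlonglongrightarrow> v + s" by (intro tendsto_intros q)
      moreover have "q m + s \<in> C" for m using C_add q(1) s by blast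
      ultimately have "v + s \<in> closure C"
        unfolding closure_sequential by (intro exI[of _ "\<lambda>m. q m + s"]) blast
      from v(2)[OF this] show ?thesis by (simp add: n_def inner_diff_left)
    qed
    have "inner n v \<le> 0"
      using v(2)[of 0] \<open>0 \<in> C\<close> closure_subset by (auto simp: n_def inner_diff_left)
    moreover have "inner n t = inner n v - (norm n)\<^sup>2"
      unfolding power2_norm_eq_inner by (simp add: n_def inner_diff_right)
    moreover have "(norm n)\<^sup>2 > 0" using \<open>v \<noteq> t\<close> by (simp add: n_def)
    ultimately have neg: "inner n t < 0" by linarith
    define B where "B = (\<lambda>x y. coord n (Inl (x, y)))"
    define p where "p = (\<lambda>i. Re (coord n (Inr i)))"
    have inner_n: "inner n (pair_vec F f d) = Re (\<Sum>x\<in>F. \<Sum>y\<in>F. B x y * cnj (f x y)) + (\<Sum>i\<in>F <+> F. p i * d i)" for f d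
      unfolding inner_pair_vec[OF F] B_def p_def ..
    have finF2: "finite (F <+> F)" using F by simp
    have p_nonneg: "p i \<ge> 0" if i: "i \<in> F <+> F" for i
    proof -
      have "0 \<le> inner n (elt (\<lambda>_ _. 0) (\<lambda>j. if j = i then 1 else 0))"
        by (intro n_nonneg C_I zero) simp
      then show ?thesis
        unfolding elt_def inner_n using i finF2 by (simp add: if_distrib[of "\<lambda>x. _ * x"] cong: if_cong)
    qed
    have k: "k \<ge> 0" using \<psi> by (rule schur_bounded_nonneg)
    \<comment> \<open>The weights \<open>p\<close> may vanish. Raising all of them by \<open>\<delta>\<close> allows one to divide by their square
      roots, and \<open>\<delta>\<close> is so small that the separation stays strict.\<close>
    define \<delta> where "\<delta> = - inner n t / (2 * (k * card (F <+> F) + 1))"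
    have den: "k * card (F <+> F) + 1 > 0" using k by (simp add: add_nonneg_pos)
    have \<delta>: "\<delta> > 0" unfolding \<delta>_def using neg den by (intro divide_pos_pos) simp_all
    define p' where "p' = (\<lambda>i. p i + \<delta>)"
    have p': "p' i > 0" if "i \<in> F <+> F" for i using p_nonneg[OF that] \<delta> by (simp add: p'_def)
    have pl: "p' (Inl x) > 0" "p' (Inr x) > 0" if "x \<in> F" for x using p' that by auto
    define P where "P = (\<Sum>x\<in>F. p' (Inl x))"
    define Q where "Q = (\<Sum>y\<in>F. p' (Inr y))"
    have PQ_nonneg: "P \<ge> 0" "Q \<ge> 0" unfolding P_def Q_def using pl by (auto intro: sum_nonneg less_imp_le)
    have PQ: "(\<Sum>i\<in>F <+> F. p' i) = P + Q"
      unfolding sum.Plus[OF F F] P_def Q_def by simp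
    define W where "W = Re (\<Sum>x\<in>F. \<Sum>y\<in>F. B x y * cnj (\<psi> x y))"
    have strict: "W + k * (P + Q) < 0"
    proof -
      have "k * (P + Q) = (\<Sum>i\<in>F <+> F. p i * k) + k * card (F <+> F) * \<delta>"
        unfolding PQ[symmetric] p'_def by (simp add: sum.distrib sum_distrib_left distrib_left mult.commute)
      moreover have "k * card (F <+> F) * \<delta> < - inner n t"
      proof -
        have "k * card (F <+> F) * \<delta> \<le> (k * card (F <+> F) + 1) * \<delta>" using \<delta> by (simp add: distrib_right)
        also have "\<dots> = - inner n t / 2" unfolding \<delta>_def using den by (simp add: field_simps)
        also have "\<dots> < - inner n t" using neg by simp
        finally show ?thesis .
      qed
      moreover have "inner n t = W + (\<Sum>i\<in>F <+> F. p i * k)" unfolding t_def inner_n W_def ..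
      ultimately show ?thesis by linarith
    qed
    define rl where "rl = (\<lambda>x. complex_of_real (sqrt (p' (Inl x))))"
    define rr where "rr = (\<lambda>y. complex_of_real (sqrt (p' (Inr y))))"
    have rl: "rl x \<noteq> 0" "(cmod (rl x))\<^sup>2 = p' (Inl x)" "cnj (rl x) = rl x" if "x \<in> F" for x
      using pl[OF that] by (auto simp: rl_def)
    have rr: "rr x \<noteq> 0" "(cmod (rr x))\<^sup>2 = p' (Inr x)" "cnj (rr x) = rr x" if "x \<in> F" for x
      using pl[OF that] by (auto simp: rr_def)
    define a where "a = (\<lambda>x y. cnj (B x y) / (2 * rl x * rr y))"
    have contraction: "cmod (\<Sum>x\<in>F. \<Sum>y\<in>F. a x y * s x * cnj (u y))
        \<le> L2_set (\<lambda>x. cmod (s x)) F * L2_set (\<lambda>y. cmod (u y)) F" for s u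
    proof (rule sesquilinear_bound[OF F])
      fix s u :: "'y \<Rightarrow> complex"
      define z where "z = (\<lambda>i. case i of Inl x \<Rightarrow> s x / rl x | Inr y \<Rightarrow> u y / rr y)"
      have "0 \<le> inner n (elt (\<lambda>i j. z i * cnj (z j)) (\<lambda>_. 0))"
        by (intro n_nonneg C_I psd_rank_one) simp
      also have "\<dots> = Re (\<Sum>x\<in>F. \<Sum>y\<in>F. B x y * cnj (z (Inl x) * cnj (z (Inr y)))) + (\<Sum>i\<in>F <+> F. p i * (cmod (z i))\<^sup>2)"
        unfolding elt_def inner_n by (simp add: complex_norm_square[symmetric] del: complex_cnj_mult)
      also have "Re (\<Sum>x\<in>F. \<Sum>y\<in>F. B x y * cnj (z (Inl x) * cnj (z (Inr y))))
          = Re (cnj (\<Sum>x\<in>F. \<Sum>y\<in>F. B x y * cnj (z (Inl x) * cnj (z (Inr y)))))"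
        by (rule cnj.simps(1)[symmetric])
      also have "cnj (\<Sum>x\<in>F. \<Sum>y\<in>F. B x y * cnj (z (Inl x) * cnj (z (Inr y))))
          = 2 * (\<Sum>x\<in>F. \<Sum>y\<in>F. a x y * s x * cnj (u y))"
        unfolding cnj_sum sum_distrib_left a_def z_def
        by (intro sum.cong refl) (simp add: rl rr)
      also have "(\<Sum>i\<in>F <+> F. p i * (cmod (z i))\<^sup>2) \<le> (\<Sum>i\<in>F <+> F. p' i * (cmod (z i))\<^sup>2)"
        unfolding p'_def using \<delta> by (intro sum_mono mult_right_mono) auto
      also have "\<dots> = (\<Sum>x\<in>F. (cmod (s x))\<^sup>2) + (\<Sum>y\<in>F. (cmod (u y))\<^sup>2)"
      proof -
        have "p' (Inl x) * (cmod (z (Inl x)))\<^sup>2 = (cmod (s x))\<^sup>2" if "x \<in> F" for x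
          using rl(2)[OF that] pl[OF that] by (simp add: z_def norm_divide power_divide)
        moreover have "p' (Inr x) * (cmod (z (Inr x)))\<^sup>2 = (cmod (u x))\<^sup>2" if "x \<in> F" for x
          using rr(2)[OF that] pl[OF that] by (simp add: z_def norm_divide power_divide)
        ultimately show ?thesis unfolding sum.Plus[OF F F] by simp
      qed
      finally show "- ((L2_set (\<lambda>x. cmod (s x)) F)\<^sup>2 + (L2_set (\<lambda>y. cmod (u y)) F)\<^sup>2) / 2
          \<le> Re (\<Sum>x\<in>F. \<Sum>y\<in>F. a x y * s x * cnj (u y))"
        by (simp add: L2_set_def sum_nonneg)
    qed
    have "cmod (\<Sum>x\<in>F. \<Sum>y\<in>F. \<psi> x y * a x y * rl x * cnj (rr y))
        \<le> k * L2_set (\<lambda>x. cmod (rl x)) F * L2_set (\<lambda>y. cmod (rr y)) F"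
      using \<psi> F contraction unfolding schur_bounded_def by blast
    moreover have "(\<Sum>x\<in>F. \<Sum>y\<in>F. \<psi> x y * a x y * rl x * cnj (rr y))
        = (\<Sum>x\<in>F. \<Sum>y\<in>F. \<psi> x y * cnj (B x y)) / 2"
      unfolding sum_divide_distrib a_def by (intro sum.cong refl) (simp add: rl rr)
    moreover have "L2_set (\<lambda>x. cmod (rl x)) F = sqrt P" "L2_set (\<lambda>y. cmod (rr y)) F = sqrt Q"
      unfolding L2_set_def P_def Q_def using rl(2) rr(2) by simp_all
    ultimately have "cmod (\<Sum>x\<in>F. \<Sum>y\<in>F. \<psi> x y * cnj (B x y)) \<le> k * (2 * (sqrt P * sqrt Q))"
      by (simp add: norm_divide)
    also have "\<dots> \<le> k * (P + Q)"
      using sum_squares_bound[of "sqrt P" "sqrt Q"] PQ_nonneg k by (intro mult_left_mono) (auto simp: mult.assoc)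
    finally have "- (k * (P + Q)) \<le> Re (\<Sum>x\<in>F. \<Sum>y\<in>F. \<psi> x y * cnj (B x y))"
      using abs_Re_le_cmod[of "\<Sum>x\<in>F. \<Sum>y\<in>F. \<psi> x y * cnj (B x y)"] by linarith
    also have "\<dots> = Re (cnj (\<Sum>x\<in>F. \<Sum>y\<in>F. \<psi> x y * cnj (B x y)))" by (rule cnj.simps(1)[symmetric])
    also have "\<dots> = W" unfolding W_def by (simp add: mult.commute)
    finally show False using strict by linarith
  qed
  with v(1) e obtain u where u: "u \<in> C" "dist u t < e"
    by (auto simp: closure_approachable)
  then obtain Z \<rho> where Z: "u = elt Z \<rho>" "psd Z" "\<And>i. 0 \<le> \<rho> i" unfolding C_def by blast
  have close: "cmod (coord u j - coord t j) \<le> e" for j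
    using coord_le_norm[of "u - t" j] u(2) by (simp add: dist_norm)
  have "Re (Z i i) \<le> k + e" if i: "i \<in> F <+> F" for i
  proof -
    have "Re (coord u (Inr i) - coord t (Inr i)) \<le> e"
      using complex_Re_le_cmod close order_trans by blast
    then show ?thesis
      using i Z(3)[of i] unfolding Z(1) elt_def t_def coord_pair_vec[OF F] by simp
  qed
  moreover have "cmod (Z (Inl x) (Inr y) - \<psi> x y) \<le> e" if "x \<in> F" "y \<in> F" for x y
    using close[of "Inl (x, y)"] that unfolding Z(1) elt_def t_def coord_pair_vec[OF F] by simp
  ultimately show ?thesis using Z(2) by blast
qed

lemma compact_bounded_functions: "compact {f :: 'j \<Rightarrow> complex. \<forall>j. cmod (f j) \<le> r}"
proof -
  have "{f :: 'j \<Rightarrow> complex. \<forall>j. cmod (f j) \<le> r} = PiE UNIV (\<lambda>_. cball 0 r)"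
    by (auto simp: PiE_def Pi_def)
  moreover have "compactin (product_topology (\<lambda>_. euclidean) UNIV) (PiE UNIV (\<lambda>_ :: 'j. cball (0 :: complex) r))"
    unfolding compactin_PiE by simp
  ultimately show ?thesis by (simp add: euclidean_product_topology)
qed

text \<open>  This is Grothendieck's description of Schur multipliers: \<open>\<psi>\<close> is the off-diagonal corner of a positive
  semidefinite kernel with diagonal at most \<open>k\<close>. The entries of such kernels are bounded, so by
  Tychonoff's theorem one kernel satisfies all the approximate conditions on finite sets at once.\<close>

theorem psd_completion:
  fixes \<psi> :: "'y \<Rightarrow> 'y \<Rightarrow> complex"
  assumes \<psi>: "schur_bounded \<psi> k"
  obtains Z where "psd Z" "\<And>i. Re (Z i i) \<le> k" "\<And>x y. Z (Inl x) (Inr y) = \<psi> x y"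
proof -
  define S where "S = {f :: ('y + 'y) \<times> ('y + 'y) \<Rightarrow> complex. \<forall>j. cmod (f j) \<le> k + 1}"
  define I where "I = {(F :: 'y set, e :: real). finite F \<and> 0 < e \<and> e \<le> 1}"
  define A where "A = (\<lambda>(F, e). {f :: ('y + 'y) \<times> ('y + 'y) \<Rightarrow> complex. psd (curry f) \<and>
      (\<forall>i\<in>F <+> F. Re (f (i, i)) \<le> k + e) \<and> (\<forall>x\<in>F. \<forall>y\<in>F. cmod (f (Inl x, Inr y) - \<psi> x y) \<le> e)})"
  have [continuous_intros]: "continuous_on UNIV (\<lambda>f :: ('y + 'y) \<times> ('y + 'y) \<Rightarrow> complex. f p)" for p
    by (rule continuous_on_product_coordinates)
  have "S \<inter> (\<Inter>i\<in>I. A i) \<noteq> {}"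
  proof (rule compact_imp_fip_image)
    show "compact S" unfolding S_def by (rule compact_bounded_functions)
    show "closed (A i)" if "i \<in> I" for i
    proof -
      obtain F e where i: "i = (F, e)" by (cases i)
      show ?thesis
        unfolding i A_def psd_def curry_def Ball_def prod.case
        by (intro closed_Collect_conj closed_Collect_all closed_Collect_imp open_Collect_const
            closed_Collect_eq closed_Collect_le continuous_intros)
    qed
    fix I' assume I': "finite I'" "I' \<subseteq> I"
    define F where "F = \<Union>(fst ` I')"
    define e where "e = Min (insert 1 (snd ` I'))"
    have F: "finite F" unfolding F_def using I' by (auto simp: I_def)
    have "e > 0" "e \<le> 1" unfolding e_def using I' by (auto simp: I_def)
    obtain Z where Z: "psd Z" "\<forall>i\<in>F <+> F. Re (Z i i) \<le> k + e"
        "\<forall>x\<in>F. \<forall>y\<in>F. cmod (Z (Inl x) (Inr y) - \<psi> x y) \<le> e"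
      using psd_completion_approximate[OF \<psi> F \<open>e > 0\<close>] by blast
    define Z' where "Z' = (\<lambda>i j. if i \<in> F <+> F \<and> j \<in> F <+> F then Z i j else 0)"
    have Z': "psd Z'" unfolding Z'_def by (rule psd_restrict[OF Z(1)]) (use F in simp)
    have diag: "Re (Z' i i) \<le> k + 1" for i
      using Z(2) \<open>e \<le> 1\<close> schur_bounded_nonneg[OF \<psi>] unfolding Z'_def by force
    have "(\<lambda>(i, j). Z' i j) \<in> S"
      unfolding S_def using psd_entry_le[OF Z' diag diag] by auto
    moreover have "(\<lambda>(i, j). Z' i j) \<in> A i" if "i \<in> I'" for i
    proof -
      obtain G d where i: "i = (G, d)" by (cases i)
      have "G \<subseteq> F" using that unfolding F_def i by force
      have "e \<le> d" unfolding e_def using I'(1) that i by (intro Min_le) force+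
      show ?thesis
        unfolding i A_def using Z' Z(2,3) \<open>G \<subseteq> F\<close> \<open>e \<le> d\<close>
        by (auto simp: Z'_def curry_def subset_iff intro: order_trans[of _ "k + e"] order_trans[of _ e])
    qed
    ultimately show "S \<inter> (\<Inter>i\<in>I'. A i) \<noteq> {}" by blast
  qed
  then obtain f where f: "\<And>F e. finite F \<Longrightarrow> 0 < e \<Longrightarrow> e \<le> 1 \<Longrightarrow> f \<in> A (F, e)"
    unfolding I_def by blast
  show thesis
  proof (rule that[of "curry f"])
    show "psd (curry f)" using f[of "{}" 1] unfolding A_def by simp
    show "Re (curry f i i) \<le> k" for i
    proof (rule field_le_epsilon)
      fix e :: real assume e: "e > 0"
      define F where "F = (case i of Inl x \<Rightarrow> {x} | Inr x \<Rightarrow> {x})"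
      have "i \<in> F <+> F" "finite F" unfolding F_def by (auto split: sum.splits)
      then have "Re (f (i, i)) \<le> k + min e 1" using f[of F "min e 1"] e unfolding A_def by simp
      then show "Re (curry f i i) \<le> k + e" by simp
    qed
    show "curry f (Inl x) (Inr y) = \<psi> x y" for x y
    proof -
      have "cmod (f (Inl x, Inr y) - \<psi> x y) \<le> 0 + e" if "e > 0" for e
        using f[of "{x, y}" "min e 1"] that unfolding A_def by simp
      then have "cmod (f (Inl x, Inr y) - \<psi> x y) \<le> 0" by (rule field_le_epsilon)
      then show ?thesis by simp
    qed
  qed
qed

section \<open>Gram vectors of positive semidefinite kernels\<close>

text \<open>A family \<open>g\<close> may take a point several times; collecting the coefficients of each point reduces
  sums over families to sums over sets.\<close>

lemma sum_over_image:
  fixes c :: "'a \<Rightarrow> complex"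
  assumes "finite F"
  shows "(\<Sum>i\<in>F. c i * h (g i)) = (\<Sum>p\<in>g ` F. (\<Sum>i\<in>{i \<in> F. g i = p}. c i) * h p)"
proof -
  have "(\<Sum>i\<in>F. c i * h (g i)) = (\<Sum>p\<in>g ` F. \<Sum>i\<in>{i \<in> F. g i = p}. c i * h (g i))"
    by (rule sum.image_gen[OF assms])
  also have "\<dots> = (\<Sum>p\<in>g ` F. (\<Sum>i\<in>{i \<in> F. g i = p}. c i) * h p)"
    unfolding sum_distrib_right by (intro sum.cong refl) auto
  finally show ?thesis .
qed

lemma sum_sum_over_image:
  fixes c :: "'a \<Rightarrow> complex"
  assumes "finite F" and d_def: "d = (\<lambda>p. \<Sum>i\<in>{i \<in> F. g i = p}. c i)"
  shows "(\<Sum>i\<in>F. \<Sum>j\<in>F. c i * cnj (c j) * Z (g i) (g j)) = (\<Sum>p\<in>g ` F. \<Sum>q\<in>g ` F. d p * cnj (d q) * Z p q)"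
proof -
  have inner: "(\<Sum>j\<in>F. cnj (c j) * h (g j)) = (\<Sum>q\<in>g ` F. cnj (d q) * h q)" for h
    using sum_over_image[OF assms(1), of "\<lambda>j. cnj (c j)" h g] unfolding d_def cnj_sum .
  have "(\<Sum>i\<in>F. \<Sum>j\<in>F. c i * cnj (c j) * Z (g i) (g j)) = (\<Sum>i\<in>F. c i * (\<Sum>j\<in>F. cnj (c j) * Z (g i) (g j)))"
    by (simp add: sum_distrib_left mult.assoc)
  also have "\<dots> = (\<Sum>i\<in>F. c i * (\<Sum>q\<in>g ` F. cnj (d q) * Z (g i) q))"
    by (simp only: inner)
  also have "\<dots> = (\<Sum>p\<in>g ` F. d p * (\<Sum>q\<in>g ` F. cnj (d q) * Z p q))"
    unfolding d_def by (rule sum_over_image[OF assms(1)])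
  also have "\<dots> = (\<Sum>p\<in>g ` F. \<Sum>q\<in>g ` F. d p * cnj (d q) * Z p q)"
    by (simp add: sum_distrib_left mult.assoc)
  finally show ?thesis .
qed

lemma psd_comap:
  assumes "psd Z"
  shows "psd (\<lambda>i j. Z (g i) (g j))"
proof (rule psdI)
  show "Z (g j) (g i) = cnj (Z (g i) (g j))" for i j by (rule psd_hermitian[OF assms])
  show "0 \<le> Re (\<Sum>i\<in>F. \<Sum>j\<in>F. c i * cnj (c j) * Z (g i) (g j))" if F: "finite F" for F c
    unfolding sum_sum_over_image[OF F refl] using F by (intro psd_nonneg[OF assms]) simp
qed

lemma psd_cauchy_schwarz_family:
  assumes "psd Z" "finite F"
  shows "(cmod (\<Sum>i\<in>F. c i * Z (g i) p))\<^sup>2 \<le> Re (Z p p) * Re (\<Sum>i\<in>F. \<Sum>j\<in>F. c i * cnj (c j) * Z (g i) (g j))"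
  unfolding sum_sum_over_image[OF assms(2) refl] sum_over_image[OF assms(2), of c "\<lambda>q. Z q p"]
  using assms(2) by (intro psd_cauchy_schwarz[OF assms(1)]) simp

lemma norm_lincomb: "(\<Sum>i\<in>F. \<Sum>j\<in>F. c i * cnj (c j) * cip (w i) (w j)) = of_real ((norm (lincomb w F c))\<^sup>2)"
  unfolding cip_self_norm[symmetric]
  by (subst cip_lincomb_left, subst cip_lincomb_right) (simp add: sum_distrib_left mult.assoc)

lemma riesz_psd:
  assumes Z: "psd Z" and w: "\<And>i j. Z (g i) (g j) = cip (w i) (w j)"
  obtains v where "v \<in> closed_cspan w" "norm v \<le> sqrt (Re (Z p p))" "\<And>i. cip (w i) v = Z (g i) p"
proof -
  have nn: "0 \<le> Re (Z p p)" by (rule psd_diagonal(2)[OF Z])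
  have "cmod (\<Sum>i\<in>F. c i * Z (g i) p) \<le> sqrt (Re (Z p p)) * norm (lincomb w F c)" if F: "finite F" for F c
  proof -
    have "(cmod (\<Sum>i\<in>F. c i * Z (g i) p))\<^sup>2 \<le> Re (Z p p) * (norm (lincomb w F c))\<^sup>2"
      using psd_cauchy_schwarz_family[OF Z F, of c g p] unfolding w norm_lincomb by simp
    then have "(cmod (\<Sum>i\<in>F. c i * Z (g i) p))\<^sup>2 \<le> (sqrt (Re (Z p p)) * norm (lincomb w F c))\<^sup>2"
      using nn by (simp add: power_mult_distrib)
    then show ?thesis by (rule power2_le_imp_le) (use nn in simp)
  qed
  then show thesis
    using riesz[of "\<lambda>i. Z (g i) p" "sqrt (Re (Z p p))" w] nn that by (metis real_sqrt_ge_zero)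
qed

definition unit_vec :: "'i \<Rightarrow> 'i l2" where
  "unit_vec n = Abs_l2 (\<lambda>m. if m = n then 1 else 0)"

lemma coord_unit_vec: "coord (unit_vec n) m = (if m = n then 1 else 0)"
  unfolding unit_vec_def by (subst coord_Abs_finite_support[of "{n}"]) auto

lemma cip_unit_vec: "cip f (unit_vec n) = coord f n"
  by (subst cip_finite_support[of "{n}"]) (auto simp: coord_unit_vec)

lemma cip_unit_vec_left: "cip (unit_vec n) f = cnj (coord f n)"
  using cip_commute[of "unit_vec n" f] by (simp add: cip_unit_vec)

text \<open>Each new vector is the Riesz representative of its prescribed inner products with the earlier ones
  plus a multiple of a new basis vector that corrects its norm, as in the Cholesky decomposition.\<close>

lemma gram_sequence:
  assumes K: "psd (K :: nat \<Rightarrow> nat \<Rightarrow> complex)"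
  obtains w :: "nat \<Rightarrow> nat l2" where "\<And>i j. K i j = cip (w i) (w j)"
proof -
  define P where "P = (\<lambda>N (u :: nat \<Rightarrow> nat l2). (\<forall>i<N. \<forall>m\<ge>N. coord (u i) m = 0) \<and>
      (\<forall>i<N. \<forall>j<N. K i j = cip (u i) (u j)))"
  have step: "\<exists>u'. P (Suc N) u' \<and> (\<forall>i<N. u' i = u i)" if u: "P N u" for N u
  proof -
    have supp: "coord (u i) m = 0" if "i < N" "m \<ge> N" for i m using u that unfolding P_def by blast
    have Ku: "K i j = cip (u i) (u j)" if "i < N" "j < N" for i j using u that unfolding P_def by blast
    define Z where "Z = (\<lambda>i j :: nat. if i \<in> {..N} \<and> j \<in> {..N} then K i j else 0)"
    have Z: "psd Z" unfolding Z_def by (rule psd_restrict[OF K]) simp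
    define w where "w = (\<lambda>i. if i < N then u i else 0)"
    define g where "g = (\<lambda>i. if i < N then i else Suc N)"
    have "Z (g i) (g j) = cip (w i) (w j)" for i j
      unfolding Z_def g_def w_def using Ku by (auto simp: cip.zero_left cip.zero_right)
    then obtain v where v: "norm v \<le> sqrt (Re (Z N N))" "\<And>i. cip (w i) v = Z (g i) N"
      using riesz_psd[OF Z] by metis
    have uv: "cip (u i) v = K i N" if "i < N" for i
      using v(2)[of i] that by (simp add: w_def g_def Z_def)
    define v' where "v' = Abs_l2 (\<lambda>m. if m < N then coord v m else 0)"
    have v': "coord v' m = (if m < N then coord v m else 0)" for m
      unfolding v'_def by (subst coord_Abs_finite_support[of "{..<N}"]) auto
    have uv': "cip (u i) v' = K i N" if i: "i < N" for i
    proof -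
      have "cip a (u i) = (\<Sum>m\<in>{..<N}. coord a m * cnj (coord (u i) m))" for a
        by (rule cip_finite_support) (use supp[OF i] in auto)
      then have "cip v' (u i) = cip v (u i)" by (simp add: v')
      then show ?thesis using uv[OF i] cip_commute[of "u i" v] cip_commute[of "u i" v'] by simp
    qed
    have "norm v' \<le> norm v"
    proof (rule norm_l2_le)
      fix F :: "nat set" assume "finite F"
      have "(\<Sum>i\<in>F. (cmod (coord v' i))\<^sup>2) \<le> (\<Sum>i\<in>F. (cmod (coord v i))\<^sup>2)"
        by (rule sum_mono) (simp add: v')
      then show "(\<Sum>i\<in>F. (cmod (coord v' i))\<^sup>2) \<le> (norm v)\<^sup>2"
        using sum_coord_le_norm[OF \<open>finite F\<close>, of v] by simp
    qed simp
    then have "norm v' \<le> sqrt (Re (K N N))" using v(1) by (simp add: Z_def)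
    then have "(norm v')\<^sup>2 \<le> (sqrt (Re (K N N)))\<^sup>2" by (intro power_mono) simp_all
    then have r: "(norm v')\<^sup>2 \<le> Re (K N N)" using psd_diagonal(2)[OF K] by simp
    define \<rho> where "\<rho> = sqrt (Re (K N N) - (norm v')\<^sup>2)"
    define x where "x = v' + scaleC (of_real \<rho>) (unit_vec N)"
    have xx: "cip x x = K N N"
    proof -
      have "cip x x = of_real ((norm v')\<^sup>2) + of_real \<rho> * of_real \<rho>"
        unfolding x_def
        by (simp add: cip_add_left cip_add_right cip_scaleC_left cip_scaleC_right cip_unit_vec cip_unit_vec_left
            v' coord_unit_vec cip_self_norm[of v'])
      also have "\<dots> = of_real (Re (K N N))"
        unfolding of_real_mult[symmetric] of_real_add[symmetric] \<rho>_def using r by simp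
      finally show ?thesis using psd_diagonal(1)[OF K, of N] by simp
    qed
    have ux: "cip (u i) x = K i N" if "i < N" for i
      unfolding x_def by (simp add: cip_add_right cip_scaleC_right cip_unit_vec uv'[OF that] supp[OF that])
    have xu: "cip x (u i) = K N i" if "i < N" for i
      using ux[OF that] cip_commute[of x "u i"] psd_hermitian[OF K, of N i] by simp
    have "P (Suc N) (u(N := x))"
      unfolding P_def using supp Ku xx ux xu
      by (auto simp: less_Suc_eq x_def v' coord_unit_vec)
    then show ?thesis by (intro exI[of _ "u(N := x)"]) auto
  qed
  have "\<exists>f. \<forall>n. P n (f n) \<and> (\<forall>i<n. f (Suc n) i = f n i)"
    by (rule dependent_nat_choice) (use step in \<open>auto simp: P_def\<close>)
  then obtain f where f: "\<And>n. P n (f n)" "\<And>n i. i < n \<Longrightarrow> f (Suc n) i = f n i" by blast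
  have stable: "f n i = f (Suc i) i" if "n \<ge> Suc i" for n i
    using that by (induction n rule: nat_induct_at_least) (use f(2) in auto)
  show thesis
  proof (rule that[of "\<lambda>i. f (Suc i) i"])
    fix i j
    define n where "n = Suc (max i j)"
    have "K i j = cip (f n i) (f n j)"
      using f(1)[of n] unfolding P_def n_def by simp
    then show "K i j = cip (f (Suc i) i) (f (Suc j) j)"
      using stable[of i n] stable[of j n] by (simp add: n_def)
  qed
qed

lemma dense_sequence:
  obtains r :: "nat \<Rightarrow> 'g :: second_countable_topology" where "closure (range r) = UNIV"
proof -
  obtain D :: "'g set" where D: "countable D" "\<And>X. open X \<Longrightarrow> X \<noteq> {} \<Longrightarrow> \<exists>d\<in>D. d \<in> X"
    using countable_dense_exists[where 'a = 'g] by blast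
  have "D \<noteq> {}" using D(2)[of UNIV] by blast
  then have "range (from_nat_into D) = D" using D(1) by (rule range_from_nat_into)
  moreover have "closure D = UNIV"
  proof (rule ccontr)
    assume "closure D \<noteq> UNIV"
    then obtain d where "d \<in> D" "d \<in> - closure D"
      using D(2)[of "- closure D"] by blast
    then show False using closure_subset[of D] by blast
  qed
  ultimately show thesis using that[of "from_nat_into D"] by simp
qed

text \<open>
  The vectors come from a dense sequence of points. The limits exist because both inner products in
  $\|P(x) - P(y)\|^2 = K(x,x) - 2 Re K(x,y) + K(y,y)$ are continuous where they are needed.
\<close>

lemma gram_continuous:
  fixes K :: "'g :: second_countable_topology \<Rightarrow> 'g \<Rightarrow> complex"
  assumes K: "psd K" and cont: "\<And>y. continuous_on UNIV (\<lambda>x. K x y)"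
    and cont_diag: "continuous_on UNIV (\<lambda>x. K x x)"
  obtains P :: "'g \<Rightarrow> nat l2" where "\<And>x y. K x y = cip (P x) (P y)" "continuous_on UNIV P"
proof -
  obtain r :: "nat \<Rightarrow> 'g" where r: "closure (range r) = UNIV" by (rule dense_sequence)
  obtain w :: "nat \<Rightarrow> nat l2" where w: "\<And>i j. K (r i) (r j) = cip (w i) (w j)"
    using gram_sequence[OF psd_comap[OF K, of r]] by blast
  have "\<forall>x. \<exists>v. norm v \<le> sqrt (Re (K x x)) \<and> (\<forall>i. cip (w i) v = K (r i) x)"
  proof
    fix x
    show "\<exists>v. norm v \<le> sqrt (Re (K x x)) \<and> (\<forall>i. cip (w i) v = K (r i) x)"
      by (rule riesz_psd[of K r w x, OF K w]) blast
  qed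
  then obtain P where P: "\<And>x. norm (P x) \<le> sqrt (Re (K x x))" "\<And>x i. cip (w i) (P x) = K (r i) x"
    by metis
  have lim: "((\<lambda>n. K (s n) y) \<longlonglongrightarrow> K x y)" "((\<lambda>n. K (s n) (s n)) \<longlonglongrightarrow> K x x)" if "s \<longlonglongrightarrow> x" for s x y
    by (rule continuous_on_tendsto_compose[OF cont that], simp, simp)
      (rule continuous_on_tendsto_compose[OF cont_diag that], simp, simp)
  have KP: "K x y = cip (P x) (P y)" for x y
  proof -
    have "x \<in> closure (range r)" using r by simp
    then have "\<exists>s. (\<forall>n. s n \<in> range r) \<and> s \<longlonglongrightarrow> x"
      unfolding closure_sequential .
    then obtain s where s: "\<And>n. s n \<in> range r" "s \<longlonglongrightarrow> x" by blast
    have "\<forall>n. \<exists>i. s n = r i" using s(1) by blast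
    then obtain i where i: "\<And>n. s n = r (i n)" by (auto dest!: choice)
    have "(\<lambda>n. w (i n)) \<longlonglongrightarrow> P x"
    proof -
      have "(norm (w (i n) - P x))\<^sup>2 \<le> Re (K (s n) (s n)) - 2 * Re (K (s n) x) + Re (K x x)" for n
      proof -
        have "(norm (P x))\<^sup>2 \<le> (sqrt (Re (K x x)))\<^sup>2" using P(1) by (intro power_mono) simp_all
        then have "(norm (P x))\<^sup>2 \<le> Re (K x x)" using psd_diagonal(2)[OF K] by simp
        moreover have "(norm (w (i n)))\<^sup>2 = Re (K (s n) (s n))" unfolding i w cip_self_norm by simp
        ultimately show ?thesis unfolding norm_diff_l2 P(2) i by simp
      qed
      then have bd: "\<forall>n. norm ((norm (w (i n) - P x))\<^sup>2) \<le> Re (K (s n) (s n)) - 2 * Re (K (s n) x) + Re (K x x)"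
        by simp
      have "(\<lambda>n. Re (K (s n) (s n)) - 2 * Re (K (s n) x) + Re (K x x)) \<longlonglongrightarrow> Re (K x x) - 2 * Re (K x x) + Re (K x x)"
        by (intro tendsto_intros lim s)
      then have "(\<lambda>n. Re (K (s n) (s n)) - 2 * Re (K (s n) x) + Re (K x x)) \<longlonglongrightarrow> 0" by simp
      then have "(\<lambda>n. (norm (w (i n) - P x))\<^sup>2) \<longlonglongrightarrow> 0"
        by (rule Lim_null_comparison[OF always_eventually[OF bd]])
      then have "(\<lambda>n. sqrt ((norm (w (i n) - P x))\<^sup>2)) \<longlonglongrightarrow> sqrt 0" by (rule tendsto_real_sqrt)
      then have "(\<lambda>n. norm (w (i n) - P x)) \<longlonglongrightarrow> 0" by simp
      then have "(\<lambda>n. w (i n) - P x) \<longlonglongrightarrow> 0" by (rule tendsto_norm_zero_cancel)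
      then show ?thesis by (rule LIM_zero_cancel)
    qed
    then have "(\<lambda>n. cip (w (i n)) (P y)) \<longlonglongrightarrow> cip (P x) (P y)" by (intro cip.tendsto tendsto_const)
    then have "(\<lambda>n. K (s n) y) \<longlonglongrightarrow> cip (P x) (P y)" unfolding P(2) i .
    then show ?thesis using lim(1)[OF s(2)] LIMSEQ_unique by blast
  qed
  have "continuous_on UNIV P"
    unfolding continuous_on_def
  proof
    fix x
    have kx: "((\<lambda>y. K y x) \<longlongrightarrow> K x x) (at x)" "((\<lambda>y. K y y) \<longlongrightarrow> K x x) (at x)"
      using cont[of x] cont_diag unfolding continuous_on_def by auto
    have "((\<lambda>y. Re (K y y) - 2 * Re (K y x) + Re (K x x)) \<longlongrightarrow> Re (K x x) - 2 * Re (K x x) + Re (K x x)) (at x)"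
      by (intro tendsto_intros kx)
    then have "((\<lambda>y. (norm (P y - P x))\<^sup>2) \<longlongrightarrow> 0) (at x)"
      unfolding norm_diff_l2 KP by (simp add: cip_self_norm)
    then have "((\<lambda>y. sqrt ((norm (P y - P x))\<^sup>2)) \<longlongrightarrow> sqrt 0) (at x)" by (rule tendsto_real_sqrt)
    then have "((\<lambda>y. norm (P y - P x)) \<longlongrightarrow> 0) (at x)" by simp
    then have "((\<lambda>y. P y - P x) \<longlongrightarrow> 0) (at x)" by (rule tendsto_norm_zero_cancel)
    then show "(P \<longlongrightarrow> P x) (at x within UNIV)" by (rule LIM_zero_cancel)
  qed
  with KP show thesis by (rule that)
qed

text \<open>
  The first factor of the completed kernel, with the second factor restricted to a dense sequence and the
  first one projected onto its span: the inner products of \<open>f x\<close> with the generators of the span are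
  values of \<open>\<phi>\<close>, hence continuous in \<open>x\<close>. In the last conclusion the second factor survives only as a
  bound for functionals on the span of \<open>f\<close>, which is the form that can be averaged.
\<close>

lemma weakly_continuous_factor:
  fixes \<phi> :: "'g :: {topological_group_add, second_countable_topology} \<Rightarrow> complex"
  assumes \<phi>: "continuous_on UNIV \<phi>" and k: "schur_bounded (\<lambda>x y. \<phi> (- y + x)) k"
  obtains f :: "'g \<Rightarrow> nat l2" where "\<And>v. continuous_on UNIV (\<lambda>x. cip (f x) v)" "\<And>x. (norm (f x))\<^sup>2 \<le> k"
    "\<And>F c g y. finite F \<Longrightarrow> (cmod (\<Sum>x\<in>F. c x * \<phi> (- y + g x)))\<^sup>2 \<le> k * (norm (lincomb (\<lambda>x :: 'g. f (g x)) F c))\<^sup>2"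
proof -
  obtain Z where Z: "psd Z" "\<And>i. Re (Z i i) \<le> k" "\<And>x y. Z (Inl x) (Inr y) = \<phi> (- y + x)"
    using psd_completion[OF k] by blast
  have k0: "k \<ge> 0" using k by (rule schur_bounded_nonneg)
  obtain r :: "nat \<Rightarrow> 'g" where r: "closure (range r) = UNIV" by (rule dense_sequence)
  obtain w :: "nat \<Rightarrow> nat l2" where w: "\<And>i j. Z (Inr (r i)) (Inr (r j)) = cip (w i) (w j)"
    using gram_sequence[OF psd_comap[OF Z(1), of "\<lambda>i. Inr (r i)"]] by blast
  have "\<forall>x. \<exists>v. v \<in> closed_cspan w \<and> norm v \<le> sqrt (Re (Z (Inl x) (Inl x))) \<and> (\<forall>i. cip (w i) v = Z (Inr (r i)) (Inl x))"
  proof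
    fix x
    show "\<exists>v. v \<in> closed_cspan w \<and> norm v \<le> sqrt (Re (Z (Inl x) (Inl x))) \<and> (\<forall>i. cip (w i) v = Z (Inr (r i)) (Inl x))"
      by (rule riesz_psd[of Z "\<lambda>i. Inr (r i)" w "Inl x", OF Z(1) w]) blast
  qed
  then obtain f where f: "\<And>x. f x \<in> closed_cspan w" "\<And>x. norm (f x) \<le> sqrt (Re (Z (Inl x) (Inl x)))"
      "\<And>x i. cip (w i) (f x) = Z (Inr (r i)) (Inl x)"
    by metis
  have f_w: "cip (f x) (w i) = \<phi> (- r i + x)" for x i
    using cip_commute[of "f x" "w i"] psd_hermitian[OF Z(1), of "Inl x" "Inr (r i)"] f(3) Z(3) by simp
  have norm_f: "(norm (f x))\<^sup>2 \<le> k" for x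
  proof -
    have "(norm (f x))\<^sup>2 \<le> (sqrt (Re (Z (Inl x) (Inl x))))\<^sup>2" using f(2) by (intro power_mono) simp_all
    also have "\<dots> = Re (Z (Inl x) (Inl x))" using psd_diagonal(2)[OF Z(1)] by simp
    finally show ?thesis using Z(2) order_trans by blast
  qed
  show thesis
  proof (rule that[of f])
    show "(norm (f x))\<^sup>2 \<le> k" for x by (rule norm_f)
    show "continuous_on UNIV (\<lambda>x. cip (f x) v)" for v
    proof (rule weakly_continuous_in_closed_cspan[OF f(1)])
      show "norm (f x) \<le> sqrt k" for x
        using norm_f real_le_rsqrt by blast
      show "continuous_on UNIV (\<lambda>x. cip (f x) (w i))" for i
        unfolding f_w by (intro continuous_on_compose2[OF \<phi>] continuous_intros) simp
    qed
    fix F :: "'g set" and c g y assume F: "finite F"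
    let ?B = "k * (norm (lincomb (\<lambda>x. f (g x)) F c))\<^sup>2"
    have "range r \<subseteq> {y. (cmod (\<Sum>x\<in>F. c x * \<phi> (- y + g x)))\<^sup>2 \<le> ?B}"
    proof (clarify)
      fix i
      have "(\<Sum>x\<in>F. c x * \<phi> (- r i + g x)) = cip (lincomb (\<lambda>x. f (g x)) F c) (w i)"
        unfolding cip_lincomb_left f_w ..
      then have "(cmod (\<Sum>x\<in>F. c x * \<phi> (- r i + g x)))\<^sup>2 \<le> (norm (lincomb (\<lambda>x. f (g x)) F c) * norm (w i))\<^sup>2"
        by (simp only:) (intro power_mono cmod_cip_le norm_ge_zero)
      also have "\<dots> \<le> (norm (lincomb (\<lambda>x. f (g x)) F c))\<^sup>2 * k"
      proof -
        have "(norm (w i))\<^sup>2 = Re (Z (Inr (r i)) (Inr (r i)))" unfolding w cip_self_norm by simp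
        then show ?thesis unfolding power_mult_distrib using Z(2) by (intro mult_left_mono) simp_all
      qed
      finally show "(cmod (\<Sum>x\<in>F. c x * \<phi> (- r i + g x)))\<^sup>2 \<le> ?B" by (simp only: mult.commute)
    qed
    moreover have "closed {y. (cmod (\<Sum>x\<in>F. c x * \<phi> (- y + g x)))\<^sup>2 \<le> ?B}"
      by (intro closed_Collect_le continuous_intros continuous_on_compose2[OF \<phi>]) simp_all
    ultimately have "closure (range r) \<subseteq> {y. (cmod (\<Sum>x\<in>F. c x * \<phi> (- y + g x)))\<^sup>2 \<le> ?B}"
      by (rule closure_minimal)
    then show "(cmod (\<Sum>x\<in>F. c x * \<phi> (- y + g x)))\<^sup>2 \<le> ?B" using r by blast
  qed
qed

section \<open>Averaging a kernel over the group\<close>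

lemma continuous_on_UNIV_sequentiallyI:
  fixes h :: "'a :: first_countable_topology \<Rightarrow> 'b :: topological_space"
  assumes "\<And>s x. s \<longlonglongrightarrow> x \<Longrightarrow> (\<lambda>n. h (s n)) \<longlonglongrightarrow> h x"
  shows "continuous_on UNIV h"
  unfolding continuous_on_def tendsto_at_iff_sequentially comp_def using assms by blast

lemma cip_sums: 
  fixes f g :: "nat l2"
  shows "(\<lambda>n. coord f n * cnj (coord g n)) sums cip f g"
  unfolding cip_def by (rule has_sum_imp_sums[OF has_sum_infsum[OF cip_summable]])

locale left_invariant_measure =
  fixes \<mu> :: "'g :: {topological_group_add, t2_space, second_countable_topology} measure"
  assumes sets_mu: "sets \<mu> = sets borel"
    and emeasure_translate: "\<And>g A. A \<in> sets borel \<Longrightarrow> emeasure \<mu> ((\<lambda>x. g + x) ` A) = emeasure \<mu> A"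
begin

lemma space_mu: "space \<mu> = UNIV"
  using sets_eq_imp_space_eq[OF sets_mu] by simp

lemma measurable_mu: "f \<in> measurable borel N \<Longrightarrow> f \<in> measurable \<mu> N"
  by (subst measurable_cong_sets[OF sets_mu refl])

lemma distr_translate: "distr \<mu> borel (\<lambda>u. g + u) = \<mu>"
proof (rule measure_eqI)
  show "sets (distr \<mu> borel (\<lambda>u. g + u)) = sets \<mu>" using sets_mu by simp
  fix A assume "A \<in> sets (distr \<mu> borel (\<lambda>u. g + u))"
  then have A: "A \<in> sets borel" by simp
  have meas: "(\<lambda>u. g + u) \<in> measurable \<mu> borel"
    by (intro measurable_mu borel_measurable_continuous_onI continuous_intros)
  have "(\<lambda>u. g + u) -` A = (\<lambda>x. - g + x) ` A"
  proof (intro set_eqI iffI)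
    fix u assume "u \<in> (\<lambda>u. g + u) -` A"
    then show "u \<in> (\<lambda>x. - g + x) ` A" by (intro image_eqI[of _ _ "g + u"]) (simp_all add: add.assoc[symmetric])
  next
    fix u assume "u \<in> (\<lambda>x. - g + x) ` A"
    then show "u \<in> (\<lambda>u. g + u) -` A" by (auto simp: add.assoc[symmetric])
  qed
  then show "emeasure (distr \<mu> borel (\<lambda>u. g + u)) A = emeasure \<mu> A"
    using emeasure_distr[OF meas A] emeasure_translate[OF A, of "- g"] by (simp add: space_mu)
qed

lemma
  fixes h :: "'g \<Rightarrow> 'b :: {banach, second_countable_topology}"
  assumes h: "h \<in> borel_measurable borel"
  shows integral_translate: "(\<integral>u. h (g + u) \<partial>\<mu>) = (\<integral>u. h u \<partial>\<mu>)"
    and integrable_translate: "integrable \<mu> h \<Longrightarrow> integrable \<mu> (\<lambda>u. h (g + u))"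
proof -
  have meas: "(\<lambda>u. g + u) \<in> measurable \<mu> borel"
    by (intro measurable_mu borel_measurable_continuous_onI continuous_intros)
  show "(\<integral>u. h (g + u) \<partial>\<mu>) = (\<integral>u. h u \<partial>\<mu>)"
    using integral_distr[OF meas h] unfolding distr_translate by simp
  show "integrable \<mu> (\<lambda>u. h (g + u))" if "integrable \<mu> h"
    using integrable_distr_eq[OF meas h] that unfolding distr_translate by simp
qed

end

text \<open>The function \<open>L\<close> is the length of a group element. With \<open>L (- g) = L g\<close> the condition
  \<open>L_triangle\<close> is the triangle inequality for \<open>v = - g + (g + v)\<close>.\<close>

locale weighted_haar = left_invariant_measure \<mu>
  for \<mu> :: "'g :: {topological_group_add, t2_space, second_countable_topology} measure" +
  fixes L :: "'g \<Rightarrow> real" and c :: real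
  assumes L_continuous: "continuous_on UNIV L"
    and L_triangle: "\<And>g v. L v \<le> L g + L (g + v)"
    and c_nonneg: "c \<ge> 0"
    and weight_integrable: "integrable \<mu> (\<lambda>u. exp (- c * L u))"
    and mu_nonzero: "emeasure \<mu> UNIV \<noteq> 0"
begin

definition wt :: "'g \<Rightarrow> real" where "wt u = exp (- c * L u)"

lemma wt_pos: "wt u > 0" by (simp add: wt_def)

lemma wt_integrable: "integrable \<mu> wt"
  using weight_integrable unfolding wt_def[abs_def] .

lemma wt_continuous: "continuous_on UNIV wt"
  unfolding wt_def[abs_def] by (intro continuous_intros L_continuous)

lemma wt_translate: "wt (g + v) \<le> exp (c * L g) * wt v"
proof -
  have "c * L v \<le> c * (L g + L (g + v))" by (rule mult_left_mono[OF L_triangle c_nonneg])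
  then show ?thesis unfolding wt_def exp_add[symmetric] by (simp add: algebra_simps)
qed

definition W :: real where "W = (\<integral>u. wt u \<partial>\<mu>)"

lemma W_pos: "W > 0"
proof -
  have "W \<ge> 0" unfolding W_def using wt_pos by (intro integral_nonneg_AE) (simp add: less_imp_le)
  moreover have "W \<noteq> 0"
  proof
    assume "W = 0"
    then have "AE u in \<mu>. wt u = 0"
      unfolding W_def using integral_nonneg_eq_0_iff_AE[OF wt_integrable] wt_pos by (simp add: less_imp_le)
    then have "eventually (\<lambda>_. False) (ae_filter \<mu>)"
    proof (rule eventually_mono)
      fix u assume "wt u = 0"
      then show False using wt_pos[of u] by simp
    qed
    then have "ae_filter \<mu> = bot" by (simp only: eventually_False)
    then show False using mu_nonzero space_mu by (simp add: ae_filter_eq_bot_iff)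
  qed
  ultimately show ?thesis by simp
qed

context
  fixes f :: "'g \<Rightarrow> nat l2" and k :: real
  assumes f_weak: "\<And>v. continuous_on UNIV (\<lambda>x. cip (f x) v)"
    and f_bound: "\<And>x. (norm (f x))\<^sup>2 \<le> k"
begin

text \<open>The weighted mean of the left translates of the kernel \<open>cip (f x) (f y)\<close>. The factor \<open>1 / W\<close> makes
  the weight a probability density, so the bound \<open>k\<close> on the diagonal is kept.\<close>

definition avg :: "'g \<Rightarrow> 'g \<Rightarrow> complex" where
  "avg x y = (\<integral>u. wt u *\<^sub>R cip (f (- u + x)) (f (- u + y)) \<partial>\<mu>) /\<^sub>R W"

lemma coord_f_continuous: "continuous_on UNIV (\<lambda>x. coord (f x) n)"
  using f_weak[of "unit_vec n"] by (simp add: cip_unit_vec)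

lemma integrand_measurable:
  assumes "continuous_on UNIV p" "continuous_on UNIV q"
  shows "(\<lambda>u. cip (f (p u)) (f (q u))) \<in> borel_measurable borel"
proof -
  have "cip (f (p u)) (f (q u)) = (\<Sum>n. coord (f (p u)) n * cnj (coord (f (q u)) n))" for u
    using cip_sums sums_unique by blast
  moreover have "(\<lambda>u. \<Sum>n. coord (f (p u)) n * cnj (coord (f (q u)) n)) \<in> borel_measurable borel"
    by (intro borel_measurable_suminf borel_measurable_continuous_onI continuous_intros
        continuous_on_compose2[OF coord_f_continuous] assms) simp_all
  ultimately show ?thesis by simp
qed

lemma wt_measurable: "wt \<in> borel_measurable borel"
  by (rule borel_measurable_continuous_onI[OF wt_continuous])

lemma weighted_integrand_measurable:
  assumes "continuous_on UNIV p" "continuous_on UNIV q"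
  shows "(\<lambda>u. wt u *\<^sub>R cip (f (p u)) (f (q u))) \<in> borel_measurable borel"
  by (intro borel_measurable_scaleR wt_measurable integrand_measurable assms)

lemma cip_f_le: "cmod (cip (f x) (f y)) \<le> k"
proof -
  have "2 * (norm (f x) * norm (f y)) \<le> (norm (f x))\<^sup>2 + (norm (f y))\<^sup>2"
    using sum_squares_bound[of "norm (f x)" "norm (f y)"] by (simp add: mult.assoc)
  then show ?thesis using cmod_cip_le[of "f x" "f y"] f_bound[of x] f_bound[of y] by linarith
qed

lemma integrand_le: "norm (wt u *\<^sub>R cip (f x) (f y)) \<le> k * wt u"
  using mult_right_mono[OF cip_f_le[of x y], of "wt u"] wt_pos[of u] by (simp add: mult.commute)

lemma neg_plus_continuous: "continuous_on UNIV (\<lambda>u :: 'g. - u + x)"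
  by (intro continuous_intros)

lemma integrand_integrable: "integrable \<mu> (\<lambda>u. wt u *\<^sub>R cip (f (- u + x)) (f (- u + y)))"
proof (rule Bochner_Integration.integrable_bound)
  show "integrable \<mu> (\<lambda>u. k * wt u)" by (intro integrable_mult_right wt_integrable)
  show "(\<lambda>u. wt u *\<^sub>R cip (f (- u + x)) (f (- u + y))) \<in> borel_measurable \<mu>"
    by (intro measurable_mu weighted_integrand_measurable neg_plus_continuous)
  show "AE u in \<mu>. norm (wt u *\<^sub>R cip (f (- u + x)) (f (- u + y))) \<le> norm (k * wt u)"
    by (intro AE_I2 order_trans[OF integrand_le]) simp
qed

lemma
  assumes F: "finite F"
  shows avg_form_integrable: "integrable \<mu> (\<lambda>u. wt u * (norm (lincomb (\<lambda>x. f (- u + g x)) F b))\<^sup>2)" (is ?int)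
    and avg_form: "(\<Sum>x\<in>F. \<Sum>y\<in>F. b x * cnj (b y) * avg (g x) (g y))
      = of_real ((\<integral>u. wt u * (norm (lincomb (\<lambda>x. f (- u + g x)) F b))\<^sup>2 \<partial>\<mu>) / W)" (is ?eq)
proof -
  have pt: "complex_of_real (wt u * (norm (lincomb (\<lambda>x. f (- u + g x)) F b))\<^sup>2)
      = (\<Sum>x\<in>F. \<Sum>y\<in>F. (b x * cnj (b y)) * (wt u *\<^sub>R cip (f (- u + g x)) (f (- u + g y))))" for u
    unfolding of_real_mult norm_lincomb[symmetric] by (simp add: sum_distrib_left scaleR_conv_of_real mult_ac)
  have int: "integrable \<mu> (\<lambda>u. complex_of_real (wt u * (norm (lincomb (\<lambda>x. f (- u + g x)) F b))\<^sup>2))"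
    unfolding pt by (intro Bochner_Integration.integrable_sum integrable_mult_right integrand_integrable)
  show ?int using integrable_Re[OF int] by simp
  have "(\<Sum>x\<in>F. \<Sum>y\<in>F. b x * cnj (b y) * avg (g x) (g y))
      = (\<Sum>x\<in>F. \<Sum>y\<in>F. \<integral>u. (b x * cnj (b y)) * (wt u *\<^sub>R cip (f (- u + g x)) (f (- u + g y))) \<partial>\<mu>) /\<^sub>R W"
    unfolding Bochner_Integration.integral_mult_right[OF integrand_integrable] avg_def
    by (simp only: mult_scaleR_right scaleR_sum_right)
  also have "(\<Sum>x\<in>F. \<Sum>y\<in>F. \<integral>u. (b x * cnj (b y)) * (wt u *\<^sub>R cip (f (- u + g x)) (f (- u + g y))) \<partial>\<mu>)
      = (\<integral>u. (\<Sum>x\<in>F. \<Sum>y\<in>F. (b x * cnj (b y)) * (wt u *\<^sub>R cip (f (- u + g x)) (f (- u + g y)))) \<partial>\<mu>)"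
    by (simp only: Bochner_Integration.integral_sum Bochner_Integration.integrable_sum integrable_mult_right integrand_integrable)
  also have "\<dots> = of_real (\<integral>u. wt u * (norm (lincomb (\<lambda>x. f (- u + g x)) F b))\<^sup>2 \<partial>\<mu>)"
    unfolding pt[symmetric] by (rule integral_complex_of_real)
  finally show ?eq by (simp add: scaleR_conv_of_real divide_inverse mult.commute)
qed

lemma psd_avg: "psd avg"
proof (rule psdI)
  fix x y
  have "cnj (\<integral>u. wt u *\<^sub>R cip (f (- u + x)) (f (- u + y)) \<partial>\<mu>)
      = (\<integral>u. cnj (wt u *\<^sub>R cip (f (- u + x)) (f (- u + y))) \<partial>\<mu>)"
    by (rule Bochner_Integration.integral_cnj[symmetric])
  also have "(\<lambda>u. cnj (wt u *\<^sub>R cip (f (- u + x)) (f (- u + y)))) = (\<lambda>u. wt u *\<^sub>R cip (f (- u + y)) (f (- u + x)))"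
    unfolding complex_cnj_scaleR by (simp only: cip_commute[symmetric])
  finally show "avg y x = cnj (avg x y)" unfolding avg_def complex_cnj_scaleR by (simp only:)
next
  fix F :: "'g set" and b assume F: "finite F"
  have "0 \<le> (\<integral>u. wt u * (norm (lincomb (\<lambda>x. f (- u + x)) F b))\<^sup>2 \<partial>\<mu>)"
    using wt_pos by (intro integral_nonneg_AE AE_I2 mult_nonneg_nonneg) (simp_all add: less_imp_le)
  then show "0 \<le> Re (\<Sum>x\<in>F. \<Sum>y\<in>F. b x * cnj (b y) * avg x y)"
    using W_pos avg_form[OF F, of b "\<lambda>x. x"] by simp
qed

lemma avg_diagonal_le: "Re (avg x x) \<le> k"
proof -
  have "norm (\<integral>u. wt u *\<^sub>R cip (f (- u + x)) (f (- u + x)) \<partial>\<mu>)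
      \<le> (\<integral>u. norm (wt u *\<^sub>R cip (f (- u + x)) (f (- u + x))) \<partial>\<mu>)"
    by (rule Bochner_Integration.integral_norm_bound)
  also have "\<dots> \<le> (\<integral>u. k * wt u \<partial>\<mu>)"
    by (intro integral_mono integrable_norm integrand_integrable integrable_mult_right wt_integrable integrand_le)
  also have "\<dots> = k * W" unfolding W_def by simp
  finally have "norm (avg x x) \<le> k" unfolding avg_def using W_pos by (simp add: field_simps)
  then show ?thesis using complex_Re_le_cmod order_trans by blast
qed

text \<open>The substitution \<open>u = g + v\<close> undoes the translation of the vectors and moves it to the weight, where
  the triangle inequality controls it.\<close>

lemma avg_translate:
  assumes F: "finite F"
  shows "Re (\<Sum>x\<in>F. \<Sum>y\<in>F. b x * cnj (b y) * avg (g + x) (g + y))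
    \<le> exp (c * L g) * Re (\<Sum>x\<in>F. \<Sum>y\<in>F. b x * cnj (b y) * avg x y)"
proof -
  define h where "h = (\<lambda>u. wt u * (norm (lincomb (\<lambda>x. f (- u + (g + x))) F b))\<^sup>2)"
  define h' where "h' = (\<lambda>u. wt u * (norm (lincomb (\<lambda>x. f (- u + x)) F b))\<^sup>2)"
  have int: "integrable \<mu> h" unfolding h_def by (rule avg_form_integrable[OF F])
  have int': "integrable \<mu> h'" unfolding h'_def by (rule avg_form_integrable[OF F])
  have meas: "h \<in> borel_measurable borel"
    using borel_measurable_integrable[OF int] by (subst measurable_cong_sets[OF sets_mu[symmetric] refl])
  have shift: "- (g + v) + (g + x) = - v + x" for v x :: 'g
    by (simp only: minus_add add.assoc minus_add_cancel)
  have "(\<integral>u. h u \<partial>\<mu>) = (\<integral>v. h (g + v) \<partial>\<mu>)" by (rule integral_translate[OF meas, symmetric])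
  also have "\<dots> \<le> (\<integral>v. exp (c * L g) * h' v \<partial>\<mu>)"
  proof (rule integral_mono[OF integrable_translate[OF meas int] integrable_mult_right[OF int']])
    fix v
    show "h (g + v) \<le> exp (c * L g) * h' v"
      unfolding h_def h'_def shift mult.assoc[symmetric] by (intro mult_right_mono wt_translate) simp
  qed
  also have "\<dots> = exp (c * L g) * (\<integral>v. h' v \<partial>\<mu>)" by simp
  finally have "(\<integral>u. h u \<partial>\<mu>) / W \<le> exp (c * L g) * (\<integral>v. h' v \<partial>\<mu>) / W"
    using W_pos by (intro divide_right_mono) simp_all
  then show ?thesis
    using avg_form[OF F, of b "\<lambda>x. g + x"] avg_form[OF F, of b "\<lambda>x. x"] unfolding h_def h'_def by simp
qed

text \<open>Since \<open>- y + x = - (- u + y) + (- u + x)\<close>, the left side is the same for every translate, so the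
  bound holds for every \<open>u\<close> before averaging.\<close>

lemma avg_dominates:
  assumes F: "finite F"
    and dom: "\<And>y g. (cmod (\<Sum>x\<in>F. b x * \<phi> (- y + g x)))\<^sup>2 \<le> k * (norm (lincomb (\<lambda>x. f (g x)) F b))\<^sup>2"
  shows "(cmod (\<Sum>x\<in>F. b x * \<phi> (- y + x)))\<^sup>2 \<le> k * Re (\<Sum>x\<in>F. \<Sum>y\<in>F. b x * cnj (b y) * avg x y)"
proof -
  define A where "A = (cmod (\<Sum>x\<in>F. b x * \<phi> (- y + x)))\<^sup>2"
  define h where "h = (\<lambda>u. wt u * (norm (lincomb (\<lambda>x. f (- u + x)) F b))\<^sup>2)"
  have int: "integrable \<mu> h" unfolding h_def by (rule avg_form_integrable[OF F])
  have pt: "A * wt u \<le> k * h u" for u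
  proof -
    have "- (- u + y) + (- u + x) = - y + x" for x by (simp add: minus_add add.assoc)
    then have "A \<le> k * (norm (lincomb (\<lambda>x. f (- u + x)) F b))\<^sup>2"
      using dom[of "- u + y" "\<lambda>x. - u + x"] unfolding A_def by simp
    from mult_right_mono[OF this less_imp_le[OF wt_pos[of u]]] show ?thesis
      unfolding h_def by (simp add: mult_ac)
  qed
  have "A * W = (\<integral>u. A * wt u \<partial>\<mu>)" unfolding W_def by simp
  also have "\<dots> \<le> (\<integral>u. k * h u \<partial>\<mu>)"
    by (intro integral_mono integrable_mult_right wt_integrable int pt)
  also have "\<dots> = k * (\<integral>u. h u \<partial>\<mu>)" by simp
  finally have "A \<le> k * ((\<integral>u. h u \<partial>\<mu>) / W)" using W_pos by (simp add: field_simps)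
  then show ?thesis
    using avg_form[OF F, of b "\<lambda>x. x"] unfolding A_def h_def by simp
qed

lemma avg_continuous: "continuous_on UNIV (\<lambda>x. avg x y)"
proof (rule continuous_on_UNIV_sequentiallyI)
  fix s :: "nat \<Rightarrow> 'g" and x assume s: "s \<longlonglongrightarrow> x"
  have "(\<lambda>n. \<integral>u. wt u *\<^sub>R cip (f (- u + s n)) (f (- u + y)) \<partial>\<mu>)
      \<longlonglongrightarrow> (\<integral>u. wt u *\<^sub>R cip (f (- u + x)) (f (- u + y)) \<partial>\<mu>)"
  proof (rule integral_dominated_convergence)
    show "integrable \<mu> (\<lambda>u. k * wt u)" by (intro integrable_mult_right wt_integrable)
    show "(\<lambda>u. wt u *\<^sub>R cip (f (- u + z)) (f (- u + y))) \<in> borel_measurable \<mu>" for z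
      by (rule borel_measurable_integrable[OF integrand_integrable])
    then show "(\<lambda>u. wt u *\<^sub>R cip (f (- u + s n)) (f (- u + y))) \<in> borel_measurable \<mu>" for n .
    show "AE u in \<mu>. (\<lambda>n. wt u *\<^sub>R cip (f (- u + s n)) (f (- u + y))) \<longlonglongrightarrow> wt u *\<^sub>R cip (f (- u + x)) (f (- u + y))"
    proof (rule AE_I2)
      fix u
      have "(\<lambda>n. - u + s n) \<longlonglongrightarrow> - u + x" by (intro tendsto_intros s)
      then have "(\<lambda>n. cip (f (- u + s n)) (f (- u + y))) \<longlonglongrightarrow> cip (f (- u + x)) (f (- u + y))"
        by (rule continuous_on_tendsto_compose[OF f_weak]) simp_all
      then show "(\<lambda>n. wt u *\<^sub>R cip (f (- u + s n)) (f (- u + y))) \<longlonglongrightarrow> wt u *\<^sub>R cip (f (- u + x)) (f (- u + y))"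
        by (intro tendsto_intros)
    qed
    show "AE u in \<mu>. norm (wt u *\<^sub>R cip (f (- u + s n)) (f (- u + y))) \<le> k * wt u" for n
      by (intro AE_I2 integrand_le)
  qed
  then show "(\<lambda>n. avg (s n) y) \<longlonglongrightarrow> avg x y" unfolding avg_def by (intro tendsto_intros)
qed

text \<open>Weak continuity of \<open>f\<close> gives continuity in one variable at a time, while strong continuity of the
  Gram vectors requires it on the diagonal. There the substitution \<open>u = x + v\<close> moves \<open>x\<close> into the weight,
  which is continuous.\<close>

lemma avg_diagonal: "avg x x = (\<integral>v. wt (x + v) *\<^sub>R cip (f (- v)) (f (- v)) \<partial>\<mu>) /\<^sub>R W"
proof -
  have "- (x + v) + x = - v" for v by (simp add: minus_add add.assoc)
  then show ?thesis
    unfolding avg_def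
    using integral_translate[OF weighted_integrand_measurable[OF neg_plus_continuous[of x] neg_plus_continuous[of x]], of x]
    by simp
qed

lemma avg_diagonal_continuous: "continuous_on UNIV (\<lambda>x. avg x x)"
proof (rule continuous_on_UNIV_sequentiallyI)
  fix s :: "nat \<Rightarrow> 'g" and x assume s: "s \<longlonglongrightarrow> x"
  have Ls: "(\<lambda>n. exp (c * L (s n))) \<longlonglongrightarrow> exp (c * L x)"
    by (intro tendsto_intros continuous_on_tendsto_compose[OF L_continuous s]) simp_all
  obtain B where B: "\<And>n. norm (exp (c * L (s n))) \<le> B"
    using convergent_imp_Bseq[OF convergentI[OF Ls]] unfolding Bseq_def by blast
  have "(\<lambda>n. \<integral>v. wt (s n + v) *\<^sub>R cip (f (- v)) (f (- v)) \<partial>\<mu>) \<longlonglongrightarrow> (\<integral>v. wt (x + v) *\<^sub>R cip (f (- v)) (f (- v)) \<partial>\<mu>)"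
  proof (rule integral_dominated_convergence)
    show "integrable \<mu> (\<lambda>v. k * (B * wt v))" by (intro integrable_mult_right wt_integrable)
    show meas: "(\<lambda>v. wt (z + v) *\<^sub>R cip (f (- v)) (f (- v))) \<in> borel_measurable \<mu>" for z
      by (intro measurable_mu borel_measurable_scaleR integrand_measurable borel_measurable_continuous_onI
          continuous_on_compose2[OF wt_continuous] continuous_intros) simp_all
    then show "(\<lambda>v. wt (s n + v) *\<^sub>R cip (f (- v)) (f (- v))) \<in> borel_measurable \<mu>" for n .
    show "AE v in \<mu>. (\<lambda>n. wt (s n + v) *\<^sub>R cip (f (- v)) (f (- v))) \<longlonglongrightarrow> wt (x + v) *\<^sub>R cip (f (- v)) (f (- v))"
      by (intro AE_I2 tendsto_intros continuous_on_tendsto_compose[OF wt_continuous] s) simp_all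
    show "AE v in \<mu>. norm (wt (s n + v) *\<^sub>R cip (f (- v)) (f (- v))) \<le> k * (B * wt v)" for n
    proof (rule AE_I2)
      fix v
      have k: "k \<ge> 0" using order_trans[OF zero_le_power2 f_bound] .
      have "wt (s n + v) \<le> exp (c * L (s n)) * wt v" by (rule wt_translate)
      also have "\<dots> \<le> B * wt v" using B[of n] wt_pos[of v] by (intro mult_right_mono) auto
      finally have "k * wt (s n + v) \<le> k * (B * wt v)" by (rule mult_left_mono[OF _ k])
      then show "norm (wt (s n + v) *\<^sub>R cip (f (- v)) (f (- v))) \<le> k * (B * wt v)"
        by (rule order_trans[OF integrand_le])
    qed
  qed
  then show "(\<lambda>n. avg (s n) (s n)) \<longlonglongrightarrow> avg x x" unfolding avg_diagonal by (intro tendsto_intros)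
qed

end

end

section \<open>The representation\<close>

text \<open>  The vectors \<open>P x\<close> are to be moved by left translation. By \<open>P_translate\<close> this extends to a bounded
  operator on their closed span, and by \<open>\<phi>_bound\<close> the values of \<open>\<phi>\<close> define bounded functionals there.
  The adjoint \<open>backward\<close> of translation is constructed first: its values are Riesz vectors, which the
  Riesz theorem provides for all arguments at once, and translation is recovered as the adjoint of it.\<close>

locale kernel_representation =
  fixes P :: "'g :: {topological_group_add, t2_space, second_countable_topology} \<Rightarrow> nat l2"
    and N :: "'g \<Rightarrow> real" and \<phi> :: "'g \<Rightarrow> complex" and k :: real
  assumes P_continuous: "continuous_on UNIV P"
    and P_bound: "\<And>x. (norm (P x))\<^sup>2 \<le> k"
    and P_translate: "\<And>F b g. finite F \<Longrightarrow> norm (lincomb (\<lambda>x. P (g + x)) F b) \<le> N g * norm (lincomb P F b)"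
    and N_continuous: "continuous_on UNIV N" and N_pos: "\<And>g. N g > 0"
    and \<phi>_bound: "\<And>F b y. finite F \<Longrightarrow> (cmod (\<Sum>x\<in>F. b x * \<phi> (- y + x)))\<^sup>2 \<le> k * (norm (lincomb P F b))\<^sup>2"
    and \<phi>_continuous: "continuous_on UNIV \<phi>"
begin

definition M :: "nat l2 set" where "M = closed_cspan P"

lemma M: "closed_csubspace M"
  unfolding M_def by (rule closed_csubspace_closed_cspan)

lemma P_in_M: "P x \<in> M"
  unfolding M_def by (rule base_in_closed_cspan)

lemma M_eqI: "x \<in> M \<Longrightarrow> y \<in> M \<Longrightarrow> (\<And>z. cip (P z) x = cip (P z) y) \<Longrightarrow> x = y"
  unfolding M_def by (rule eq_in_closed_cspan)

lemma k_nonneg: "k \<ge> 0"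
  using order_trans[OF zero_le_power2 P_bound] .

lemma ex_backward: "\<exists>v. v \<in> M \<and> norm v \<le> N g * norm z \<and> (\<forall>x. cip (P x) v = cip (P (g + x)) z)"
proof -
  have bd: "cmod (\<Sum>x\<in>F. b x * cip (P (g + x)) z) \<le> N g * norm z * norm (lincomb P F b)" if F: "finite F" for F b
  proof -
    have "cmod (cip (lincomb (\<lambda>x. P (g + x)) F b) z) \<le> norm (lincomb (\<lambda>x. P (g + x)) F b) * norm z"
      by (rule cmod_cip_le)
    also have "\<dots> \<le> N g * norm (lincomb P F b) * norm z" by (intro mult_right_mono P_translate[OF F] norm_ge_zero)
    finally show ?thesis unfolding cip_lincomb_left by (simp only: mult_ac)
  qed
  have "0 \<le> N g * norm z" using N_pos[of g] by simp
  then obtain v where "v \<in> closed_cspan P" "norm v \<le> N g * norm z" "\<And>x. cip (P x) v = cip (P (g + x)) z"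
    using riesz[OF bd] by blast
  then show ?thesis unfolding M_def by blast
qed

definition backward :: "'g \<Rightarrow> nat l2 \<Rightarrow> nat l2" where
  "backward g z = (SOME v. v \<in> M \<and> norm v \<le> N g * norm z \<and> (\<forall>x. cip (P x) v = cip (P (g + x)) z))"

lemma backward: "backward g z \<in> M" "norm (backward g z) \<le> N g * norm z" "cip (P x) (backward g z) = cip (P (g + x)) z"
  using someI_ex[OF ex_backward[of g z]] unfolding backward_def by blast+

lemma backward_add: "backward g (y + z) = backward g y + backward g z"
  by (rule M_eqI) (simp_all add: backward closed_csubspaceD[OF M] cip_add_right)

lemma backward_scaleC: "backward g (scaleC a z) = scaleC a (backward g z)"
  by (rule M_eqI) (simp_all add: backward closed_csubspaceD[OF M] cip_scaleC_right)

lemma ex_rep: "\<exists>T. \<forall>v. T v \<in> M \<and> norm (T v) \<le> N g * norm v \<and> (\<forall>z\<in>M. cip z (T v) = cip (backward g z) v)"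
proof (rule adjoint_on_closed_csubspace[OF M, of "backward g" "N g"])
  show "backward g (x + y) = backward g x + backward g y" for x y by (rule backward_add)
  show "backward g (scaleC a x) = scaleC a (backward g x)" for a x by (rule backward_scaleC)
  show "norm (backward g x) \<le> N g * norm x" for x by (rule backward)
  show "0 \<le> N g" using N_pos[of g] by simp
  fix T assume "\<And>v. T v \<in> M" "\<And>v. norm (T v) \<le> N g * norm v" "\<And>z v. z \<in> M \<Longrightarrow> cip z (T v) = cip (backward g z) v"
  then show ?thesis by blast
qed

definition rep :: "'g \<Rightarrow> nat l2 \<Rightarrow> nat l2" where
  "rep g = (SOME T. \<forall>v. T v \<in> M \<and> norm (T v) \<le> N g * norm v \<and> (\<forall>z\<in>M. cip z (T v) = cip (backward g z) v))"

lemma rep: "rep g v \<in> M" "norm (rep g v) \<le> N g * norm v" "z \<in> M \<Longrightarrow> cip z (rep g v) = cip (backward g z) v"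
  using someI_ex[OF ex_rep[of g]] unfolding rep_def by blast+

lemma rep_adjoint: "z \<in> M \<Longrightarrow> cip (rep g v) z = cip v (backward g z)"
  using rep(3)[of z g v] by (metis cip_commute)

lemma rep_add: "rep g (v + w) = rep g v + rep g w"
  by (rule M_eqI) (simp_all add: rep P_in_M closed_csubspaceD[OF M] cip_add_right)

lemma rep_scaleC: "rep g (scaleC a v) = scaleC a (rep g v)"
  by (rule M_eqI) (simp_all add: rep P_in_M closed_csubspaceD[OF M] cip_scaleC_right)

lemma rep_P: "rep g (P x) = P (g + x)"
proof (rule eq_in_closed_csubspace[OF M rep(1) P_in_M])
  fix z assume z: "z \<in> M"
  have "cip (rep g (P x)) z = cip (P (g + x)) z" unfolding rep_adjoint[OF z] by (rule backward)
  then show "cip z (rep g (P x)) = cip z (P (g + x))" by (metis cip_commute)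
qed

lemma rep_diff: "rep g (v - w) = rep g v - rep g w"
  using rep_add[of g "v - w" w] by simp

lemma rep_lincomb: 
  assumes "finite F" 
  shows "rep g (lincomb P F b) = lincomb (\<lambda>x. P (g + x)) F b"
  using assms
proof (induction F)
  case empty
  show ?case using rep_scaleC[of g 0 0] by (simp add: lincomb_def scaleC.zero_left)
next
  case (insert x F)
  then have "rep g (scaleC (b x) (P x) + lincomb P F b) = scaleC (b x) (P (g + x)) + lincomb (\<lambda>x. P (g + x)) F b"
    by (simp add: rep_add rep_scaleC rep_P)
  with insert show ?case by (simp add: lincomb_def)
qed

lemma backward_plus: "z \<in> M \<Longrightarrow> backward (g + h) z = backward h (backward g z)"
  by (rule M_eqI) (simp_all add: backward add.assoc)

lemma backward_zero: "z \<in> M \<Longrightarrow> backward 0 z = z"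
  by (rule M_eqI) (simp_all add: backward)

lemma rep_plus: "v \<in> M \<Longrightarrow> rep (g + h) v = rep g (rep h v)"
  by (rule eq_in_closed_csubspace[OF M]) (simp_all add: rep backward backward_plus)

lemma rep_zero: "v \<in> M \<Longrightarrow> rep 0 v = v"
  by (rule eq_in_closed_csubspace[OF M]) (simp_all add: rep backward_zero)

text \<open>On finite combinations of the vectors \<open>P x\<close> the orbit maps are continuous because \<open>P\<close> is; local
  boundedness of the operator norms carries this over to the closure.\<close>

lemma rep_continuous:
  assumes v: "v \<in> M"
  shows "continuous_on UNIV (\<lambda>g. rep g v)"
proof (rule continuous_on_UNIV_sequentiallyI)
  fix s :: "nat \<Rightarrow> 'g" and x assume s: "s \<longlonglongrightarrow> x"
  have Ns: "(\<lambda>n. N (s n)) \<longlonglongrightarrow> N x"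
    by (rule continuous_on_tendsto_compose[OF N_continuous s]) simp_all
  obtain B where B: "B > 0" "\<And>n. norm (N (s n)) \<le> B"
    using convergent_imp_Bseq[OF convergentI[OF Ns]] unfolding Bseq_def by blast
  have Bx: "N x \<le> B"
    by (rule LIMSEQ_le_const2[OF Ns]) (use B(2) abs_le_D1 in auto)
  obtain F b where Fb: "\<And>n :: nat. finite (F n)" "(\<lambda>n. lincomb P (F n) (b n)) \<longlonglongrightarrow> v"
    using v closed_cspan_sequence[of v P] unfolding M_def by blast
  show "(\<lambda>n. rep (s n) v) \<longlonglongrightarrow> rep x v"
  proof (rule metric_LIMSEQ_I)
    fix e :: real assume e: "e > 0"
    then have "e / (3 * B) > 0" using B by simp
    then obtain m where m: "dist (lincomb P (F m) (b m)) v < e / (3 * B)"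
      using metric_LIMSEQ_D[OF Fb(2)] by blast
    define u where "u = lincomb P (F m) (b m)"
    have near: "norm (rep g v - rep g u) < e / 3" if "N g \<le> B" for g
    proof -
      have "norm (rep g v - rep g u) \<le> N g * norm (v - u)"
        unfolding rep_diff[symmetric] by (rule rep(2))
      also have "\<dots> \<le> B * norm (v - u)" using that by (intro mult_right_mono) auto
      also have "\<dots> < B * (e / (3 * B))"
        using m B(1) by (intro mult_strict_left_mono) (auto simp: u_def dist_norm norm_minus_commute)
      finally show ?thesis using B(1) by simp
    qed
    have "(\<lambda>n. rep (s n) u) \<longlonglongrightarrow> rep x u"
      unfolding u_def rep_lincomb[OF Fb(1)] unfolding lincomb_def
      by (intro tendsto_sum scaleC.tendsto tendsto_const continuous_on_tendsto_compose[OF P_continuous] tendsto_add s) simp_all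
    then obtain n0 where n0: "\<And>n. n \<ge> n0 \<Longrightarrow> norm (rep (s n) u - rep x u) < e / 3"
      using metric_LIMSEQ_D[of "\<lambda>n. rep (s n) u" "rep x u" "e / 3"] e unfolding dist_norm by auto
    have "dist (rep (s n) v) (rep x v) < e" if n: "n \<ge> n0" for n
    proof -
      have "rep (s n) v - rep x v = (rep (s n) v - rep (s n) u) + (rep (s n) u - rep x u) - (rep x v - rep x u)"
        by simp
      then have "norm (rep (s n) v - rep x v) \<le> norm (rep (s n) v - rep (s n) u) + norm (rep (s n) u - rep x u) + norm (rep x v - rep x u)"
        using norm_triangle_ineq4[of "(rep (s n) v - rep (s n) u) + (rep (s n) u - rep x u)" "rep x v - rep x u"]
          norm_triangle_ineq[of "rep (s n) v - rep (s n) u" "rep (s n) u - rep x u"] by simp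
      moreover have "N (s n) \<le> B" using B(2)[of n] by simp
      ultimately show ?thesis using near[of "s n"] near[OF Bx] n0[OF n] unfolding dist_norm by linarith
    qed
    then show "\<exists>no. \<forall>n\<ge>no. dist (rep (s n) v) (rep x v) < e" by blast
  qed
qed

lemma ex_Q: "\<exists>v. v \<in> M \<and> norm v \<le> sqrt k \<and> (\<forall>x. cip (P x) v = \<phi> (- y + x))"
proof -
  have bd: "cmod (\<Sum>x\<in>F. b x * \<phi> (- y + x)) \<le> sqrt k * norm (lincomb P F b)" if F: "finite F" for F b
  proof (rule power2_le_imp_le)
    show "(cmod (\<Sum>x\<in>F. b x * \<phi> (- y + x)))\<^sup>2 \<le> (sqrt k * norm (lincomb P F b))\<^sup>2"
      using \<phi>_bound[OF F, of b y] k_nonneg by (simp add: power_mult_distrib)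
  qed (simp add: k_nonneg)
  have "0 \<le> sqrt k" by (simp add: k_nonneg)
  then obtain v where "v \<in> closed_cspan P" "norm v \<le> sqrt k" "\<And>x. cip (P x) v = \<phi> (- y + x)"
    using riesz[OF bd] by blast
  then show ?thesis unfolding M_def by blast
qed

definition Q :: "'g \<Rightarrow> nat l2" where
  "Q y = (SOME v. v \<in> M \<and> norm v \<le> sqrt k \<and> (\<forall>x. cip (P x) v = \<phi> (- y + x)))"

lemma Q: "Q y \<in> M" "norm (Q y) \<le> sqrt k" "cip (P x) (Q y) = \<phi> (- y + x)"
  using someI_ex[OF ex_Q[of y]] unfolding Q_def by blast+

lemma backward_Q: "backward (- y) (Q 0) = Q y"
  by (rule M_eqI) (simp_all add: backward Q)

lemma norm_P: "norm (P x) \<le> sqrt k"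
  using P_bound real_le_rsqrt by blast

lemma Q_weakly_continuous: "continuous_on UNIV (\<lambda>y. cip (Q y) v)"
proof (rule weakly_continuous_in_closed_cspan[where w = P and C = "sqrt k"])
  show "Q y \<in> closed_cspan P" for y using Q(1) unfolding M_def .
  show "norm (Q y) \<le> sqrt k" for y by (rule Q(2))
  have "cip (Q y) (P x) = cnj (\<phi> (- y + x))" for x y
    using cip_commute[of "Q y" "P x"] Q(3) by simp
  then show "continuous_on UNIV (\<lambda>y. cip (Q y) (P x))" for x
    by (simp only:) (intro continuous_intros continuous_on_compose2[OF \<phi>_continuous], simp_all)
qed

end

section \<open>Closed subspaces as Hilbert spaces with explicit carriers\<close>

definition hspace_of :: "nat l2 set \<Rightarrow> (nat \<Rightarrow> complex) hspace" where
  "hspace_of M = \<lparr>vecs = coord ` M,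
     vadd = (\<lambda>f g. coord (Abs_l2 f + Abs_l2 g)),
     vzero = coord 0,
     vscale = (\<lambda>a f. coord (scaleC a (Abs_l2 f))),
     ip = (\<lambda>f g. cip (Abs_l2 f) (Abs_l2 g))\<rparr>"

lemma hspace_of_simps [simp]:
  "vecs (hspace_of M) = coord ` M"
  "vadd (hspace_of M) (coord x) (coord y) = coord (x + y)"
  "vzero (hspace_of M) = coord 0"
  "vscale (hspace_of M) a (coord x) = coord (scaleC a x)"
  "ip (hspace_of M) (coord x) (coord y) = cip x y"
  by (simp_all add: hspace_of_def coord_inverse)

lemma coord_image_iff [simp]: "coord x \<in> coord ` M \<longleftrightarrow> x \<in> M"
  by (auto simp: coord_inject)

lemma vnorm_hspace_of [simp]: "vnorm (hspace_of M) (coord x) = norm x"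
  unfolding vnorm_def by (simp add: cip_self_norm)

lemma vdist_hspace_of:
  "x \<in> M \<Longrightarrow> y \<in> M \<Longrightarrow> vdist (hspace_of M) (coord x) (coord y) = dist x y"
  unfolding vdist_def by (simp add: dist_norm scaleC.minus_left)

lemma Metric_space_hspace_of: "Metric_space (coord ` M) (vdist (hspace_of M))"
proof
  have cases: "(\<exists>u\<in>M. \<exists>v\<in>M. x = coord u \<and> y = coord v) \<or> vdist (hspace_of M) x y = 0 \<and> vdist (hspace_of M) y x = 0" for x y
    by (auto simp: vdist_def)
  show "0 \<le> vdist (hspace_of M) x y" for x y
    using cases[of x y] by (auto simp: vdist_hspace_of)
  show "vdist (hspace_of M) x y = vdist (hspace_of M) y x" for x y
    using cases[of x y] by (auto simp: vdist_hspace_of dist_commute)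
  show "vdist (hspace_of M) x y = 0 \<longleftrightarrow> x = y" if "x \<in> coord ` M" "y \<in> coord ` M" for x y
    using that by (auto simp: vdist_hspace_of coord_inject)
  show "vdist (hspace_of M) x z \<le> vdist (hspace_of M) x y + vdist (hspace_of M) y z"
    if "x \<in> coord ` M" "y \<in> coord ` M" "z \<in> coord ` M" for x y z
    using that by (auto simp: vdist_hspace_of dist_triangle)
qed

lemma mcomplete_hspace_of:
  assumes "closed M"
  shows "Metric_space.mcomplete (coord ` M) (vdist (hspace_of M))"
proof -
  interpret m: Metric_space "coord ` M" "vdist (hspace_of M)" by (rule Metric_space_hspace_of)
  show ?thesis
    unfolding m.mcomplete_def
  proof (intro allI impI)
    fix \<sigma> assume \<sigma>: "m.MCauchy \<sigma>"
    have "\<forall>n. \<exists>x. x \<in> M \<and> \<sigma> n = coord x"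
      using \<sigma> unfolding m.MCauchy_def by blast
    then obtain x where x: "\<And>n :: nat. x n \<in> M" "\<And>n. \<sigma> n = coord (x n)"
      by (auto dest!: choice)
    have "Cauchy x"
    proof (rule metric_CauchyI)
      fix e :: real assume "e > 0"
      then have "\<exists>N. \<forall>n n'. N \<le> n \<longrightarrow> N \<le> n' \<longrightarrow> vdist (hspace_of M) (\<sigma> n) (\<sigma> n') < e"
        using \<sigma> unfolding m.MCauchy_def by blast
      then show "\<exists>N. \<forall>n\<ge>N. \<forall>n'\<ge>N. dist (x n) (x n') < e"
        unfolding x(2) vdist_hspace_of[OF x(1) x(1)] by blast
    qed
    then obtain l where l: "x \<longlonglongrightarrow> l" using Cauchy_convergent convergent_def by blast
    have lM: "l \<in> M" by (rule closed_sequentially[OF assms x(1) l])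
    have "limitin m.mtopology \<sigma> (coord l) sequentially"
      unfolding m.limitin_metric
    proof (intro conjI allI impI)
      show "coord l \<in> coord ` M" using lM by simp
      fix e :: real assume "e > 0"
      then have "\<forall>\<^sub>F n in sequentially. dist (x n) l < e" using l tendstoD by blast
      then show "\<forall>\<^sub>F n in sequentially. \<sigma> n \<in> coord ` M \<and> vdist (hspace_of M) (\<sigma> n) (coord l) < e"
        by eventually_elim (simp add: x vdist_hspace_of lM)
    qed
    then show "\<exists>x. limitin m.mtopology \<sigma> x sequentially" by blast
  qed
qed

lemma hilbert_space_hspace_of:
  assumes M: "closed_csubspace M"
  shows "hilbert_space (hspace_of M)"
proof
  show "Metric_space.mcomplete (vecs (hspace_of M)) (vdist (hspace_of M))"
    using mcomplete_hspace_of[OF closed_csubspaceD(1)[OF M]] by simp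
  show "\<exists>w\<in>vecs (hspace_of M). vadd (hspace_of M) v w = vzero (hspace_of M)"
    if v: "v \<in> vecs (hspace_of M)" for v
  proof -
    obtain x where x: "x \<in> M" "v = coord x" using v by auto
    show ?thesis
      using closed_csubspaceD(4)[OF M x(1), of "-1"] unfolding x(2)
      by (intro bexI[of _ "coord (scaleC (-1) x)"]) (simp_all add: scaleC.minus_left)
  qed
  show "ip (hspace_of M) v u = cnj (ip (hspace_of M) u v)"
    if "u \<in> vecs (hspace_of M)" "v \<in> vecs (hspace_of M)" for u v
    using that by (auto simp: cip_commute[symmetric])
qed (auto simp: closed_csubspaceD[OF M] add_ac scaleC.add_right scaleC.add_left
    cip_add_left cip_scaleC_left cip_self_norm)

definition op_of :: "nat l2 set \<Rightarrow> (nat l2 \<Rightarrow> nat l2) \<Rightarrow> (nat \<Rightarrow> complex) \<Rightarrow> nat \<Rightarrow> complex" where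
  "op_of M T = (\<lambda>f\<in>coord ` M. coord (T (Abs_l2 f)))"

lemma op_of_coord [simp]: "x \<in> M \<Longrightarrow> op_of M T (coord x) = coord (T x)"
  by (simp add: op_of_def coord_inverse)

lemma op_of_bounded:
  assumes M: "closed_csubspace M" and T: "\<And>x. x \<in> M \<Longrightarrow> T x \<in> M" "\<And>x y. T (x + y) = T x + T y"
    "\<And>a x. T (scaleC a x) = scaleC a (T x)" "\<And>x. norm (T x) \<le> C * norm x"
  shows "op_of M T \<in> bounded_ops (hspace_of M)"
  unfolding bounded_ops_def
proof (intro CollectI conjI)
  show "op_of M T \<in> vecs (hspace_of M) \<rightarrow>\<^sub>E vecs (hspace_of M)"
    by (rule PiE_I) (auto simp: T(1), auto simp: op_of_def)
  show "\<exists>C. \<forall>v\<in>vecs (hspace_of M). vnorm (hspace_of M) (op_of M T v) \<le> C * vnorm (hspace_of M) v"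
    using T(4) by (intro exI[of _ C]) auto
qed (auto simp: closed_csubspaceD[OF M] T)

lemma compose_op_of:
  assumes "\<And>x. x \<in> M \<Longrightarrow> T x \<in> M"
  shows "compose (coord ` M) (op_of M S) (op_of M T) = op_of M (\<lambda>x. S (T x))"
proof
  fix f show "compose (coord ` M) (op_of M S) (op_of M T) f = op_of M (\<lambda>x. S (T x)) f"
  proof (cases "f \<in> coord ` M")
    case True
    then obtain x where "x \<in> M" "f = coord x" by blast
    then show ?thesis using assms by (simp add: compose_def)
  qed (auto simp: compose_def op_of_def)
qed

lemma op_of_cong: "(\<And>x. x \<in> M \<Longrightarrow> S x = T x) \<Longrightarrow> op_of M S = op_of M T"
  unfolding op_of_def by (rule restrict_ext) (auto simp: coord_inverse)

lemma id_op_hspace_of: "id_op (hspace_of M) = op_of M (\<lambda>x. x)"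
  unfolding id_op_def op_of_def hspace_of_simps by (rule restrict_ext) (auto simp: coord_inverse)

lemma adjoint_op_of:
  assumes M: "closed_csubspace M" and S: "op_of M S \<in> bounded_ops (hspace_of M)" "\<And>x. x \<in> M \<Longrightarrow> S x \<in> M"
    and T: "\<And>x y. x \<in> M \<Longrightarrow> y \<in> M \<Longrightarrow> cip (T x) y = cip x (S y)"
  shows "adjoint_op (hspace_of M) (op_of M T) = op_of M S"
  unfolding adjoint_op_def
proof (rule the_equality)
  show "op_of M S \<in> bounded_ops (hspace_of M) \<and> (\<forall>v\<in>vecs (hspace_of M). \<forall>w\<in>vecs (hspace_of M).
      ip (hspace_of M) (op_of M T v) w = ip (hspace_of M) v (op_of M S w))"
    using S T by auto
  fix R assume R: "R \<in> bounded_ops (hspace_of M) \<and> (\<forall>v\<in>vecs (hspace_of M). \<forall>w\<in>vecs (hspace_of M).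
      ip (hspace_of M) (op_of M T v) w = ip (hspace_of M) v (R w))"
  have ext: "R \<in> coord ` M \<rightarrow>\<^sub>E coord ` M" using R unfolding bounded_ops_def by simp
  show "R = op_of M S"
  proof
    fix f show "R f = op_of M S f"
    proof (cases "f \<in> coord ` M")
      case True
      then obtain y where y: "y \<in> M" "f = coord y" by blast
      obtain z where z: "z \<in> M" "R f = coord z" using PiE_mem[OF ext True] by blast
      have "z = S y"
      proof (rule eq_in_closed_csubspace[OF M z(1) S(2)[OF y(1)]])
        fix x assume x: "x \<in> M"
        have "ip (hspace_of M) (op_of M T (coord x)) (coord y) = ip (hspace_of M) (coord x) (R (coord y))"
          using R x y(1) by simp
        then show "cip x z = cip x (S y)"
          using x z y T[OF x y(1)] by simp
      qed
      then show ?thesis using z y by simp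
    next
      case False
      then show ?thesis using PiE_arb[OF ext] by (simp add: op_of_def)
    qed
  qed
qed

section \<open>Schur multipliers that are invariant under translations are bounded\<close>

lemma unit_vec_fun: "(\<lambda>z. if z = y then 1 else 0) = coord (unit_vec y)"
  by (rule ext) (simp add: coord_unit_vec)

lemma vecs_ell2: "vecs ell2 = range coord"
proof -
  have "f = coord (Abs_l2 f)" if "(\<lambda>y. (cmod (f y))\<^sup>2) summable_on UNIV" for f :: "'a \<Rightarrow> complex"
    using that by (simp add: Abs_l2_inverse)
  then show ?thesis unfolding ell2_def using coord_square_summable by auto
qed

lemma ell2_simps [simp]:
  "vadd ell2 (coord x) (coord y) = coord (x + y)"
  "vscale ell2 a (coord x) = coord (scaleC a x)"
  "vnorm ell2 (coord x) = norm x"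
proof -
  show "vadd ell2 (coord x) (coord y) = coord (x + y)" "vscale ell2 a (coord x) = coord (scaleC a x)"
    by (simp_all add: ell2_def fun_eq_iff)
  have "ip ell2 (coord x) (coord x) = cip x x" by (simp add: ell2_def cip_def)
  then show "vnorm ell2 (coord x) = norm x" unfolding vnorm_def by (simp add: cip_self_norm)
qed

lemma ell2_op_lower:
  assumes B: "B \<in> bounded_ops ell2"
  obtains b C where "\<And>f. B (coord f) = coord (b f)" "\<And>f g. b (f + g) = b f + b g"
    "\<And>a f. b (scaleC a f) = scaleC a (b f)" "\<And>f. norm (b f) \<le> C * norm f"
proof -
  have ext: "B \<in> range coord \<rightarrow>\<^sub>E range coord"
    and add: "\<And>f g. B (coord (f + g)) = vadd ell2 (B (coord f)) (B (coord g))"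
    and scale: "\<And>a f. B (coord (scaleC a f)) = vscale ell2 a (B (coord f))"
    and bd: "\<exists>C. \<forall>v\<in>range coord. vnorm ell2 (B v) \<le> C * vnorm ell2 v"
    using B unfolding bounded_ops_def vecs_ell2 by force+
  obtain C where C: "\<And>f. vnorm ell2 (B (coord f)) \<le> C * vnorm ell2 (coord f)" using bd by blast
  define b where "b = (\<lambda>f. Abs_l2 (B (coord f)))"
  have b: "B (coord f) = coord (b f)" for f
  proof -
    have "B (coord f) \<in> range coord" using PiE_mem[OF ext] by blast
    then obtain g where "B (coord f) = coord g" by blast
    then show ?thesis by (simp add: b_def coord_inverse)
  qed
  show thesis
  proof (rule that[of b C])
    show "B (coord f) = coord (b f)" for f by (rule b)
    show "b (f + g) = b f + b g" for f g using add[of f g] by (simp add: b coord_inject)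
    show "b (scaleC a f) = scaleC a (b f)" for a f using scale[of a f] by (simp add: b coord_inject)
    show "norm (b f) \<le> C * norm f" for f using C[of f] by (simp add: b)
  qed
qed

lemma additive_lincomb:
  assumes "\<And>f g. b (f + g) = b f + b g" "\<And>a f. b (scaleC a f) = scaleC a (b f)" "finite F"
  shows "b (lincomb w F c) = lincomb (\<lambda>i. b (w i)) F c"
  using assms(3)
proof (induction F)
  case empty
  show ?case using assms(2)[of 0 0] by (simp add: lincomb_def scaleC.zero_left)
next
  case (insert i F)
  then have "b (scaleC (c i) (w i) + lincomb w F c) = scaleC (c i) (b (w i)) + lincomb (\<lambda>i. b (w i)) F c"
    by (simp add: assms)
  with insert show ?case by (simp add: lincomb_def)
qed

lemma coord_lincomb: "coord (lincomb w F c) x = (\<Sum>i\<in>F. c i * coord (w i) x)"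
  unfolding lincomb_def by (simp add: coord_sum)

lemma norm_lincomb_unit_vec:
  assumes "finite F"
  shows "norm (lincomb unit_vec F c) = L2_set (\<lambda>y. cmod (c y)) F"
proof -
  have cz: "coord (lincomb unit_vec F c) y = (if y \<in> F then c y else 0)" for y
    using assms by (simp add: coord_lincomb coord_unit_vec if_distrib[of "\<lambda>x. _ * x"] cong: if_cong)
  have "cip (lincomb unit_vec F c) (lincomb unit_vec F c) = (\<Sum>y\<in>F. of_real ((cmod (c y))\<^sup>2))"
    by (subst cip_finite_support[OF assms]) (simp_all add: cz complex_norm_square del: of_real_power)
  then have "complex_of_real ((norm (lincomb unit_vec F c))\<^sup>2) = of_real (\<Sum>y\<in>F. (cmod (c y))\<^sup>2)"
    unfolding cip_self_norm by simp
  then have "(norm (lincomb unit_vec F c))\<^sup>2 = (\<Sum>y\<in>F. (cmod (c y))\<^sup>2)" by (simp only: of_real_eq_iff)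
  then show ?thesis unfolding L2_set_def by (metis norm_ge_zero real_sqrt_abs abs_of_nonneg)
qed

definition contractive_matrix :: "'y set \<Rightarrow> ('y \<Rightarrow> 'y \<Rightarrow> complex) \<Rightarrow> bool" where
  "contractive_matrix F a \<longleftrightarrow> (\<forall>s t. cmod (\<Sum>x\<in>F. \<Sum>y\<in>F. a x y * s x * cnj (t y))
      \<le> L2_set (\<lambda>x. cmod (s x)) F * L2_set (\<lambda>y. cmod (t y)) F)"

lemma contractive_matrix_row_norm:
  assumes F: "finite F" and a: "contractive_matrix F a"
  shows "(\<Sum>x\<in>F. (cmod (\<Sum>y\<in>F. a x y * v y))\<^sup>2) \<le> (\<Sum>y\<in>F. (cmod (v y))\<^sup>2)"
proof -
  define w where "w = (\<lambda>x. \<Sum>y\<in>F. a x y * v y)"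
  define p where "p = L2_set (\<lambda>x. cmod (w x)) F"
  define q where "q = L2_set (\<lambda>y. cmod (v y)) F"
  have p2: "p\<^sup>2 = (\<Sum>x\<in>F. (cmod (w x))\<^sup>2)" and q2: "q\<^sup>2 = (\<Sum>y\<in>F. (cmod (v y))\<^sup>2)"
    unfolding p_def q_def L2_set_def by (simp_all add: sum_nonneg)
  have nn: "p \<ge> 0" "q \<ge> 0" by (simp_all add: p_def q_def)
  have "(\<Sum>y\<in>F. a x y * z * cnj (cnj (v y))) = w x * z" for x z
    unfolding w_def sum_distrib_right by (simp add: mult_ac)
  then have "(\<Sum>x\<in>F. \<Sum>y\<in>F. a x y * cnj (w x) * cnj (cnj (v y))) = (\<Sum>x\<in>F. w x * cnj (w x))"
    by (simp only:)
  also have "\<dots> = of_real (p\<^sup>2)" unfolding p2 of_real_sum complex_norm_square ..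
  finally have eq: "(\<Sum>x\<in>F. \<Sum>y\<in>F. a x y * cnj (w x) * cnj (cnj (v y))) = of_real (p\<^sup>2)" .
  have "cmod (of_real (p\<^sup>2)) \<le> p * q"
    using a[unfolded contractive_matrix_def, rule_format, of "\<lambda>x. cnj (w x)" "\<lambda>y. cnj (v y)"]
    unfolding eq complex_mod_cnj p_def[symmetric] q_def[symmetric] .
  then have "p * p \<le> p * q" by (simp add: power2_eq_square norm_mult)
  then have "p \<le> q" using nn by (cases "p = 0") simp_all
  then have "p\<^sup>2 \<le> q\<^sup>2" using nn by (simp add: power_mono)
  then show ?thesis unfolding p2 q2 w_def .
qed

lemma block_diagonal_operator:
  fixes B :: "nat \<Rightarrow> 'y set"
  assumes fin: "\<And>n. finite (B n)" and disj: "\<And>m n. m \<noteq> n \<Longrightarrow> B m \<inter> B n = {}"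
    and a: "\<And>n. contractive_matrix (B n) (a n)"
  obtains A where "A \<in> bounded_ops ell2" "\<And>n x y. x \<in> B n \<Longrightarrow> y \<in> B n \<Longrightarrow> mat_entry A x y = a n x y"
proof -
  define row where "row = (\<lambda>v x. if \<exists>n. x \<in> B n then (let n = (THE n. x \<in> B n) in \<Sum>y\<in>B n. a n x y * v y) else 0 :: complex)"
  have row: "row v x = (\<Sum>y\<in>B n. a n x y * v y)" if "x \<in> B n" for v x n
  proof -
    have "(THE n. x \<in> B n) = n" using that disj by (intro the_equality) blast+
    then show ?thesis using that unfolding row_def by auto
  qed
  have row0: "row v x = 0" if "\<And>n. x \<notin> B n" for v x using that unfolding row_def by simp
  have bound: "(\<Sum>x\<in>F. (cmod (row (coord f) x))\<^sup>2) \<le> (norm f)\<^sup>2" if F: "finite F" for F f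
  proof -
    have "\<exists>N. \<forall>x\<in>F. (\<exists>n. x \<in> B n) \<longrightarrow> (\<exists>n<N. x \<in> B n)"
      using F
    proof (induction F)
      case (insert x F)
      then obtain N where N: "\<forall>x\<in>F. (\<exists>n. x \<in> B n) \<longrightarrow> (\<exists>n<N. x \<in> B n)" by blast
      show ?case
      proof (cases "\<exists>n. x \<in> B n")
        case True
        then obtain n where n: "x \<in> B n" by blast
        have "\<exists>m<max N (Suc n). z \<in> B m" if z: "z \<in> insert x F" "\<exists>m. z \<in> B m" for z
        proof (cases "z = x")
          case True
          then show ?thesis using n by (intro exI[of _ n]) simp
        next
          case False
          then obtain m where "m < N" "z \<in> B m" using N z by blast
          then show ?thesis by (intro exI[of _ m]) simp
        qed
        then show ?thesis by blast
      next
        case False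
        then show ?thesis using N by (intro exI[of _ N]) blast
      qed
    qed simp
    then obtain N where N: "\<And>x. x \<in> F \<Longrightarrow> \<exists>n. x \<in> B n \<Longrightarrow> \<exists>n<N. x \<in> B n" by blast
    define U where "U = (\<Union>n\<in>{..<N}. B n)"
    have finU: "finite U" unfolding U_def using fin by simp
    have out: "row (coord f) x = 0" if "x \<in> F - U" for x
      using that N[of x] row0[of x] unfolding U_def by blast
    have "(\<Sum>x\<in>F. (cmod (row (coord f) x))\<^sup>2) = (\<Sum>x\<in>F \<inter> U. (cmod (row (coord f) x))\<^sup>2)"
      using F out by (intro sum.mono_neutral_right) auto
    also have "\<dots> \<le> (\<Sum>x\<in>U. (cmod (row (coord f) x))\<^sup>2)" using finU by (intro sum_mono2) auto
    also have "\<dots> = (\<Sum>n\<in>{..<N}. \<Sum>x\<in>B n. (cmod (row (coord f) x))\<^sup>2)"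
      unfolding U_def using fin disj by (intro sum.UNION_disjoint) auto
    also have "\<dots> \<le> (\<Sum>n\<in>{..<N}. \<Sum>x\<in>B n. (cmod (coord f x))\<^sup>2)"
    proof (rule sum_mono)
      fix n
      show "(\<Sum>x\<in>B n. (cmod (row (coord f) x))\<^sup>2) \<le> (\<Sum>x\<in>B n. (cmod (coord f x))\<^sup>2)"
        using contractive_matrix_row_norm[OF fin a, of n "coord f"] by (simp add: row cong: sum.cong)
    qed
    also have "\<dots> = (\<Sum>x\<in>U. (cmod (coord f x))\<^sup>2)"
      unfolding U_def using fin disj by (intro sum.UNION_disjoint[symmetric]) auto
    also have "\<dots> \<le> (norm f)\<^sup>2" by (rule sum_coord_le_norm[OF finU])
    finally show ?thesis .
  qed
  define T where "T = (\<lambda>f. Abs_l2 (row (coord f)))"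
  have T: "coord (T f) = row (coord f)" for f
  proof -
    have "(\<lambda>x. (cmod (row (coord f) x))\<^sup>2) summable_on UNIV"
      by (rule nonneg_bdd_above_summable_on) (auto intro!: bdd_aboveI2[of _ _ "(norm f)\<^sup>2"] bound)
    then show ?thesis unfolding T_def by (simp add: Abs_l2_inverse)
  qed
  have row_add: "row (\<lambda>y. u y + v y) x = row u x + row v x" for u v x
    by (cases "\<exists>n. x \<in> B n") (auto simp: row row0 distrib_left sum.distrib)
  have row_scale: "row (\<lambda>y. b * u y) x = b * row u x" for b u x
    by (cases "\<exists>n. x \<in> B n") (auto simp: row row0 sum_distrib_left mult_ac)
  define A where "A = (\<lambda>f\<in>range coord. coord (T (Abs_l2 f)))"
  have A: "A (coord f) = coord (T f)" for f by (simp add: A_def coord_inverse)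
  have T_add: "T (f + g) = T f + T g" for f g
  proof (rule l2_eqI)
    have "coord (f + g) = (\<lambda>y. coord f y + coord g y)" by (rule ext) simp
    then show "coord (T (f + g)) i = coord (T f + T g) i" for i by (simp add: T row_add)
  qed
  have T_scale: "T (scaleC b f) = scaleC b (T f)" for b f
  proof (rule l2_eqI)
    have "coord (scaleC b f) = (\<lambda>y. b * coord f y)" by (rule ext) simp
    then show "coord (T (scaleC b f)) i = coord (scaleC b (T f)) i" for i by (simp add: T row_scale)
  qed
  have T_norm: "norm (T f) \<le> norm f" for f
    by (rule norm_l2_le) (simp_all add: T bound)
  have "A \<in> bounded_ops ell2"
    unfolding bounded_ops_def vecs_ell2
  proof (intro CollectI conjI)
    show "A \<in> range coord \<rightarrow>\<^sub>E range coord" unfolding A_def by auto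
    show "\<exists>C. \<forall>v\<in>range coord. vnorm ell2 (A v) \<le> C * vnorm ell2 v"
      by (intro exI[of _ 1]) (auto simp: A T_norm)
  qed (auto simp: A T_add T_scale)
  moreover have "mat_entry A x y = a n x y" if "x \<in> B n" "y \<in> B n" for n x y
    using that fin[of n] unfolding mat_entry_def unit_vec_fun A T row[OF that(1)]
    by (simp add: coord_unit_vec if_distrib[of "\<lambda>x. _ * x"] cong: if_cong)
  ultimately show thesis by (rule that)
qed

text \<open>Each new translate has to avoid the finite union of the earlier ones, which excludes only finitely
  many elements of the group.\<close>

lemma disjoint_translates:
  fixes F :: "nat \<Rightarrow> 'g :: group_add set"
  assumes inf: "infinite (UNIV :: 'g set)" and fin: "\<And>n. finite (F n)"
  obtains h where "\<And>m n. m \<noteq> n \<Longrightarrow> (+) (h m) ` F m \<inter> (+) (h n) ` F n = {}"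
proof -
  have step: "\<exists>U'. finite U' \<and> U \<subseteq> U' \<and> (\<exists>g. (+) g ` F n \<subseteq> U' \<and> (+) g ` F n \<inter> U = {})" if U: "finite U" for U :: "'g set" and n
  proof -
    have "finite ((\<lambda>(u, x). u - x) ` (U \<times> F n))" using U fin by simp
    then obtain g where g: "g \<notin> (\<lambda>(u, x). u - x) ` (U \<times> F n)" using inf ex_new_if_finite by blast
    have "g + x \<notin> U" if "x \<in> F n" for x
    proof
      assume "g + x \<in> U"
      then have "(g + x) - x \<in> (\<lambda>(u, x). u - x) ` (U \<times> F n)" using that by (intro image_eqI[of _ _ "(g + x, x)"]) auto
      then show False using g by simp
    qed
    then show ?thesis using U fin[of n] by (intro exI[of _ "U \<union> (+) g ` F n"] conjI exI[of _ g]) auto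
  qed
  define R where "R = (\<lambda>n U U'. U \<subseteq> U' \<and> (\<exists>g. (+) g ` F n \<subseteq> U' \<and> (+) g ` F n \<inter> U = {}))"
  have "\<exists>U. \<forall>n. finite (U n) \<and> R n (U n) (U (Suc n))"
  proof (rule dependent_nat_choice)
    show "\<exists>U :: 'g set. finite U" by (rule exI[of _ "{}"]) simp
    show "\<exists>U'. finite U' \<and> R n U U'" if "finite U" for U n
      using step[OF that, of n] unfolding R_def .
  qed
  then obtain U where U: "\<And>n. R n (U n) (U (Suc n))" by blast
  have Umono: "U n \<subseteq> U (Suc n)" for n using U[of n] unfolding R_def by (rule conjunct1)
  have "\<exists>g. (+) g ` F n \<subseteq> U (Suc n) \<and> (+) g ` F n \<inter> U n = {}" for n using U[of n] unfolding R_def by (rule conjunct2)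
  then have "\<forall>n. \<exists>g. (+) g ` F n \<subseteq> U (Suc n) \<and> (+) g ` F n \<inter> U n = {}" by (rule allI)
  from choice[OF this] obtain h
    where h: "\<And>n. (+) (h n) ` F n \<subseteq> U (Suc n)" "\<And>n. (+) (h n) ` F n \<inter> U n = {}" by blast
  have mono: "U m \<subseteq> U n" if "m \<le> n" for m n using that by (rule lift_Suc_mono_le[of U, OF Umono])
  have less: "(+) (h m) ` F m \<inter> (+) (h n) ` F n = {}" if "m < n" for m n
    using h(1)[of m] h(2)[of n] mono[of "Suc m" n, OF Suc_leI[OF that]] by blast
  have "(+) (h m) ` F m \<inter> (+) (h n) ` F n = {}" if "m \<noteq> n" for m n
    using less[of m n] less[of n m] that by (cases m n rule: linorder_cases) blast+
  then show thesis by (rule that)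
qed

text \<open>If no bound existed, invariance would allow one to move finite matrices that violate larger and
  larger bounds to disjoint places. Their direct sum is a contraction whose Schur product with the kernel
  would be unbounded.\<close>

theorem schur_multiplier_schur_bounded:
  fixes \<phi> :: "'g :: group_add \<Rightarrow> complex"
  assumes mult: "schur_multiplier (\<lambda>x y. \<phi> (- y + x))"
  shows "\<exists>k. schur_bounded (\<lambda>x y. \<phi> (- y + x)) k"
proof (rule ccontr)
  define \<psi> where "\<psi> = (\<lambda>x y. \<phi> (- y + x))"
  assume "\<nexists>k. schur_bounded (\<lambda>x y. \<phi> (- y + x)) k"
  then have unb: "\<not> schur_bounded \<psi> k" for k unfolding \<psi>_def by blast
  define V where "V = (\<lambda>(n :: nat) F a s t. finite F \<and> contractive_matrix F a \<and>
      \<not> cmod (\<Sum>x\<in>F. \<Sum>y\<in>F. \<psi> x y * a x y * s x * cnj (t y))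
        \<le> real n * L2_set (\<lambda>x. cmod (s x)) F * L2_set (\<lambda>y. cmod (t y)) F)"
  have "\<exists>F a s t. V n F a s t" for n
    using unb[of "real n"] unfolding V_def schur_bounded_def contractive_matrix_def by blast
  then obtain F a s t where V: "\<And>n. V n (F n) (a n) (s n) (t n)" by metis
  have F: "finite (F n)" and a: "contractive_matrix (F n) (a n)" and
    viol: "\<not> cmod (\<Sum>x\<in>F n. \<Sum>y\<in>F n. \<psi> x y * a n x y * s n x * cnj (t n y))
      \<le> real n * L2_set (\<lambda>x. cmod (s n x)) (F n) * L2_set (\<lambda>y. cmod (t n y)) (F n)" for n
    using V[of n] unfolding V_def by blast+
  show False
  proof (cases "finite (UNIV :: 'g set)")
    case True
    \<comment> \<open>A finite group has no room for disjoint translates, but there the sum of all \<open>cmod (\<psi> x y)\<close> is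
      a bound.\<close>
    define K where "K = (\<Sum>x\<in>UNIV. \<Sum>y\<in>UNIV. cmod (\<psi> x y))"
    obtain n :: nat where n: "K \<le> real n" using real_arch_simple by blast
    let ?S = "L2_set (\<lambda>x. cmod (s n x)) (F n)" and ?T = "L2_set (\<lambda>y. cmod (t n y)) (F n)"
    have entry: "cmod (a n x y * s n x * cnj (t n y)) \<le> ?S * ?T" if xy: "x \<in> F n" "y \<in> F n" for x y
    proof -
      have one: "L2_set (\<lambda>x. cmod (if x = z then b else 0)) (F n) = cmod b" if "z \<in> F n" for z b
        using F[of n] that unfolding L2_set_def by (simp add: if_distrib[of cmod] if_distrib[of "\<lambda>x. x\<^sup>2"] cong: if_cong)
      have sm: "cmod (u z) \<le> L2_set (\<lambda>x. cmod (u x)) (F n)" if "z \<in> F n" for u z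
        using member_le_L2_set[OF F that, of "\<lambda>x. cmod (u x)"] .
      have "(\<Sum>x'\<in>F n. \<Sum>y'\<in>F n. a n x' y' * (if x' = x then s n x else 0) * cnj (if y' = y then t n y else 0)) = a n x y * s n x * cnj (t n y)"
        using F[of n] xy by (simp add: if_distrib[of cnj] if_distrib[of "\<lambda>x. _ * x"] if_distrib[of "\<lambda>x. x * _"] cong: if_cong)
      then have "cmod (a n x y * s n x * cnj (t n y)) \<le> cmod (s n x) * cmod (t n y)"
        using a[of n, unfolded contractive_matrix_def, rule_format,
            of "\<lambda>x'. if x' = x then s n x else 0" "\<lambda>y'. if y' = y then t n y else 0"]
        unfolding one[OF xy(1), of "s n x"] one[OF xy(2), of "t n y"] by (simp only:)
      also have "\<dots> \<le> ?S * ?T" by (intro mult_mono sm xy) simp_all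
      finally show ?thesis .
    qed
    have "cmod (\<Sum>x\<in>F n. \<Sum>y\<in>F n. \<psi> x y * a n x y * s n x * cnj (t n y))
        \<le> (\<Sum>x\<in>F n. \<Sum>y\<in>F n. cmod (\<psi> x y) * (?S * ?T))"
    proof (intro order_trans[OF norm_sum] sum_mono)
      fix x y assume xy: "x \<in> F n" "y \<in> F n"
      have "cmod (\<psi> x y * a n x y * s n x * cnj (t n y)) = cmod (\<psi> x y) * cmod (a n x y * s n x * cnj (t n y))"
        by (simp add: norm_mult mult_ac)
      also have "\<dots> \<le> cmod (\<psi> x y) * (?S * ?T)" by (intro mult_left_mono entry xy) simp
      finally show "cmod (\<psi> x y * a n x y * s n x * cnj (t n y)) \<le> cmod (\<psi> x y) * (?S * ?T)" .
    qed
    also have "\<dots> = (\<Sum>x\<in>F n. \<Sum>y\<in>F n. cmod (\<psi> x y)) * (?S * ?T)" by (simp add: sum_distrib_right)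
    also have "\<dots> \<le> K * (?S * ?T)"
    proof (rule mult_right_mono)
      have "(\<Sum>x\<in>F n. \<Sum>y\<in>F n. cmod (\<psi> x y)) \<le> (\<Sum>x\<in>F n. \<Sum>y\<in>UNIV. cmod (\<psi> x y))"
        using True by (intro sum_mono sum_mono2) auto
      also have "\<dots> \<le> K" unfolding K_def using True by (intro sum_mono2) (auto intro: sum_nonneg)
      finally show "(\<Sum>x\<in>F n. \<Sum>y\<in>F n. cmod (\<psi> x y)) \<le> K" .
    qed simp
    also have "\<dots> \<le> real n * (?S * ?T)" using n by (intro mult_right_mono) simp_all
    finally show False using viol[of n] by (simp add: mult.assoc)
  next
    case False
    obtain h where h: "\<And>m n. m \<noteq> n \<Longrightarrow> (+) (h m) ` F m \<inter> (+) (h n) ` F n = {}"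
      by (rule disjoint_translates[of F, OF False F]) blast
    define B where "B = (\<lambda>n. (+) (h n) ` F n)"
    define a' where "a' = (\<lambda>n x y. a n (- h n + x) (- h n + y))"
    define s' where "s' = (\<lambda>n x. s n (- h n + x))"
    define t' where "t' = (\<lambda>n x. t n (- h n + x))"
    have reindex: "(\<Sum>x\<in>B n. G x) = (\<Sum>x\<in>F n. G (h n + x))" for G :: "'g \<Rightarrow> complex" and n
      unfolding B_def by (subst sum.reindex) (auto simp: inj_on_def)
    have reindex': "L2_set (\<lambda>x. G (- h n + x)) (B n) = L2_set G (F n)" for G n
      unfolding B_def L2_set_def by (subst sum.reindex) (auto simp: inj_on_def)
    have a'_contr: "contractive_matrix (B n) (a' n)" for n
      unfolding contractive_matrix_def
    proof (intro allI)
      fix u v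
      have "L2_set (\<lambda>x. cmod (u (h n + x))) (F n) = L2_set (\<lambda>x. cmod (u x)) (B n)" for u :: "'g \<Rightarrow> complex"
        using reindex'[of "\<lambda>x. cmod (u (h n + x))" n] by simp
      then show "cmod (\<Sum>x\<in>B n. \<Sum>y\<in>B n. a' n x y * u x * cnj (v y))
          \<le> L2_set (\<lambda>x. cmod (u x)) (B n) * L2_set (\<lambda>y. cmod (v y)) (B n)"
        using a[of n, unfolded contractive_matrix_def, rule_format, of "\<lambda>x. u (h n + x)" "\<lambda>y. v (h n + y)"]
        unfolding reindex a'_def by simp
    qed
    obtain A where A: "A \<in> bounded_ops ell2" "\<And>n x y. x \<in> B n \<Longrightarrow> y \<in> B n \<Longrightarrow> mat_entry A x y = a' n x y"
    proof (rule block_diagonal_operator[of B a'])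
      show "finite (B n)" for n unfolding B_def using F by simp
      show "B m \<inter> B n = {}" if "m \<noteq> n" for m n unfolding B_def using h[OF that] .
      show "contractive_matrix (B n) (a' n)" for n by (rule a'_contr)
    qed blast
    obtain R where R: "R \<in> bounded_ops ell2" "\<And>x y. mat_entry R x y = \<psi> x y * mat_entry A x y"
      using mult A(1) unfolding schur_multiplier_def \<psi>_def by blast
    obtain b C where b: "\<And>f. R (coord f) = coord (b f)" "\<And>f g. b (f + g) = b f + b g"
      "\<And>a f. b (scaleC a f) = scaleC a (b f)" "\<And>f. norm (b f) \<le> C * norm f"
      by (rule ell2_op_lower[OF R(1)]) blast
    obtain n :: nat where n: "C \<le> real n" using real_arch_simple by blast
    have finB: "finite (B n)" unfolding B_def using F by simp
    define v where "v = lincomb unit_vec (B n) (\<lambda>y. cnj (t' n y))"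
    have norm_v: "norm v = L2_set (\<lambda>y. cmod (t n y)) (F n)"
      unfolding v_def norm_lincomb_unit_vec[OF finB] t'_def using reindex'[of "\<lambda>x. cmod (t n x)" n] by simp
    have bv: "coord (b v) x = (\<Sum>y\<in>B n. \<psi> x y * a' n x y * cnj (t' n y))" if x: "x \<in> B n" for x
    proof -
      have "coord (b (unit_vec y)) x = mat_entry R x y" for y
        unfolding mat_entry_def unit_vec_fun b(1) ..
      then have "coord (b (unit_vec y)) x = \<psi> x y * a' n x y" if "y \<in> B n" for y
        using A(2)[OF x that] R(2) by simp
      then show ?thesis
        unfolding v_def additive_lincomb[of b, OF b(2,3) finB] coord_lincomb by (simp add: mult_ac)
    qed
    have "(\<Sum>x\<in>F n. \<Sum>y\<in>F n. \<psi> x y * a n x y * s n x * cnj (t n y))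
        = (\<Sum>x\<in>B n. \<Sum>y\<in>B n. \<psi> x y * a' n x y * s' n x * cnj (t' n y))"
      unfolding reindex a'_def s'_def t'_def \<psi>_def by (simp only: minus_add add.assoc minus_add_cancel)
    also have "\<dots> = (\<Sum>x\<in>B n. s' n x * coord (b v) x)"
      by (intro sum.cong refl) (simp add: bv sum_distrib_left mult_ac)
    also have "cmod \<dots> \<le> (\<Sum>x\<in>B n. cmod (s' n x) * cmod (coord (b v) x))"
      by (rule order_trans[OF norm_sum]) (simp add: norm_mult)
    also have "\<dots> \<le> L2_set (\<lambda>x. cmod (s' n x)) (B n) * L2_set (\<lambda>x. cmod (coord (b v) x)) (B n)"
      using L2_set_mult_ineq[of "\<lambda>x. cmod (s' n x)" "\<lambda>x. cmod (coord (b v) x)" "B n"] by simp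
    also have "\<dots> \<le> L2_set (\<lambda>x. cmod (s' n x)) (B n) * norm (b v)"
      using sum_coord_le_norm[OF finB, of "b v"] unfolding L2_set_def
      by (intro mult_left_mono) (auto intro: real_le_lsqrt sum_nonneg)
    also have "\<dots> \<le> L2_set (\<lambda>x. cmod (s' n x)) (B n) * (real n * norm v)"
      using order_trans[OF b(4)[of v] mult_right_mono[OF n norm_ge_zero[of v]]] by (intro mult_left_mono) simp_all
    also have "\<dots> = real n * L2_set (\<lambda>x. cmod (s n x)) (F n) * L2_set (\<lambda>y. cmod (t n y)) (F n)"
      unfolding norm_v s'_def using reindex'[of "\<lambda>x. cmod (s n x)" n] by simp
    finally show False using viol[of n] by blast
  qed
qed

section \<open>Multipliers on the operators of an inner product space\<close>

text \<open>Inner product spaces pass to finite powers, so that the estimates for operators also apply to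
  matrices of operators.\<close>

locale inner_product_space =
  fixes H :: "'v hspace"
  assumes zero_closed: "vzero H \<in> vecs H"
    and add_closed: "\<lbrakk>u \<in> vecs H; v \<in> vecs H\<rbrakk> \<Longrightarrow> vadd H u v \<in> vecs H"
    and scale_closed: "v \<in> vecs H \<Longrightarrow> vscale H \<alpha> v \<in> vecs H"
    and add_assoc: "\<lbrakk>u \<in> vecs H; v \<in> vecs H; w \<in> vecs H\<rbrakk>
      \<Longrightarrow> vadd H (vadd H u v) w = vadd H u (vadd H v w)"
    and add_commute: "\<lbrakk>u \<in> vecs H; v \<in> vecs H\<rbrakk> \<Longrightarrow> vadd H u v = vadd H v u"
    and add_zero: "v \<in> vecs H \<Longrightarrow> vadd H v (vzero H) = v"
    and scale_add_left: "v \<in> vecs H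
      \<Longrightarrow> vscale H (\<alpha> + \<beta>) v = vadd H (vscale H \<alpha> v) (vscale H \<beta> v)"
    and scale_one: "v \<in> vecs H \<Longrightarrow> vscale H 1 v = v"
    and ip_add_left: "\<lbrakk>u \<in> vecs H; v \<in> vecs H; w \<in> vecs H\<rbrakk>
      \<Longrightarrow> ip H (vadd H u v) w = ip H u w + ip H v w"
    and ip_scale_left: "\<lbrakk>u \<in> vecs H; v \<in> vecs H\<rbrakk> \<Longrightarrow> ip H (vscale H \<alpha> u) v = \<alpha> * ip H u v"
    and ip_commute: "\<lbrakk>u \<in> vecs H; v \<in> vecs H\<rbrakk> \<Longrightarrow> ip H v u = cnj (ip H u v)"
    and ip_nonneg: "v \<in> vecs H \<Longrightarrow> 0 \<le> Re (ip H v v)"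
    and ip_eq_zero: "\<lbrakk>v \<in> vecs H; ip H v v = 0\<rbrakk> \<Longrightarrow> v = vzero H"
begin

definition sq :: "'v \<Rightarrow> real" where "sq v = Re (ip H v v)"

lemma sq_nonneg: "v \<in> vecs H \<Longrightarrow> sq v \<ge> 0"
  unfolding sq_def by (rule ip_nonneg)

lemma ip_self: "v \<in> vecs H \<Longrightarrow> ip H v v = of_real (sq v)"
  using arg_cong[OF ip_commute[of v v], of Im] by (simp add: sq_def complex_eq_iff)

lemma vnorm_eq: "vnorm H v = sqrt (sq v)"
  unfolding vnorm_def sq_def ..

lemma ip_add_right: "\<lbrakk>u \<in> vecs H; v \<in> vecs H; w \<in> vecs H\<rbrakk> \<Longrightarrow> ip H w (vadd H u v) = ip H w u + ip H w v"
  using ip_commute[of "vadd H u v" w] ip_commute[of u w] ip_commute[of v w] ip_add_left[of u v w]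
  by (simp add: add_closed)

lemma ip_scale_right: "\<lbrakk>u \<in> vecs H; v \<in> vecs H\<rbrakk> \<Longrightarrow> ip H v (vscale H \<alpha> u) = cnj \<alpha> * ip H v u"
  using ip_commute[of "vscale H \<alpha> u" v] ip_commute[of u v] ip_scale_left[of u v \<alpha>]
  by (simp add: scale_closed)

lemma scale_zero: "v \<in> vecs H \<Longrightarrow> vscale H 0 v = vzero H"
  by (rule ip_eq_zero) (simp_all add: scale_closed ip_scale_left)

lemma ip_zero_left: "v \<in> vecs H \<Longrightarrow> ip H (vzero H) v = 0"
  using ip_scale_left[of v v 0] scale_zero[of v] by simp

lemma vec_eqI:
  assumes u: "u \<in> vecs H" and v: "v \<in> vecs H" and eq: "\<And>w. w \<in> vecs H \<Longrightarrow> ip H u w = ip H v w"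
  shows "u = v"
proof -
  define d where "d = vadd H u (vscale H (- 1) v)"
  have nv: "vscale H (- 1) v \<in> vecs H" by (rule scale_closed[OF v])
  have d: "d \<in> vecs H" unfolding d_def by (rule add_closed[OF u nv])
  have "ip H d d = ip H u d + (- 1) * ip H v d"
    unfolding d_def ip_add_left[OF u nv d[unfolded d_def]] ip_scale_left[OF v d[unfolded d_def]] ..
  then have "ip H d d = 0" using eq[OF d] by simp
  then have "d = vzero H" using ip_eq_zero d by blast
  have "vadd H (vscale H (- 1) v) v = vzero H"
    using scale_add_left[OF v, of "- 1" 1] scale_one[OF v] scale_zero[OF v] by simp
  then have "vadd H d v = u"
    unfolding d_def using add_assoc[OF u nv v] add_zero[OF u] by simp
  moreover have "vadd H d v = v"
    unfolding \<open>d = vzero H\<close> using add_commute[OF zero_closed v] add_zero[OF v] by simp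
  ultimately show ?thesis by simp
qed

lemma sq_scale: "v \<in> vecs H \<Longrightarrow> sq (vscale H \<alpha> v) = (cmod \<alpha>)\<^sup>2 * sq v"
proof -
  assume v: "v \<in> vecs H"
  have "ip H (vscale H \<alpha> v) (vscale H \<alpha> v) = (\<alpha> * cnj \<alpha>) * ip H v v"
    using v by (simp add: ip_scale_left ip_scale_right scale_closed)
  then show ?thesis
    unfolding complex_norm_square[symmetric] ip_self[OF v] ip_self[OF scale_closed[OF v]] of_real_mult[symmetric] of_real_eq_iff .
qed

lemma ip_le_sq: 
  assumes u: "u \<in> vecs H" and v: "v \<in> vecs H"
  shows "2 * cmod (ip H u v) \<le> sq u + sq v"
proof (cases "ip H u v = 0")
  case True
  then show ?thesis using sq_nonneg[OF u] sq_nonneg[OF v] by simp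
next
  case False
  define c where "c = - sgn (ip H u v)"
  have cv: "vscale H c v \<in> vecs H" by (rule scale_closed[OF v])
  have c: "cmod c = 1" using False by (simp add: c_def norm_sgn)
  have Re_uv: "Re (ip H u (vscale H c v)) = - cmod (ip H u v)"
    unfolding ip_scale_right[OF v u] c_def using cnj_sgn_mult[of "ip H u v"] by simp
  have "ip H (vadd H u (vscale H c v)) (vadd H u (vscale H c v))
      = ip H u u + ip H u (vscale H c v) + (cnj (ip H u (vscale H c v)) + ip H (vscale H c v) (vscale H c v))"
    using u cv ip_commute[OF u cv] by (simp add: ip_add_left ip_add_right add_closed)
  then have "sq (vadd H u (vscale H c v)) = sq u - 2 * cmod (ip H u v) + sq (vscale H c v)"
    unfolding sq_def using Re_uv by simp
  then show ?thesis using sq_nonneg[OF add_closed[OF u cv]] sq_scale[OF v, of c] c by simp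
qed

lemma ip_le_sq_weighted:
  assumes "u \<in> vecs H" "v \<in> vecs H" "t > 0"
  shows "2 * t * cmod (ip H u v) \<le> t\<^sup>2 * sq u + sq v"
  using ip_le_sq[OF scale_closed[OF assms(1), of "of_real t"] assms(2)] assms
  by (simp add: ip_scale_left sq_scale norm_mult)

lemma sq_add_le: 
  assumes u: "u \<in> vecs H" and v: "v \<in> vecs H"
  shows "sq (vadd H u v) \<le> 2 * sq u + 2 * sq v"
proof -
  have "ip H (vadd H u v) (vadd H u v) = ip H u u + ip H u v + (cnj (ip H u v) + ip H v v)"
    using u v ip_commute[OF u v] by (simp add: ip_add_left ip_add_right add_closed)
  then have "sq (vadd H u v) = sq u + 2 * Re (ip H u v) + sq v" unfolding sq_def by simp
  then show ?thesis using ip_le_sq[OF u v] complex_Re_le_cmod[of "ip H u v"] by linarith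
qed

end

lemma quadratic_bound:
  fixes a x y :: real
  assumes "\<And>t. t > 0 \<Longrightarrow> 2 * t * a \<le> t\<^sup>2 * x + y" "a \<ge> 0" "x \<ge> 0" "y \<ge> 0"
  shows "a\<^sup>2 \<le> x * y"
proof (cases "a = 0")
  case True
  then show ?thesis using assms by simp
next
  case False
  then have a: "a > 0" using assms(2) by simp
  show ?thesis
  proof (cases "x = 0")
    case True
    have "2 * ((y + 1) / (2 * a)) * a = y + 1" using a by simp
    moreover have "(y + 1) / (2 * a) > 0" using a assms(4) by simp
    ultimately show ?thesis using assms(1)[of "(y + 1) / (2 * a)"] True by simp
  next
    case False
    then have x: "x > 0" using assms(3) by simp
    then have "2 * (a / x) * a \<le> (a / x)\<^sup>2 * x + y" using a by (intro assms(1)) simp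
    then have "x * (2 * (a / x) * a) \<le> x * ((a / x)\<^sup>2 * x + y)" using x by (intro mult_left_mono) simp_all
    then show ?thesis using x by (simp add: power2_eq_square distrib_left)
  qed
qed

context inner_product_space
begin

text \<open>The norm of \<open>R\<close> is bounded by applying the Cauchy--Schwarz inequality to the series for its inner
  product with itself; one factor of \<open>sq R\<close> reappears on the right and is cancelled.\<close>

lemma series_bound:
  assumes R: "R \<in> vecs H" and g: "\<And>n. g n \<in> vecs H" and q: "\<And>n. q n \<in> vecs H"
    and eq: "(\<lambda>n. ip H (g n) (q n)) sums ip H R R"
    and X: "\<And>N. (\<Sum>n<N. sq (g n)) \<le> X" and Y: "\<And>N. (\<Sum>n<N. sq (q n)) \<le> b * sq R" and b: "b \<ge> 0"
  shows "sq R \<le> b * X"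
proof (cases "sq R = 0")
  case True
  have "X \<ge> 0" using X[of 0] by simp
  then show ?thesis using True b by simp
next
  case False
  then have pos: "sq R > 0" using sq_nonneg[OF R] by simp
  have "(sq R)\<^sup>2 \<le> X * (b * sq R)"
  proof (rule quadratic_bound)
    fix t :: real assume t: "t > 0"
    have "2 * t * (\<Sum>n<N. cmod (ip H (g n) (q n))) \<le> t\<^sup>2 * X + b * sq R" for N
    proof -
      have "2 * t * (\<Sum>n<N. cmod (ip H (g n) (q n))) \<le> (\<Sum>n<N. t\<^sup>2 * sq (g n) + sq (q n))"
        unfolding sum_distrib_left by (intro sum_mono ip_le_sq_weighted g q t)
      also have "\<dots> = t\<^sup>2 * (\<Sum>n<N. sq (g n)) + (\<Sum>n<N. sq (q n))" by (simp add: sum.distrib sum_distrib_left)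
      also have "\<dots> \<le> t\<^sup>2 * X + b * sq R" by (intro add_mono mult_left_mono X Y) simp
      finally show ?thesis .
    qed
    moreover have "cmod (\<Sum>n<N. ip H (g n) (q n)) \<le> (\<Sum>n<N. cmod (ip H (g n) (q n)))" for N by (rule norm_sum)
    ultimately have "2 * t * cmod (\<Sum>n<N. ip H (g n) (q n)) \<le> t\<^sup>2 * X + b * sq R" for N
      using t by (meson mult_left_mono order_trans less_imp_le zero_less_mult_iff zero_less_numeral)
    moreover have "(\<lambda>N. 2 * t * cmod (\<Sum>n<N. ip H (g n) (q n))) \<longlonglongrightarrow> 2 * t * cmod (ip H R R)"
      using eq unfolding sums_def by (intro tendsto_intros)
    ultimately have "2 * t * cmod (ip H R R) \<le> t\<^sup>2 * X + b * sq R" by (intro LIMSEQ_le_const2) blast+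
    then show "2 * t * sq R \<le> t\<^sup>2 * X + b * sq R" unfolding ip_self[OF R] using pos by simp
  qed (use X[of 0] b pos in simp_all)
  then have "sq R * sq R \<le> sq R * (b * X)" by (simp add: power2_eq_square mult_ac)
  then show ?thesis using pos by simp
qed

lemma bounded_opsD:
  assumes "T \<in> bounded_ops H"
  shows "T \<in> vecs H \<rightarrow>\<^sub>E vecs H" "v \<in> vecs H \<Longrightarrow> T v \<in> vecs H"
    "u \<in> vecs H \<Longrightarrow> v \<in> vecs H \<Longrightarrow> T (vadd H u v) = vadd H (T u) (T v)"
    "v \<in> vecs H \<Longrightarrow> T (vscale H \<alpha> v) = vscale H \<alpha> (T v)"
  using assms unfolding bounded_ops_def by auto

lemma bounded_ops_sq:
  assumes T: "T \<in> bounded_ops H"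
  obtains C where "C \<ge> 0" "\<And>v. v \<in> vecs H \<Longrightarrow> sq (T v) \<le> C * sq v"
proof -
  obtain C where C: "\<forall>v\<in>vecs H. vnorm H (T v) \<le> C * vnorm H v" using T unfolding bounded_ops_def by blast
  show thesis
  proof (rule that[of "C\<^sup>2"])
    fix v assume v: "v \<in> vecs H"
    have "sq (T v) = (vnorm H (T v))\<^sup>2" unfolding vnorm_eq using sq_nonneg[OF bounded_opsD(2)[OF T v]] by simp
    also have "\<dots> \<le> (C * vnorm H v)\<^sup>2" using C v sq_nonneg[OF bounded_opsD(2)[OF T v]]
      by (intro power_mono) (auto simp: vnorm_eq)
    also have "\<dots> = C\<^sup>2 * sq v" unfolding vnorm_eq using sq_nonneg[OF v] by (simp add: power_mult_distrib)
    finally show "sq (T v) \<le> C\<^sup>2 * sq v" .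
  qed simp
qed

lemma bounded_opsI:
  assumes "T \<in> extensional (vecs H)" "\<And>v. v \<in> vecs H \<Longrightarrow> T v \<in> vecs H"
    "\<And>u v. u \<in> vecs H \<Longrightarrow> v \<in> vecs H \<Longrightarrow> T (vadd H u v) = vadd H (T u) (T v)"
    "\<And>\<alpha> v. v \<in> vecs H \<Longrightarrow> T (vscale H \<alpha> v) = vscale H \<alpha> (T v)"
    and sq: "\<And>v. v \<in> vecs H \<Longrightarrow> sq (T v) \<le> C * sq v"
  shows "T \<in> bounded_ops H"
  unfolding bounded_ops_def
proof (intro CollectI conjI)
  show "T \<in> vecs H \<rightarrow>\<^sub>E vecs H" using assms(1,2) by (auto simp: PiE_def)
  show "\<exists>C. \<forall>v\<in>vecs H. vnorm H (T v) \<le> C * vnorm H v"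
    using real_sqrt_le_mono[OF sq] by (intro exI[of _ "sqrt C"]) (simp add: vnorm_eq real_sqrt_mult)
qed (use assms(3,4) in auto)

lemma op_norm_bound:
  assumes T: "T \<in> bounded_ops H" and v: "v \<in> vecs H"
  shows "vnorm H (T v) \<le> op_norm H T * vnorm H v"
proof -
  obtain C where C: "C \<ge> 0" "\<And>v. v \<in> vecs H \<Longrightarrow> sq (T v) \<le> C * sq v" by (rule bounded_ops_sq[OF T]) blast
  have bdd: "bdd_above {vnorm H (T v) | v. v \<in> vecs H \<and> vnorm H v \<le> 1}"
  proof (rule bdd_aboveI)
    fix r assume "r \<in> {vnorm H (T v) | v. v \<in> vecs H \<and> vnorm H v \<le> 1}"
    then obtain v where v: "r = vnorm H (T v)" "v \<in> vecs H" "sq v \<le> 1" by (auto simp: vnorm_eq)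
    then have "sq (T v) \<le> C * 1" using C(2)[OF v(2)] mult_left_mono[OF v(3) C(1)] by linarith
    then show "r \<le> sqrt C" unfolding v(1) vnorm_eq by simp
  qed
  show ?thesis
  proof (cases "sq v = 0")
    case True
    then have "sq (T v) = 0" using C(2)[OF v] sq_nonneg[OF bounded_opsD(2)[OF T v]] by simp
    then show ?thesis using True by (simp add: vnorm_eq)
  next
    case False
    then have pos: "sq v > 0" using sq_nonneg[OF v] by simp
    define w where "w = vscale H (of_real (1 / vnorm H v)) v"
    have w: "w \<in> vecs H" unfolding w_def by (rule scale_closed[OF v])
    have "sq w = 1" unfolding w_def sq_scale[OF v] vnorm_eq using pos by (simp add: norm_divide power_divide)
    then have "vnorm H (T w) \<le> op_norm H T"
      unfolding op_norm_def using w by (intro cSup_upper bdd) (auto simp: vnorm_eq)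
    also have "vnorm H (T w) = vnorm H (T v) / vnorm H v"
      unfolding w_def bounded_opsD(4)[OF T v] vnorm_eq sq_scale[OF bounded_opsD(2)[OF T v]]
      using pos by (simp add: norm_divide power_divide real_sqrt_divide)
    finally show ?thesis using pos by (simp add: vnorm_eq field_simps)
  qed
qed

lemma op_norm_le:
  assumes r: "r \<ge> 0" and T: "\<And>v. v \<in> vecs H \<Longrightarrow> vnorm H (T v) \<le> r * vnorm H v"
  shows "op_norm H T \<le> r"
  unfolding op_norm_def
proof (rule cSup_least)
  have "vnorm H (vzero H) \<le> 1" using ip_zero_left[OF zero_closed] by (simp add: vnorm_def)
  then show "{vnorm H (T v) | v. v \<in> vecs H \<and> vnorm H v \<le> 1} \<noteq> {}" using zero_closed by blast
  fix x assume "x \<in> {vnorm H (T v) | v. v \<in> vecs H \<and> vnorm H v \<le> 1}"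
  then obtain v where v: "x = vnorm H (T v)" "v \<in> vecs H" "vnorm H v \<le> 1" by blast
  show "x \<le> r" using T[OF v(2)] mult_left_mono[OF v(3) r] v(1) by simp
qed

lemma op_add_bounded:
  assumes S: "S \<in> bounded_ops H" and T: "T \<in> bounded_ops H"
  shows "op_add H S T \<in> bounded_ops H"
proof -
  obtain C where C: "C \<ge> 0" "\<And>v. v \<in> vecs H \<Longrightarrow> sq (S v) \<le> C * sq v" by (rule bounded_ops_sq[OF S]) blast
  obtain D where D: "D \<ge> 0" "\<And>v. v \<in> vecs H \<Longrightarrow> sq (T v) \<le> D * sq v" by (rule bounded_ops_sq[OF T]) blast
  note ST = bounded_opsD(2)[OF S] bounded_opsD(2)[OF T]
  show ?thesis
  proof (rule bounded_opsI[where C = "2 * C + 2 * D"])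
    fix u v \<alpha> assume u: "u \<in> vecs H" and v: "v \<in> vecs H"
    show "op_add H S T (vadd H u v) = vadd H (op_add H S T u) (op_add H S T v)"
      by (rule vec_eqI)
        (use u v in \<open>simp_all add: op_add_def add_closed ST bounded_opsD(3)[OF S] bounded_opsD(3)[OF T] ip_add_left\<close>)
  next
    fix v \<alpha> assume v: "v \<in> vecs H"
    show "op_add H S T (vscale H \<alpha> v) = vscale H \<alpha> (op_add H S T v)"
      by (rule vec_eqI)
        (use v in \<open>simp_all add: op_add_def add_closed scale_closed ST bounded_opsD(4)[OF S] bounded_opsD(4)[OF T] ip_add_left ip_scale_left distrib_left\<close>)
    show "sq (op_add H S T v) \<le> (2 * C + 2 * D) * sq v"
      using sq_add_le[OF ST(1)[OF v] ST(2)[OF v]] C(2)[OF v] D(2)[OF v] v by (simp add: op_add_def distrib_right)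
  qed (auto simp: op_add_def add_closed ST)
qed

lemma op_scale_bounded:
  assumes T: "T \<in> bounded_ops H"
  shows "op_scale H \<beta> T \<in> bounded_ops H"
proof -
  obtain D where D: "D \<ge> 0" "\<And>v. v \<in> vecs H \<Longrightarrow> sq (T v) \<le> D * sq v" by (rule bounded_ops_sq[OF T]) blast
  note Tc = bounded_opsD(2)[OF T]
  show ?thesis
  proof (rule bounded_opsI[where C = "(cmod \<beta>)\<^sup>2 * D"])
    fix u v assume u: "u \<in> vecs H" and v: "v \<in> vecs H"
    show "op_scale H \<beta> T (vadd H u v) = vadd H (op_scale H \<beta> T u) (op_scale H \<beta> T v)"
      by (rule vec_eqI)
        (use u v in \<open>simp_all add: op_scale_def add_closed scale_closed Tc bounded_opsD(3)[OF T] ip_add_left ip_scale_left distrib_left\<close>)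
  next
    fix v \<alpha> assume v: "v \<in> vecs H"
    show "op_scale H \<beta> T (vscale H \<alpha> v) = vscale H \<alpha> (op_scale H \<beta> T v)"
      by (rule vec_eqI)
        (use v in \<open>simp_all add: op_scale_def scale_closed Tc bounded_opsD(4)[OF T] ip_scale_left\<close>)
    show "sq (op_scale H \<beta> T v) \<le> (cmod \<beta>)\<^sup>2 * D * sq v"
      using v mult_left_mono[OF D(2)[OF v], of "(cmod \<beta>)\<^sup>2"] by (simp add: op_scale_def sq_scale Tc mult.assoc)
  qed (auto simp: op_scale_def scale_closed Tc)
qed

lemma vsum_closed: "(\<And>j. j < n \<Longrightarrow> v j \<in> vecs H) \<Longrightarrow> vsum H v n \<in> vecs H"
  by (induction n) (auto simp: zero_closed add_closed)

lemma ip_vsum_left: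
  "(\<And>j. j < n \<Longrightarrow> v j \<in> vecs H) \<Longrightarrow> w \<in> vecs H \<Longrightarrow> ip H (vsum H v n) w = (\<Sum>j<n. ip H (v j) w)"
  by (induction n) (auto simp: ip_zero_left ip_add_left vsum_closed)

end

lemma inner_product_space_power:
  assumes "inner_product_space H"
  shows "inner_product_space (power_space n H)"
proof -
  interpret inner_product_space H by fact
  have [simp]: "vecs (power_space n H) = {..<n} \<rightarrow>\<^sub>E vecs H"
    "vadd (power_space n H) = (\<lambda>v w. \<lambda>i\<in>{..<n}. vadd H (v i) (w i))"
    "vzero (power_space n H) = (\<lambda>i\<in>{..<n}. vzero H)"
    "vscale (power_space n H) = (\<lambda>\<alpha> v. \<lambda>i\<in>{..<n}. vscale H \<alpha> (v i))"
    "ip (power_space n H) = (\<lambda>v w. \<Sum>i<n. ip H (v i) (w i))"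
    by (simp_all add: power_space_def)
  have mem: "v i \<in> vecs H" if "v \<in> {..<n} \<rightarrow>\<^sub>E vecs H" "i < n" for v i using PiE_mem[OF that(1)] that(2) by simp
  have ext: "(\<lambda>i\<in>{..<n}. v i) = v" if "v \<in> {..<n} \<rightarrow>\<^sub>E vecs H" for v using PiE_restrict[OF that] .
  show ?thesis
  proof
    fix v assume v: "v \<in> vecs (power_space n H)"
    note m = mem[OF v[simplified]]
    show "vadd (power_space n H) v (vzero (power_space n H)) = v"
      using ext[OF v[simplified]] by (simp add: add_zero m cong: restrict_cong)
    show "vscale (power_space n H) 1 v = v"
      using ext[OF v[simplified]] by (simp add: scale_one m cong: restrict_cong)
    show "0 \<le> Re (ip (power_space n H) v v)" by (auto intro!: sum_nonneg ip_nonneg m)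
    show "v = vzero (power_space n H)" if "ip (power_space n H) v v = 0"
    proof -
      have "(\<Sum>i<n. sq (v i)) = Re (ip (power_space n H) v v)" by (simp add: sq_def)
      then have "(\<Sum>i<n. sq (v i)) = 0" unfolding that by simp
      then have "sq (v i) = 0" if "i < n" for i
        using that sum_nonneg_eq_0_iff[of "{..<n}" "\<lambda>i. sq (v i)"] by (auto simp: sq_nonneg m)
      then have "v i = vzero H" if "i < n" for i using ip_eq_zero[OF m[OF that]] ip_self[OF m[OF that]] that by simp
      then have "(\<lambda>i\<in>{..<n}. v i) = (\<lambda>i\<in>{..<n}. vzero H)" by (intro restrict_ext) simp
      then show ?thesis using ext[OF v[simplified]] by simp
    qed
  next
    fix u v assume u: "u \<in> vecs (power_space n H)" and v: "v \<in> vecs (power_space n H)"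
    note mu = mem[OF u[simplified]] and mv = mem[OF v[simplified]]
    show "ip (power_space n H) v u = cnj (ip (power_space n H) u v)"
      by (simp, intro sum.cong refl) (simp add: ip_commute[OF mu mv])
    show "vadd (power_space n H) u v \<in> vecs (power_space n H)" by (auto intro!: add_closed mu mv)
    show "vadd (power_space n H) u v = vadd (power_space n H) v u"
      by (simp, rule restrict_ext) (simp add: add_commute[OF mu mv])
    show "ip (power_space n H) (vscale (power_space n H) \<alpha> u) v = \<alpha> * ip (power_space n H) u v" for \<alpha>
      by (simp add: sum_distrib_left ip_scale_left mu mv)
    fix w assume w: "w \<in> vecs (power_space n H)"
    note mw = mem[OF w[simplified]]
    show "vadd (power_space n H) (vadd (power_space n H) u v) w = vadd (power_space n H) u (vadd (power_space n H) v w)"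
      by (simp, rule restrict_ext) (simp add: add_assoc mu mv mw)
    show "ip (power_space n H) (vadd (power_space n H) u v) w = ip (power_space n H) u w + ip (power_space n H) v w"
      by (simp add: sum.distrib[symmetric] ip_add_left mu mv mw)
  next
    fix v \<alpha> \<beta> assume v: "v \<in> vecs (power_space n H)"
    note mv = mem[OF v[simplified]]
    show "vscale (power_space n H) \<alpha> v \<in> vecs (power_space n H)" by (auto intro!: scale_closed mv)
    show "vscale (power_space n H) (\<alpha> + \<beta>) v = vadd (power_space n H) (vscale (power_space n H) \<alpha> v) (vscale (power_space n H) \<beta> v)"
      by (simp, rule restrict_ext) (simp add: scale_add_left mv)
  qed (auto intro!: zero_closed)
qed

section \<open>The ultraweak topology and multipliers of operators\<close>

lemma double_series:
  fixes F :: "nat \<Rightarrow> nat \<Rightarrow> complex"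
  assumes abs: "summable (\<lambda>k. norm (case prod_decode k of (i, n) \<Rightarrow> F i n))" and S: "\<And>i. F i sums S i"
  shows "(\<Sum>k. case prod_decode k of (i, n) \<Rightarrow> F i n) = (\<Sum>i. S i)"
proof -
  define G where "G = (\<lambda>(i, n). F i n)"
  have bij: "bij_betw prod_decode UNIV (Sigma UNIV (\<lambda>_. UNIV))"
    using bij_prod_decode by simp
  have k: "(\<lambda>k. G (prod_decode k)) summable_on UNIV"
    using abs unfolding G_def by (rule norm_summable_imp_summable_on)
  then have G: "G summable_on (Sigma UNIV (\<lambda>_. UNIV))"
    unfolding summable_on_reindex_bij_betw[OF bij] .
  have inner: "infsum (\<lambda>n. G (i, n)) UNIV = S i" for i
  proof -
    have "G summable_on (Pair i ` UNIV)" by (rule summable_on_subset_banach[OF G]) auto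
    then have "(\<lambda>n. G (i, n)) summable_on UNIV"
      by (subst (asm) summable_on_reindex) (auto simp: inj_on_def o_def)
    then have "(\<lambda>n. G (i, n)) sums infsum (\<lambda>n. G (i, n)) UNIV"
      by (rule has_sum_imp_sums[OF has_sum_infsum])
    then show ?thesis using S[of i] sums_unique2 unfolding G_def by fastforce
  qed
  have "(\<lambda>i. S i) summable_on UNIV"
    using summable_on_Sigma_banach[OF G[unfolded G_def]] inner unfolding G_def by simp
  then have "S sums infsum S UNIV" by (rule has_sum_imp_sums[OF has_sum_infsum])
  then have "(\<Sum>i. S i) = infsum S UNIV" by (rule sums_unique[symmetric])
  also have "\<dots> = infsum G (Sigma UNIV (\<lambda>_. UNIV))"
    using infsum_Sigma_banach[OF G] unfolding inner .
  also have "\<dots> = infsum (\<lambda>k. G (prod_decode k)) UNIV"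
    by (rule infsum_reindex_bij_betw[OF bij, symmetric])
  also have "\<dots> = (\<Sum>k. G (prod_decode k))"
    by (rule sums_unique[OF has_sum_imp_sums[OF has_sum_infsum[OF k]]])
  finally show ?thesis unfolding G_def by simp
qed

context inner_product_space
begin

definition pairing :: "('v \<Rightarrow> 'v) \<Rightarrow> (nat \<Rightarrow> 'v) \<Rightarrow> (nat \<Rightarrow> 'v) \<Rightarrow> complex" where
  "pairing T \<xi> \<eta> = (\<Sum>i. ip H (T (\<xi> i)) (\<eta> i))"

lemma vnorm_power2: "v \<in> vecs H \<Longrightarrow> (vnorm H v)\<^sup>2 = sq v"
  unfolding vnorm_eq by (rule real_sqrt_pow2[OF sq_nonneg])

lemma square_summableI:
  assumes \<xi>: "\<And>i. \<xi> i \<in> vecs H" and "summable (\<lambda>i. sq (\<xi> i))"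
  shows "square_summable H \<xi>"
  unfolding square_summable_def vnorm_power2[OF \<xi>] using assms by blast

lemma square_summableD:
  assumes "square_summable H \<xi>"
  shows "\<xi> i \<in> vecs H" "summable (\<lambda>i. sq (\<xi> i))"
proof -
  show \<xi>: "\<xi> i \<in> vecs H" for i using assms unfolding square_summable_def by blast
  show "summable (\<lambda>i. sq (\<xi> i))"
    using assms unfolding square_summable_def vnorm_power2[OF \<xi>] by blast
qed

lemma pairing_summable:
  assumes T: "T \<in> bounded_ops H" and \<xi>: "square_summable H \<xi>" and \<eta>: "square_summable H \<eta>"
  shows "summable (\<lambda>i. cmod (ip H (T (\<xi> i)) (\<eta> i)))"
proof -
  obtain C where C: "C \<ge> 0" "\<And>v. v \<in> vecs H \<Longrightarrow> sq (T v) \<le> C * sq v" by (rule bounded_ops_sq[OF T]) blast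
  note v = square_summableD(1)[OF \<xi>] square_summableD(1)[OF \<eta>]
  show ?thesis
  proof (rule summable_comparison_test')
    show "summable (\<lambda>i. C * sq (\<xi> i) + sq (\<eta> i))"
      by (intro summable_add summable_mult square_summableD(2) \<xi> \<eta>)
    fix i :: nat assume "i \<ge> 0"
    have "2 * cmod (ip H (T (\<xi> i)) (\<eta> i)) \<le> sq (T (\<xi> i)) + sq (\<eta> i)"
      by (rule ip_le_sq[OF bounded_opsD(2)[OF T v(1)] v(2)])
    then show "norm (cmod (ip H (T (\<xi> i)) (\<eta> i))) \<le> C * sq (\<xi> i) + sq (\<eta> i)"
      using C(2)[OF v(1)[of i]] norm_ge_zero[of "ip H (T (\<xi> i)) (\<eta> i)"]
      unfolding real_norm_def abs_norm_cancel by linarith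
  qed
qed

lemma sigma_weak_Basis:
  assumes "square_summable H \<xi>" "square_summable H \<eta>" "open U"
  shows "openin (sigma_weak_topology H) {T \<in> bounded_ops H. pairing T \<xi> \<eta> \<in> U}"
  unfolding sigma_weak_topology_def pairing_def
  by (rule topology_generated_by_Basis) (use assms in blast)

lemma square_summable_single: 
  assumes "v \<in> vecs H"
  shows "square_summable H (\<lambda>i. if i = 0 then v else vzero H)"
proof (rule square_summableI)
  show "(if i = 0 then v else vzero H) \<in> vecs H" for i :: nat using assms zero_closed by simp
  have "sq (vzero H) = 0" unfolding sq_def ip_zero_left[OF zero_closed] by simp
  then have "sq (if i = 0 then v else vzero H) = 0" if "i \<notin> {0}" for i :: nat using that by simp
  then show "summable (\<lambda>i :: nat. sq (if i = 0 then v else vzero H))"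
    by (rule summable_finite[of "{0}", OF finite.insertI[OF finite.emptyI]])
qed

lemma topspace_sigma_weak: "topspace (sigma_weak_topology H) = bounded_ops H"
proof
  show "topspace (sigma_weak_topology H) \<subseteq> bounded_ops H"
    unfolding sigma_weak_topology_def by auto
  note z = square_summable_single[OF zero_closed]
  show "bounded_ops H \<subseteq> topspace (sigma_weak_topology H)"
    using openin_subset[OF sigma_weak_Basis[OF z z open_UNIV]] by (simp only: UNIV_I simp_thms Collect_mem_eq)
qed

lemma continuous_into_sigma_weak:
  assumes "\<And>T. T \<in> topspace X \<Longrightarrow> f T \<in> bounded_ops H"
    and "\<And>\<xi> \<eta> U. square_summable H \<xi> \<Longrightarrow> square_summable H \<eta> \<Longrightarrow> open U \<Longrightarrow>
      openin X {T \<in> topspace X. pairing (f T) \<xi> \<eta> \<in> U}"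
  shows "continuous_map X (sigma_weak_topology H) f"
  unfolding sigma_weak_topology_def
proof (rule continuous_on_generated_topo)
  let ?B = "{{T \<in> bounded_ops H. (\<Sum>i. ip H (T (\<xi> i)) (\<eta> i)) \<in> U} | \<xi> \<eta> U. square_summable H \<xi> \<and> square_summable H \<eta> \<and> open U}"
  show "f ` topspace X \<subseteq> \<Union> ?B"
  proof -
    have "\<Union> ?B = bounded_ops H" using topspace_sigma_weak unfolding sigma_weak_topology_def topology_generated_by_topspace .
    then show ?thesis by (auto simp: assms(1))
  qed
  fix V assume "V \<in> ?B"
  then have "\<exists>\<xi> \<eta> U. V = {T \<in> bounded_ops H. pairing T \<xi> \<eta> \<in> U} \<and>
      square_summable H \<xi> \<and> square_summable H \<eta> \<and> open U"
    unfolding pairing_def by (rule CollectD)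
  then obtain \<xi> \<eta> U where V: "V = {T \<in> bounded_ops H. pairing T \<xi> \<eta> \<in> U}"
    "square_summable H \<xi>" "square_summable H \<eta>" "open U" by (elim exE conjE)
  have "f -` V \<inter> topspace X = {T \<in> topspace X. pairing (f T) \<xi> \<eta> \<in> U}"
    unfolding V(1) by (auto simp: assms(1))
  then show "openin X (f -` V \<inter> topspace X)" by (simp only: assms(2)[OF V(2-4)])
qed

lemma Hausdorff_sigma_weak: "Hausdorff_space (sigma_weak_topology H)"
  unfolding Hausdorff_space_def topspace_sigma_weak
proof (intro allI impI)
  fix S T assume ST: "S \<in> bounded_ops H \<and> T \<in> bounded_ops H \<and> S \<noteq> T"
  have "\<exists>v\<in>vecs H. S v \<noteq> T v"
  proof (rule ccontr)
    assume "\<not> (\<exists>v\<in>vecs H. S v \<noteq> T v)"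
    then have eq: "\<And>v. v \<in> vecs H \<Longrightarrow> S v = T v" by blast
    have "S = T"
      by (rule PiE_ext[OF bounded_opsD(1)[OF conjunct1[OF ST]] bounded_opsD(1)[OF conjunct1[OF conjunct2[OF ST]]] eq])
    then show False using ST by blast
  qed
  then obtain v where v: "v \<in> vecs H" "S v \<noteq> T v" by blast
  have "S v \<in> vecs H" "T v \<in> vecs H" using ST v bounded_opsD(2) by blast+
  then obtain w where w: "w \<in> vecs H" "ip H (S v) w \<noteq> ip H (T v) w" using vec_eqI v(2) by blast
  define \<xi> where "\<xi> = (\<lambda>i :: nat. if i = 0 then v else vzero H)"
  define \<eta> where "\<eta> = (\<lambda>i :: nat. if i = 0 then w else vzero H)"
  have ss: "square_summable H \<xi>" "square_summable H \<eta>"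
    unfolding \<xi>_def \<eta>_def by (rule square_summable_single[OF v(1)], rule square_summable_single[OF w(1)])
  have pair: "pairing R \<xi> \<eta> = ip H (R v) w" if R: "R \<in> bounded_ops H" for R
  proof -
    have z: "ip H (R (vzero H)) (vzero H) = 0"
      unfolding ip_commute[OF zero_closed bounded_opsD(2)[OF R zero_closed]] ip_zero_left[OF bounded_opsD(2)[OF R zero_closed]]
      by (rule complex_cnj_zero)
    have "(\<Sum>i. ip H (R (\<xi> i)) (\<eta> i)) = (\<Sum>i\<in>{0}. ip H (R (\<xi> i)) (\<eta> i))"
      by (rule suminf_finite) (simp_all add: \<xi>_def \<eta>_def z)
    then show ?thesis unfolding pairing_def by (simp add: \<xi>_def \<eta>_def)
  qed
  obtain U V where UV: "open U" "open V" "ip H (S v) w \<in> U" "ip H (T v) w \<in> V" "U \<inter> V = {}"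
    using hausdorff[OF w(2)] by blast
  show "\<exists>A B. openin (sigma_weak_topology H) A \<and> openin (sigma_weak_topology H) B \<and> S \<in> A \<and> T \<in> B \<and> disjnt A B"
  proof (intro exI conjI)
    show "openin (sigma_weak_topology H) {R \<in> bounded_ops H. pairing R \<xi> \<eta> \<in> U}" by (rule sigma_weak_Basis[OF ss UV(1)])
    show "openin (sigma_weak_topology H) {R \<in> bounded_ops H. pairing R \<xi> \<eta> \<in> V}" by (rule sigma_weak_Basis[OF ss UV(2)])
    show "S \<in> {R \<in> bounded_ops H. pairing R \<xi> \<eta> \<in> U}" "T \<in> {R \<in> bounded_ops H. pairing R \<xi> \<eta> \<in> V}"
      using ST UV(3,4) by (simp_all add: pair)
    show "disjnt {R \<in> bounded_ops H. pairing R \<xi> \<eta> \<in> U} {R \<in> bounded_ops H. pairing R \<xi> \<eta> \<in> V}"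
      using UV(5) unfolding disjnt_def by blast
  qed
qed

lemma pairing_add:
  assumes S: "S \<in> bounded_ops H" and T: "T \<in> bounded_ops H" and \<xi>: "square_summable H \<xi>" and \<eta>: "square_summable H \<eta>"
  shows "pairing (op_add H S T) \<xi> \<eta> = pairing S \<xi> \<eta> + pairing T \<xi> \<eta>"
proof -
  note v = square_summableD(1)[OF \<xi>] square_summableD(1)[OF \<eta>]
  have "ip H (op_add H S T (\<xi> i)) (\<eta> i) = ip H (S (\<xi> i)) (\<eta> i) + ip H (T (\<xi> i)) (\<eta> i)" for i
    using v by (simp add: op_add_def ip_add_left bounded_opsD(2)[OF S] bounded_opsD(2)[OF T])
  then show ?thesis
    unfolding pairing_def
    using suminf_add[OF summable_norm_cancel[OF pairing_summable[OF S \<xi> \<eta>]] summable_norm_cancel[OF pairing_summable[OF T \<xi> \<eta>]]]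
    by simp
qed

lemma pairing_scale:
  assumes T: "T \<in> bounded_ops H" and \<xi>: "square_summable H \<xi>" and \<eta>: "square_summable H \<eta>"
  shows "pairing (op_scale H \<beta> T) \<xi> \<eta> = \<beta> * pairing T \<xi> \<eta>"
proof -
  note v = square_summableD(1)[OF \<xi>] square_summableD(1)[OF \<eta>]
  have "ip H (op_scale H \<beta> T (\<xi> i)) (\<eta> i) = \<beta> * ip H (T (\<xi> i)) (\<eta> i)" for i
    using v by (simp add: op_scale_def ip_scale_left bounded_opsD(2)[OF T])
  then show ?thesis
    unfolding pairing_def using suminf_mult[OF summable_norm_cancel[OF pairing_summable[OF T \<xi> \<eta>]], of \<beta>] by simp
qed

lemma continuous_op_add:
  assumes S: "S \<in> bounded_ops H"
  shows "continuous_map (sigma_weak_topology H) (sigma_weak_topology H) (op_add H S)"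
proof (rule continuous_into_sigma_weak; unfold topspace_sigma_weak)
  show "op_add H S T \<in> bounded_ops H" if "T \<in> bounded_ops H" for T by (rule op_add_bounded[OF S that])
  fix \<xi> \<eta> and U :: "complex set" assume ss: "square_summable H \<xi>" "square_summable H \<eta>" and U: "open U"
  have "open ((\<lambda>z. pairing S \<xi> \<eta> + z) -` U)" using U by (intro open_vimage continuous_intros)
  moreover have "{T \<in> bounded_ops H. pairing (op_add H S T) \<xi> \<eta> \<in> U}
      = {T \<in> bounded_ops H. pairing T \<xi> \<eta> \<in> (\<lambda>z. pairing S \<xi> \<eta> + z) -` U}"
    using pairing_add[OF S _ ss] by auto
  ultimately show "openin (sigma_weak_topology H) {T \<in> bounded_ops H. pairing (op_add H S T) \<xi> \<eta> \<in> U}"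
    by (simp only: sigma_weak_Basis[OF ss])
qed

lemma continuous_op_scale:
  "continuous_map (sigma_weak_topology H) (sigma_weak_topology H) (op_scale H \<beta>)"
proof (rule continuous_into_sigma_weak; unfold topspace_sigma_weak)
  show "op_scale H \<beta> T \<in> bounded_ops H" if "T \<in> bounded_ops H" for T by (rule op_scale_bounded[OF that])
  fix \<xi> \<eta> and U :: "complex set" assume ss: "square_summable H \<xi>" "square_summable H \<eta>" and U: "open U"
  have "open ((\<lambda>z. \<beta> * z) -` U)" using U by (intro open_vimage continuous_intros)
  moreover have "{T \<in> bounded_ops H. pairing (op_scale H \<beta> T) \<xi> \<eta> \<in> U}
      = {T \<in> bounded_ops H. pairing T \<xi> \<eta> \<in> (\<lambda>z. \<beta> * z) -` U}"
    using pairing_scale[OF _ ss] by auto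
  ultimately show "openin (sigma_weak_topology H) {T \<in> bounded_ops H. pairing (op_scale H \<beta> T) \<xi> \<eta> \<in> U}"
    by (simp only: sigma_weak_Basis[OF ss])
qed

lemma op_add_commute:
  assumes "S \<in> bounded_ops H" "T \<in> bounded_ops H"
  shows "op_add H S T = op_add H T S"
  unfolding op_add_def
  by (rule restrict_ext) (rule add_commute[OF bounded_opsD(2)[OF assms(1)] bounded_opsD(2)[OF assms(2)]])

abbreviation weak_closure :: "('v \<Rightarrow> 'v) set \<Rightarrow> ('v \<Rightarrow> 'v) set" where
  "weak_closure \<S> \<equiv> (sigma_weak_topology H) closure_of (op_span H \<S>)"

lemma op_span_bounded: "\<S> \<subseteq> bounded_ops H \<Longrightarrow> op_span H \<S> \<subseteq> bounded_ops H"
proof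
  fix T assume "\<S> \<subseteq> bounded_ops H" "T \<in> op_span H \<S>"
  from this(2,1) show "T \<in> bounded_ops H"
    by induction (auto intro: op_add_bounded op_scale_bounded)
qed

lemma weak_closure_bounded: "weak_closure \<S> \<subseteq> bounded_ops H"
  using closure_of_subset_topspace[of "sigma_weak_topology H"] unfolding topspace_sigma_weak .

lemma op_span_weak_closure: "\<S> \<subseteq> bounded_ops H \<Longrightarrow> op_span H \<S> \<subseteq> weak_closure \<S>"
  by (rule closure_of_subset) (simp add: topspace_sigma_weak op_span_bounded)

lemma weak_closure_scale:
  assumes S: "\<S> \<subseteq> bounded_ops H" and T: "T \<in> weak_closure \<S>"
  shows "op_scale H \<beta> T \<in> weak_closure \<S>"
proof -
  have "op_scale H \<beta> T \<in> (sigma_weak_topology H) closure_of (op_scale H \<beta> ` op_span H \<S>)"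
    using continuous_map_image_closure_subset[OF continuous_op_scale, of \<beta> "op_span H \<S>"] T by blast
  also have "\<dots> \<subseteq> weak_closure \<S>"
    by (rule closure_of_mono) (auto intro: op_span.scale)
  finally show ?thesis .
qed

lemma weak_closure_add:
  assumes S: "\<S> \<subseteq> bounded_ops H" and A: "A \<in> weak_closure \<S>" and B: "B \<in> weak_closure \<S>"
  shows "op_add H A B \<in> weak_closure \<S>"
proof -
  have span: "op_add H C B \<in> weak_closure \<S>" if C: "C \<in> op_span H \<S>" "B \<in> weak_closure \<S>" for C B
  proof -
    have "C \<in> bounded_ops H" using op_span_bounded[OF S] C by blast
    then have "op_add H C B \<in> (sigma_weak_topology H) closure_of (op_add H C ` op_span H \<S>)"
      using continuous_map_image_closure_subset[OF continuous_op_add, of C "op_span H \<S>"] C(2) by blast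
    also have "\<dots> \<subseteq> weak_closure \<S>"
      by (rule closure_of_mono) (use C(1) in \<open>auto intro: op_span.add\<close>)
    finally show ?thesis .
  qed
  have Bb: "B \<in> bounded_ops H" and Ab: "A \<in> bounded_ops H" using weak_closure_bounded A B by blast+
  have sub: "op_add H B ` op_span H \<S> \<subseteq> weak_closure \<S>"
  proof
    fix R assume "R \<in> op_add H B ` op_span H \<S>"
    then obtain C where C: "R = op_add H B C" "C \<in> op_span H \<S>" by blast
    have "C \<in> bounded_ops H" using op_span_bounded[OF S] C(2) by blast
    then show "R \<in> weak_closure \<S>" unfolding C(1) using op_add_commute[OF Bb] span[OF C(2) B] by simp
  qed
  have "op_add H B A \<in> (sigma_weak_topology H) closure_of (op_add H B ` op_span H \<S>)"
    using continuous_map_image_closure_subset[OF continuous_op_add[OF Bb], of "op_span H \<S>"] A by blast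
  also have "\<dots> \<subseteq> (sigma_weak_topology H) closure_of (weak_closure \<S>)" by (rule closure_of_mono[OF sub])
  also have "\<dots> = weak_closure \<S>" by simp
  finally show ?thesis using op_add_commute[OF Ab Bb] by simp
qed

text \<open>Two such maps agree on the span, and hence on its closure, because the topology is Hausdorff.\<close>

lemma weak_closure_map_unique:
  assumes S: "\<S> \<subseteq> bounded_ops H"
    and M: "\<And>M. M \<in> {M1, M2} \<Longrightarrow> continuous_map (subtopology (sigma_weak_topology H) (weak_closure \<S>)) (sigma_weak_topology H) M"
    and add: "\<And>M A B. M \<in> {M1, M2} \<Longrightarrow> A \<in> weak_closure \<S> \<Longrightarrow> B \<in> weak_closure \<S> \<Longrightarrow> M (op_add H A B) = op_add H (M A) (M B)"
    and scale: "\<And>M A \<beta>. M \<in> {M1, M2} \<Longrightarrow> A \<in> weak_closure \<S> \<Longrightarrow> M (op_scale H \<beta> A) = op_scale H \<beta> (M A)"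
    and gen: "\<And>A. A \<in> \<S> \<Longrightarrow> M1 A = M2 A" and T: "T \<in> weak_closure \<S>"
  shows "M1 T = M2 T"
proof (rule forall_in_closure_of_eq[where f = M1 and g = M2 and S = "op_span H \<S>"
      and X = "subtopology (sigma_weak_topology H) (weak_closure \<S>)" and Y = "sigma_weak_topology H"])
  show "Hausdorff_space (sigma_weak_topology H)" by (rule Hausdorff_sigma_weak)
  show "continuous_map (subtopology (sigma_weak_topology H) (weak_closure \<S>)) (sigma_weak_topology H) M1"
    "continuous_map (subtopology (sigma_weak_topology H) (weak_closure \<S>)) (sigma_weak_topology H) M2"
    using M by blast+
  have "weak_closure \<S> \<inter> op_span H \<S> = op_span H \<S>" using op_span_weak_closure[OF S] by blast
  then show "T \<in> (subtopology (sigma_weak_topology H) (weak_closure \<S>)) closure_of (op_span H \<S>)"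
    unfolding closure_of_subtopology using T by simp
  fix A assume "A \<in> op_span H \<S>"
  then show "M1 A = M2 A"
  proof induction
    case (add A B)
    have "A \<in> weak_closure \<S>" "B \<in> weak_closure \<S>" using op_span_weak_closure[OF S] add.hyps by blast+
    then show ?case using assms(3)[of M1 A B] assms(3)[of M2 A B] add.IH by simp
  next
    case (scale A \<beta>)
    have "A \<in> weak_closure \<S>" using op_span_weak_closure[OF S] scale.hyps by blast
    then show ?case using assms(4)[of M1 A \<beta>] assms(4)[of M2 A \<beta>] scale.IH by simp
  qed (rule gen)
qed

end

text \<open>  Below, \<open>mf n\<close> and \<open>mq n\<close> are multiplications by the \<open>n\<close>-th coordinates of the two factors of
  \<open>\<phi> (- y + x)\<close>. The multiplier is the map that sends \<open>T\<close> to the sum over \<open>n\<close> of the operators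
  (adjoint of \<open>mq n\<close>) \<open>\<circ> T \<circ> mf n\<close>, the Kraus form of a completely bounded map; the condition \<open>assemble\<close> says
  that this sum converges weakly.\<close>

locale operator_multiplier = inner_product_space H for H :: "'v hspace" +
  fixes mf mq :: "nat \<Rightarrow> 'v \<Rightarrow> 'v" and A B :: real
  assumes mf_closed: "\<And>n v. v \<in> vecs H \<Longrightarrow> mf n v \<in> vecs H"
    and mf_add: "\<And>n u v. u \<in> vecs H \<Longrightarrow> v \<in> vecs H \<Longrightarrow> mf n (vadd H u v) = vadd H (mf n u) (mf n v)"
    and mf_scale: "\<And>n \<alpha> v. v \<in> vecs H \<Longrightarrow> mf n (vscale H \<alpha> v) = vscale H \<alpha> (mf n v)"
    and mf_bound: "\<And>N v. v \<in> vecs H \<Longrightarrow> (\<Sum>n<N. sq (mf n v)) \<le> A\<^sup>2 * sq v"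
    and mq_closed: "\<And>n v. v \<in> vecs H \<Longrightarrow> mq n v \<in> vecs H"
    and mq_bound: "\<And>N v. v \<in> vecs H \<Longrightarrow> (\<Sum>n<N. sq (mq n v)) \<le> B\<^sup>2 * sq v"
    and assemble: "\<And>g X. (\<And>n. g n \<in> vecs H) \<Longrightarrow> (\<And>N. (\<Sum>n<N. sq (g n)) \<le> X) \<Longrightarrow>
      \<exists>G\<in>vecs H. \<forall>w\<in>vecs H. (\<lambda>n. ip H (g n) (mq n w)) sums ip H G w"
    and A_nonneg: "A \<ge> 0" and B_nonneg: "B \<ge> 0"
begin

definition mult :: "('v \<Rightarrow> 'v) \<Rightarrow> 'v \<Rightarrow> 'v" where
  "mult T = (\<lambda>v\<in>vecs H. SOME G. G \<in> vecs H \<and> (\<forall>w\<in>vecs H. (\<lambda>n. ip H (T (mf n v)) (mq n w)) sums ip H G w))"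

lemma sum_sq_mf_le:
  assumes T: "\<And>v. v \<in> vecs H \<Longrightarrow> sq (T v) \<le> C * sq v" and C: "C \<ge> 0" and v: "v \<in> vecs H"
  shows "(\<Sum>n<N. sq (T (mf n v))) \<le> C * (A\<^sup>2 * sq v)"
proof -
  have "(\<Sum>n<N. sq (T (mf n v))) \<le> C * (\<Sum>n<N. sq (mf n v))"
    unfolding sum_distrib_left by (intro sum_mono T mf_closed v)
  also have "\<dots> \<le> C * (A\<^sup>2 * sq v)" by (rule mult_left_mono[OF mf_bound[OF v] C])
  finally show ?thesis .
qed

lemma
  assumes T: "T \<in> bounded_ops H" and v: "v \<in> vecs H"
  shows mult_closed: "mult T v \<in> vecs H"
    and mult_sums: "w \<in> vecs H \<Longrightarrow> (\<lambda>n. ip H (T (mf n v)) (mq n w)) sums ip H (mult T v) w"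
proof -
  obtain C where C: "C \<ge> 0" "\<And>v. v \<in> vecs H \<Longrightarrow> sq (T v) \<le> C * sq v" by (rule bounded_ops_sq[OF T]) blast
  have "\<exists>G\<in>vecs H. \<forall>w\<in>vecs H. (\<lambda>n. ip H (T (mf n v)) (mq n w)) sums ip H G w"
    by (rule assemble[where X = "C * (A\<^sup>2 * sq v)"])
      (rule bounded_opsD(2)[OF T mf_closed[OF v]], rule sum_sq_mf_le[OF C(2) C(1) v])
  then have "\<exists>G. G \<in> vecs H \<and> (\<forall>w\<in>vecs H. (\<lambda>n. ip H (T (mf n v)) (mq n w)) sums ip H G w)" by blast
  from someI_ex[OF this] show "mult T v \<in> vecs H"
    "w \<in> vecs H \<Longrightarrow> (\<lambda>n. ip H (T (mf n v)) (mq n w)) sums ip H (mult T v) w"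
    unfolding mult_def using v by simp_all
qed

lemma mult_unique:
  assumes T: "T \<in> bounded_ops H" and v: "v \<in> vecs H" and G: "G \<in> vecs H"
    and "\<And>w. w \<in> vecs H \<Longrightarrow> (\<lambda>n. ip H (T (mf n v)) (mq n w)) sums ip H G w"
  shows "mult T v = G"
  by (rule vec_eqI[OF mult_closed[OF T v] G]) (rule sums_unique2[OF mult_sums[OF T v] assms(4)])

lemma mult_bounded:
  assumes T: "T \<in> bounded_ops H"
  shows "mult T \<in> bounded_ops H"
proof -
  obtain C where C: "C \<ge> 0" "\<And>v. v \<in> vecs H \<Longrightarrow> sq (T v) \<le> C * sq v" by (rule bounded_ops_sq[OF T]) blast
  note Tc = bounded_opsD(2)[OF T]
  show ?thesis
  proof (rule bounded_opsI[where C = "B\<^sup>2 * (C * A\<^sup>2)"])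
    show "mult T \<in> extensional (vecs H)" unfolding mult_def by simp
    show "mult T v \<in> vecs H" if "v \<in> vecs H" for v by (rule mult_closed[OF T that])
    show "mult T (vadd H u v) = vadd H (mult T u) (mult T v)" if u: "u \<in> vecs H" and v: "v \<in> vecs H" for u v
    proof (rule mult_unique[OF T add_closed[OF u v] add_closed[OF mult_closed[OF T u] mult_closed[OF T v]]])
      fix w assume w: "w \<in> vecs H"
      show "(\<lambda>n. ip H (T (mf n (vadd H u v))) (mq n w)) sums ip H (vadd H (mult T u) (mult T v)) w"
        using sums_add[OF mult_sums[OF T u w] mult_sums[OF T v w]] u v w
        by (simp add: mf_add mf_closed mq_closed Tc bounded_opsD(3)[OF T] ip_add_left mult_closed[OF T])
    qed
    show "mult T (vscale H \<alpha> v) = vscale H \<alpha> (mult T v)" if v: "v \<in> vecs H" for \<alpha> v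
    proof (rule mult_unique[OF T scale_closed[OF v] scale_closed[OF mult_closed[OF T v]]])
      fix w assume w: "w \<in> vecs H"
      show "(\<lambda>n. ip H (T (mf n (vscale H \<alpha> v))) (mq n w)) sums ip H (vscale H \<alpha> (mult T v)) w"
        using sums_mult[OF mult_sums[OF T v w], of \<alpha>] v w
        by (simp add: mf_scale mf_closed mq_closed Tc bounded_opsD(4)[OF T] ip_scale_left mult_closed[OF T])
    qed
    show "sq (mult T v) \<le> B\<^sup>2 * (C * A\<^sup>2) * sq v" if v: "v \<in> vecs H" for v
    proof -
      have "sq (mult T v) \<le> B\<^sup>2 * (C * (A\<^sup>2 * sq v))"
        by (rule series_bound[OF mult_closed[OF T v] Tc[OF mf_closed[OF v]] mq_closed[OF mult_closed[OF T v]]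
              mult_sums[OF T v mult_closed[OF T v]] sum_sq_mf_le[OF C(2) C(1) v] mq_bound[OF mult_closed[OF T v]]]) (assumption | rule zero_le_power2)+
      then show ?thesis by (simp add: mult.assoc)
    qed
  qed
qed

lemma mult_op_add:
  assumes S: "S \<in> bounded_ops H" and T: "T \<in> bounded_ops H"
  shows "mult (op_add H S T) = op_add H (mult S) (mult T)"
proof (rule PiE_ext[OF bounded_opsD(1)[OF mult_bounded[OF op_add_bounded[OF S T]]]
      bounded_opsD(1)[OF op_add_bounded[OF mult_bounded[OF S] mult_bounded[OF T]]]])
  fix v assume v: "v \<in> vecs H"
  have "mult (op_add H S T) v = vadd H (mult S v) (mult T v)"
  proof (rule mult_unique[OF op_add_bounded[OF S T] v add_closed[OF mult_closed[OF S v] mult_closed[OF T v]]])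
    fix w assume w: "w \<in> vecs H"
    show "(\<lambda>n. ip H (op_add H S T (mf n v)) (mq n w)) sums ip H (vadd H (mult S v) (mult T v)) w"
      using sums_add[OF mult_sums[OF S v w] mult_sums[OF T v w]] v w
      by (simp add: op_add_def mf_closed mq_closed ip_add_left bounded_opsD(2)[OF S] bounded_opsD(2)[OF T] mult_closed[OF S] mult_closed[OF T])
  qed
  then show "mult (op_add H S T) v = op_add H (mult S) (mult T) v" using v by (simp add: op_add_def)
qed

lemma mult_op_scale:
  assumes T: "T \<in> bounded_ops H"
  shows "mult (op_scale H \<beta> T) = op_scale H \<beta> (mult T)"
proof (rule PiE_ext[OF bounded_opsD(1)[OF mult_bounded[OF op_scale_bounded[OF T]]]
      bounded_opsD(1)[OF op_scale_bounded[OF mult_bounded[OF T]]]])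
  fix v assume v: "v \<in> vecs H"
  have "mult (op_scale H \<beta> T) v = vscale H \<beta> (mult T v)"
  proof (rule mult_unique[OF op_scale_bounded[OF T] v scale_closed[OF mult_closed[OF T v]]])
    fix w assume w: "w \<in> vecs H"
    show "(\<lambda>n. ip H (op_scale H \<beta> T (mf n v)) (mq n w)) sums ip H (vscale H \<beta> (mult T v)) w"
      using sums_mult[OF mult_sums[OF T v w], of \<beta>] v w
      by (simp add: op_scale_def mf_closed mq_closed ip_scale_left bounded_opsD(2)[OF T] mult_closed[OF T])
  qed
  then show "mult (op_scale H \<beta> T) v = op_scale H \<beta> (mult T) v" using v by (simp add: op_scale_def)
qed

lemma square_summable_double:
  assumes \<xi>: "square_summable H \<xi>" and closed: "\<And>n v. v \<in> vecs H \<Longrightarrow> m n v \<in> vecs H"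
    and bound: "\<And>N v. v \<in> vecs H \<Longrightarrow> (\<Sum>n<N. sq (m n v)) \<le> b * sq v" and b: "b \<ge> 0"
  shows "square_summable H (\<lambda>k. case prod_decode k of (i, n) \<Rightarrow> m n (\<xi> i))"
proof (rule square_summableI)
  note v = square_summableD(1)[OF \<xi>]
  show "(case prod_decode k of (i, n) \<Rightarrow> m n (\<xi> i)) \<in> vecs H" for k
    by (cases "prod_decode k") (simp add: closed v)
  have nn: "0 \<le> sq (case p of (i, n) \<Rightarrow> m n (\<xi> i))" for p by (cases p) (simp add: sq_nonneg closed v)
  show "summable (\<lambda>k. sq (case prod_decode k of (i, n) \<Rightarrow> m n (\<xi> i)))"
  proof (rule summableI_nonneg_bounded)
    show "0 \<le> sq (case prod_decode k of (i, n) \<Rightarrow> m n (\<xi> i))" for k by (rule nn)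
    fix K
    define N where "N = Suc (Max (insert 0 (fst ` prod_decode ` {..<K} \<union> snd ` prod_decode ` {..<K})))"
    have sub: "prod_decode ` {..<K} \<subseteq> {..<N} \<times> {..<N}"
    proof
      fix p assume p: "p \<in> prod_decode ` {..<K}"
      have "fst p \<le> Max (insert 0 (fst ` prod_decode ` {..<K} \<union> snd ` prod_decode ` {..<K}))"
        "snd p \<le> Max (insert 0 (fst ` prod_decode ` {..<K} \<union> snd ` prod_decode ` {..<K}))"
        using p by (auto intro!: Max_ge)
      then show "p \<in> {..<N} \<times> {..<N}" unfolding N_def by (cases p) simp
    qed
    have "(\<Sum>k<K. sq (case prod_decode k of (i, n) \<Rightarrow> m n (\<xi> i))) = (\<Sum>p\<in>prod_decode ` {..<K}. sq (case p of (i, n) \<Rightarrow> m n (\<xi> i)))"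
      by (subst sum.reindex) (auto intro: inj_on_subset[OF inj_prod_decode])
    also have "\<dots> \<le> (\<Sum>p\<in>{..<N} \<times> {..<N}. sq (case p of (i, n) \<Rightarrow> m n (\<xi> i)))"
      by (rule sum_mono2[OF _ sub]) (simp_all only: finite_cartesian_product finite_lessThan nn)
    also have "\<dots> = (\<Sum>i<N. \<Sum>n<N. sq (m n (\<xi> i)))" unfolding sum.cartesian_product by (rule sum.cong) auto
    also have "\<dots> \<le> (\<Sum>i<N. b * sq (\<xi> i))" by (intro sum_mono bound v)
    also have "\<dots> \<le> b * (\<Sum>i. sq (\<xi> i))"
      unfolding sum_distrib_left[symmetric]
      by (intro mult_left_mono sum_le_suminf square_summableD(2)[OF \<xi>] b) (auto simp: sq_nonneg v)
    finally show "(\<Sum>k<K. sq (case prod_decode k of (i, n) \<Rightarrow> m n (\<xi> i))) \<le> b * (\<Sum>i. sq (\<xi> i))" .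
  qed
qed

text \<open>A pairing of \<open>mult T\<close> with two square summable sequences is a pairing of \<open>T\<close> with two doubly indexed
  families, which are again square summable.\<close>

lemma mult_continuous: "continuous_map (sigma_weak_topology H) (sigma_weak_topology H) mult"
proof (rule continuous_into_sigma_weak; unfold topspace_sigma_weak)
  show "mult T \<in> bounded_ops H" if "T \<in> bounded_ops H" for T by (rule mult_bounded[OF that])
  fix \<xi> \<eta> and U :: "complex set" assume ss: "square_summable H \<xi>" "square_summable H \<eta>" and U: "open U"
  define \<xi>' where "\<xi>' = (\<lambda>k. case prod_decode k of (i, n) \<Rightarrow> mf n (\<xi> i))"
  define \<eta>' where "\<eta>' = (\<lambda>k. case prod_decode k of (i, n) \<Rightarrow> mq n (\<eta> i))"
  have ss': "square_summable H \<xi>'" "square_summable H \<eta>'"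
    unfolding \<xi>'_def \<eta>'_def
    by (rule square_summable_double[OF ss(1) mf_closed mf_bound], simp_all)
      (rule square_summable_double[OF ss(2) mq_closed mq_bound], simp_all)
  have "pairing (mult T) \<xi> \<eta> = pairing T \<xi>' \<eta>'" if T: "T \<in> bounded_ops H" for T
  proof -
    have eq: "ip H (T (\<xi>' k)) (\<eta>' k) = (case prod_decode k of (i, n) \<Rightarrow> ip H (T (mf n (\<xi> i))) (mq n (\<eta> i)))" for k
      unfolding \<xi>'_def \<eta>'_def by (cases "prod_decode k") simp
    have "(\<Sum>k. case prod_decode k of (i, n) \<Rightarrow> ip H (T (mf n (\<xi> i))) (mq n (\<eta> i))) = (\<Sum>i. ip H (mult T (\<xi> i)) (\<eta> i))"
      by (rule double_series) (use pairing_summable[OF T ss'] mult_sums[OF T square_summableD(1)[OF ss(1)] square_summableD(1)[OF ss(2)]] in \<open>simp_all add: eq\<close>)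
    then show ?thesis unfolding pairing_def eq by simp
  qed
  then have "{T \<in> bounded_ops H. pairing (mult T) \<xi> \<eta> \<in> U} = {T \<in> bounded_ops H. pairing T \<xi>' \<eta>' \<in> U}" by auto
  then show "openin (sigma_weak_topology H) {T \<in> bounded_ops H. pairing (mult T) \<xi> \<eta> \<in> U}"
    using sigma_weak_Basis[OF ss' U] by simp
qed

end

section \<open>Complete boundedness\<close>

lemma power_space_simps:
  "vecs (power_space n H) = {..<n} \<rightarrow>\<^sub>E vecs H"
  "vadd (power_space n H) u v = (\<lambda>i\<in>{..<n}. vadd H (u i) (v i))"
  "vscale (power_space n H) \<alpha> v = (\<lambda>i\<in>{..<n}. vscale H \<alpha> (v i))"
  "ip (power_space n H) u v = (\<Sum>i<n. ip H (u i) (v i))"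
  by (simp_all add: power_space_def)

lemma vsum_cong: "(\<And>j. j < n \<Longrightarrow> u j = v j) \<Longrightarrow> vsum H u n = vsum H v n"
  by (induction n) simp_all

context inner_product_space
begin

lemma power_mem: "v \<in> vecs (power_space n H) \<Longrightarrow> i < n \<Longrightarrow> v i \<in> vecs H"
  using PiE_mem[of v "{..<n}" "\<lambda>_. vecs H" i] by (simp add: power_space_simps)

lemma sq_power: "inner_product_space.sq (power_space n H) v = (\<Sum>i<n. sq (v i))"
  unfolding inner_product_space.sq_def[OF inner_product_space_power[OF inner_product_space_axioms]] sq_def power_space_simps
  by simp

lemma sq_vsum_le:
  assumes "\<And>j. j < n \<Longrightarrow> v j \<in> vecs H"
  shows "sq (vsum H v n) \<le> 2 ^ n * (\<Sum>j<n. sq (v j))"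
  using assms
proof (induction n)
  case 0
  show ?case by (simp add: sq_def ip_zero_left[OF zero_closed])
next
  case (Suc n)
  have v: "v j \<in> vecs H" if "j < Suc n" for j using Suc.prems[OF that] .
  have vs: "vsum H v n \<in> vecs H" by (rule vsum_closed) (simp add: v)
  have "sq (vsum H v (Suc n)) \<le> 2 * sq (vsum H v n) + 2 * sq (v n)"
    using sq_add_le[OF vs v[of n]] by simp
  also have "\<dots> \<le> 2 * (2 ^ n * (\<Sum>j<n. sq (v j))) + 2 ^ Suc n * sq (v n)"
  proof (rule add_mono)
    show "2 * sq (vsum H v n) \<le> 2 * (2 ^ n * (\<Sum>j<n. sq (v j)))" using Suc.IH v by simp
    have "(2 :: real) \<le> 2 ^ Suc n" by simp
    then show "2 * sq (v n) \<le> 2 ^ Suc n * sq (v n)" by (rule mult_right_mono) (simp add: sq_nonneg v)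
  qed
  finally show ?case by (simp add: distrib_left)
qed

lemma matrix_op_apply:
  "v \<in> vecs (power_space n H) \<Longrightarrow> i < n \<Longrightarrow> matrix_op H n T v i = vsum H (\<lambda>j. T i j (v j)) n"
  unfolding matrix_op_def by simp

lemma matrix_op_mem:
  assumes T: "\<And>i j. i < n \<Longrightarrow> j < n \<Longrightarrow> T i j \<in> bounded_ops H" and v: "v \<in> vecs (power_space n H)"
  shows "matrix_op H n T v \<in> vecs (power_space n H)"
proof -
  have "vsum H (\<lambda>j. T i j (v j)) n \<in> vecs H" if "i < n" for i
    by (rule vsum_closed) (rule bounded_opsD(2)[OF T[OF that] power_mem[OF v]])
  then show ?thesis unfolding matrix_op_def using v by (simp add: power_space_simps)
qed

lemma matrix_op_bounded:
  assumes T: "\<And>i j. i < n \<Longrightarrow> j < n \<Longrightarrow> T i j \<in> bounded_ops H"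
  shows "matrix_op H n T \<in> bounded_ops (power_space n H)"
proof -
  interpret K: inner_product_space "power_space n H" by (rule inner_product_space_power[OF inner_product_space_axioms])
  have "\<exists>C. C \<ge> 0 \<and> (\<forall>v\<in>vecs H. sq (T i j v) \<le> C * sq v)" if "i < n" "j < n" for i j
    by (rule bounded_ops_sq[OF T[OF that]]) blast
  then have "\<forall>i j. \<exists>C. i < n \<longrightarrow> j < n \<longrightarrow> C \<ge> 0 \<and> (\<forall>v\<in>vecs H. sq (T i j v) \<le> C * sq v)" by blast
  then obtain c where c: "\<And>i j. i < n \<Longrightarrow> j < n \<Longrightarrow> c i j \<ge> 0"
    "\<And>i j v. i < n \<Longrightarrow> j < n \<Longrightarrow> v \<in> vecs H \<Longrightarrow> sq (T i j v) \<le> c i j * sq v" by metis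
  define C where "C = (\<Sum>i<n. \<Sum>j<n. c i j)"
  have cC: "c i j \<le> C" if "i < n" "j < n" for i j
  proof -
    have "c i j \<le> (\<Sum>j<n. c i j)" by (rule member_le_sum) (use that c(1) in auto)
    also have "\<dots> \<le> C" unfolding C_def by (rule member_le_sum) (use that c(1) in \<open>auto intro: sum_nonneg\<close>)
    finally show ?thesis .
  qed
  have Tc: "T i j u \<in> vecs H" if "i < n" "j < n" "u \<in> vecs H" for i j u
    by (rule bounded_opsD(2)[OF T[OF that(1,2)] that(3)])
  show ?thesis
  proof (rule K.bounded_opsI[where C = "n * (2 ^ n * C)"])
    show "matrix_op H n T \<in> extensional (vecs (power_space n H))" unfolding matrix_op_def by simp
    show "matrix_op H n T v \<in> vecs (power_space n H)" if "v \<in> vecs (power_space n H)" for v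
      by (rule matrix_op_mem[OF T that])
    show "matrix_op H n T (vadd (power_space n H) u v) = vadd (power_space n H) (matrix_op H n T u) (matrix_op H n T v)"
      if u: "u \<in> vecs (power_space n H)" and v: "v \<in> vecs (power_space n H)" for u v
    proof (rule PiE_ext[where k = "{..<n}" and s = "\<lambda>_. vecs H"])
      show "matrix_op H n T (vadd (power_space n H) u v) \<in> {..<n} \<rightarrow>\<^sub>E vecs H"
        using matrix_op_mem[OF T K.add_closed[OF u v]] unfolding power_space_simps .
      show "vadd (power_space n H) (matrix_op H n T u) (matrix_op H n T v) \<in> {..<n} \<rightarrow>\<^sub>E vecs H"
        using K.add_closed[OF matrix_op_mem[OF T u] matrix_op_mem[OF T v]] unfolding power_space_simps .
      fix i assume "i \<in> {..<n}"
      then have i: "i < n" by simp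
      note um = power_mem[OF u] and vm = power_mem[OF v]
      have "vsum H (\<lambda>j. T i j (vadd H (u j) (v j))) n = vadd H (vsum H (\<lambda>j. T i j (u j)) n) (vsum H (\<lambda>j. T i j (v j)) n)"
      proof (rule vec_eqI)
        fix w assume w: "w \<in> vecs H"
        show "ip H (vsum H (\<lambda>j. T i j (vadd H (u j) (v j))) n) w = ip H (vadd H (vsum H (\<lambda>j. T i j (u j)) n) (vsum H (\<lambda>j. T i j (v j)) n)) w"
          using i w um vm by (simp add: ip_vsum_left ip_add_left vsum_closed Tc add_closed bounded_opsD(3)[OF T] sum.distrib)
      qed (use i um vm in \<open>simp_all add: vsum_closed Tc add_closed\<close>)
      then have "vsum H (\<lambda>j. T i j (vadd (power_space n H) u v j)) n = vadd H (vsum H (\<lambda>j. T i j (u j)) n) (vsum H (\<lambda>j. T i j (v j)) n)"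
        by (simp add: power_space_simps cong: vsum_cong)
      then have L: "matrix_op H n T (vadd (power_space n H) u v) i = vadd H (vsum H (\<lambda>j. T i j (u j)) n) (vsum H (\<lambda>j. T i j (v j)) n)"
        unfolding matrix_op_apply[OF K.add_closed[OF u v] i] .
      have R: "vadd (power_space n H) (matrix_op H n T u) (matrix_op H n T v) i = vadd H (vsum H (\<lambda>j. T i j (u j)) n) (vsum H (\<lambda>j. T i j (v j)) n)"
        unfolding power_space_simps using i by (simp add: matrix_op_apply[OF u i] matrix_op_apply[OF v i])
      show "matrix_op H n T (vadd (power_space n H) u v) i = vadd (power_space n H) (matrix_op H n T u) (matrix_op H n T v) i"
        unfolding L R ..
    qed
    show "matrix_op H n T (vscale (power_space n H) \<alpha> v) = vscale (power_space n H) \<alpha> (matrix_op H n T v)"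
      if v: "v \<in> vecs (power_space n H)" for \<alpha> v
    proof (rule PiE_ext[where k = "{..<n}" and s = "\<lambda>_. vecs H"])
      show "matrix_op H n T (vscale (power_space n H) \<alpha> v) \<in> {..<n} \<rightarrow>\<^sub>E vecs H"
        using matrix_op_mem[OF T K.scale_closed[OF v]] unfolding power_space_simps .
      show "vscale (power_space n H) \<alpha> (matrix_op H n T v) \<in> {..<n} \<rightarrow>\<^sub>E vecs H"
        using K.scale_closed[OF matrix_op_mem[OF T v]] unfolding power_space_simps .
      fix i assume "i \<in> {..<n}"
      then have i: "i < n" by simp
      note vm = power_mem[OF v]
      have "vsum H (\<lambda>j. T i j (vscale H \<alpha> (v j))) n = vscale H \<alpha> (vsum H (\<lambda>j. T i j (v j)) n)"
      proof (rule vec_eqI)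
        fix w assume w: "w \<in> vecs H"
        show "ip H (vsum H (\<lambda>j. T i j (vscale H \<alpha> (v j))) n) w = ip H (vscale H \<alpha> (vsum H (\<lambda>j. T i j (v j)) n)) w"
          using i w vm by (simp add: ip_vsum_left ip_scale_left vsum_closed Tc scale_closed bounded_opsD(4)[OF T] sum_distrib_left)
      qed (use i vm in \<open>simp_all add: vsum_closed Tc scale_closed\<close>)
      then have "vsum H (\<lambda>j. T i j (vscale (power_space n H) \<alpha> v j)) n = vscale H \<alpha> (vsum H (\<lambda>j. T i j (v j)) n)"
        by (simp add: power_space_simps cong: vsum_cong)
      then have L: "matrix_op H n T (vscale (power_space n H) \<alpha> v) i = vscale H \<alpha> (vsum H (\<lambda>j. T i j (v j)) n)"
        unfolding matrix_op_apply[OF K.scale_closed[OF v] i] .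
      have R: "vscale (power_space n H) \<alpha> (matrix_op H n T v) i = vscale H \<alpha> (vsum H (\<lambda>j. T i j (v j)) n)"
        unfolding power_space_simps using i by (simp add: matrix_op_apply[OF v i])
      show "matrix_op H n T (vscale (power_space n H) \<alpha> v) i = vscale (power_space n H) \<alpha> (matrix_op H n T v) i"
        unfolding L R ..
    qed
    show "K.sq (matrix_op H n T v) \<le> n * (2 ^ n * C) * K.sq v" if v: "v \<in> vecs (power_space n H)" for v
    proof -
      note vm = power_mem[OF v]
      have row: "sq (matrix_op H n T v i) \<le> 2 ^ n * (C * (\<Sum>j<n. sq (v j)))" if i: "i < n" for i
      proof -
        have "sq (matrix_op H n T v i) \<le> 2 ^ n * (\<Sum>j<n. sq (T i j (v j)))"
          unfolding matrix_op_apply[OF v i] by (rule sq_vsum_le) (rule Tc[OF i _ vm])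
        also have "\<dots> \<le> 2 ^ n * (\<Sum>j<n. C * sq (v j))"
        proof (intro mult_left_mono sum_mono)
          fix j assume "j \<in> {..<n}"
          then have j: "j < n" by simp
          show "sq (T i j (v j)) \<le> C * sq (v j)"
            using c(2)[OF i j vm[OF j]] mult_right_mono[OF cC[OF i j] sq_nonneg[OF vm[OF j]]] by linarith
        qed simp
        finally show ?thesis by (simp add: sum_distrib_left)
      qed
      have "(\<Sum>i<n. sq (matrix_op H n T v i)) \<le> (\<Sum>i<n. 2 ^ n * (C * (\<Sum>j<n. sq (v j))))"
        by (rule sum_mono) (simp add: row)
      then show ?thesis unfolding sq_power by (simp add: mult_ac)
    qed
  qed
qed

end

context operator_multiplier
begin

text \<open>The defining series of the multiplier also holds for matrices, with the multiplications acting on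
  every entry, so the bound of a single operator holds with the same constant for all matrices.\<close>

lemma mult_matrix_norm_le:
  assumes T: "\<And>i j. i < n \<Longrightarrow> j < n \<Longrightarrow> T i j \<in> bounded_ops H" and norm: "matrix_norm H n T \<le> 1"
  shows "matrix_norm H n (\<lambda>i j. mult (T i j)) \<le> A * B"
proof -
  interpret K: inner_product_space "power_space n H" by (rule inner_product_space_power[OF inner_product_space_axioms])
  have mT: "mult (T i j) \<in> bounded_ops H" if "i < n" "j < n" for i j by (rule mult_bounded[OF T[OF that]])
  have contr: "K.sq (matrix_op H n T v) \<le> 1 * K.sq v" if v: "v \<in> vecs (power_space n H)" for v
  proof -
    have "vnorm (power_space n H) (matrix_op H n T v) \<le> op_norm (power_space n H) (matrix_op H n T) * vnorm (power_space n H) v"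
      by (rule K.op_norm_bound[OF matrix_op_bounded[OF T] v])
    also have "\<dots> \<le> 1 * vnorm (power_space n H) v"
      using norm unfolding matrix_norm_def by (rule mult_right_mono) (simp add: K.vnorm_eq K.sq_nonneg[OF v])
    finally show ?thesis unfolding K.vnorm_eq by simp
  qed
  show ?thesis
    unfolding matrix_norm_def
  proof (rule K.op_norm_le)
    show "0 \<le> A * B" using A_nonneg B_nonneg by simp
    fix v assume v: "v \<in> vecs (power_space n H)"
    define R where "R = matrix_op H n (\<lambda>i j. mult (T i j)) v"
    have R: "R \<in> vecs (power_space n H)" unfolding R_def by (rule matrix_op_mem[OF mT v])
    note vm = power_mem[OF v] and Rm = power_mem[OF R]
    define f where "f = (\<lambda>k. \<lambda>i\<in>{..<n}. mf k (v i))"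
    define q where "q = (\<lambda>k. \<lambda>i\<in>{..<n}. mq k (R i))"
    have f: "f k \<in> vecs (power_space n H)" and q: "q k \<in> vecs (power_space n H)" for k
      unfolding f_def q_def power_space_simps by (auto simp: mf_closed mq_closed vm Rm)
    have "(\<lambda>k. \<Sum>i<n. \<Sum>j<n. ip H (T i j (mf k (v j))) (mq k (R i))) sums (\<Sum>i<n. \<Sum>j<n. ip H (mult (T i j) (v j)) (R i))"
      by (intro sums_sum mult_sums T vm Rm) simp_all
    moreover have "(\<Sum>i<n. \<Sum>j<n. ip H (T i j (mf k (v j))) (mq k (R i))) = ip (power_space n H) (matrix_op H n T (f k)) (q k)" for k
      unfolding power_space_simps
    proof (rule sum.cong[OF refl])
      fix i assume "i \<in> {..<n}"
      then have i: "i < n" by simp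
      have "ip H (matrix_op H n T (f k) i) (q k i) = ip H (vsum H (\<lambda>j. T i j (f k j)) n) (mq k (R i))"
        unfolding matrix_op_apply[OF f i] using i by (simp add: q_def)
      also have "\<dots> = (\<Sum>j<n. ip H (T i j (f k j)) (mq k (R i)))"
        by (rule ip_vsum_left[OF bounded_opsD(2)[OF T[OF i] power_mem[OF f]] mq_closed[OF Rm[OF i]]])
      finally show "(\<Sum>j<n. ip H (T i j (mf k (v j))) (mq k (R i))) = ip H (matrix_op H n T (f k) i) (q k i)"
        by (simp add: f_def)
    qed
    moreover have "(\<Sum>i<n. \<Sum>j<n. ip H (mult (T i j) (v j)) (R i)) = ip (power_space n H) R R"
      unfolding power_space_simps
    proof (rule sum.cong[OF refl])
      fix i assume "i \<in> {..<n}"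
      then have i: "i < n" by simp
      have "R i = vsum H (\<lambda>j. mult (T i j) (v j)) n" unfolding R_def by (rule matrix_op_apply[OF v i])
      then have "ip H (R i) (R i) = ip H (vsum H (\<lambda>j. mult (T i j) (v j)) n) (R i)" by simp
      also have "\<dots> = (\<Sum>j<n. ip H (mult (T i j) (v j)) (R i))"
        by (rule ip_vsum_left[OF bounded_opsD(2)[OF mT[OF i] vm] Rm[OF i]])
      finally show "(\<Sum>j<n. ip H (mult (T i j) (v j)) (R i)) = ip H (R i) (R i)" by simp
    qed
    ultimately have eq: "(\<lambda>k. ip (power_space n H) (matrix_op H n T (f k)) (q k)) sums ip (power_space n H) R R" by simp
    have "K.sq R \<le> B\<^sup>2 * (A\<^sup>2 * K.sq v)"
    proof (rule K.series_bound[OF R matrix_op_mem[OF T f] q eq])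
      fix N
      have "(\<Sum>k<N. K.sq (matrix_op H n T (f k))) \<le> (\<Sum>k<N. K.sq (f k))"
        by (rule sum_mono) (use contr[OF f] in simp)
      also have "\<dots> = (\<Sum>i<n. \<Sum>k<N. sq (mf k (v i)))"
        unfolding sq_power f_def by (subst sum.swap) simp
      also have "\<dots> \<le> (\<Sum>i<n. A\<^sup>2 * sq (v i))" by (rule sum_mono) (simp add: mf_bound vm)
      finally show "(\<Sum>k<N. K.sq (matrix_op H n T (f k))) \<le> A\<^sup>2 * K.sq v" unfolding sq_power by (simp add: sum_distrib_left)
      have "(\<Sum>k<N. K.sq (q k)) = (\<Sum>i<n. \<Sum>k<N. sq (mq k (R i)))"
        unfolding sq_power q_def by (subst sum.swap) simp
      also have "\<dots> \<le> (\<Sum>i<n. B\<^sup>2 * sq (R i))" by (rule sum_mono) (simp add: mq_bound Rm)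
      finally show "(\<Sum>k<N. K.sq (q k)) \<le> B\<^sup>2 * K.sq R" unfolding sq_power by (simp add: sum_distrib_left)
    qed ((assumption | rule zero_le_power2)+)
    then have "K.sq R \<le> (A * B)\<^sup>2 * K.sq v" by (simp add: power_mult_distrib mult_ac)
    then have "sqrt (K.sq R) \<le> sqrt ((A * B)\<^sup>2 * K.sq v)" by (rule real_sqrt_le_mono)
    then show "vnorm (power_space n H) (matrix_op H n (\<lambda>i j. mult (T i j)) v) \<le> A * B * vnorm (power_space n H) v"
      unfolding K.vnorm_eq R_def using A_nonneg B_nonneg by (simp add: real_sqrt_mult)
  qed
qed

end

section \<open>Square integrable functions\<close>

lemma l2_funD:
  assumes "f \<in> l2_fun \<mu>"
  shows "f \<in> borel_measurable \<mu>" "integrable \<mu> (\<lambda>x. (cmod (f x))\<^sup>2)"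
  using assms unfolding l2_fun_def by simp_all

lemma l2_fun_zero: "(\<lambda>x. 0) \<in> l2_fun \<mu>"
  unfolding l2_fun_def by simp

lemma l2_fun_bound:
  assumes "integrable \<mu> h" "f \<in> borel_measurable \<mu>" "AE x in \<mu>. (cmod (f x))\<^sup>2 \<le> h x"
  shows "f \<in> l2_fun \<mu>"
  unfolding l2_fun_def
proof (intro CollectI conjI)
  show "integrable \<mu> (\<lambda>x. (cmod (f x))\<^sup>2)"
  proof (rule Bochner_Integration.integrable_bound[OF assms(1)])
    show "(\<lambda>x. (cmod (f x))\<^sup>2) \<in> borel_measurable \<mu>" using assms(2) by measurable
    show "AE x in \<mu>. norm ((cmod (f x))\<^sup>2) \<le> norm (h x)" using assms(3) by eventually_elim simp
  qed
qed (rule assms(2))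

lemma l2_fun_add:
  assumes f: "f \<in> l2_fun \<mu>" and g: "g \<in> l2_fun \<mu>"
  shows "(\<lambda>x. f x + g x) \<in> l2_fun \<mu>"
proof (rule l2_fun_bound)
  show "integrable \<mu> (\<lambda>x. 2 * ((cmod (f x))\<^sup>2 + (cmod (g x))\<^sup>2))"
    by (intro integrable_mult_right Bochner_Integration.integrable_add l2_funD(2) f g)
  show "(\<lambda>x. f x + g x) \<in> borel_measurable \<mu>" by (intro borel_measurable_add l2_funD(1) f g)
  show "AE x in \<mu>. (cmod (f x + g x))\<^sup>2 \<le> 2 * ((cmod (f x))\<^sup>2 + (cmod (g x))\<^sup>2)"
  proof (rule AE_I2)
    fix x
    have "(cmod (f x + g x))\<^sup>2 \<le> (cmod (f x) + cmod (g x))\<^sup>2"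
      by (intro power_mono norm_triangle_ineq norm_ge_zero)
    also have "\<dots> \<le> 2 * ((cmod (f x))\<^sup>2 + (cmod (g x))\<^sup>2)"
      using sum_squares_bound[of "cmod (f x)" "cmod (g x)"] by (simp add: power2_sum)
    finally show "(cmod (f x + g x))\<^sup>2 \<le> 2 * ((cmod (f x))\<^sup>2 + (cmod (g x))\<^sup>2)" .
  qed
qed

lemma l2_fun_mult:
  assumes f: "f \<in> l2_fun \<mu>" and m: "m \<in> borel_measurable \<mu>" "\<And>x. cmod (m x) \<le> C"
  shows "(\<lambda>x. m x * f x) \<in> l2_fun \<mu>"
proof (rule l2_fun_bound)
  show "integrable \<mu> (\<lambda>x. C\<^sup>2 * (cmod (f x))\<^sup>2)" by (intro integrable_mult_right l2_funD(2) f)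
  show "(\<lambda>x. m x * f x) \<in> borel_measurable \<mu>" by (intro borel_measurable_times l2_funD(1) f m)
  show "AE x in \<mu>. (cmod (m x * f x))\<^sup>2 \<le> C\<^sup>2 * (cmod (f x))\<^sup>2"
    by (rule AE_I2) (simp add: norm_mult power_mult_distrib mult_right_mono power_mono m)
qed

lemma l2_fun_scale: "f \<in> l2_fun \<mu> \<Longrightarrow> (\<lambda>x. \<alpha> * f x) \<in> l2_fun \<mu>"
  by (rule l2_fun_mult[where C = "cmod \<alpha>"]) simp_all

lemma l2_fun_product_integrable:
  assumes f: "f \<in> l2_fun \<mu>" and g: "g \<in> l2_fun \<mu>"
  shows "integrable \<mu> (\<lambda>x. f x * cnj (g x))"
proof (rule Bochner_Integration.integrable_bound)
  show "integrable \<mu> (\<lambda>x. (cmod (f x))\<^sup>2 + (cmod (g x))\<^sup>2)"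
    by (intro Bochner_Integration.integrable_add l2_funD(2) f g)
  have "(\<lambda>x. cnj (g x)) \<in> borel_measurable \<mu>"
    by (rule borel_measurable_continuous_on[OF continuous_on_cnj[OF continuous_on_id] l2_funD(1)[OF g]])
  then show "(\<lambda>x. f x * cnj (g x)) \<in> borel_measurable \<mu>" by (rule borel_measurable_times[OF l2_funD(1)[OF f]])
  show "AE x in \<mu>. norm (f x * cnj (g x)) \<le> norm ((cmod (f x))\<^sup>2 + (cmod (g x))\<^sup>2)"
  proof (rule AE_I2)
    fix x
    have "cmod (f x) * cmod (g x) \<ge> 0" by simp
    then have "cmod (f x) * cmod (g x) \<le> (cmod (f x))\<^sup>2 + (cmod (g x))\<^sup>2"
      using sum_squares_bound[of "cmod (f x)" "cmod (g x)"] unfolding mult.assoc by linarith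
    then show "norm (f x * cnj (g x)) \<le> norm ((cmod (f x))\<^sup>2 + (cmod (g x))\<^sup>2)" by (simp add: norm_mult)
  qed
qed

lemma l2_class_cong: "AE x in \<mu>. f x = g x \<Longrightarrow> l2_class \<mu> f = l2_class \<mu> g"
  unfolding l2_class_def by (intro Collect_cong conj_cong refl) (auto elim: eventually_elim2)

lemma
  assumes "f \<in> l2_fun \<mu>"
  shows l2_rep_class_fun: "l2_rep (l2_class \<mu> f) \<in> l2_fun \<mu>"
    and l2_rep_class: "AE x in \<mu>. l2_rep (l2_class \<mu> f) x = f x"
proof -
  have "f \<in> l2_class \<mu> f" using assms unfolding l2_class_def by simp
  then have "l2_rep (l2_class \<mu> f) \<in> l2_class \<mu> f" unfolding l2_rep_def by (rule someI[of "\<lambda>g. g \<in> l2_class \<mu> f"])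
  then show "l2_rep (l2_class \<mu> f) \<in> l2_fun \<mu>" "AE x in \<mu>. l2_rep (l2_class \<mu> f) x = f x"
    unfolding l2_class_def by simp_all
qed

lemma L2_simps:
  "vecs (L2 \<mu>) = l2_class \<mu> ` l2_fun \<mu>"
  "vadd (L2 \<mu>) E F = l2_class \<mu> (\<lambda>x. l2_rep E x + l2_rep F x)"
  "vzero (L2 \<mu>) = l2_class \<mu> (\<lambda>x. 0)"
  "vscale (L2 \<mu>) \<alpha> F = l2_class \<mu> (\<lambda>x. \<alpha> * l2_rep F x)"
  "ip (L2 \<mu>) E F = (\<integral>x. l2_rep E x * cnj (l2_rep F x) \<partial>\<mu>)"
  by (simp_all add: L2_def)

lemma l2_class_vec: "f \<in> l2_fun \<mu> \<Longrightarrow> l2_class \<mu> f \<in> vecs (L2 \<mu>)"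
  unfolding L2_simps by (rule imageI)

lemma
  assumes "F \<in> vecs (L2 \<mu>)"
  shows vec_rep_fun: "l2_rep F \<in> l2_fun \<mu>" and class_rep: "l2_class \<mu> (l2_rep F) = F"
proof -
  obtain f where f: "f \<in> l2_fun \<mu>" "F = l2_class \<mu> f" using assms unfolding L2_simps by blast
  show "l2_rep F \<in> l2_fun \<mu>" unfolding f(2) by (rule l2_rep_class_fun[OF f(1)])
  show "l2_class \<mu> (l2_rep F) = F" unfolding f(2) by (rule l2_class_cong[OF l2_rep_class[OF f(1)]])
qed

lemma ip_class:
  assumes f: "f \<in> l2_fun \<mu>" and g: "g \<in> l2_fun \<mu>"
  shows "ip (L2 \<mu>) (l2_class \<mu> f) (l2_class \<mu> g) = (\<integral>x. f x * cnj (g x) \<partial>\<mu>)"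
  unfolding L2_simps
proof (rule integral_cong_AE)
  show "(\<lambda>x. l2_rep (l2_class \<mu> f) x * cnj (l2_rep (l2_class \<mu> g) x)) \<in> borel_measurable \<mu>"
    by (rule borel_measurable_integrable[OF l2_fun_product_integrable[OF l2_rep_class_fun[OF f] l2_rep_class_fun[OF g]]])
  show "(\<lambda>x. f x * cnj (g x)) \<in> borel_measurable \<mu>"
    by (rule borel_measurable_integrable[OF l2_fun_product_integrable[OF f g]])
  show "AE x in \<mu>. l2_rep (l2_class \<mu> f) x * cnj (l2_rep (l2_class \<mu> g) x) = f x * cnj (g x)"
    using l2_rep_class[OF f] l2_rep_class[OF g] by eventually_elim simp
qed

lemma ip_self_integral:
  "ip (L2 \<mu>) F F = of_real (\<integral>x. (cmod (l2_rep F x))\<^sup>2 \<partial>\<mu>)"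
  unfolding L2_simps complex_norm_square[symmetric] by (rule integral_complex_of_real)

lemma inner_product_space_L2: "inner_product_space (L2 \<mu>)"
proof
  note reps = vec_rep_fun
  show "vzero (L2 \<mu>) \<in> vecs (L2 \<mu>)" unfolding L2_simps(3) by (rule l2_class_vec[OF l2_fun_zero])
  fix u assume u: "u \<in> vecs (L2 \<mu>)"
  note ru = vec_rep_fun[OF u]
  show "vscale (L2 \<mu>) \<alpha> u \<in> vecs (L2 \<mu>)" for \<alpha> unfolding L2_simps(4) by (rule l2_class_vec[OF l2_fun_scale[OF ru]])
  show "vadd (L2 \<mu>) u (vzero (L2 \<mu>)) = u"
  proof -
    have "AE x in \<mu>. l2_rep u x + l2_rep (l2_class \<mu> (\<lambda>x. 0)) x = l2_rep u x"
      using l2_rep_class[OF l2_fun_zero] by eventually_elim simp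
    from l2_class_cong[OF this] show ?thesis unfolding L2_simps(2,3) class_rep[OF u] .
  qed
  show "vscale (L2 \<mu>) (\<alpha> + \<beta>) u = vadd (L2 \<mu>) (vscale (L2 \<mu>) \<alpha> u) (vscale (L2 \<mu>) \<beta> u)" for \<alpha> \<beta>
    unfolding L2_simps(2,4)
    by (rule l2_class_cong) (use l2_rep_class[OF l2_fun_scale[OF ru, of \<alpha>]] l2_rep_class[OF l2_fun_scale[OF ru, of \<beta>]] in \<open>eventually_elim, simp add: distrib_right\<close>)
  show "vscale (L2 \<mu>) 1 u = u" unfolding L2_simps(4) mult_1_left by (rule class_rep[OF u])
  show "0 \<le> Re (ip (L2 \<mu>) u u)" unfolding ip_self_integral by (simp add: integral_nonneg_AE)
  show "u = vzero (L2 \<mu>)" if "ip (L2 \<mu>) u u = 0"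
  proof -
    have "(\<integral>x. (cmod (l2_rep u x))\<^sup>2 \<partial>\<mu>) = 0" using that unfolding ip_self_integral of_real_eq_0_iff .
    then have "AE x in \<mu>. (cmod (l2_rep u x))\<^sup>2 = 0"
      using integral_nonneg_eq_0_iff_AE[OF l2_funD(2)[OF ru]] by simp
    then have "AE x in \<mu>. l2_rep u x = 0" by eventually_elim simp
    from l2_class_cong[OF this] show ?thesis unfolding L2_simps(3) class_rep[OF u] .
  qed
  fix v assume v: "v \<in> vecs (L2 \<mu>)"
  note rv = vec_rep_fun[OF v]
  show "vadd (L2 \<mu>) u v \<in> vecs (L2 \<mu>)" unfolding L2_simps(2) by (rule l2_class_vec[OF l2_fun_add[OF ru rv]])
  show "vadd (L2 \<mu>) u v = vadd (L2 \<mu>) v u" unfolding L2_simps(2) by (simp only: add.commute)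
  show "ip (L2 \<mu>) (vscale (L2 \<mu>) \<alpha> u) v = \<alpha> * ip (L2 \<mu>) u v" for \<alpha>
    using ip_class[OF l2_fun_scale[OF ru, of \<alpha>] rv] unfolding class_rep[OF v] L2_simps(4,5) by (simp add: mult.assoc)
  show "ip (L2 \<mu>) v u = cnj (ip (L2 \<mu>) u v)"
    unfolding L2_simps(5) Bochner_Integration.integral_cnj[symmetric] by (simp add: mult.commute)
  fix w assume w: "w \<in> vecs (L2 \<mu>)"
  note rw = vec_rep_fun[OF w]
  show "vadd (L2 \<mu>) (vadd (L2 \<mu>) u v) w = vadd (L2 \<mu>) u (vadd (L2 \<mu>) v w)"
    unfolding L2_simps(2)
    by (rule l2_class_cong) (use l2_rep_class[OF l2_fun_add[OF ru rv]] l2_rep_class[OF l2_fun_add[OF rv rw]] in \<open>eventually_elim, simp add: add.assoc\<close>)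
  show "ip (L2 \<mu>) (vadd (L2 \<mu>) u v) w = ip (L2 \<mu>) u w + ip (L2 \<mu>) v w"
    using ip_class[OF l2_fun_add[OF ru rv] rw]
      Bochner_Integration.integral_add[OF l2_fun_product_integrable[OF ru rw] l2_fun_product_integrable[OF rv rw]]
    unfolding class_rep[OF w] L2_simps(2,5) by (simp add: distrib_right)
qed

section \<open>The Fourier multiplier of a factorization\<close>

context left_invariant_measure
begin

sublocale L: inner_product_space "L2 \<mu>" by (rule inner_product_space_L2)

lemma sq_integral: "L.sq F = (\<integral>x. (cmod (l2_rep F x))\<^sup>2 \<partial>\<mu>)"
  unfolding L.sq_def ip_self_integral by simp

lemma sq_class: "f \<in> l2_fun \<mu> \<Longrightarrow> L.sq (l2_class \<mu> f) = (\<integral>x. (cmod (f x))\<^sup>2 \<partial>\<mu>)"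
  unfolding L.sq_def ip_class complex_norm_square[symmetric] integral_complex_of_real by simp

lemma measurable_borel: "f \<in> measurable \<mu> N \<Longrightarrow> f \<in> measurable borel N"
  by (subst measurable_cong_sets[OF sets_mu[symmetric] refl])

lemma translate_measurable: "(\<lambda>u. g + u) \<in> measurable \<mu> borel"
  by (intro measurable_mu borel_measurable_continuous_onI continuous_intros)

lemma AE_translate:
  assumes "AE x in \<mu>. R x"
  shows "AE x in \<mu>. R (g + x)"
proof -
  have "AE x in distr \<mu> borel (\<lambda>u. g + u). R x" using assms unfolding distr_translate .
  then show ?thesis by (rule AE_distrD[OF translate_measurable])
qed

lemma l2_fun_translate:
  assumes f: "f \<in> l2_fun \<mu>"
  shows "(\<lambda>x. f (g + x)) \<in> l2_fun \<mu>"
  unfolding l2_fun_def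
proof (intro CollectI conjI)
  show "(\<lambda>x. f (g + x)) \<in> borel_measurable \<mu>"
    by (rule measurable_compose[OF translate_measurable measurable_borel[OF l2_funD(1)[OF f]]])
  show "integrable \<mu> (\<lambda>x. (cmod (f (g + x)))\<^sup>2)"
    by (rule integrable_translate[OF measurable_borel[OF borel_measurable_integrable[OF l2_funD(2)[OF f]]] l2_funD(2)[OF f]])
qed

lemma integral_square_translate:
  assumes f: "f \<in> l2_fun \<mu>"
  shows "(\<integral>x. (cmod (f (g + x)))\<^sup>2 \<partial>\<mu>) = (\<integral>x. (cmod (f x))\<^sup>2 \<partial>\<mu>)"
  by (rule integral_translate[OF measurable_borel[OF borel_measurable_integrable[OF l2_funD(2)[OF f]]]])

lemma left_regular_apply: "F \<in> vecs (L2 \<mu>) \<Longrightarrow> left_regular \<mu> g F = l2_class \<mu> (\<lambda>x. l2_rep F (- g + x))"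
  unfolding left_regular_def by simp

lemma left_regular_closed: "F \<in> vecs (L2 \<mu>) \<Longrightarrow> left_regular \<mu> g F \<in> vecs (L2 \<mu>)"
  unfolding left_regular_apply by (rule l2_class_vec[OF l2_fun_translate[OF vec_rep_fun]])

lemma left_regular_rep: "F \<in> vecs (L2 \<mu>) \<Longrightarrow> AE x in \<mu>. l2_rep (left_regular \<mu> g F) x = l2_rep F (- g + x)"
  unfolding left_regular_apply by (rule l2_rep_class[OF l2_fun_translate[OF vec_rep_fun]])

lemma left_regular_sq:
  assumes F: "F \<in> vecs (L2 \<mu>)"
  shows "L.sq (left_regular \<mu> g F) = L.sq F"
proof -
  note f = vec_rep_fun[OF F]
  show ?thesis
    unfolding left_regular_apply[OF F] sq_class[OF l2_fun_translate[OF f]] sq_integral[of F]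
    by (rule integral_square_translate[OF f])
qed

lemma left_regular_bounded: "left_regular \<mu> g \<in> bounded_ops (L2 \<mu>)"
proof (rule L.bounded_opsI[where C = 1])
  show "left_regular \<mu> g \<in> extensional (vecs (L2 \<mu>))" unfolding left_regular_def by simp
  fix u \<alpha> assume u: "u \<in> vecs (L2 \<mu>)"
  show "left_regular \<mu> g u \<in> vecs (L2 \<mu>)" by (rule left_regular_closed[OF u])
  show "L.sq (left_regular \<mu> g u) \<le> 1 * L.sq u" by (simp add: left_regular_sq[OF u])
  have "AE x in \<mu>. l2_rep (vscale (L2 \<mu>) \<alpha> u) x = \<alpha> * l2_rep u x"
    unfolding L2_simps by (rule l2_rep_class[OF l2_fun_scale[OF vec_rep_fun[OF u]]])
  from AE_translate[OF this, of "- g"] left_regular_rep[OF u, of g]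
  have "AE x in \<mu>. l2_rep (vscale (L2 \<mu>) \<alpha> u) (- g + x) = \<alpha> * l2_rep (left_regular \<mu> g u) x"
    by eventually_elim simp
  from l2_class_cong[OF this]
  show "left_regular \<mu> g (vscale (L2 \<mu>) \<alpha> u) = vscale (L2 \<mu>) \<alpha> (left_regular \<mu> g u)"
    unfolding left_regular_apply[OF L.scale_closed[OF u]] L2_simps(4)[of _ _ "left_regular \<mu> g u"] .
  fix v assume v: "v \<in> vecs (L2 \<mu>)"
  have "AE x in \<mu>. l2_rep (vadd (L2 \<mu>) u v) x = l2_rep u x + l2_rep v x"
    unfolding L2_simps by (rule l2_rep_class[OF l2_fun_add[OF vec_rep_fun[OF u] vec_rep_fun[OF v]]])
  from AE_translate[OF this, of "- g"] left_regular_rep[OF u, of g] left_regular_rep[OF v, of g]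
  have "AE x in \<mu>. l2_rep (vadd (L2 \<mu>) u v) (- g + x) = l2_rep (left_regular \<mu> g u) x + l2_rep (left_regular \<mu> g v) x"
    by eventually_elim simp
  from l2_class_cong[OF this]
  show "left_regular \<mu> g (vadd (L2 \<mu>) u v) = vadd (L2 \<mu>) (left_regular \<mu> g u) (left_regular \<mu> g v)"
    unfolding left_regular_apply[OF L.add_closed[OF u v]] L2_simps(2)[of _ "left_regular \<mu> g u"] .
qed

lemma left_regular_plus:
  assumes F: "F \<in> vecs (L2 \<mu>)"
  shows "left_regular \<mu> g (left_regular \<mu> h F) = left_regular \<mu> (g + h) F"
proof -
  have eq: "- h + (- g + x) = - (g + h) + x" for x by (simp only: minus_add add.assoc)
  from AE_translate[OF left_regular_rep[OF F, of h], of "- g"]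
  have "AE x in \<mu>. l2_rep (left_regular \<mu> h F) (- g + x) = l2_rep F (- (g + h) + x)" unfolding eq .
  from l2_class_cong[OF this] show ?thesis
    unfolding left_regular_apply[OF left_regular_closed[OF F]] left_regular_apply[OF F, of "g + h"] .
qed

lemma range_left_regular: "range (left_regular \<mu>) \<subseteq> bounded_ops (L2 \<mu>)"
  using left_regular_bounded by blast

lemma left_regular_in_group_vn: "left_regular \<mu> g \<in> group_vn \<mu>"
  unfolding group_vn_def by (rule subsetD[OF L.op_span_weak_closure[OF range_left_regular] op_span.base[OF rangeI]])

lemma group_vn_bounded: "group_vn \<mu> \<subseteq> bounded_ops (L2 \<mu>)"
  unfolding group_vn_def by (rule L.weak_closure_bounded)

lemma fourier_multiplier_map_unique:
  assumes M: "fourier_multiplier_map \<mu> \<phi> M1" "fourier_multiplier_map \<mu> \<phi> M2"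
  shows "M1 = M2"
proof -
  have E: "M1 \<in> group_vn \<mu> \<rightarrow>\<^sub>E group_vn \<mu>" "M2 \<in> group_vn \<mu> \<rightarrow>\<^sub>E group_vn \<mu>"
    using M unfolding fourier_multiplier_map_def by blast+
  have F: "fourier_multiplier_map \<mu> \<phi> N" if "N \<in> {M1, M2}" for N using that M by blast
  show ?thesis
  proof (rule PiE_ext[OF E])
    fix T assume T: "T \<in> group_vn \<mu>"
    show "M1 T = M2 T"
    proof (rule L.weak_closure_map_unique[OF range_left_regular, of M1 M2])
      show "T \<in> L.weak_closure (range (left_regular \<mu>))" using T unfolding group_vn_def .
      fix N assume "N \<in> {M1, M2}"
      note N = F[OF this, unfolded fourier_multiplier_map_def]
      show "continuous_map (subtopology (sigma_weak_topology (L2 \<mu>)) (L.weak_closure (range (left_regular \<mu>)))) (sigma_weak_topology (L2 \<mu>)) N"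
        using N continuous_map_into_fulltopology unfolding group_vn_def by blast
      fix S assume S: "S \<in> L.weak_closure (range (left_regular \<mu>))"
      show "N (op_scale (L2 \<mu>) \<beta> S) = op_scale (L2 \<mu>) \<beta> (N S)" for \<beta> using N S unfolding group_vn_def by blast
      fix R assume R: "R \<in> L.weak_closure (range (left_regular \<mu>))"
      show "N (op_add (L2 \<mu>) S R) = op_add (L2 \<mu>) (N S) (N R)" using N S R unfolding group_vn_def by blast
    next
      fix S assume "S \<in> range (left_regular \<mu>)"
      then obtain g where S: "S = left_regular \<mu> g" by blast
      have "M1 (left_regular \<mu> g) = op_scale (L2 \<mu>) (\<phi> g) (left_regular \<mu> g)" using M(1) unfolding fourier_multiplier_map_def by blast
      moreover have "M2 (left_regular \<mu> g) = op_scale (L2 \<mu>) (\<phi> g) (left_regular \<mu> g)" using M(2) unfolding fourier_multiplier_map_def by blast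
      ultimately show "M1 S = M2 S" unfolding S by simp
    qed
  qed
qed

definition mulv :: "('g \<Rightarrow> complex) \<Rightarrow> ('g \<Rightarrow> complex) set \<Rightarrow> ('g \<Rightarrow> complex) set" where
  "mulv m F = l2_class \<mu> (\<lambda>x. m x * l2_rep F x)"

context
  fixes m :: "'g \<Rightarrow> complex" and C :: real
  assumes m: "m \<in> borel_measurable \<mu>" "\<And>x. cmod (m x) \<le> C"
begin

lemma mulv_fun: "F \<in> vecs (L2 \<mu>) \<Longrightarrow> (\<lambda>x. m x * l2_rep F x) \<in> l2_fun \<mu>"
  by (rule l2_fun_mult[OF vec_rep_fun m])

lemma mulv_closed: "F \<in> vecs (L2 \<mu>) \<Longrightarrow> mulv m F \<in> vecs (L2 \<mu>)"
  unfolding mulv_def by (rule l2_class_vec[OF mulv_fun])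

lemma mulv_rep: "F \<in> vecs (L2 \<mu>) \<Longrightarrow> AE x in \<mu>. l2_rep (mulv m F) x = m x * l2_rep F x"
  unfolding mulv_def by (rule l2_rep_class[OF mulv_fun])

lemma mulv_add:
  assumes u: "u \<in> vecs (L2 \<mu>)" and v: "v \<in> vecs (L2 \<mu>)"
  shows "mulv m (vadd (L2 \<mu>) u v) = vadd (L2 \<mu>) (mulv m u) (mulv m v)"
proof -
  have "AE x in \<mu>. l2_rep (vadd (L2 \<mu>) u v) x = l2_rep u x + l2_rep v x"
    unfolding L2_simps by (rule l2_rep_class[OF l2_fun_add[OF vec_rep_fun[OF u] vec_rep_fun[OF v]]])
  with mulv_rep[OF u] mulv_rep[OF v]
  have "AE x in \<mu>. m x * l2_rep (vadd (L2 \<mu>) u v) x = l2_rep (mulv m u) x + l2_rep (mulv m v) x"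
    by eventually_elim (simp add: distrib_left)
  from l2_class_cong[OF this] show ?thesis unfolding L2_simps(2)[of _ "mulv m u"] unfolding mulv_def .
qed

lemma mulv_scale:
  assumes u: "u \<in> vecs (L2 \<mu>)"
  shows "mulv m (vscale (L2 \<mu>) \<alpha> u) = vscale (L2 \<mu>) \<alpha> (mulv m u)"
proof -
  have "AE x in \<mu>. l2_rep (vscale (L2 \<mu>) \<alpha> u) x = \<alpha> * l2_rep u x"
    unfolding L2_simps by (rule l2_rep_class[OF l2_fun_scale[OF vec_rep_fun[OF u]]])
  with mulv_rep[OF u] have "AE x in \<mu>. m x * l2_rep (vscale (L2 \<mu>) \<alpha> u) x = \<alpha> * l2_rep (mulv m u) x"
    by eventually_elim simp
  from l2_class_cong[OF this] show ?thesis unfolding L2_simps(4)[of _ _ "mulv m u"] unfolding mulv_def .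
qed

end

lemma mulv_sum_bound:
  assumes m: "\<And>n. m n \<in> borel_measurable \<mu>" "\<And>n x. cmod (m n x) \<le> C"
    and sum: "\<And>N x. (\<Sum>n<N. (cmod (m n x))\<^sup>2) \<le> C\<^sup>2" and F: "F \<in> vecs (L2 \<mu>)"
  shows "(\<Sum>n<N. L.sq (mulv (m n) F)) \<le> C\<^sup>2 * L.sq F"
proof -
  note int = l2_funD(2)[OF mulv_fun[OF m F]]
  have "(\<Sum>n<N. L.sq (mulv (m n) F)) = (\<integral>x. (\<Sum>n<N. (cmod (m n x * l2_rep F x))\<^sup>2) \<partial>\<mu>)"
    unfolding mulv_def sq_class[OF mulv_fun[OF m F]] by (rule Bochner_Integration.integral_sum[OF int, symmetric])
  also have "\<dots> \<le> (\<integral>x. C\<^sup>2 * (cmod (l2_rep F x))\<^sup>2 \<partial>\<mu>)"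
  proof (rule integral_mono[OF Bochner_Integration.integrable_sum[OF int] integrable_mult_right[OF l2_funD(2)[OF vec_rep_fun[OF F]]]])
    fix x
    show "(\<Sum>n<N. (cmod (m n x * l2_rep F x))\<^sup>2) \<le> C\<^sup>2 * (cmod (l2_rep F x))\<^sup>2"
      unfolding norm_mult power_mult_distrib sum_distrib_right[symmetric] by (rule mult_right_mono[OF sum]) simp
  qed
  also have "\<dots> = C\<^sup>2 * L.sq F" unfolding sq_integral by simp
  finally show ?thesis .
qed

end

text \<open>A factorization of the kernel through two bounded weakly continuous maps into the Hilbert space.
  Weak continuity makes the coordinates of both factors measurable functions.\<close>

locale herz_schur_factorization = left_invariant_measure \<mu>
  for \<mu> :: "'g :: {topological_group_add, t2_space, second_countable_topology} measure" +
  fixes P Q :: "'g \<Rightarrow> nat l2" and \<phi> :: "'g \<Rightarrow> complex" and A B :: real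
  assumes P_coord: "\<And>n. continuous_on UNIV (\<lambda>x. coord (P x) n)" and Q_coord: "\<And>n. continuous_on UNIV (\<lambda>x. coord (Q x) n)"
    and P_norm: "\<And>x. norm (P x) \<le> A" and Q_norm: "\<And>x. norm (Q x) \<le> B"
    and factor: "\<And>x y. cip (P x) (Q y) = \<phi> (- y + x)"
begin

text \<open>The arguments are negated because \<open>\<phi> (- y + x)\<close> is invariant under left translations, while
  translation by \<open>g\<close> connects the values of a function at \<open>- g + x\<close> and \<open>x\<close>. With the signs,
  the sum over \<open>n\<close> of \<open>p n (- g + x) * cnj (q n x)\<close> is \<open>\<phi> g\<close>, whatever \<open>x\<close> is.\<close>

definition p :: "nat \<Rightarrow> 'g \<Rightarrow> complex" where "p n x = coord (P (- x)) n"
definition q :: "nat \<Rightarrow> 'g \<Rightarrow> complex" where "q n x = coord (Q (- x)) n"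

lemma p_measurable: "p n \<in> borel_measurable \<mu>"
  unfolding p_def[abs_def]
  by (intro measurable_mu borel_measurable_continuous_onI continuous_on_compose2[OF P_coord] continuous_intros) simp

lemma q_measurable: "q n \<in> borel_measurable \<mu>"
  unfolding q_def[abs_def]
  by (intro measurable_mu borel_measurable_continuous_onI continuous_on_compose2[OF Q_coord] continuous_intros) simp

lemma p_le: "cmod (p n x) \<le> A"
  unfolding p_def by (rule order_trans[OF coord_le_norm P_norm])

lemma q_le: "cmod (q n x) \<le> B"
  unfolding q_def by (rule order_trans[OF coord_le_norm Q_norm])

lemma p_sum_le: "(\<Sum>n<N. (cmod (p n x))\<^sup>2) \<le> A\<^sup>2"
  unfolding p_def by (rule order_trans[OF sum_coord_le_norm[OF finite_lessThan] power_mono[OF P_norm norm_ge_zero]])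

lemma q_sum_le: "(\<Sum>n<N. (cmod (q n x))\<^sup>2) \<le> B\<^sup>2"
  unfolding q_def by (rule order_trans[OF sum_coord_le_norm[OF finite_lessThan] power_mono[OF Q_norm norm_ge_zero]])

lemma series_at_point:
  fixes c :: "nat \<Rightarrow> complex"
  assumes c: "summable (\<lambda>n. (cmod (c n))\<^sup>2)"
  shows "(\<lambda>n. cnj (q n x) * c n) sums (\<Sum>n. cnj (q n x) * c n)"
    and "(cmod (\<Sum>n. cnj (q n x) * c n))\<^sup>2 \<le> B\<^sup>2 * (\<Sum>n. (cmod (c n))\<^sup>2)"
proof -
  have coord: "coord (Abs_l2 c) = c"
    using c by (intro Abs_l2_inverse) (simp add: summable_on_UNIV_nonneg_real_iff)
  have s: "(\<lambda>n. cnj (q n x) * c n) sums cip (Abs_l2 c) (Q (- x))"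
    using cip_sums[of "Abs_l2 c" "Q (- x)"] unfolding coord q_def by (simp only: mult.commute)
  show "(\<lambda>n. cnj (q n x) * c n) sums (\<Sum>n. cnj (q n x) * c n)"
    by (rule summable_sums[OF sums_summable[OF s]])
  have "(\<lambda>n. complex_of_real ((cmod (c n))\<^sup>2)) sums complex_of_real ((norm (Abs_l2 c))\<^sup>2)"
    using cip_sums[of "Abs_l2 c" "Abs_l2 c"] unfolding coord cip_self_norm complex_norm_square[symmetric] .
  then have "(\<lambda>n. (cmod (c n))\<^sup>2) sums ((norm (Abs_l2 c))\<^sup>2)" by (simp only: sums_of_real_iff)
  then have n: "(norm (Abs_l2 c))\<^sup>2 = (\<Sum>n. (cmod (c n))\<^sup>2)" by (rule sums_unique)
  have "cmod (cip (Abs_l2 c) (Q (- x))) \<le> norm (Abs_l2 c) * B"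
    by (rule order_trans[OF cmod_cip_le mult_left_mono[OF Q_norm norm_ge_zero]])
  then have "(cmod (cip (Abs_l2 c) (Q (- x))))\<^sup>2 \<le> (norm (Abs_l2 c) * B)\<^sup>2" by (intro power_mono) simp_all
  also have "\<dots> = B\<^sup>2 * (\<Sum>n. (cmod (c n))\<^sup>2)" unfolding power_mult_distrib n by (rule mult.commute)
  finally show "(cmod (\<Sum>n. cnj (q n x) * c n))\<^sup>2 \<le> B\<^sup>2 * (\<Sum>n. (cmod (c n))\<^sup>2)"
    unfolding sums_unique[OF s, symmetric] .
qed

text \<open>The weak sum is the pointwise sum over \<open>n\<close> of \<open>cnj (q n)\<close> times \<open>g n\<close>, which exists almost everywhere
  by the Cauchy--Schwarz inequality for sequences.\<close>

lemma
  assumes g: "\<And>n. g n \<in> vecs (L2 \<mu>)" and X: "\<And>N. (\<Sum>n<N. L.sq (g n)) \<le> X"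
  defines "G \<equiv> \<lambda>x. \<Sum>n. cnj (q n x) * l2_rep (g n) x"
  shows assemble_fun: "G \<in> l2_fun \<mu>"
    and assemble_sums: "w \<in> vecs (L2 \<mu>) \<Longrightarrow> (\<lambda>n. ip (L2 \<mu>) (g n) (mulv (q n) w)) sums ip (L2 \<mu>) (l2_class \<mu> G) w"
proof -
  note gf = vec_rep_fun[OF g]
  have S: "summable (\<lambda>n. L.sq (g n))"
    by (rule summableI_nonneg_bounded[OF L.sq_nonneg[OF g] X])
  have AE_s: "AE x in \<mu>. summable (\<lambda>n. (cmod (l2_rep (g n) x))\<^sup>2)"
  proof -
    have meas: "(\<lambda>x. ennreal ((cmod (l2_rep (g n) x))\<^sup>2)) \<in> borel_measurable \<mu>" for n
      using borel_measurable_integrable[OF l2_funD(2)[OF gf]] by simp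
    have "(\<integral>\<^sup>+x. (\<Sum>n. ennreal ((cmod (l2_rep (g n) x))\<^sup>2)) \<partial>\<mu>) = (\<Sum>n. \<integral>\<^sup>+x. ennreal ((cmod (l2_rep (g n) x))\<^sup>2) \<partial>\<mu>)"
      by (rule nn_integral_suminf[OF meas])
    also have "\<dots> = (\<Sum>n. ennreal (L.sq (g n)))"
      unfolding sq_integral by (subst nn_integral_eq_integral[OF l2_funD(2)[OF gf]]) simp_all
    also have "\<dots> = ennreal (\<Sum>n. L.sq (g n))" by (rule suminf_ennreal2[OF L.sq_nonneg[OF g] S])
    also have "\<dots> \<noteq> \<infinity>" by simp
    finally have "AE x in \<mu>. (\<Sum>n. ennreal ((cmod (l2_rep (g n) x))\<^sup>2)) \<noteq> \<infinity>"
      by (intro nn_integral_PInf_AE borel_measurable_suminf_order meas)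
    then show ?thesis by eventually_elim (rule summable_suminf_not_top, simp_all)
  qed
  have int: "integrable \<mu> (\<lambda>x. \<Sum>n. (cmod (l2_rep (g n) x))\<^sup>2)"
    by (rule integrable_suminf[OF l2_funD(2)[OF gf]]) (use AE_s S in \<open>simp_all add: sq_integral\<close>)
  have cq: "(\<lambda>x. cnj (q n x)) \<in> borel_measurable \<mu>" for n
    by (rule borel_measurable_continuous_on[OF continuous_on_cnj[OF continuous_on_id] q_measurable])
  show G: "G \<in> l2_fun \<mu>"
  proof (rule l2_fun_bound[OF integrable_mult_right[OF int, of "B\<^sup>2"]])
    show "G \<in> borel_measurable \<mu>"
      unfolding G_def by (intro borel_measurable_suminf borel_measurable_times cq l2_funD(1)[OF gf])
    show "AE x in \<mu>. (cmod (G x))\<^sup>2 \<le> B\<^sup>2 * (\<Sum>n. (cmod (l2_rep (g n) x))\<^sup>2)"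
      using AE_s by eventually_elim (unfold G_def, rule series_at_point(2))
  qed
  assume w: "w \<in> vecs (L2 \<mu>)"
  note wf = vec_rep_fun[OF w]
  define h where "h = (\<lambda>n x. l2_rep (g n) x * cnj (q n x * l2_rep w x))"
  have mw: "(\<lambda>x. q n x * l2_rep w x) \<in> l2_fun \<mu>" for n by (rule mulv_fun[OF q_measurable q_le w])
  have h_int: "integrable \<mu> (h n)" for n unfolding h_def by (rule l2_fun_product_integrable[OF gf mw])
  have le: "cmod (a * cnj b) \<le> (cmod a)\<^sup>2 + (cmod b)\<^sup>2" for a b :: complex
  proof -
    have "cmod a * cmod b \<ge> 0" by simp
    then show ?thesis using sum_squares_bound[of "cmod a" "cmod b"] unfolding norm_mult complex_mod_cnj mult.assoc by linarith
  qed
  have S': "summable (\<lambda>n. \<integral>x. norm (h n x) \<partial>\<mu>)"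
  proof (rule summable_comparison_test')
    have "summable (\<lambda>n. L.sq (mulv (q n) w))"
      by (rule summableI_nonneg_bounded[OF L.sq_nonneg[OF mulv_closed[OF q_measurable q_le w]]
            mulv_sum_bound[OF q_measurable q_le q_sum_le w]])
    then show "summable (\<lambda>n. L.sq (g n) + L.sq (mulv (q n) w))" by (rule summable_add[OF S])
    fix n :: nat assume "n \<ge> 0"
    have "(\<integral>x. norm (h n x) \<partial>\<mu>) \<le> (\<integral>x. (cmod (l2_rep (g n) x))\<^sup>2 + (cmod (q n x * l2_rep w x))\<^sup>2 \<partial>\<mu>)"
      unfolding h_def
      by (rule integral_mono[OF integrable_norm[OF l2_fun_product_integrable[OF gf mw]]
            Bochner_Integration.integrable_add[OF l2_funD(2)[OF gf] l2_funD(2)[OF mw]] le])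
    also have "\<dots> = L.sq (g n) + L.sq (mulv (q n) w)"
      unfolding mulv_def sq_class[OF mw] sq_integral[of "g n"]
      by (rule Bochner_Integration.integral_add[OF l2_funD(2)[OF gf] l2_funD(2)[OF mw]])
    finally show "norm (\<integral>x. norm (h n x) \<partial>\<mu>) \<le> L.sq (g n) + L.sq (mulv (q n) w)"
      by (simp add: integral_nonneg_AE)
  qed
  have AE_h: "AE x in \<mu>. summable (\<lambda>n. norm (h n x))"
    using AE_s
  proof eventually_elim
    case (elim x)
    show ?case
    proof (rule summable_comparison_test')
      have "summable (\<lambda>n. (cmod (q n x))\<^sup>2)" by (rule summableI_nonneg_bounded[OF zero_le_power2 q_sum_le])
      then have "summable (\<lambda>n. (cmod (q n x))\<^sup>2 * (cmod (l2_rep w x))\<^sup>2)" by (rule summable_mult2)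
      then show "summable (\<lambda>n. (cmod (l2_rep (g n) x))\<^sup>2 + (cmod (q n x))\<^sup>2 * (cmod (l2_rep w x))\<^sup>2)"
        by (rule summable_add[OF elim])
      show "norm (norm (h n x)) \<le> (cmod (l2_rep (g n) x))\<^sup>2 + (cmod (q n x))\<^sup>2 * (cmod (l2_rep w x))\<^sup>2" for n
        using le[of "l2_rep (g n) x" "q n x * l2_rep w x"] unfolding h_def by (simp add: norm_mult power_mult_distrib)
    qed
  qed
  have "(\<lambda>n. \<integral>x. h n x \<partial>\<mu>) sums (\<integral>x. (\<Sum>n. h n x) \<partial>\<mu>)"
    by (rule sums_integral[OF h_int AE_h S'])
  also have "(\<lambda>n. \<integral>x. h n x \<partial>\<mu>) = (\<lambda>n. ip (L2 \<mu>) (g n) (mulv (q n) w))"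
    using ip_class[OF gf mw] unfolding class_rep[OF g] mulv_def h_def by simp
  also have "(\<integral>x. (\<Sum>n. h n x) \<partial>\<mu>) = (\<integral>x. G x * cnj (l2_rep w x) \<partial>\<mu>)"
  proof (rule integral_cong_AE)
    show "(\<lambda>x. \<Sum>n. h n x) \<in> borel_measurable \<mu>" by (intro borel_measurable_suminf borel_measurable_integrable h_int)
    show "(\<lambda>x. G x * cnj (l2_rep w x)) \<in> borel_measurable \<mu>"
      by (rule borel_measurable_integrable[OF l2_fun_product_integrable[OF G wf]])
    show "AE x in \<mu>. (\<Sum>n. h n x) = G x * cnj (l2_rep w x)"
      using AE_s
    proof eventually_elim
      case (elim x)
      have eq: "h n x = cnj (q n x) * l2_rep (g n) x * cnj (l2_rep w x)" for n unfolding h_def by (simp add: mult_ac)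
      from sums_mult2[OF series_at_point(1)[OF elim, of x], of "cnj (l2_rep w x)"]
      have "(\<lambda>n. h n x) sums (G x * cnj (l2_rep w x))" unfolding eq G_def .
      then show ?case by (rule sums_unique[symmetric])
    qed
  qed
  also have "\<dots> = ip (L2 \<mu>) (l2_class \<mu> G) w"
    using ip_class[OF G wf] unfolding class_rep[OF w] by simp
  finally show "(\<lambda>n. ip (L2 \<mu>) (g n) (mulv (q n) w)) sums ip (L2 \<mu>) (l2_class \<mu> G) w" .
qed

sublocale operator_multiplier "L2 \<mu>" "\<lambda>n. mulv (p n)" "\<lambda>n. mulv (q n)" A B
proof (unfold_locales)
  show "mulv (p n) v \<in> vecs (L2 \<mu>)" "mulv (q n) v \<in> vecs (L2 \<mu>)" if "v \<in> vecs (L2 \<mu>)" for n v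
    by (rule mulv_closed[OF p_measurable p_le that], rule mulv_closed[OF q_measurable q_le that])
  show "mulv (p n) (vadd (L2 \<mu>) u v) = vadd (L2 \<mu>) (mulv (p n) u) (mulv (p n) v)"
    if "u \<in> vecs (L2 \<mu>)" "v \<in> vecs (L2 \<mu>)" for n u v by (rule mulv_add[OF p_measurable p_le that])
  show "mulv (p n) (vscale (L2 \<mu>) \<alpha> v) = vscale (L2 \<mu>) \<alpha> (mulv (p n) v)" if "v \<in> vecs (L2 \<mu>)" for n \<alpha> v
    by (rule mulv_scale[OF p_measurable p_le that])
  show "(\<Sum>n<N. L.sq (mulv (p n) v)) \<le> A\<^sup>2 * L.sq v" if "v \<in> vecs (L2 \<mu>)" for N v
    by (rule mulv_sum_bound[OF p_measurable p_le p_sum_le that])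
  show "(\<Sum>n<N. L.sq (mulv (q n) v)) \<le> B\<^sup>2 * L.sq v" if "v \<in> vecs (L2 \<mu>)" for N v
    by (rule mulv_sum_bound[OF q_measurable q_le q_sum_le that])
  show "\<exists>G\<in>vecs (L2 \<mu>). \<forall>w\<in>vecs (L2 \<mu>). (\<lambda>n. ip (L2 \<mu>) (g n) (mulv (q n) w)) sums ip (L2 \<mu>) G w"
    if g: "\<And>n. g n \<in> vecs (L2 \<mu>)" and X: "\<And>N. (\<Sum>n<N. L.sq (g n)) \<le> X" for g X
    using l2_class_vec[OF assemble_fun[OF g X]] assemble_sums[OF g X] by blast
  show "0 \<le> A" using order_trans[OF norm_ge_zero P_norm] .
  show "0 \<le> B" using order_trans[OF norm_ge_zero Q_norm] .
qed

text \<open>The series that defines the multiplier is evaluated pointwise: almost everywhere its coefficients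
  sum up to \<open>\<phi> g\<close>.\<close>

lemma mult_left_regular: "mult (left_regular \<mu> g) = op_scale (L2 \<mu>) (\<phi> g) (left_regular \<mu> g)"
proof (rule PiE_ext[OF L.bounded_opsD(1)[OF mult_bounded[OF left_regular_bounded]]
      L.bounded_opsD(1)[OF L.op_scale_bounded[OF left_regular_bounded]]])
  fix v assume v: "v \<in> vecs (L2 \<mu>)"
  define r where "r = (\<lambda>n. left_regular \<mu> g (mulv (p n) v))"
  note pv = mulv_closed[OF p_measurable p_le v]
  have r: "r n \<in> vecs (L2 \<mu>)" for n unfolding r_def by (rule left_regular_closed[OF pv])
  have rb: "(\<Sum>n<N. L.sq (r n)) \<le> A\<^sup>2 * L.sq v" for N
    unfolding r_def left_regular_sq[OF pv] by (rule mf_bound[OF v])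
  define G where "G = (\<lambda>x. \<Sum>n. cnj (q n x) * l2_rep (r n) x)"
  have "AE x in \<mu>. \<forall>n. l2_rep (r n) x = l2_rep (mulv (p n) v) (- g + x)"
    unfolding AE_all_countable r_def by (intro allI left_regular_rep[OF pv])
  moreover have "AE x in \<mu>. \<forall>n. l2_rep (mulv (p n) v) (- g + x) = p n (- g + x) * l2_rep v (- g + x)"
    unfolding AE_all_countable by (intro allI AE_translate[OF mulv_rep[OF p_measurable p_le v]])
  ultimately have "AE x in \<mu>. G x = \<phi> g * l2_rep (left_regular \<mu> g v) x"
    using left_regular_rep[OF v, of g]
  proof eventually_elim
    case (elim x)
    have "- (- g + x) = - x + g" "- (- x) + (- x + g) = g"
      by (simp_all only: minus_add minus_minus add.assoc[symmetric] right_minus add_0_left)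
    then have "(\<lambda>n. p n (- g + x) * cnj (q n x)) sums \<phi> g"
      using cip_sums[of "P (- x + g)" "Q (- x)"] unfolding p_def q_def factor by simp
    from sums_mult2[OF this, of "l2_rep v (- g + x)"]
    have "(\<lambda>n. cnj (q n x) * l2_rep (r n) x) sums (\<phi> g * l2_rep v (- g + x))"
      using elim(1,2) by (simp add: mult_ac)
    from sums_unique[OF this] show ?case unfolding G_def elim(3) by simp
  qed
  from l2_class_cong[OF this] have cl: "l2_class \<mu> G = op_scale (L2 \<mu>) (\<phi> g) (left_regular \<mu> g) v"
    using v unfolding op_scale_def by (simp add: L2_simps(4))
  have "mult (left_regular \<mu> g) v = l2_class \<mu> G"
  proof (rule mult_unique[OF left_regular_bounded v])
    show "l2_class \<mu> G \<in> vecs (L2 \<mu>)" unfolding G_def by (rule l2_class_vec[OF assemble_fun[OF r rb]])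
    show "(\<lambda>n. ip (L2 \<mu>) (left_regular \<mu> g (mulv (p n) v)) (mulv (q n) w)) sums ip (L2 \<mu>) (l2_class \<mu> G) w"
      if "w \<in> vecs (L2 \<mu>)" for w
      using assemble_sums[OF r rb that] unfolding G_def r_def .
  qed
  with cl show "mult (left_regular \<mu> g) v = op_scale (L2 \<mu>) (\<phi> g) (left_regular \<mu> g) v" by simp
qed

lemma mult_group_vn: 
  assumes T: "T \<in> group_vn \<mu>"
  shows "mult T \<in> group_vn \<mu>"
proof -
  have span: "mult S \<in> op_span (L2 \<mu>) (range (left_regular \<mu>))" if "S \<in> op_span (L2 \<mu>) (range (left_regular \<mu>))" for S
    using that
  proof induction
    case (base S)
    then obtain g where "S = left_regular \<mu> g" by blast
    then show ?case by (simp add: mult_left_regular op_span.scale op_span.base)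
  next
    case (add S R)
    have "S \<in> bounded_ops (L2 \<mu>)" "R \<in> bounded_ops (L2 \<mu>)" using L.op_span_bounded[OF range_left_regular] add.hyps by blast+
    then show ?case using op_span.add[OF add.IH] by (simp add: mult_op_add)
  next
    case (scale S \<alpha>)
    have "S \<in> bounded_ops (L2 \<mu>)" using L.op_span_bounded[OF range_left_regular] scale.hyps by blast
    then show ?case using op_span.scale[OF scale.IH] by (simp add: mult_op_scale)
  qed
  have "mult T \<in> (sigma_weak_topology (L2 \<mu>)) closure_of (mult ` op_span (L2 \<mu>) (range (left_regular \<mu>)))"
    using continuous_map_image_closure_subset[OF mult_continuous, of "op_span (L2 \<mu>) (range (left_regular \<mu>))"] T
    unfolding group_vn_def by blast
  also have "\<dots> \<subseteq> group_vn \<mu>"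
    unfolding group_vn_def by (rule closure_of_mono) (use span in blast)
  finally show ?thesis .
qed

lemma cb_values_le:
  assumes "r \<in> cb_values (L2 \<mu>) (group_vn \<mu>) (restrict mult (group_vn \<mu>))"
  shows "r \<le> A * B"
proof -
  obtain n T where nT: "r = matrix_norm (L2 \<mu>) n (\<lambda>i j. restrict mult (group_vn \<mu>) (T i j))"
    "\<forall>i<n. \<forall>j<n. T i j \<in> group_vn \<mu>" "matrix_norm (L2 \<mu>) n T \<le> 1"
    using assms unfolding cb_values_def by blast
  have "matrix_op (L2 \<mu>) n (\<lambda>i j. restrict mult (group_vn \<mu>) (T i j)) = matrix_op (L2 \<mu>) n (\<lambda>i j. mult (T i j))"
    unfolding matrix_op_def by (intro restrict_ext vsum_cong) (use nT(2) in simp)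
  then have "r = matrix_norm (L2 \<mu>) n (\<lambda>i j. mult (T i j))" unfolding nT(1) matrix_norm_def by simp
  also have "\<dots> \<le> A * B"
    by (rule mult_matrix_norm_le[OF _ nT(3)]) (use nT(2) group_vn_bounded in blast)
  finally show ?thesis .
qed

text \<open>The multiplier is \<open>\<sigma>\<close>-weakly continuous and multiplies each translation by a scalar, so it maps the
  closure of their span into itself.\<close>

theorem fourier_multiplier_map_exists: "fourier_multiplier_map \<mu> \<phi> (restrict mult (group_vn \<mu>))"
  unfolding fourier_multiplier_map_def
proof (intro conjI ballI allI)
  show "restrict mult (group_vn \<mu>) \<in> group_vn \<mu> \<rightarrow>\<^sub>E group_vn \<mu>" by (auto simp: mult_group_vn)
  show "restrict mult (group_vn \<mu>) (left_regular \<mu> g) = op_scale (L2 \<mu>) (\<phi> g) (left_regular \<mu> g)" for g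
    by (simp add: left_regular_in_group_vn mult_left_regular)
  show "completely_bounded (L2 \<mu>) (group_vn \<mu>) (restrict mult (group_vn \<mu>))"
    unfolding completely_bounded_def by (rule bdd_aboveI[OF cb_values_le])
  have "continuous_map (subtopology (sigma_weak_topology (L2 \<mu>)) (group_vn \<mu>)) (subtopology (sigma_weak_topology (L2 \<mu>)) (group_vn \<mu>)) mult"
    by (intro continuous_map_into_subtopology continuous_map_from_subtopology mult_continuous) (auto simp: mult_group_vn)
  then show "continuous_map (subtopology (sigma_weak_topology (L2 \<mu>)) (group_vn \<mu>)) (subtopology (sigma_weak_topology (L2 \<mu>)) (group_vn \<mu>)) (restrict mult (group_vn \<mu>))"
    by (rule continuous_map_eq) simp
  fix S assume S: "S \<in> group_vn \<mu>"
  have Sb: "S \<in> bounded_ops (L2 \<mu>)" using group_vn_bounded S by blast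
  have "op_scale (L2 \<mu>) \<alpha> S \<in> group_vn \<mu>" for \<alpha>
    using L.weak_closure_scale[OF range_left_regular S[unfolded group_vn_def]] unfolding group_vn_def .
  then show "restrict mult (group_vn \<mu>) (op_scale (L2 \<mu>) \<alpha> S) = op_scale (L2 \<mu>) \<alpha> (restrict mult (group_vn \<mu>) S)" for \<alpha>
    using S by (simp add: mult_op_scale[OF Sb])
  fix T assume T: "T \<in> group_vn \<mu>"
  have Tb: "T \<in> bounded_ops (L2 \<mu>)" using group_vn_bounded T by blast
  have "op_add (L2 \<mu>) S T \<in> group_vn \<mu>"
    using L.weak_closure_add[OF range_left_regular S[unfolded group_vn_def] T[unfolded group_vn_def]] unfolding group_vn_def .
  then show "restrict mult (group_vn \<mu>) (op_add (L2 \<mu>) S T) = op_add (L2 \<mu>) (restrict mult (group_vn \<mu>) S) (restrict mult (group_vn \<mu>) T)"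
    using S T by (simp add: mult_op_add[OF Sb Tb])
qed

lemma the_fourier_multiplier_map: "(THE M. fourier_multiplier_map \<mu> \<phi> M) = restrict mult (group_vn \<mu>)"
  using fourier_multiplier_map_exists fourier_multiplier_map_unique by (intro the_equality) blast+

lemma m0a_norm_le: "m0a_norm \<mu> \<phi> \<le> A * B"
  unfolding m0a_norm_def cb_norm_def the_fourier_multiplier_map
proof (rule cSup_least[OF _ cb_values_le])
  have "matrix_norm (L2 \<mu>) 0 (\<lambda>_ _. undefined) \<le> 1"
    unfolding matrix_norm_def
    by (rule inner_product_space.op_norm_le[OF inner_product_space_power[OF inner_product_space_L2]])
      (simp_all add: vnorm_def power_space_simps)
  then have "matrix_norm (L2 \<mu>) 0 (\<lambda>i j. restrict mult (group_vn \<mu>) undefined) \<in> cb_values (L2 \<mu>) (group_vn \<mu>) (restrict mult (group_vn \<mu>))"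
    unfolding cb_values_def by (intro CollectI exI[of _ 0] exI[of _ "\<lambda>_ _. undefined"]) simp
  then show "cb_values (L2 \<mu>) (group_vn \<mu>) (restrict mult (group_vn \<mu>)) \<noteq> {}" by blast
qed

end

section \<open>The completely bounded norm dominates the Schur bound\<close>

context inner_product_space
begin

lemma scale_scale: "v \<in> vecs H \<Longrightarrow> vscale H \<alpha> (vscale H \<beta> v) = vscale H (\<alpha> * \<beta>) v"
  by (rule vec_eqI) (simp_all add: scale_closed ip_scale_left)

lemma op_vsum:
  assumes T: "T \<in> bounded_ops H"
  shows "(\<And>j. j < n \<Longrightarrow> v j \<in> vecs H) \<Longrightarrow> T (vsum H v n) = vsum H (\<lambda>j. T (v j)) n"
proof (induction n)
  case 0
  have "T (vscale H 0 (vzero H)) = vscale H 0 (T (vzero H))" using T zero_closed unfolding bounded_ops_def by blast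
  then show ?case by (simp add: scale_zero zero_closed bounded_opsD(2)[OF T])
next
  case (Suc n)
  have "vsum H v n \<in> vecs H" "v n \<in> vecs H" using Suc.prems by (auto intro: vsum_closed)
  then have "T (vadd H (vsum H v n) (v n)) = vadd H (T (vsum H v n)) (T (v n))" using T unfolding bounded_ops_def by blast
  then show ?case using Suc by simp
qed

lemma vsum_scale_vec: "u \<in> vecs H \<Longrightarrow> vsum H (\<lambda>j. vscale H (\<beta> j) u) n = vscale H (\<Sum>j<n. \<beta> j) u"
  by (induction n) (simp_all add: scale_zero scale_add_left)

end

context left_invariant_measure
begin

lemma vsum_rep:
  assumes "\<And>j. j < n \<Longrightarrow> w j \<in> vecs (L2 \<mu>)"
  shows "AE x in \<mu>. l2_rep (vsum (L2 \<mu>) (\<lambda>j. vscale (L2 \<mu>) (\<beta> j) (w j)) n) x = (\<Sum>j<n. \<beta> j * l2_rep (w j) x)"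
  using assms
proof (induction n)
  case 0
  show ?case using l2_rep_class[OF l2_fun_zero[of \<mu>]] by (simp add: L2_simps(3))
next
  case (Suc n)
  let ?S = "vsum (L2 \<mu>) (\<lambda>j. vscale (L2 \<mu>) (\<beta> j) (w j)) n" and ?w = "vscale (L2 \<mu>) (\<beta> n) (w n)"
  have S: "?S \<in> vecs (L2 \<mu>)" using Suc.prems by (intro L.vsum_closed L.scale_closed) simp
  have wn: "w n \<in> vecs (L2 \<mu>)" using Suc.prems by simp
  have w: "?w \<in> vecs (L2 \<mu>)" by (rule L.scale_closed[OF wn])
  have "AE x in \<mu>. l2_rep (vadd (L2 \<mu>) ?S ?w) x = l2_rep ?S x + l2_rep ?w x"
    unfolding L2_simps(2) by (rule l2_rep_class[OF l2_fun_add[OF vec_rep_fun[OF S] vec_rep_fun[OF w]]])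
  moreover have "AE x in \<mu>. l2_rep ?w x = \<beta> n * l2_rep (w n) x"
    unfolding L2_simps(4) by (rule l2_rep_class[OF l2_fun_scale[OF vec_rep_fun[OF wn]]])
  moreover have "AE x in \<mu>. l2_rep ?S x = (\<Sum>j<n. \<beta> j * l2_rep (w j) x)" using Suc by simp
  ultimately show ?case by eventually_elim simp
qed

text \<open>The inequality \<open>\<beta>\<close> holds at almost every point of the group and is integrated.\<close>

lemma scalar_matrix_contraction:
  assumes w: "\<And>j. j < n \<Longrightarrow> w j \<in> vecs (L2 \<mu>)"
    and \<beta>: "\<And>v. (\<Sum>i<n. (cmod (\<Sum>j<n. \<beta> i j * v j))\<^sup>2) \<le> (\<Sum>j<n. (cmod (v j))\<^sup>2)"
  shows "(\<Sum>i<n. L.sq (vsum (L2 \<mu>) (\<lambda>j. vscale (L2 \<mu>) (\<beta> i j) (w j)) n)) \<le> (\<Sum>j<n. L.sq (w j))"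
proof -
  let ?S = "\<lambda>i. vsum (L2 \<mu>) (\<lambda>j. vscale (L2 \<mu>) (\<beta> i j) (w j)) n"
  have S: "?S i \<in> vecs (L2 \<mu>)" for i by (intro L.vsum_closed L.scale_closed w)
  have iS: "integrable \<mu> (\<lambda>x. (cmod (l2_rep (?S i) x))\<^sup>2)" for i by (rule l2_funD(2)[OF vec_rep_fun[OF S]])
  have iw: "integrable \<mu> (\<lambda>x. (cmod (l2_rep (w j) x))\<^sup>2)" if "j < n" for j by (rule l2_funD(2)[OF vec_rep_fun[OF w[OF that]]])
  have "(\<Sum>i<n. L.sq (?S i)) = (\<integral>x. (\<Sum>i<n. (cmod (l2_rep (?S i) x))\<^sup>2) \<partial>\<mu>)"
    unfolding sq_integral by (rule Bochner_Integration.integral_sum[OF iS, symmetric])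
  also have "\<dots> \<le> (\<integral>x. (\<Sum>j<n. (cmod (l2_rep (w j) x))\<^sup>2) \<partial>\<mu>)"
  proof (rule integral_mono_AE[OF Bochner_Integration.integrable_sum[OF iS] Bochner_Integration.integrable_sum[OF iw]])
    have "AE x in \<mu>. \<forall>i\<in>{..<n}. l2_rep (?S i) x = (\<Sum>j<n. \<beta> i j * l2_rep (w j) x)"
      by (rule AE_finite_allI[OF _ vsum_rep[OF w]]) simp_all
    then show "AE x in \<mu>. (\<Sum>i<n. (cmod (l2_rep (?S i) x))\<^sup>2) \<le> (\<Sum>j<n. (cmod (l2_rep (w j) x))\<^sup>2)"
    proof eventually_elim
      case (elim x)
      then have "(\<Sum>i<n. (cmod (l2_rep (?S i) x))\<^sup>2) = (\<Sum>i<n. (cmod (\<Sum>j<n. \<beta> i j * l2_rep (w j) x))\<^sup>2)"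
        by (intro sum.cong refl) simp
      also have "\<dots> \<le> (\<Sum>j<n. (cmod (l2_rep (w j) x))\<^sup>2)" by (rule \<beta>)
      finally show ?case .
    qed
  qed simp_all
  also have "\<dots> = (\<Sum>j<n. L.sq (w j))"
    unfolding sq_integral by (rule Bochner_Integration.integral_sum[OF iw]) simp
  finally show ?thesis .
qed

text \<open>  A scalar contraction \<open>\<beta>\<close> becomes the matrix of operators \<open>\<beta> i j\<close> times translation by \<open>- h i + h j\<close>. It is
  \<open>\<beta>\<close> conjugated by a diagonal matrix of translations, which are isometric, so it is a contraction. The
  Fourier multiplier turns it into the corresponding matrix for the Schur product of \<open>\<beta>\<close> with \<open>\<phi>\<close>.\<close>

lemma fourier_multiplier_schur_row:
  fixes n :: nat
  assumes M: "fourier_multiplier_map \<mu> \<phi> M" and \<omega>: "\<omega> \<in> vecs (L2 \<mu>)" "L.sq \<omega> > 0"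
    and \<beta>: "\<And>v. (\<Sum>i<n. (cmod (\<Sum>j<n. \<beta> i j * v j))\<^sup>2) \<le> (\<Sum>j<n. (cmod (v j))\<^sup>2)"
  shows "L2_set (\<lambda>i. cmod (\<Sum>j<n. \<phi> (- h i + h j) * \<beta> i j * s j)) {..<n}
    \<le> cb_norm (L2 \<mu>) (group_vn \<mu>) M * L2_set (\<lambda>j. cmod (s j)) {..<n}"
proof -
  interpret K: inner_product_space "power_space n (L2 \<mu>)" by (rule inner_product_space_power[OF inner_product_space_L2])
  define T where "T = (\<lambda>i j. op_scale (L2 \<mu>) (\<beta> i j) (left_regular \<mu> (- h i + h j)))"
  have T_vn: "T i j \<in> group_vn \<mu>" for i j
    unfolding T_def group_vn_def
    by (rule L.weak_closure_scale[OF range_left_regular left_regular_in_group_vn[unfolded group_vn_def]])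
  have Tb: "T i j \<in> bounded_ops (L2 \<mu>)" for i j using T_vn group_vn_bounded by blast
  have T_apply: "T i j v = vscale (L2 \<mu>) (\<beta> i j) (left_regular \<mu> (- h i) (left_regular \<mu> (h j) v))" if "v \<in> vecs (L2 \<mu>)" for i j v
    using that left_regular_plus[OF that] unfolding T_def op_scale_def by simp
  have lr_scale: "left_regular \<mu> g (vscale (L2 \<mu>) \<alpha> v) = vscale (L2 \<mu>) \<alpha> (left_regular \<mu> g v)" if "v \<in> vecs (L2 \<mu>)" for g \<alpha> v
    using left_regular_bounded[of g] that unfolding bounded_ops_def by blast
  have "matrix_norm (L2 \<mu>) n T \<le> 1"
    unfolding matrix_norm_def
  proof (rule K.op_norm_le)
    fix v assume v: "v \<in> vecs (power_space n (L2 \<mu>))"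
    define w where "w = (\<lambda>j. left_regular \<mu> (h j) (v j))"
    note vj = L.power_mem[OF v]
    have w: "w j \<in> vecs (L2 \<mu>)" if "j < n" for j unfolding w_def by (rule left_regular_closed[OF vj[OF that]])
    have S: "vsum (L2 \<mu>) (\<lambda>j. vscale (L2 \<mu>) (\<beta> i j) (w j)) n \<in> vecs (L2 \<mu>)" for i by (intro L.vsum_closed L.scale_closed w)
    have comp: "matrix_op (L2 \<mu>) n T v i = left_regular \<mu> (- h i) (vsum (L2 \<mu>) (\<lambda>j. vscale (L2 \<mu>) (\<beta> i j) (w j)) n)" if i: "i < n" for i
    proof -
      have "matrix_op (L2 \<mu>) n T v i = vsum (L2 \<mu>) (\<lambda>j. left_regular \<mu> (- h i) (vscale (L2 \<mu>) (\<beta> i j) (w j))) n"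
        unfolding L.matrix_op_apply[OF v i]
        by (rule vsum_cong) (simp add: T_apply vj lr_scale w, simp add: w_def)
      also have "\<dots> = left_regular \<mu> (- h i) (vsum (L2 \<mu>) (\<lambda>j. vscale (L2 \<mu>) (\<beta> i j) (w j)) n)"
        by (rule L.op_vsum[OF left_regular_bounded L.scale_closed[OF w], symmetric])
      finally show ?thesis .
    qed
    have "K.sq (matrix_op (L2 \<mu>) n T v) = (\<Sum>i<n. L.sq (vsum (L2 \<mu>) (\<lambda>j. vscale (L2 \<mu>) (\<beta> i j) (w j)) n))"
      unfolding L.sq_power by (rule sum.cong) (simp_all add: comp left_regular_sq S)
    also have "\<dots> \<le> (\<Sum>j<n. L.sq (w j))" by (rule scalar_matrix_contraction[OF w \<beta>])
    also have "\<dots> = K.sq v" unfolding L.sq_power by (rule sum.cong) (simp_all add: w_def left_regular_sq vj)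
    finally show "vnorm (power_space n (L2 \<mu>)) (matrix_op (L2 \<mu>) n T v) \<le> 1 * vnorm (power_space n (L2 \<mu>)) v"
      unfolding K.vnorm_eq by simp
  qed simp
  then have "matrix_norm (L2 \<mu>) n (\<lambda>i j. M (T i j)) \<in> cb_values (L2 \<mu>) (group_vn \<mu>) M"
    unfolding cb_values_def using T_vn by blast
  moreover have "bdd_above (cb_values (L2 \<mu>) (group_vn \<mu>) M)"
    using M unfolding fourier_multiplier_map_def completely_bounded_def by (elim conjE)
  ultimately have norm_le: "matrix_norm (L2 \<mu>) n (\<lambda>i j. M (T i j)) \<le> cb_norm (L2 \<mu>) (group_vn \<mu>) M"
    unfolding cb_norm_def by (rule cSup_upper)
  have MT: "M (T i j) = op_scale (L2 \<mu>) (\<beta> i j) (op_scale (L2 \<mu>) (\<phi> (- h i + h j)) (left_regular \<mu> (- h i + h j)))" for i j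
  proof -
    have "M (T i j) = op_scale (L2 \<mu>) (\<beta> i j) (M (left_regular \<mu> (- h i + h j)))"
      using M left_regular_in_group_vn unfolding fourier_multiplier_map_def T_def by blast
    also have "M (left_regular \<mu> (- h i + h j)) = op_scale (L2 \<mu>) (\<phi> (- h i + h j)) (left_regular \<mu> (- h i + h j))"
      using M unfolding fourier_multiplier_map_def by blast
    finally show ?thesis .
  qed
  have MTb: "M (T i j) \<in> bounded_ops (L2 \<mu>)" for i j
    unfolding MT by (intro L.op_scale_bounded left_regular_bounded)
  \<comment> \<open>The matrix of operators \<open>M (T i j)\<close> is tested on a vector whose entries it moves into multiples of
    translates of the single vector \<open>\<omega>\<close>.\<close>
  define v where "v = (\<lambda>j\<in>{..<n}. vscale (L2 \<mu>) (s j) (left_regular \<mu> (- h j) \<omega>))"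
  define c where "c = (\<lambda>i. \<Sum>j<n. \<phi> (- h i + h j) * \<beta> i j * s j)"
  have lc: "left_regular \<mu> g \<omega> \<in> vecs (L2 \<mu>)" for g by (rule left_regular_closed[OF \<omega>(1)])
  have v: "v \<in> vecs (power_space n (L2 \<mu>))" unfolding power_space_simps v_def by (auto intro: L.scale_closed lc)
  have entry: "M (T i j) (v j) = vscale (L2 \<mu>) (\<phi> (- h i + h j) * \<beta> i j * s j) (left_regular \<mu> (- h i) \<omega>)" if "j < n" for i j
  proof -
    have "left_regular \<mu> (- h i + h j) (left_regular \<mu> (- h j) \<omega>) = left_regular \<mu> (- h i) \<omega>"
      unfolding left_regular_plus[OF \<omega>(1)] by (simp only: add.assoc right_minus add_0_right)
    then show ?thesis using that
      unfolding MT v_def op_scale_def by (simp add: lr_scale lc L.scale_closed L.scale_scale mult_ac)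
  qed
  have "matrix_op (L2 \<mu>) n (\<lambda>i j. M (T i j)) v i = vscale (L2 \<mu>) (c i) (left_regular \<mu> (- h i) \<omega>)" if i: "i < n" for i
    unfolding L.matrix_op_apply[OF v i] c_def L.vsum_scale_vec[OF lc, symmetric] by (rule vsum_cong[OF entry])
  then have "K.sq (matrix_op (L2 \<mu>) n (\<lambda>i j. M (T i j)) v) = (\<Sum>i<n. (cmod (c i))\<^sup>2 * L.sq \<omega>)"
    unfolding L.sq_power by (intro sum.cong refl) (simp add: L.sq_scale[OF lc] left_regular_sq[OF \<omega>(1)])
  then have 1: "vnorm (power_space n (L2 \<mu>)) (matrix_op (L2 \<mu>) n (\<lambda>i j. M (T i j)) v)
      = L2_set (\<lambda>i. cmod (c i)) {..<n} * sqrt (L.sq \<omega>)"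
    unfolding K.vnorm_eq L2_set_def by (simp add: sum_distrib_right[symmetric] real_sqrt_mult)
  have "K.sq v = (\<Sum>j<n. (cmod (s j))\<^sup>2 * L.sq \<omega>)"
    unfolding L.sq_power v_def by (intro sum.cong refl) (simp add: L.sq_scale[OF lc] left_regular_sq[OF \<omega>(1)])
  then have 2: "vnorm (power_space n (L2 \<mu>)) v = L2_set (\<lambda>j. cmod (s j)) {..<n} * sqrt (L.sq \<omega>)"
    unfolding K.vnorm_eq L2_set_def by (simp add: sum_distrib_right[symmetric] real_sqrt_mult)
  have "vnorm (power_space n (L2 \<mu>)) (matrix_op (L2 \<mu>) n (\<lambda>i j. M (T i j)) v)
      \<le> matrix_norm (L2 \<mu>) n (\<lambda>i j. M (T i j)) * vnorm (power_space n (L2 \<mu>)) v"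
    unfolding matrix_norm_def by (rule K.op_norm_bound[OF L.matrix_op_bounded[OF MTb] v])
  also have "\<dots> \<le> cb_norm (L2 \<mu>) (group_vn \<mu>) M * vnorm (power_space n (L2 \<mu>)) v"
    by (rule mult_right_mono[OF norm_le]) (simp add: 2 \<omega>(2) less_imp_le)
  finally show ?thesis
    unfolding 1 2 mult.assoc[symmetric] c_def using \<omega>(2) by simp
qed

text \<open>This is the half of the theorem of Bozejko and Fendler that bounds the Schur norm by the completely
  bounded norm. The transposed matrix appears because the first index of \<open>a\<close> is summed against \<open>s\<close>.\<close>

lemma fourier_multiplier_schur_bounded:
  assumes M: "fourier_multiplier_map \<mu> \<phi> M" and \<omega>: "\<omega> \<in> vecs (L2 \<mu>)" "L.sq \<omega> > 0"
  shows "schur_bounded (\<lambda>x y. \<phi> (- y + x)) (cb_norm (L2 \<mu>) (group_vn \<mu>) M)"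
  unfolding schur_bounded_def
proof (intro allI impI)
  fix F :: "'g set" and a s t
  assume F: "finite F" and a: "\<forall>s t. cmod (\<Sum>x\<in>F. \<Sum>y\<in>F. a x y * s x * cnj (t y))
      \<le> L2_set (\<lambda>x. cmod (s x)) F * L2_set (\<lambda>y. cmod (t y)) F"
  have contr: "contractive_matrix F (\<lambda>x y. a y x)"
    unfolding contractive_matrix_def
  proof (intro allI)
    fix u v :: "'g \<Rightarrow> complex"
    have "(\<Sum>x\<in>F. \<Sum>y\<in>F. a y x * u x * cnj (v y)) = (\<Sum>y\<in>F. \<Sum>x\<in>F. a y x * cnj (v y) * cnj (cnj (u x)))"
      by (subst sum.swap) (simp add: mult_ac)
    then show "cmod (\<Sum>x\<in>F. \<Sum>y\<in>F. a y x * u x * cnj (v y)) \<le> L2_set (\<lambda>x. cmod (u x)) F * L2_set (\<lambda>y. cmod (v y)) F"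
      using a[rule_format, of "\<lambda>y. cnj (v y)" "\<lambda>x. cnj (u x)"] by (simp add: mult.commute)
  qed
  define n where "n = card F"
  obtain h where h: "bij_betw h {..<n} F"
    using ex_bij_betw_nat_finite[OF F] unfolding n_def atLeast0LessThan by blast
  note re = sum.reindex_bij_betw[OF h]
  have set_re: "L2_set (\<lambda>i. r (h i)) {..<n} = L2_set r F" for r :: "'g \<Rightarrow> real"
    unfolding L2_set_def re[of "\<lambda>x. (r x)\<^sup>2"] ..
  define C where "C = (\<lambda>y. \<Sum>x\<in>F. \<phi> (- y + x) * a x y * s x)"
  have rows: "(\<Sum>i<n. (cmod (\<Sum>j<n. a (h j) (h i) * v j))\<^sup>2) \<le> (\<Sum>j<n. (cmod (v j))\<^sup>2)" for v
  proof -
    define v' where "v' = (\<lambda>x. v (inv_into {..<n} h x))"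
    have v': "v' (h j) = v j" if "j < n" for j
      using that h unfolding v'_def bij_betw_def by simp
    have "(\<Sum>x\<in>F. (cmod (\<Sum>y\<in>F. a y x * v' y))\<^sup>2) \<le> (\<Sum>y\<in>F. (cmod (v' y))\<^sup>2)"
      by (rule contractive_matrix_row_norm[OF F contr])
    then show ?thesis unfolding re[symmetric] using v' by simp
  qed
  have "L2_set (\<lambda>y. cmod (C y)) F \<le> cb_norm (L2 \<mu>) (group_vn \<mu>) M * L2_set (\<lambda>x. cmod (s x)) F"
    using fourier_multiplier_schur_row[OF M \<omega>, where n = n and h = h and s = "\<lambda>j. s (h j)", OF rows]
    unfolding set_re[of "\<lambda>x. cmod (s x)"] re[of "\<lambda>x. \<phi> (- h i + x) * a x (h i) * s x" for i]
      C_def[symmetric] set_re[of "\<lambda>y. cmod (C y)"] set_re[of "\<lambda>y. cmod (\<Sum>x\<in>F. \<phi> (- y + x) * a x y * s x)"] unfolding C_def .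
  note row = this
  have "(\<Sum>x\<in>F. \<Sum>y\<in>F. \<phi> (- y + x) * a x y * s x * cnj (t y)) = (\<Sum>y\<in>F. C y * cnj (t y))"
    unfolding C_def sum_distrib_right by (rule sum.swap)
  then have "cmod (\<Sum>x\<in>F. \<Sum>y\<in>F. \<phi> (- y + x) * a x y * s x * cnj (t y)) = cmod (\<Sum>y\<in>F. C y * cnj (t y))"
    by (rule arg_cong)
  also have "\<dots> \<le> (\<Sum>y\<in>F. \<bar>cmod (C y)\<bar> * \<bar>cmod (t y)\<bar>)"
    by (rule order_trans[OF norm_sum]) (simp add: norm_mult)
  also have "\<dots> \<le> L2_set (\<lambda>y. cmod (C y)) F * L2_set (\<lambda>y. cmod (t y)) F" by (rule L2_set_mult_ineq)
  also have "\<dots> \<le> cb_norm (L2 \<mu>) (group_vn \<mu>) M * L2_set (\<lambda>x. cmod (s x)) F * L2_set (\<lambda>y. cmod (t y)) F"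
    by (rule mult_right_mono[OF row]) simp
  finally show "cmod (\<Sum>x\<in>F. \<Sum>y\<in>F. \<phi> (- y + x) * a x y * s x * cnj (t y))
      \<le> cb_norm (L2 \<mu>) (group_vn \<mu>) M * L2_set (\<lambda>x. cmod (s x)) F * L2_set (\<lambda>y. cmod (t y)) F" .
qed

end

section \<open>The representation on its carrier\<close>

lemma (in hilbert_space) inner_product_space: "inner_product_space H"
  by unfold_locales
    (fact zero_closed add_closed scale_closed add_assoc add_commute add_zero scale_add_left scale_one
      ip_add_left ip_scale_left ip_commute ip_nonneg ip_eq_zero)+

context kernel_representation
begin

abbreviation H :: "separable_hspace" where "H \<equiv> hspace_of M"
abbreviation rep_op :: "'g \<Rightarrow> (nat \<Rightarrow> complex) \<Rightarrow> nat \<Rightarrow> complex" where "rep_op g \<equiv> op_of M (rep g)"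

lemma rep_op_bounded: "rep_op g \<in> bounded_ops H"
  by (rule op_of_bounded[OF M rep(1) rep_add rep_scaleC rep(2)])

lemma rep_op_norm: "op_norm H (rep_op g) \<le> N g"
proof (rule inner_product_space.op_norm_le[OF hilbert_space.inner_product_space[OF hilbert_space_hspace_of[OF M]]])
  show "0 \<le> N g" using N_pos[of g] by simp
  fix v assume "v \<in> vecs H"
  then obtain x where "x \<in> M" "v = coord x" by auto
  then show "vnorm H (rep_op g v) \<le> N g * vnorm H v" by (simp add: rep(2))
qed

lemma rep_op_plus: "rep_op (g + h) = compose (vecs H) (rep_op g) (rep_op h)"
  unfolding hspace_of_simps compose_op_of[of M "rep h" "rep g", OF rep(1)] by (rule op_of_cong[OF rep_plus])

lemma rep_op_zero: "rep_op 0 = id_op H"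
  unfolding id_op_hspace_of by (rule op_of_cong[OF rep_zero])

lemma rep_op_invertible: "rep_op g \<in> invertible_ops H"
  unfolding invertible_ops_def
  using rep_op_bounded rep_op_plus[of "- g" g, symmetric] rep_op_plus[of g "- g", symmetric]
  by (auto intro!: bexI[of _ "rep_op (- g)"] simp: rep_op_zero)

lemma strongly_continuous_rep_op: "strongly_continuous_rep H rep_op"
  unfolding strongly_continuous_rep_def group_rep_def
proof (intro conjI allI)
  show "hilbert_space H" by (rule hilbert_space_hspace_of[OF M])
  show "range rep_op \<subseteq> invertible_ops H" using rep_op_invertible by blast
  show "rep_op (g + h) = compose (vecs H) (rep_op g) (rep_op h)" for g h by (rule rep_op_plus)
  interpret m: Metric_space "coord ` M" "vdist H" by (rule Metric_space_hspace_of)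
  show "continuous_map euclidean (strong_topology H) rep_op"
    unfolding strong_topology_def
  proof (rule continuous_on_generated_topo)
    fix S assume "S \<in> {{T \<in> bounded_ops H. T v \<in> U} | v U.
        v \<in> vecs H \<and> openin (Metric_space.mtopology (vecs H) (vdist H)) U}"
    then obtain v U where S: "S = {T \<in> bounded_ops H. T v \<in> U}" and v: "v \<in> coord ` M" and U: "openin m.mtopology U"
      by auto
    from v obtain x where x: "x \<in> M" "v = coord x" by blast
    have "open {g. coord (rep g x) \<in> U}"
    proof (subst open_subopen, intro ballI)
      fix g assume "g \<in> {g. coord (rep g x) \<in> U}"
      then obtain r where r: "r > 0" "m.mball (coord (rep g x)) r \<subseteq> U" using U unfolding m.openin_mtopology by blast
      show "\<exists>T. open T \<and> g \<in> T \<and> T \<subseteq> {g. coord (rep g x) \<in> U}"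
      proof (intro exI conjI)
        show "open {h. dist (rep g x) (rep h x) < r}"
          by (intro open_Collect_less continuous_intros rep_continuous[OF x(1)])
        show "g \<in> {h. dist (rep g x) (rep h x) < r}" using r(1) by simp
        show "{h. dist (rep g x) (rep h x) < r} \<subseteq> {g. coord (rep g x) \<in> U}"
          using r(2) by (auto simp: rep(1) vdist_hspace_of)
      qed
    qed
    moreover have "rep_op -` S \<inter> topspace euclidean = {g. coord (rep g x) \<in> U}"
      using S x rep_op_bounded by auto
    ultimately show "openin euclidean (rep_op -` S \<inter> topspace euclidean)" by simp
  next
    have "bounded_ops H \<in> {{T \<in> bounded_ops H. T v \<in> U} | v U.
        v \<in> vecs H \<and> openin (Metric_space.mtopology (vecs H) (vdist H)) U}"
    proof (intro CollectI exI conjI)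
      show "coord 0 \<in> vecs H" using closed_csubspaceD(2)[OF M] by simp
      show "openin (Metric_space.mtopology (vecs H) (vdist H)) (coord ` M)"
        using openin_topspace[of m.mtopology] by simp
      show "bounded_ops H = {T \<in> bounded_ops H. T (coord 0) \<in> coord ` M}"
        using closed_csubspaceD(2)[OF M] unfolding bounded_ops_def by auto
    qed
    then show "rep_op ` topspace euclidean \<subseteq> \<Union> {{T \<in> bounded_ops H. T v \<in> U} | v U.
        v \<in> vecs H \<and> openin (Metric_space.mtopology (vecs H) (vdist H)) U}"
      using rep_op_bounded by blast
  qed
qed

text \<open>These two equations identify the orbits of \<open>\<xi>\<close> and \<open>\<eta>\<close> with the two factors of the kernel.\<close>

lemma rep_op_P: "rep_op g (coord (P 0)) = coord (P g)"
  by (simp add: P_in_M rep_P)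

lemma adjoint_rep_op_Q: "adjoint_op H (rep_op (- y)) (coord (Q 0)) = coord (Q y)"
proof -
  have "op_of M (backward (- y)) \<in> bounded_ops H"
    by (rule op_of_bounded[OF M backward(1) backward_add backward_scaleC backward(2)])
  then have "adjoint_op H (rep_op (- y)) = op_of M (backward (- y))"
    by (rule adjoint_op_of[OF M _ backward(1) rep_adjoint])
  then show ?thesis by (simp add: Q(1) backward_Q)
qed

lemma coord_P_continuous: "continuous_on UNIV (\<lambda>x. coord (P x) n)"
  unfolding cip_unit_vec[symmetric] by (rule cip.continuous_on[OF P_continuous continuous_on_const])

lemma coord_Q_continuous: "continuous_on UNIV (\<lambda>x. coord (Q x) n)"
  unfolding cip_unit_vec[symmetric] by (rule Q_weakly_continuous)

end

text \<open>The averaged kernel is continuous and positive semidefinite, so it has continuous Gram vectors; the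
  exponent is halved because \<open>avg_translate\<close> bounds squares of norms.\<close>

lemma (in weighted_haar) kernel_representation_of_schur_bounded:
  assumes \<phi>: "continuous_on UNIV \<phi>" and k: "schur_bounded (\<lambda>x y. \<phi> (- y + x)) k"
  shows "\<exists>P. kernel_representation P (\<lambda>g. exp (c / 2 * L g)) \<phi> k"
proof -
  obtain f :: "'g \<Rightarrow> nat l2" where f: "\<And>v. continuous_on UNIV (\<lambda>x. cip (f x) v)" "\<And>x. (norm (f x))\<^sup>2 \<le> k"
    and dom: "\<And>F c g y. finite F \<Longrightarrow> (cmod (\<Sum>x\<in>F. c x * \<phi> (- y + g x)))\<^sup>2 \<le> k * (norm (lincomb (\<lambda>x :: 'g. f (g x)) F c))\<^sup>2"
    by (rule weakly_continuous_factor[OF \<phi> k]) blast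
  obtain P :: "'g \<Rightarrow> nat l2" where P: "\<And>x y. avg f x y = cip (P x) (P y)" "continuous_on UNIV P"
    by (rule gram_continuous[OF psd_avg[OF f] avg_continuous[OF f] avg_diagonal_continuous[OF f]]) blast
  have form: "Re (\<Sum>x\<in>F. \<Sum>y\<in>F. b x * cnj (b y) * avg f (g x) (g y)) = (norm (lincomb (\<lambda>x. P (g x)) F b))\<^sup>2" for F b g
    unfolding P(1) norm_lincomb by simp
  have "kernel_representation P (\<lambda>g. exp (c / 2 * L g)) \<phi> k"
  proof
    show "continuous_on UNIV P" by (rule P(2))
    show "(norm (P x))\<^sup>2 \<le> k" for x
      using avg_diagonal_le[OF f, of x] unfolding P(1) cip_self_norm by simp
    show "norm (lincomb (\<lambda>x. P (g + x)) F b) \<le> exp (c / 2 * L g) * norm (lincomb P F b)" if F: "finite F" for F b g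
    proof (rule power2_le_imp_le)
      have "exp (c * L g) = (exp (c / 2 * L g))\<^sup>2" by (simp add: exp_double[symmetric])
      then show "(norm (lincomb (\<lambda>x. P (g + x)) F b))\<^sup>2 \<le> (exp (c / 2 * L g) * norm (lincomb P F b))\<^sup>2"
        using avg_translate[OF f F, of b g] unfolding form[of b "\<lambda>x. g + x"] form[of b "\<lambda>x. x"] power_mult_distrib by simp
    qed simp
    show "continuous_on UNIV (\<lambda>g. exp (c / 2 * L g))" by (intro continuous_intros L_continuous)
    show "(cmod (\<Sum>x\<in>F. b x * \<phi> (- y + x)))\<^sup>2 \<le> k * (norm (lincomb P F b))\<^sup>2" if F: "finite F" for F b y
      using avg_dominates[OF f F dom[OF F], of b y] unfolding form[of b "\<lambda>x. x"] .
  qed (simp_all add: \<phi>)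
  from exI[where P = "\<lambda>P. kernel_representation P (\<lambda>g. exp (c / 2 * L g)) \<phi> k", OF this] show ?thesis .
qed

section \<open>Exponential growth\<close>

locale exponential_growth = left_invariant_measure \<mu>
  for \<mu> :: "'g :: {topological_group_add, t2_space, second_countable_topology} measure" +
  fixes d :: "'g \<Rightarrow> 'g \<Rightarrow> real" and a b :: real
  assumes metric: "Metric_space UNIV d" and topology: "Metric_space.mtopology UNIV d = euclidean"
    and d_invariant: "\<And>g x y. d (g + x) (g + y) = d x y"
    and growth: "\<And>n::nat. emeasure \<mu> (Metric_space.mball UNIV d 0 (real n)) \<le> ennreal (a * exp (b * real n))"
    and a_pos: "a > 0" and nonzero: "emeasure \<mu> UNIV \<noteq> 0"
begin

sublocale d: Metric_space UNIV d by (rule metric)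

lemma ball_sets: "d.mball 0 r \<in> sets \<mu>"
  using d.openin_mball[of 0 r] unfolding topology sets_mu by simp

lemma length_continuous: "continuous_on UNIV (\<lambda>u. d u 0)"
proof (rule continuous_on_UNIV_sequentiallyI)
  fix s :: "nat \<Rightarrow> 'g" and x assume s: "s \<longlonglongrightarrow> x"
  show "(\<lambda>n. d (s n) 0) \<longlonglongrightarrow> d x 0"
  proof (rule tendstoI)
    fix e :: real assume e: "e > 0"
    have "open (d.mball x e)" using d.openin_mball[of x e] unfolding topology by simp
    then have "eventually (\<lambda>n. s n \<in> d.mball x e) sequentially" by (rule topological_tendstoD[OF s]) (simp add: e)
    then show "eventually (\<lambda>n. dist (d (s n) 0) (d x 0) < e) sequentially"
    proof eventually_elim
      case (elim n)
      then show ?case using d.triangle[of x "s n" 0] d.triangle[of "s n" x 0] d.commute[of x "s n"] by (simp add: dist_real_def)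
    qed
  qed
qed

text \<open>On the annulus between the radii \<open>n\<close> and \<open>n + 1\<close> the weight is at most \<open>exp (- c * n)\<close>. The growth
  condition then bounds the integral by a geometric series of ratio \<open>exp (b - c)\<close>.\<close>

lemma weight_integrable:
  assumes c: "c > b" and c_nonneg: "c \<ge> 0"
  shows "integrable \<mu> (\<lambda>u. exp (- c * d u 0))"
proof (rule integrableI_bounded)
  show "(\<lambda>u. exp (- c * d u 0)) \<in> borel_measurable \<mu>"
    by (intro measurable_mu borel_measurable_continuous_onI continuous_intros length_continuous)
  let ?w = "\<lambda>n::nat. exp (- c * real n)" and ?B = "\<lambda>n::nat. d.mball 0 (real n)"
  have pt: "ennreal (exp (- c * d u 0)) \<le> (\<Sum>n. ennreal (?w n) * indicator (?B (Suc n)) u)" for u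
  proof -
    define n where "n = nat \<lfloor>d u 0\<rfloor>"
    have n: "real n \<le> d u 0" "d u 0 < real (Suc n)" unfolding n_def using d.nonneg[of u 0] by linarith+
    have "ennreal (exp (- c * d u 0)) \<le> ennreal (?w n) * indicator (?B (Suc n)) u"
      using n c c_nonneg by (simp add: d.commute ennreal_leI mult_left_mono)
    also have "\<dots> = (\<Sum>m\<in>{n}. ennreal (?w m) * indicator (?B (Suc m)) u)"
      by (simp only: sum.insert[OF finite.emptyI] empty_iff not_False_eq_True sum.empty add_0_right)
    also have "\<dots> \<le> (\<Sum>n. ennreal (?w n) * indicator (?B (Suc n)) u)"
      by (rule sum_le_suminf[OF summableI]) simp_all
    finally show ?thesis .
  qed
  have "(\<integral>\<^sup>+u. ennreal (norm (exp (- c * d u 0))) \<partial>\<mu>) \<le> (\<integral>\<^sup>+u. (\<Sum>n. ennreal (?w n) * indicator (?B (Suc n)) u) \<partial>\<mu>)"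
    by (rule nn_integral_mono) (use pt in simp)
  also have "\<dots> = (\<Sum>n. \<integral>\<^sup>+u. ennreal (?w n) * indicator (?B (Suc n)) u \<partial>\<mu>)"
    by (rule nn_integral_suminf) (intro borel_measurable_times_ennreal borel_measurable_const borel_measurable_indicator ball_sets)
  also have "\<dots> = (\<Sum>n. ennreal (?w n) * emeasure \<mu> (?B (Suc n)))"
    by (rule arg_cong[of _ _ suminf]) (intro ext nn_integral_cmult_indicator ball_sets)
  also have "\<dots> \<le> (\<Sum>n. ennreal (a * exp b * exp (b - c) ^ n))"
  proof (rule suminf_le[OF _ summableI summableI])
    fix n
    have "ennreal (?w n) * emeasure \<mu> (?B (Suc n)) \<le> ennreal (?w n) * ennreal (a * exp (b * real (Suc n)))"
      by (rule mult_left_mono[OF growth]) simp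
    also have "\<dots> = ennreal (?w n * (a * exp (b * real (Suc n))))"
      by (rule ennreal_mult[symmetric]) (use a_pos in simp_all)
    also have "?w n * (a * exp (b * real (Suc n))) = a * exp b * exp (b - c) ^ n"
      unfolding exp_of_nat_mult[symmetric] by (simp add: exp_add[symmetric] algebra_simps)
    finally show "ennreal (?w n) * emeasure \<mu> (?B (Suc n)) \<le> ennreal (a * exp b * exp (b - c) ^ n)" .
  qed
  also have "\<dots> = ennreal (\<Sum>n. a * exp b * exp (b - c) ^ n)"
    by (rule suminf_ennreal2) (use a_pos c in \<open>simp_all add: summable_mult summable_geometric\<close>)
  also have "\<dots> < \<infinity>" by simp
  finally show "(\<integral>\<^sup>+u. ennreal (norm (exp (- c * d u 0))) \<partial>\<mu>) < \<infinity>" .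
qed

lemma length_triangle: "d v 0 \<le> d g 0 + d (g + v) 0"
proof -
  have "d v (- g) = d (g + v) 0" using d_invariant[of g v "- g"] by simp
  moreover have "d (- g) 0 = d g 0" using d_invariant[of g "- g" 0] d.commute[of 0 g] by simp
  ultimately show ?thesis using d.triangle[of v "- g" 0] by simp
qed

text \<open>The indicator function of a ball of positive measure. It serves as the vector on which the
  Fourier multiplier is tested.\<close>

lemma ex_nonzero_vector: "\<exists>F\<in>vecs (L2 \<mu>). L.sq F > 0"
proof -
  have "(\<Union>n::nat. d.mball 0 (real n)) = UNIV" using reals_Archimedean2 by auto
  then obtain n :: nat where n: "emeasure \<mu> (d.mball 0 (real n)) \<noteq> 0"
    using emeasure_UN_eq_0[of \<mu> "\<lambda>n. d.mball 0 (real n)"] nonzero ball_sets by auto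
  have fin: "emeasure \<mu> (d.mball 0 (real n)) < \<infinity>"
    using growth[of n] by (rule le_less_trans) simp
  define f where "f = (indicator (d.mball 0 (real n)) :: 'g \<Rightarrow> complex)"
  have sq: "(\<lambda>x. (cmod (f x))\<^sup>2) = indicator (d.mball 0 (real n))" unfolding f_def by (auto simp: indicator_def fun_eq_iff)
  have "f \<in> borel_measurable \<mu>" unfolding f_def by (rule borel_measurable_indicator[OF ball_sets])
  moreover have "integrable \<mu> (indicator (d.mball 0 (real n)) :: 'g \<Rightarrow> real)"
    using ball_sets fin by (intro integrable_real_indicator) simp_all
  ultimately have f: "f \<in> l2_fun \<mu>" unfolding l2_fun_def mem_Collect_eq sq by (rule conjI)
  have "L.sq (l2_class \<mu> f) = measure \<mu> (d.mball 0 (real n))"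
    unfolding sq_class[OF f] sq using ball_sets fin by simp
  also have "\<dots> > 0" using n fin by (simp add: measure_def enn2real_positive_iff zero_less_iff_neq_zero)
  finally show ?thesis using l2_class_vec[OF f] by blast
qed

text \<open>  The construction is carried out twice. Starting from any Schur bound it gives a factorization, hence
  a Fourier multiplier, whose completely bounded norm \<open>k\<close> is then known to be a Schur bound itself. The
  second run, with this \<open>k\<close>, gives factors bounded by \<open>sqrt k\<close>. If one of the two suprema were smaller, the
  product of the bounds would be less than \<open>k\<close>, contrary to \<open>m0a_norm_le\<close>.\<close>

theorem representation_of_herz_schur_multiplier:
  assumes \<phi>: "herz_schur_multiplier \<phi>" and c: "c > b" "c \<ge> 0"
  shows "\<exists>(H :: separable_hspace) \<pi> \<xi> \<eta>. represents \<mu> \<phi> H \<pi> \<xi> \<eta> \<and> (\<forall>g. op_norm H (\<pi> g) \<le> exp (c / 2 * d g 0))"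
proof -
  have cont: "continuous_on UNIV \<phi>" using \<phi> unfolding herz_schur_multiplier_def by blast
  interpret weighted_haar \<mu> "\<lambda>g. d g 0" c
    by unfold_locales (rule length_continuous length_triangle c weight_integrable nonzero)+
  define k where "k = m0a_norm \<mu> \<phi>"
  have k: "schur_bounded (\<lambda>x y. \<phi> (- y + x)) k"
  proof -
    obtain k0 where k0: "schur_bounded (\<lambda>x y. \<phi> (- y + x)) k0"
      using schur_multiplier_schur_bounded \<phi> unfolding herz_schur_multiplier_def by blast
    obtain P0 where P0: "kernel_representation P0 (\<lambda>g. exp (c / 2 * d g 0)) \<phi> k0"
      using kernel_representation_of_schur_bounded[OF cont k0] by blast
    interpret K: kernel_representation P0 "\<lambda>g. exp (c / 2 * d g 0)" \<phi> k0 by (rule P0)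
    interpret F: herz_schur_factorization \<mu> P0 K.Q \<phi> "sqrt k0" "sqrt k0"
      by unfold_locales (rule K.coord_P_continuous K.coord_Q_continuous K.norm_P K.Q)+
    obtain F where "F \<in> vecs (L2 \<mu>)" "L.sq F > 0" using ex_nonzero_vector by blast
    from fourier_multiplier_schur_bounded[OF F.fourier_multiplier_map_exists this]
    show ?thesis unfolding k_def m0a_norm_def F.the_fourier_multiplier_map .
  qed
  have k0: "k \<ge> 0" by (rule schur_bounded_nonneg[OF k])
  obtain P where P: "kernel_representation P (\<lambda>g. exp (c / 2 * d g 0)) \<phi> k"
    using kernel_representation_of_schur_bounded[OF cont k] by blast
  interpret K: kernel_representation P "\<lambda>g. exp (c / 2 * d g 0)" \<phi> k by (rule P)
  have le: "k \<le> A * B" if A: "\<And>x. norm (P x) \<le> A" and B: "\<And>x. norm (K.Q x) \<le> B" for A B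
  proof -
    interpret F: herz_schur_factorization \<mu> P K.Q \<phi> A B
      by unfold_locales (rule K.coord_P_continuous K.coord_Q_continuous A B K.Q)+
    show ?thesis unfolding k_def by (rule F.m0a_norm_le)
  qed
  have sqrt_le: "sqrt k \<le> r" if "k \<le> r * sqrt k" "r \<ge> 0" for r
  proof (cases "k = 0")
    case False
    have "sqrt k * sqrt k \<le> r * sqrt k" using that(1) k0 by simp
    moreover have "sqrt k > 0" using False k0 by simp
    ultimately show ?thesis by (rule mult_right_le_imp_le)
  qed (use that in simp)
  have sup: "(SUP x. ereal (n x)) = ereal (sqrt k)"
    if n: "\<And>x. 0 \<le> n x" "\<And>x. n x \<le> sqrt k" "\<And>r. (\<And>x. n x \<le> r) \<Longrightarrow> k \<le> r * sqrt k" for n :: "'g \<Rightarrow> real"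
  proof (rule SUP_eqI)
    show "ereal (n x) \<le> ereal (sqrt k)" for x using n(2) by simp
    fix y assume y: "\<And>x. x \<in> UNIV \<Longrightarrow> ereal (n x) \<le> y"
    show "ereal (sqrt k) \<le> y"
    proof (cases y)
      case (real r)
      then have r: "n x \<le> r" for x using y[of x] by simp
      then have "sqrt k \<le> r" using sqrt_le[OF n(3)[OF r]] order_trans[OF n(1) r] by blast
      then show ?thesis by (simp add: real)
    next
      case MInf
      then show ?thesis using y[of 0] by simp
    qed simp
  qed
  have "represents \<mu> \<phi> K.H K.rep_op (coord (P 0)) (coord (K.Q 0))"
    unfolding represents_def k_def[symmetric] K.rep_op_P K.adjoint_rep_op_Q vnorm_hspace_of
  proof (intro conjI allI)
    show "strongly_continuous_rep K.H K.rep_op" by (rule K.strongly_continuous_rep_op)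
    show "coord (P 0) \<in> vecs K.H" "coord (K.Q 0) \<in> vecs K.H" by (simp_all add: K.P_in_M K.Q)
    show "\<phi> (- y + x) = ip K.H (coord (P x)) (coord (K.Q y))" for x y by (simp add: K.Q)
    show "(SUP x. ereal (norm (P x))) = ereal (sqrt k)"
      by (rule sup[OF norm_ge_zero K.norm_P le[OF _ K.Q(2)]])
    have "k \<le> r * sqrt k" if "\<And>x. norm (K.Q x) \<le> r" for r using le[OF K.norm_P that] by (simp add: mult.commute)
    then show "(SUP y. ereal (norm (K.Q y))) = ereal (sqrt k)"
      by (rule sup[OF norm_ge_zero K.Q(2)])
  qed
  with K.rep_op_norm show ?thesis by blast
qed

end

theorem theorem0p2:
  fixes \<mu> :: "'g::{topological_group_add, t2_space, second_countable_topology} measure"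
    and d :: "'g \<Rightarrow> 'g \<Rightarrow> real"
    and a b :: real
    and \<phi> :: "'g \<Rightarrow> complex"
  assumes "locally_compact_space (euclidean :: 'g topology)"
    and "left_haar_measure \<mu>"
    and "Metric_space UNIV d"
    and "Metric_space.mtopology UNIV d = euclidean"
    and "\<And>g x y. d (g + x) (g + y) = d x y"
    and "\<And>x r. compact (Metric_space.mcball UNIV d x r)"
    and "a > 0" and "b > 0"
    and "\<And>n::nat. emeasure \<mu> (Metric_space.mball UNIV d 0 (real n))
           \<le> ennreal (a * exp (b * real n))"
    and "herz_schur_multiplier \<phi>"
  shows "(\<exists>(H :: separable_hspace) \<pi> \<xi> \<eta>. represents \<mu> \<phi> H \<pi> \<xi> \<eta>) \<and>
    (\<forall>c>b. \<exists>(H :: separable_hspace) \<pi> \<xi> \<eta>. represents \<mu> \<phi> H \<pi> \<xi> \<eta> \<and>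
       (\<forall>g. op_norm H (\<pi> g) \<le> exp (c / 2 * d g 0)))"
proof -
  have haar: "sets \<mu> = sets borel" "emeasure \<mu> UNIV \<noteq> 0"
    "\<And>g A. A \<in> sets borel \<Longrightarrow> emeasure \<mu> ((\<lambda>x. g + x) ` A) = emeasure \<mu> A"
    using assms(2) unfolding left_haar_measure_def by simp_all
  interpret exponential_growth \<mu> d a b
    by (intro exponential_growth.intro exponential_growth_axioms.intro left_invariant_measure.intro assms(3-5,7,9) haar)
  note rep = representation_of_herz_schur_multiplier[OF assms(10)]
  show ?thesis
  proof (intro conjI allI impI)
    show "\<exists>(H :: separable_hspace) \<pi> \<xi> \<eta>. represents \<mu> \<phi> H \<pi> \<xi> \<eta>"
      using rep[of "b + 1"] assms(8) by auto
    show "\<exists>(H :: separable_hspace) \<pi> \<xi> \<eta>. represents \<mu> \<phi> H \<pi> \<xi> \<eta> \<and> (\<forall>g. op_norm H (\<pi> g) \<le> exp (c / 2 * d g 0))"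
      if "c > b" for c
      using rep[of c] that assms(8) by auto
  qed
qed

end
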